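(* Let $m$ be a fully supported Radon measure on $\mathbb{R}$, and let $(\mathcal{E},\mathcal{F})$ be a strongly local and regular Dirichlet form on $L^2(\mathbb{R},m)$ whose effective intervals are $\{(I_n,\mathtt{s}_n):n\ge1\}$. Assume $C_c^\infty(\mathbb{R})\subset\mathcal{F}$. Then $C_c^\infty(\mathbb{R})$ is a special standard core of $(\mathcal{E},\mathcal{F})$ if and only if the following conditions hold: (1) $\mathtt{s}_n$ is absolutely continuous for any $n\ge1$; (2) for any $i$, $I_i$ is scale-isolated with respect to $\{\mathtt{s}_n:n\ge1\}$.
   Context: Notation: $\langle a,b\rangle$ ($-\infty\le a<b\le\infty$) is a non-degenerate interval of $\mathbb{R}$ whose endpoints may or may not be included (infinite endpoints are not). For $J=\langle a,b\rangle\subset\mathbb{R}$ fix a point $e$ in the interior of $J$. A scale function on $J$ is a continuous strictly increasing $\mathtt{s}:J\to\mathbb{R}$ with $\mathtt{s}(e)=0$; $\mathtt{s}(a),\mathtt{s}(b)$ denote the (possibly infinite) limits at endpoints not in $J$. It is adapted, written $\mathtt{s}\in\mathbf{S}_\infty(J)$, if: $a\in J$ iff $a>-\infty$ and $\mathtt{s}(a)>-\infty$; and $b\in J$ iff $b<\infty$ and $\mathtt{s}(b)<\infty$. $d\mathtt{s}$ is the Lebesgue–Stieltjes measure of $\mathtt{s}$; $u\ll\mathtt{s}$ means $u=g\circ\mathtt{s}$ with $g$ absolutely continuous on $\mathtt{s}(J)$, and $\frac{du}{d\mathtt{s}}:=g'\circ\mathtt{s}$. Define on $L^2(J,m|_J)$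 $$\mathcal{F}^{(\mathtt{s})}=\Big\{u\in L^2(J,m|_J):u\ll\mathtt{s},\ \tfrac{du}{d\mathtt{s}}\in L^2(J,d\mathtt{s}),\ u(a)=0\text{ if (L) holds},\ u(b)=0\text{ if (R) holds}\Big\},\quad \mathcal{E}^{(\mathtt{s})}(u,v)=\frac12\int_J\frac{du}{d\mathtt{s}}\frac{dv}{d\mathtt{s}}d\mathtt{s},$$ where (L): $a=-\infty$, $\mathtt{s}(-\infty)>-\infty$ and $m((-\infty,0])<\infty$; (R): $b=\infty$, $\mathtt{s}(\infty)<\infty$ and $m([0,\infty))<\infty$; and $u(a),u(b)$ are limits at the endpoints. Every regular and strongly local Dirichlet form $(\mathcal{E},\mathcal{F})$ on $L^2(\mathbb{R},m)$ is given by a unique at most countable family of disjoint intervals $I_n=\langle a_n,b_n\rangle$ with $\mathtt{s}_n\in\mathbf{S}_\infty(I_n)$ via $$\mathcal{F}=\Big\{u\in L^2(\mathbb{R},m):u|_{I_n}\in\mathcal{F}^{(\mathtt{s}_n)},\ \sum_n\mathcal{E}^{(\mathtt{s}_n)}(u|_{I_n},u|_{I_n})<\infty\Big\},\quad\mathcal{E}(u,v)=\sum_n\mathcal{E}^{(\mathtt{s}_n)}(u|_{I_n},v|_{I_n}).$$ The pairs $\{(I_n,\mathtt{s}_n)\}$ are called the effective intervals of $(\mathcal{E},\mathcal{F})$. Let $e_n$ be the fixed point in the interior of $I_n$. Absolute continuity of $\mathtt{s}_n$ is understood on compact subintervals of $I_n$, i.e. $d\mathtt{s}_n$ is absolutely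 continuous with respect to Lebesgue measure. Define measures on $\mathbb{R}$ by $\lambda_{\mathtt{s}}:=\sum_{n\ge1}d\mathtt{s}_n|_{I_n}$ (not necessarily Radon) and $\lambda_l:=dx|_{(\bigcup_{n\ge1}I_n)^c}$. Two effective intervals $I_i,I_j$ are scale-connected with respect to $\{\mathtt{s}_n\}$ if $\lambda_{\mathtt{s}}([e_i,e_j])<\infty$ and $\lambda_l([e_i,e_j])=0$, where $[e_i,e_j]:=[e_j,e_i]$ if $e_j<e_i$. $I_i$ is scale-isolated with respect to $\{\mathtt{s}_n\}$ if it is not scale-connected to any other effective interval $I_j$, $j\ne i$. Special standard core is in the sense of Fukushima–Oshima–Takeda; for $\mathcal{C}=C_c^\infty(\mathbb{R})\subset\mathcal{F}$ this amounts to $C_c^\infty(\mathbb{R})$ being dense in $\mathcal{F}$ with respect to the norm $\mathcal{E}_1^{1/2}$, $\mathcal{E}_1(u,u)=\mathcal{E}(u,u)+\|u\|^2_{L^2(m)}$ (the other requirements being automatically satisfied). *)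

theory Defs
  imports "HOL-Analysis.Analysis"
begin

section \<open>Function spaces\<close>

definition L2 :: "'a measure \<Rightarrow> ('a \<Rightarrow> real) set" where
  "L2 M = {u \<in> borel_measurable M. integrable M (\<lambda>x. (u x)\<^sup>2)}"

definition Cc :: "(real \<Rightarrow> real) set" where
  "Cc = {u. continuous_on UNIV u \<and> compact (closure (support_on UNIV u))}"

definition Cc_infty :: "(real \<Rightarrow> real) set" where
  "Cc_infty = {u. (\<forall>k x. (deriv ^^ k) u differentiable (at x))
                  \<and> compact (closure (support_on UNIV u))}"

definition uniformly_dense_in :: "('a \<Rightarrow> real) set \<Rightarrow> ('a \<Rightarrow> real) set \<Rightarrow> bool" where
  "uniformly_dense_in C D \<longleftrightarrow> (\<forall>f\<in>D. \<forall>\<epsilon>>0. \<exists>g\<in>C. \<forall>x. \<bar>f x - g x\<bar> < \<epsilon>)"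

definition radon_measure :: "real measure \<Rightarrow> bool" where
  "radon_measure m \<longleftrightarrow> sets m = sets borel \<and> (\<forall>K. compact K \<longrightarrow> emeasure m K < \<infinity>)"

definition fully_supported :: "real measure \<Rightarrow> bool" where
  "fully_supported m \<longleftrightarrow> (\<forall>U. open U \<and> U \<noteq> {} \<longrightarrow> emeasure m U > 0)"


section \<open>Dirichlet forms\<close>

text \<open>
  A form on \<open>L\<^sup>2(\<real>, m)\<close> is given by a set \<open>F\<close> of functions and a map \<open>E\<close>, of which only the
  values on \<open>F \<times> F\<close> matter. The elements of \<open>L\<^sup>2(\<real>, m)\<close> are classes of functions modulo
  \<open>m\<close>-null sets; accordingly \<open>F\<close> is required to contain with a function its whole class, and
  \<open>E\<close> to depend on the classes only.
\<close>

definition E1_norm :: "real measure \<Rightarrow> ((real \<Rightarrow> real) \<Rightarrow> (real \<Rightarrow> real) \<Rightarrow> real) \<Rightarrow> (real \<Rightarrow> real) \<Rightarrow> real" where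
  "E1_norm m E u = sqrt (E u u + (\<integral>x. (u x)\<^sup>2 \<partial>m))"

definition E1_dense_in ::
    "real measure \<Rightarrow> ((real \<Rightarrow> real) \<Rightarrow> (real \<Rightarrow> real) \<Rightarrow> real) \<Rightarrow> (real \<Rightarrow> real) set \<Rightarrow> (real \<Rightarrow> real) set \<Rightarrow> bool" where
  "E1_dense_in m E C F \<longleftrightarrow> (\<forall>u\<in>F. \<forall>\<epsilon>>0. \<exists>v\<in>C. E1_norm m E (\<lambda>x. u x - v x) < \<epsilon>)"

definition dirichlet_form ::
    "real measure \<Rightarrow> ((real \<Rightarrow> real) \<Rightarrow> (real \<Rightarrow> real) \<Rightarrow> real) \<Rightarrow> (real \<Rightarrow> real) set \<Rightarrow> bool" where
  "dirichlet_form m E F \<longleftrightarrow>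
     \<comment> \<open>\<open>(E, F)\<close> lives on \<open>m\<close>-classes\<close>
     F \<subseteq> L2 m \<and>
     (\<forall>u\<in>F. \<forall>v\<in>L2 m. (AE x in m. u x = v x) \<longrightarrow> v \<in> F) \<and>
     (\<forall>u\<in>F. \<forall>u'\<in>F. \<forall>v\<in>F. (AE x in m. u x = u' x) \<longrightarrow> E u v = E u' v) \<and>
     \<comment> \<open>densely defined, nonnegative, symmetric and bilinear\<close>
     (\<lambda>x. 0) \<in> F \<and>
     (\<forall>u\<in>F. \<forall>v\<in>F. (\<lambda>x. u x + v x) \<in> F) \<and>
     (\<forall>c. \<forall>u\<in>F. (\<lambda>x. c * u x) \<in> F) \<and>
     (\<forall>u\<in>L2 m. \<forall>\<epsilon>>0. \<exists>v\<in>F. (\<integral>x. (u x - v x)\<^sup>2 \<partial>m) < \<epsilon>) \<and>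
     (\<forall>u\<in>F. \<forall>v\<in>F. E u v = E v u) \<and>
     (\<forall>u\<in>F. \<forall>v\<in>F. \<forall>w\<in>F. E (\<lambda>x. u x + v x) w = E u w + E v w) \<and>
     (\<forall>c. \<forall>u\<in>F. \<forall>v\<in>F. E (\<lambda>x. c * u x) v = c * E u v) \<and>
     (\<forall>u\<in>F. E u u \<ge> 0) \<and>
     \<comment> \<open>closed\<close>
     (\<forall>f. range f \<subseteq> F \<and>
          (\<forall>\<epsilon>>0. \<exists>M. \<forall>i\<ge>M. \<forall>j\<ge>M. E1_norm m E (\<lambda>x. f i x - f j x) < \<epsilon>) \<longrightarrow>
          (\<exists>u\<in>F. (\<lambda>i::nat. E1_norm m E (\<lambda>x. f i x - u x)) \<longlonglongrightarrow> 0)) \<and>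
     \<comment> \<open>Markovian\<close>
     (\<forall>u\<in>F. (\<lambda>x. max 0 (min 1 (u x))) \<in> F \<and>
            E (\<lambda>x. max 0 (min 1 (u x))) (\<lambda>x. max 0 (min 1 (u x))) \<le> E u u)"

definition regular_form ::
    "real measure \<Rightarrow> ((real \<Rightarrow> real) \<Rightarrow> (real \<Rightarrow> real) \<Rightarrow> real) \<Rightarrow> (real \<Rightarrow> real) set \<Rightarrow> bool" where
  "regular_form m E F \<longleftrightarrow> E1_dense_in m E (F \<inter> Cc) F \<and> uniformly_dense_in (F \<inter> Cc) Cc"

text \<open>The support of the measure \<open>u \<cdot> m\<close>, which depends only on the \<open>m\<close>-class of \<open>u\<close>.\<close>

definition ae_support :: "real measure \<Rightarrow> (real \<Rightarrow> real) \<Rightarrow> real set" where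
  "ae_support m u = - \<Union>{U. open U \<and> (AE x in m. x \<in> U \<longrightarrow> u x = 0)}"

definition strongly_local ::
    "real measure \<Rightarrow> ((real \<Rightarrow> real) \<Rightarrow> (real \<Rightarrow> real) \<Rightarrow> real) \<Rightarrow> (real \<Rightarrow> real) set \<Rightarrow> bool" where
  "strongly_local m E F \<longleftrightarrow>
     (\<forall>u\<in>F. \<forall>v\<in>F. compact (ae_support m u) \<and> compact (ae_support m v) \<and>
        (\<exists>U c. open U \<and> ae_support m u \<subseteq> U \<and> (AE x in m. x \<in> U \<longrightarrow> v x = c)) \<longrightarrow>
        E u v = 0)"

text \<open>Cores in the sense of Fukushima, Oshima and Takeda.\<close>

definition form_core ::
    "real measure \<Rightarrow> ((real \<Rightarrow> real) \<Rightarrow> (real \<Rightarrow> real) \<Rightarrow> real) \<Rightarrow> (real \<Rightarrow> real) set \<Rightarrow> (real \<Rightarrow> real) set \<Rightarrow> bool" where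
  "form_core m E F C \<longleftrightarrow> C \<subseteq> F \<inter> Cc \<and> E1_dense_in m E C F \<and> uniformly_dense_in C Cc"

definition standard_core ::
    "real measure \<Rightarrow> ((real \<Rightarrow> real) \<Rightarrow> (real \<Rightarrow> real) \<Rightarrow> real) \<Rightarrow> (real \<Rightarrow> real) set \<Rightarrow> (real \<Rightarrow> real) set \<Rightarrow> bool" where
  "standard_core m E F C \<longleftrightarrow> form_core m E F C \<and>
     (\<lambda>x. 0) \<in> C \<and>
     (\<forall>u\<in>C. \<forall>v\<in>C. (\<lambda>x. u x + v x) \<in> C) \<and>
     (\<forall>c. \<forall>u\<in>C. (\<lambda>x. c * u x) \<in> C) \<and>
     (\<forall>\<epsilon>>0. \<exists>\<phi>::real \<Rightarrow> real.
        (\<forall>t\<in>{0..1}. \<phi> t = t) \<and>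
        (\<forall>t. - \<epsilon> \<le> \<phi> t \<and> \<phi> t \<le> 1 + \<epsilon>) \<and>
        (\<forall>t t'. t < t' \<longrightarrow> 0 \<le> \<phi> t' - \<phi> t \<and> \<phi> t' - \<phi> t \<le> t' - t) \<and>
        (\<forall>u\<in>C. (\<lambda>x. \<phi> (u x)) \<in> C))"

definition special_standard_core ::
    "real measure \<Rightarrow> ((real \<Rightarrow> real) \<Rightarrow> (real \<Rightarrow> real) \<Rightarrow> real) \<Rightarrow> (real \<Rightarrow> real) set \<Rightarrow> (real \<Rightarrow> real) set \<Rightarrow> bool" where
  "special_standard_core m E F C \<longleftrightarrow> standard_core m E F C \<and>
     (\<forall>u\<in>C. \<forall>v\<in>C. (\<lambda>x. u x * v x) \<in> C) \<and>
     (\<forall>K G. compact K \<and> open G \<and> compact (closure G) \<and> K \<subseteq> G \<longrightarrow>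
        (\<exists>u\<in>C. (\<forall>x. u x \<ge> 0) \<and> (\<forall>x\<in>K. u x = 1) \<and> (\<forall>x\<in>-G. u x = 0)))"


section \<open>Scale functions\<close>

definition nondeg_interval :: "real set \<Rightarrow> bool" where
  "nondeg_interval J \<longleftrightarrow> is_interval J \<and> interior J \<noteq> {}"

definition left_end :: "real set \<Rightarrow> ereal" where
  "left_end J = (INF x\<in>J. ereal x)"

definition right_end :: "real set \<Rightarrow> ereal" where
  "right_end J = (SUP x\<in>J. ereal x)"

text \<open>
  The values of an increasing function at the endpoints of \<open>J\<close>: these are one-sided limits, hence
  an infimum and a supremum.
\<close>

definition scale_left :: "real set \<Rightarrow> (real \<Rightarrow> real) \<Rightarrow> ereal" where
  "scale_left J s = (INF x\<in>J. ereal (s x))"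

definition scale_right :: "real set \<Rightarrow> (real \<Rightarrow> real) \<Rightarrow> ereal" where
  "scale_right J s = (SUP x\<in>J. ereal (s x))"

definition scale_function :: "real set \<Rightarrow> real \<Rightarrow> (real \<Rightarrow> real) \<Rightarrow> bool" where
  "scale_function J e s \<longleftrightarrow> continuous_on J s \<and> strict_mono_on J s \<and> s e = 0"

definition adapted_scale :: "real set \<Rightarrow> real \<Rightarrow> (real \<Rightarrow> real) \<Rightarrow> bool" where
  "adapted_scale J e s \<longleftrightarrow> scale_function J e s \<and>
     (left_end J \<in> ereal ` J \<longleftrightarrow> left_end J > -\<infinity> \<and> scale_left J s > -\<infinity>) \<and>
     (right_end J \<in> ereal ` J \<longleftrightarrow> right_end J < \<infinity> \<and> scale_right J s < \<infinity>)"

text \<open>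
  The Lebesgue--Stieltjes measure of \<open>s\<close> as a measure on \<open>J\<close>, obtained as the image of Lebesgue
  measure on \<open>s(J)\<close> under the inverse of \<open>s\<close>; the lemma \<open>emeasure_stieltjes_Icc\<close> below shows that
  it charges \<open>[x, y]\<close> with \<open>s(y) - s(x)\<close>.
\<close>

definition stieltjes :: "real set \<Rightarrow> (real \<Rightarrow> real) \<Rightarrow> real measure" where
  "stieltjes J s = distr (restrict_space lborel (s ` J)) (restrict_space borel J) (the_inv_into J s)"

lemma the_inv_into_scale_measurable:
  fixes J :: "real set" and s :: "real \<Rightarrow> real"
  assumes "is_interval J" "continuous_on J s" "strict_mono_on J s"
  shows "the_inv_into J s \<in> measurable (restrict_space lborel (s ` J)) (restrict_space borel J)"
proof -
  have inj: "inj_on s J"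
    using assms(3) by (rule strict_mono_on_imp_inj_on)
  have "is_interval (s ` J)"
    using connected_continuous_image[OF assms(2) is_interval_connected[OF assms(1)]]
    by (simp only: is_interval_connected_1)
  then have B: "s ` J \<in> sets borel"
    by (rule real_interval_borel_measurable)
  have "mono_on (s ` J) (the_inv_into J s)"
    unfolding monotone_on_def
  proof (intro ballI impI)
    fix y y' assume y: "y \<in> s ` J" "y' \<in> s ` J" "y \<le> y'"
    then obtain x x' where x: "x \<in> J" "y = s x" "x' \<in> J" "y' = s x'" by auto
    then have "x \<le> x'"
      using y(3) strict_mono_onD[OF assms(3), of x' x] by force
    then show "the_inv_into J s y \<le> the_inv_into J s y'"
      using x inj by (simp add: the_inv_into_f_f)
  qed
  then have "the_inv_into J s \<in> borel_measurable (restrict_space borel (s ` J))"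
    by (rule borel_measurable_mono_on_fnc)
  then have "the_inv_into J s \<in> borel_measurable (restrict_space lborel (s ` J))"
    using measurable_cong_sets[OF sets_restrict_space_cong[OF sets_lborel] refl] by blast
  moreover have "the_inv_into J s \<in> space (restrict_space lborel (s ` J)) \<rightarrow> J"
    using inj by (auto simp: space_restrict_space the_inv_into_f_f)
  ultimately show ?thesis
    by (rule measurable_restrict_space2[rotated])
qed

lemma emeasure_stieltjes_Icc:
  fixes J :: "real set" and s :: "real \<Rightarrow> real"
  assumes J: "is_interval J" "continuous_on J s" "strict_mono_on J s"
    and xy: "x \<in> J" "y \<in> J" "x \<le> y"
  shows "emeasure (stieltjes J s) {x..y} = ennreal (s y - s x)"
proof -
  have inj: "inj_on s J"
    using J(3) by (rule strict_mono_on_imp_inj_on)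
  have sub: "{x..y} \<subseteq> J"
    by (intro subsetI mem_is_interval_1_I[OF J(1) xy(1,2)]) auto
  have conn: "is_interval (s ` J)"
    using connected_continuous_image[OF J(2) is_interval_connected[OF J(1)]]
    by (simp only: is_interval_connected_1)
  have le: "s u \<le> s v \<longleftrightarrow> u \<le> v" if "u \<in> J" "v \<in> J" for u v
    using strict_mono_on_less_eq[OF J(3) that] .
  have sub': "{s x..s y} \<subseteq> s ` J"
    by (intro subsetI mem_is_interval_1_I[OF conn imageI[OF xy(1)] imageI[OF xy(2)]]) auto
  have vimage: "the_inv_into J s -` {x..y} \<inter> space (restrict_space lborel (s ` J)) = {s x..s y}"
    using sub' xy inj le by (auto simp: space_restrict_space the_inv_into_f_f)
  have meas: "{x..y} \<in> sets (restrict_space borel J)"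
    using sub real_interval_borel_measurable[OF J(1)] by (simp add: sets_restrict_space_iff)
  have "emeasure (stieltjes J s) {x..y} = emeasure (restrict_space lborel (s ` J)) {s x..s y}"
    unfolding stieltjes_def
    by (subst emeasure_distr[OF the_inv_into_scale_measurable[OF J] meas]) (simp only: vimage)
  also have "\<dots> = emeasure lborel {s x..s y}"
    using sub' real_interval_borel_measurable[OF conn] by (intro emeasure_restrict_space) auto
  also have "\<dots> = ennreal (s y - s x)"
    using le xy by simp
  finally show ?thesis .
qed

definition abs_cont_on :: "real set \<Rightarrow> (real \<Rightarrow> real) \<Rightarrow> bool" where
  "abs_cont_on S f \<longleftrightarrow>
     (\<forall>\<epsilon>>0. \<exists>\<delta>>0. \<forall>D. finite D \<and>
        (\<forall>(x, y)\<in>D. x \<le> y \<and> {x..y} \<subseteq> S) \<and>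
        disjoint_family_on (\<lambda>(x, y). {x<..<y}) D \<and>
        (\<Sum>(x, y)\<in>D. y - x) < \<delta> \<longrightarrow> (\<Sum>(x, y)\<in>D. \<bar>f y - f x\<bar>) < \<epsilon>)"

definition locally_abs_cont_on :: "real set \<Rightarrow> (real \<Rightarrow> real) \<Rightarrow> bool" where
  "locally_abs_cont_on J f \<longleftrightarrow> (\<forall>x\<in>J. \<forall>y\<in>J. x \<le> y \<longrightarrow> abs_cont_on {x..y} f)"

text \<open>
  The relation \<open>u \<lless> s\<close> on \<open>J\<close>. Absolute continuity of \<open>g\<close> on the possibly unbounded or non-closed
  interval \<open>s(J)\<close> is local. This makes no difference in \<open>scale_domain\<close>: with a square integrable
  derivative, \<open>g\<close> is then also absolutely continuous on all of \<open>s(J)\<close>, by Cauchy--Schwarz.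
\<close>

definition scale_dominated :: "real set \<Rightarrow> (real \<Rightarrow> real) \<Rightarrow> (real \<Rightarrow> real) \<Rightarrow> bool" where
  "scale_dominated J s u \<longleftrightarrow> (\<exists>g. locally_abs_cont_on (s ` J) g \<and> (\<forall>x\<in>J. u x = g (s x)))"

text \<open>
  The derivative \<open>du/ds = g' \<circ> s\<close>, where \<open>g = u \<circ> s\<inverse>\<close> on \<open>s(J)\<close>. At the endpoints of \<open>s(J)\<close>,
  and at the points where \<open>g\<close> is not differentiable, \<open>deriv\<close> yields an unspecified number; these
  points form a null set.
\<close>

definition scale_deriv :: "real set \<Rightarrow> (real \<Rightarrow> real) \<Rightarrow> (real \<Rightarrow> real) \<Rightarrow> real \<Rightarrow> real" where
  "scale_deriv J s u x = deriv (u \<circ> the_inv_into J s) (s x)"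

text \<open>
  The domain \<open>\<F>\<^sup>(\<^sup>s\<^sup>)\<close> on \<open>J\<close>. Its members are functions on \<open>\<real>\<close>, of which only the restriction to
  \<open>J\<close> matters; so \<open>u \<in> scale_domain m J s\<close> says that \<open>u|J\<close> belongs to the domain.
\<close>

definition scale_domain :: "real measure \<Rightarrow> real set \<Rightarrow> (real \<Rightarrow> real) \<Rightarrow> (real \<Rightarrow> real) set" where
  "scale_domain m J s =
     {u \<in> L2 (restrict_space m J).
        scale_dominated J s u \<and>
        scale_deriv J s u \<in> L2 (stieltjes J s) \<and>
        (left_end J = -\<infinity> \<and> scale_left J s > -\<infinity> \<and> emeasure m {..0} < \<infinity> \<longrightarrow> (u \<longlongrightarrow> 0) at_bot) \<and>
        (right_end J = \<infinity> \<and> scale_right J s < \<infinity> \<and> emeasure m {0..} < \<infinity> \<longrightarrow> (u \<longlongrightarrow> 0) at_top)}"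

definition scale_energy :: "real set \<Rightarrow> (real \<Rightarrow> real) \<Rightarrow> (real \<Rightarrow> real) \<Rightarrow> (real \<Rightarrow> real) \<Rightarrow> real" where
  "scale_energy J s u v =
     1 / 2 * (\<integral>x. scale_deriv J s u x * scale_deriv J s v x \<partial>stieltjes J s)"


section \<open>Effective intervals\<close>

text \<open>
  A representative of the \<open>m\<close>-class of \<open>u\<close> whose restriction to each \<open>I n\<close> is absolutely continuous
  with respect to \<open>s n\<close> and lies in the domain on \<open>I n\<close>. When \<open>m\<close> has full support it is uniquely
  determined on each \<open>I n\<close>, by continuity.
\<close>

definition interval_version ::
    "real measure \<Rightarrow> nat set \<Rightarrow> (nat \<Rightarrow> real set) \<Rightarrow> (nat \<Rightarrow> real \<Rightarrow> real) \<Rightarrow> (real \<Rightarrow> real) \<Rightarrow> (real \<Rightarrow> real) \<Rightarrow> bool" where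
  "interval_version m N I s u v \<longleftrightarrow>
     v \<in> L2 m \<and> (AE x in m. v x = u x) \<and> (\<forall>n\<in>N. v \<in> scale_domain m (I n) (s n))"

text \<open>
  \<open>{(I n, s n) | n \<in> N}\<close> are the effective intervals of \<open>(E, F)\<close>, with base points \<open>e n\<close>.
  The index set \<open>N\<close> is an arbitrary set of naturals, as the family is finite or countably infinite.
\<close>

definition effective_intervals ::
    "real measure \<Rightarrow> ((real \<Rightarrow> real) \<Rightarrow> (real \<Rightarrow> real) \<Rightarrow> real) \<Rightarrow> (real \<Rightarrow> real) set \<Rightarrow>
     nat set \<Rightarrow> (nat \<Rightarrow> real set) \<Rightarrow> (nat \<Rightarrow> real \<Rightarrow> real) \<Rightarrow> (nat \<Rightarrow> real) \<Rightarrow> bool" where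
  "effective_intervals m E F N I s e \<longleftrightarrow>
     (\<forall>n\<in>N. nondeg_interval (I n) \<and> e n \<in> interior (I n) \<and> adapted_scale (I n) (e n) (s n)) \<and>
     disjoint_family_on I N \<and>
     F = {u \<in> L2 m. \<exists>v. interval_version m N I s u v \<and>
                        (\<lambda>n. scale_energy (I n) (s n) v v) summable_on N} \<and>
     (\<forall>u\<in>F. \<forall>v\<in>F. \<forall>u' v'. interval_version m N I s u u' \<and> interval_version m N I s v v' \<longrightarrow>
        E u v = (\<Sum>\<^sub>\<infinity>n\<in>N. scale_energy (I n) (s n) u' v'))"

definition lambda_s :: "nat set \<Rightarrow> (nat \<Rightarrow> real set) \<Rightarrow> (nat \<Rightarrow> real \<Rightarrow> real) \<Rightarrow> real measure" where
  "lambda_s N I s = measure_of UNIV (sets borel)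
     (\<lambda>A. \<integral>\<^sup>+ n. emeasure (stieltjes (I n) (s n)) (A \<inter> I n) \<partial>count_space N)"

definition lambda_l :: "nat set \<Rightarrow> (nat \<Rightarrow> real set) \<Rightarrow> real measure" where
  "lambda_l N I = density lborel (indicator (- (\<Union>n\<in>N. I n)))"

lemma emeasure_lambda_s:
  assumes A: "A \<in> sets borel"
  shows "emeasure (lambda_s N I s) A =
           (\<integral>\<^sup>+ n. emeasure (stieltjes (I n) (s n)) (A \<inter> I n) \<partial>count_space N)"
proof -
  let ?\<mu> = "\<lambda>A. \<integral>\<^sup>+ n. emeasure (stieltjes (I n) (s n)) (A \<inter> I n) \<partial>count_space N"
  have sets: "A \<inter> I n \<in> sets (stieltjes (I n) (s n))" if "A \<in> sets borel" "n \<in> N" for A n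
    using that by (auto simp: stieltjes_def sets_restrict_space)
  have "countably_additive (sets borel) ?\<mu>"
  proof (rule countably_additiveI)
    fix B :: "nat \<Rightarrow> real set"
    assume B: "range B \<subseteq> sets borel" "disjoint_family B"
    have "(\<Sum>i. ?\<mu> (B i)) =
            (\<integral>\<^sup>+ n. (\<Sum>i. emeasure (stieltjes (I n) (s n)) (B i \<inter> I n)) \<partial>count_space N)"
      by (rule nn_integral_suminf[symmetric]) auto
    also have "\<dots> = ?\<mu> (\<Union>i. B i)"
    proof (rule nn_integral_cong)
      fix n assume "n \<in> space (count_space N)"
      then have n: "n \<in> N" by simp
      have "(\<Sum>i. emeasure (stieltjes (I n) (s n)) (B i \<inter> I n)) =
              emeasure (stieltjes (I n) (s n)) (\<Union>i. B i \<inter> I n)"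
        using B n sets by (intro suminf_emeasure) (auto simp: disjoint_family_on_def)
      then show "(\<Sum>i. emeasure (stieltjes (I n) (s n)) (B i \<inter> I n)) =
              emeasure (stieltjes (I n) (s n)) ((\<Union>i. B i) \<inter> I n)"
        by simp
    qed
    finally show "(\<Sum>i. ?\<mu> (B i)) = ?\<mu> (\<Union>i. B i)" .
  qed
  moreover have "positive (sets borel) ?\<mu>"
    by (simp add: positive_def)
  ultimately have "measure_space UNIV (sets (borel :: real measure)) ?\<mu>"
    using sets.sigma_algebra_axioms[of "borel :: real measure"] by (simp add: measure_space_def)
  then show ?thesis
    unfolding lambda_s_def using A
    by (intro emeasure_measure_of_sigma) (auto simp: measure_space_def)
qed

text \<open>\<open>closed_segment\<close> is \<open>[e i, e j]\<close> regardless of the order of the two points.\<close>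

definition scale_connected ::
    "nat set \<Rightarrow> (nat \<Rightarrow> real set) \<Rightarrow> (nat \<Rightarrow> real \<Rightarrow> real) \<Rightarrow> (nat \<Rightarrow> real) \<Rightarrow> nat \<Rightarrow> nat \<Rightarrow> bool" where
  "scale_connected N I s e i j \<longleftrightarrow>
     emeasure (lambda_s N I s) (closed_segment (e i) (e j)) < \<infinity> \<and>
     emeasure (lambda_l N I) (closed_segment (e i) (e j)) = 0"

definition scale_isolated ::
    "nat set \<Rightarrow> (nat \<Rightarrow> real set) \<Rightarrow> (nat \<Rightarrow> real \<Rightarrow> real) \<Rightarrow> (nat \<Rightarrow> real) \<Rightarrow> nat \<Rightarrow> bool" where
  "scale_isolated N I s e i \<longleftrightarrow> (\<forall>j\<in>N. j \<noteq> i \<longrightarrow> \<not> scale_connected N I s e i j)"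

end

theory Submission
  imports Defs
begin

text \<open>
  The notation is as follows: \<open>\<sigma> = \<lambda>\<^sub>s\<close> is the sum of the measures \<open>ds\<^sub>n\<close>, \<open>G\<close> is the union of the
  intervals \<open>I\<^sub>n\<close>, \<open>D u\<close> is \<open>du/ds\<^sub>n\<close> on \<open>I\<^sub>n\<close>, and \<open>T\<^sub>n : Y\<^sub>n = s\<^sub>n(I\<^sub>n) \<rightarrow> I\<^sub>n\<close> is the inverse of \<open>s\<^sub>n\<close>.
  The form becomes a single integral, \<open>E(u, u) = 1/2 \<integral>(D u)\<^sup>2 d\<sigma>\<close>. Since the test functions belong
  to \<open>F\<close>, and among them there are functions that agree with the identity on a given bounded set,
  \<open>T\<^sub>n\<close> is locally absolutely continuous. The function \<open>\<tau>\<close> that equals \<open>T\<^sub>n' \<circ> s\<^sub>n\<close> on \<open>I\<^sub>n\<close> and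
  vanishes off \<open>G\<close> governs everything: \<open>\<tau> d\<sigma> = 1\<^sub>G dx\<close> (\<open>density_tau\<close>), a test function \<open>\<phi>\<close> has
  \<open>D \<phi> = \<phi>' \<tau>\<close>, and \<open>s\<^sub>n\<close> is locally absolutely continuous for every \<open>n\<close> exactly when \<open>\<tau> > 0\<close> holds
  \<open>\<sigma>\<close>-almost everywhere. All requirements on a special standard core other than density with
  respect to the norm \<open>E\<^sub>1\<^sup>1\<^sup>/\<^sup>2\<close> hold for the test functions (\<open>special_standard_core_Cc_infty_iff\<close>).

  Suppose that the test functions are dense. On \<open>{\<tau> = 0}\<close> all of them have \<open>D \<phi> = 0\<close>, and so do their
  limits; but \<open>F\<close> contains functions with \<open>|D u| = 1\<close> on any compact part of an \<open>I\<^sub>n\<close>. So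
  \<open>{\<tau> = 0}\<close> is \<open>\<sigma>\<close>-null (\<open>dense_imp_tau_pos\<close>). If \<open>I\<^sub>i\<close> and \<open>I\<^sub>j\<close> were scale-connected, the part of
  \<open>[e\<^sub>i, e\<^sub>j]\<close> off \<open>G\<close> would have no length, so that \<open>|\<phi>(y) - \<phi>(x)| \<le> \<integral>|D \<phi>| d\<sigma>\<close> there, and
  as \<open>\<sigma>([e\<^sub>i, e\<^sub>j])\<close> is finite, a small energy on \<open>[e\<^sub>i, e\<^sub>j]\<close> would bound the increment of a test function.
  But \<open>F\<close> contains a function that is 1 on \<open>I\<^sub>i\<close> to the right of \<open>e\<^sub>i\<close> and 0 on \<open>I\<^sub>j\<close>, without any energy on
  \<open>[e\<^sub>i, e\<^sub>j]\<close> (\<open>dense_imp_not_connected\<close>).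

  Conversely, by regularity of the form it is enough to approximate a continuous \<open>u \<in> F\<close> with compact
  support. Isolation yields the dichotomy that carries the proof (\<open>interval_dichotomy\<close>): an
  interval \<open>[p, q]\<close> that is contained in no single \<open>I\<^sub>n\<close> has infinite \<open>\<sigma>\<close>-measure or meets the
  complement of \<open>G\<close> in positive length. In both cases an absolutely continuous function can change its
  value across \<open>[p, q]\<close> at arbitrarily small cost (\<open>free_bump\<close>): on a set of
  positive length off \<open>G\<close> it costs nothing, and on a set \<open>B\<close> of \<open>\<sigma>\<close>-measure \<open>b\<close> a unit increment costs
  \<open>1/b\<close>, by letting \<open>D \<phi> = 1/b\<close> on \<open>B\<close>; this is where \<open>\<tau> > 0\<close> is used. So \<open>u\<close> can be followed by an absolutely
  continuous function: exactly inside an \<open>I\<^sub>n\<close>, by \<open>f = D u/\<tau>\<close>, and up to its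
  oscillation at almost no cost on short intervals that lie in no \<open>I\<^sub>n\<close>. A compactness argument glues these local pieces together
  (\<open>traceable_interval\<close>). What is lost is only the energy of \<open>u\<close> outside a
  finite union of compact subintervals of the \<open>I\<^sub>n\<close>, which can be made small. Finally the density \<open>f\<close> is replaced
  by a smooth function in the norm of \<open>L\<^sup>1(dx) \<inter> L\<^sup>2(\<tau> dx)\<close>, which controls both the uniform distance
  and the energy distance of the primitives (\<open>smooth_approximation\<close>).
\<close>

section \<open>Families of disjoint intervals and absolute continuity\<close>

text \<open>
  The intervals are required to be nondegenerate: distinct members of \<open>D\<close> then have distinct
  interiors, and degenerate intervals would not contribute to any of the sums below.
\<close>

definition subintervals :: "real set \<Rightarrow> (real \<times> real) set \<Rightarrow> bool" where
  "subintervals S D \<longleftrightarrow> finite D \<and> (\<forall>(x, y)\<in>D. x < y \<and> {x..y} \<subseteq> S) \<and>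
     disjoint_family_on (\<lambda>(x, y). {x<..<y}) D"

lemma subintervals_mono: "subintervals S D \<Longrightarrow> S \<subseteq> S' \<Longrightarrow> subintervals S' D"
  unfolding subintervals_def by fast

definition ac_modulus :: "real set \<Rightarrow> (real \<Rightarrow> real) \<Rightarrow> real \<Rightarrow> real \<Rightarrow> bool" where
  "ac_modulus S f e d \<longleftrightarrow> d > 0 \<and>
     (\<forall>D. subintervals S D \<longrightarrow> (\<Sum>(x, y)\<in>D. y - x) < d \<longrightarrow> (\<Sum>(x, y)\<in>D. \<bar>f y - f x\<bar>) < e)"

lemma ac_modulusI:
  assumes "d > 0"
    "\<And>D. subintervals S D \<Longrightarrow> (\<Sum>(x, y)\<in>D. y - x) < d \<Longrightarrow> (\<Sum>(x, y)\<in>D. \<bar>f y - f x\<bar>) < e"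
  shows "ac_modulus S f e d"
  unfolding ac_modulus_def using assms by simp

lemma ac_modulusD:
  assumes "ac_modulus S f e d"
  shows "d > 0"
    "subintervals S D \<Longrightarrow> (\<Sum>(x, y)\<in>D. y - x) < d \<Longrightarrow> (\<Sum>(x, y)\<in>D. \<bar>f y - f x\<bar>) < e"
  using assms unfolding ac_modulus_def by simp_all

lemma abs_cont_onD:
  assumes "abs_cont_on S f" "e > 0"
  shows "\<exists>d. ac_modulus S f e d"
proof -
  obtain d where d: "d > 0" "\<forall>D. finite D \<and> (\<forall>(x, y)\<in>D. x \<le> y \<and> {x..y} \<subseteq> S) \<and>
        disjoint_family_on (\<lambda>(x, y). {x<..<y}) D \<and>
        (\<Sum>(x, y)\<in>D. y - x) < d \<longrightarrow> (\<Sum>(x, y)\<in>D. \<bar>f y - f x\<bar>) < e"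
    using assms unfolding abs_cont_on_def by blast
  show ?thesis
  proof (intro exI[of _ d] ac_modulusI d(1))
    fix D assume D: "subintervals S D" "(\<Sum>(x, y)\<in>D. y - x) < d"
    then have "\<forall>(x, y)\<in>D. x \<le> y \<and> {x..y} \<subseteq> S"
      unfolding subintervals_def by fastforce
    with D show "(\<Sum>(x, y)\<in>D. \<bar>f y - f x\<bar>) < e"
      by (intro d(2)[rule_format]) (auto simp: subintervals_def)
  qed
qed

lemma abs_cont_onI:
  assumes "\<And>e. e > 0 \<Longrightarrow> \<exists>d. ac_modulus S f e d"
  shows "abs_cont_on S f"
  unfolding abs_cont_on_def
proof (intro allI impI)
  fix e :: real assume "e > 0"
  then obtain d where d: "ac_modulus S f e d" using assms by blast
  show "\<exists>d>0. \<forall>D. finite D \<and> (\<forall>(x, y)\<in>D. x \<le> y \<and> {x..y} \<subseteq> S) \<and>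
        disjoint_family_on (\<lambda>(x, y). {x<..<y}) D \<and>
        (\<Sum>(x, y)\<in>D. y - x) < d \<longrightarrow> (\<Sum>(x, y)\<in>D. \<bar>f y - f x\<bar>) < e"
  proof (intro exI[of _ d] conjI allI impI ac_modulusD(1)[OF d])
    fix D :: "(real \<times> real) set"
    assume D: "finite D \<and> (\<forall>(x, y)\<in>D. x \<le> y \<and> {x..y} \<subseteq> S) \<and>
        disjoint_family_on (\<lambda>(x, y). {x<..<y}) D \<and> (\<Sum>(x, y)\<in>D. y - x) < d"
    let ?D = "{p\<in>D. fst p < snd p}"
    have "?D \<subseteq> D" by auto
    then have sub: "subintervals S ?D"
      using D unfolding subintervals_def
      by (auto intro: finite_subset disjoint_family_on_mono[of ?D D])
    have fin: "finite D" and eq: "\<And>p. p \<in> D \<Longrightarrow> \<not> fst p < snd p \<Longrightarrow> snd p = fst p"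
      using D by fastforce+
    have "(\<Sum>(x, y)\<in>?D. y - x) = (\<Sum>(x, y)\<in>D. y - x)"
      using fin eq by (intro sum.mono_neutral_left) (auto simp: case_prod_beta)
    moreover have "(\<Sum>(x, y)\<in>?D. \<bar>f y - f x\<bar>) = (\<Sum>(x, y)\<in>D. \<bar>f y - f x\<bar>)"
    proof (intro sum.mono_neutral_left fin ballI)
      fix p assume "p \<in> D - ?D"
      then have "snd p = fst p" using eq by simp
      then show "(case p of (x, y) \<Rightarrow> \<bar>f y - f x\<bar>) = 0" by (simp add: case_prod_beta)
    qed auto
    ultimately show "(\<Sum>(x, y)\<in>D. \<bar>f y - f x\<bar>) < e" using ac_modulusD(2)[OF d sub] D by simp
  qed
qed

text \<open>
  Clipping a family of intervals, for instance to a smaller interval, produces degenerate members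
  and, among them, repetitions. These are discarded here, and the sums do not notice it.
\<close>

lemma subintervals_of_family:
  fixes l r :: "'i \<Rightarrow> real"
  assumes A: "finite A" "\<forall>i\<in>A. l i \<le> r i" "\<forall>i\<in>A. l i < r i \<longrightarrow> {l i..r i} \<subseteq> S"
    "disjoint_family_on (\<lambda>i. {l i<..<r i}) A"
  defines "D \<equiv> (\<lambda>i. (l i, r i)) ` {i\<in>A. l i < r i}"
  shows "subintervals S D"
    and "\<And>G::real \<Rightarrow> real \<Rightarrow> real. \<forall>x. G x x = 0 \<Longrightarrow> (\<Sum>(x, y)\<in>D. G x y) = (\<Sum>i\<in>A. G (l i) (r i))"
proof -
  have inj: "inj_on (\<lambda>i. (l i, r i)) {i\<in>A. l i < r i}"
  proof (rule inj_onI, rule ccontr)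
    fix i j assume ij: "i \<in> {i\<in>A. l i < r i}" "j \<in> {i\<in>A. l i < r i}" "(l i, r i) = (l j, r j)" "i \<noteq> j"
    then have "{l i<..<r i} \<inter> {l j<..<r j} = {}"
      by (intro disjoint_family_onD[OF A(4)]) simp_all
    moreover have "(l i + r i) / 2 \<in> {l i<..<r i} \<inter> {l j<..<r j}" using ij by auto
    ultimately show False by blast
  qed
  show "subintervals S D"
    unfolding subintervals_def
  proof (intro conjI)
    show "finite D" using A unfolding D_def by auto
    show "\<forall>(x, y)\<in>D. x < y \<and> {x..y} \<subseteq> S" using A(3) unfolding D_def by auto
    show "disjoint_family_on (\<lambda>(x, y). {x<..<y}) D"
      using A(4) unfolding D_def disjoint_family_on_def by force
  qed
  fix G :: "real \<Rightarrow> real \<Rightarrow> real" assume G: "\<forall>x. G x x = 0"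
  have "(\<Sum>(x, y)\<in>D. G x y) = (\<Sum>i\<in>{i\<in>A. l i < r i}. G (l i) (r i))"
    unfolding D_def by (subst sum.reindex[OF inj]) simp
  also have "\<dots> = (\<Sum>i\<in>A. G (l i) (r i))"
    using A(1,2) G by (intro sum.mono_neutral_left) (auto simp: le_less)
  finally show "(\<Sum>(x, y)\<in>D. G x y) = (\<Sum>i\<in>A. G (l i) (r i))" .
qed

lemma subintervals_length_emeasure:
  assumes D: "subintervals S D" and S: "S \<in> sets borel"
  shows "ennreal (\<Sum>(x, y)\<in>D. y - x) \<le> emeasure lborel S"
proof -
  have "ennreal (\<Sum>(x, y)\<in>D. y - x) = (\<Sum>(x, y)\<in>D. emeasure lborel {x<..<y})"
    using D unfolding subintervals_def
    by (subst sum_ennreal[symmetric]) (auto intro!: sum.cong simp: case_prod_beta)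
  also have "\<dots> = (\<Sum>p\<in>D. emeasure lborel (case p of (x, y) \<Rightarrow> {x<..<y}))"
    by (simp add: case_prod_beta)
  also have "\<dots> = emeasure lborel (\<Union>p\<in>D. case p of (x, y) \<Rightarrow> {x<..<y})"
    using D unfolding subintervals_def by (intro sum_emeasure) auto
  also have "\<dots> \<le> emeasure lborel S"
    using D S unfolding subintervals_def by (intro emeasure_mono) fastforce+
  finally show ?thesis .
qed

lemma subintervals_length:
  assumes "subintervals {a..b} D" "a \<le> b"
  shows "(\<Sum>(x, y)\<in>D. y - x) \<le> b - a"
proof -
  have "ennreal (\<Sum>(x, y)\<in>D. y - x) \<le> ennreal (b - a)"
    using subintervals_length_emeasure[OF assms(1)] assms(2) by simp
  then show ?thesis using assms(2) by (subst (asm) ennreal_le_iff) simp_all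
qed

lemma abs_cont_on_subset:
  assumes "abs_cont_on S f" "S' \<subseteq> S"
  shows "abs_cont_on S' f"
proof (rule abs_cont_onI)
  fix e :: real assume e: "e > 0"
  obtain d where d: "ac_modulus S f e d" using abs_cont_onD[OF assms(1) e] ..
  have "ac_modulus S' f e d"
  proof (rule ac_modulusI[OF ac_modulusD(1)[OF d]])
    fix D assume D: "subintervals S' D" "(\<Sum>(x, y)\<in>D. y - x) < d"
    show "(\<Sum>(x, y)\<in>D. \<bar>f y - f x\<bar>) < e"
      by (rule ac_modulusD(2)[OF d subintervals_mono[OF D(1) assms(2)] D(2)])
  qed
  then show "\<exists>d. ac_modulus S' f e d" ..
qed

lemma abs_cont_on_diff:
  assumes "abs_cont_on S f" "abs_cont_on S g"
  shows "abs_cont_on S (\<lambda>x. f x - g x)"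
proof (rule abs_cont_onI)
  fix e :: real assume "e > 0"
  then have e: "e / 2 > 0" by simp
  obtain d1 where d1: "ac_modulus S f (e / 2) d1" using abs_cont_onD[OF assms(1) e] ..
  obtain d2 where d2: "ac_modulus S g (e / 2) d2" using abs_cont_onD[OF assms(2) e] ..
  have "ac_modulus S (\<lambda>x. f x - g x) e (min d1 d2)"
  proof (rule ac_modulusI)
    show "min d1 d2 > 0" using ac_modulusD(1)[OF d1] ac_modulusD(1)[OF d2] by simp
    fix D assume D: "subintervals S D" "(\<Sum>(x, y)\<in>D. y - x) < min d1 d2"
    have "(\<Sum>(x, y)\<in>D. \<bar>(f y - g y) - (f x - g x)\<bar>) \<le> (\<Sum>(x, y)\<in>D. \<bar>f y - f x\<bar> + \<bar>g y - g x\<bar>)"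
      by (intro sum_mono) auto
    also have "\<dots> = (\<Sum>(x, y)\<in>D. \<bar>f y - f x\<bar>) + (\<Sum>(x, y)\<in>D. \<bar>g y - g x\<bar>)"
      by (simp add: sum.distrib case_prod_beta)
    also have "\<dots> < e / 2 + e / 2"
      by (rule add_strict_mono[OF ac_modulusD(2)[OF d1 D(1)] ac_modulusD(2)[OF d2 D(1)]]) (use D(2) in simp_all)
    also have "\<dots> = e" by simp
    finally show "(\<Sum>(x, y)\<in>D. \<bar>(f y - g y) - (f x - g x)\<bar>) < e" .
  qed
  then show "\<exists>d. ac_modulus S (\<lambda>x. f x - g x) e d" ..
qed

lemma abs_cont_on_imp_continuous_on:
  assumes "abs_cont_on S f" "is_interval S"
  shows "continuous_on S f"
  unfolding continuous_on_iff
proof (intro ballI allI impI)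
  fix x e :: real assume x: "x \<in> S" and e: "e > 0"
  obtain d where d: "ac_modulus S f e d" using abs_cont_onD[OF assms(1) e] ..
  have *: "\<bar>f q - f p\<bar> < e" if "p \<in> S" "q \<in> S" "p < q" "q - p < d" for p q
  proof -
    have "{p..q} \<subseteq> S"
      using mem_is_interval_1_I[OF assms(2) that(1,2)] by auto
    then have "subintervals S {(p, q)}"
      using that(3) by (simp add: subintervals_def disjoint_family_on_def)
    from ac_modulusD(2)[OF d this] show ?thesis using that(4) by simp
  qed
  show "\<exists>d>0. \<forall>x'\<in>S. dist x' x < d \<longrightarrow> dist (f x') (f x) < e"
  proof (rule exI[of _ d], intro conjI ballI impI)
    show "0 < d" by (rule ac_modulusD(1)[OF d])
    fix y assume y: "y \<in> S" "dist y x < d"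
    consider "x < y" | "x = y" | "y < x" by linarith
    then show "dist (f y) (f x) < e"
      using *[of x y] *[of y x] x y e by cases (simp_all add: dist_real_def abs_minus_commute)
  qed
qed

text \<open>
  Extends an absolutely continuous function by constants to all of \<open>\<real>\<close>, so that
  \<open>interval_measure\<close>, which wants a function on the whole line, can be applied to it.
\<close>

lemma abs_cont_on_clamp:
  assumes "abs_cont_on {a..b} h" "a \<le> b"
  shows "abs_cont_on UNIV (\<lambda>x. h (max a (min b x)))"
proof (rule abs_cont_onI)
  let ?c = "\<lambda>x. max a (min b x)"
  fix e :: real assume e: "e > 0"
  obtain d where d: "ac_modulus {a..b} h e d" using abs_cont_onD[OF assms(1) e] ..
  have "ac_modulus UNIV (\<lambda>x. h (?c x)) e d"
  proof (rule ac_modulusI[OF ac_modulusD(1)[OF d]])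
    fix D assume D: "subintervals UNIV D" "(\<Sum>(x, y)\<in>D. y - x) < d"
    let ?l = "\<lambda>p. ?c (fst p)" and ?r = "\<lambda>p. ?c (snd p)"
    have fam: "finite D" "\<forall>p\<in>D. ?l p \<le> ?r p" "\<forall>p\<in>D. ?l p < ?r p \<longrightarrow> {?l p..?r p} \<subseteq> {a..b}"
      using D assms(2) by (auto simp: subintervals_def)
    have dis: "disjoint_family_on (\<lambda>p. {?l p<..<?r p}) D"
    proof -
      have "{?l p<..<?r p} \<subseteq> (case p of (x, y) \<Rightarrow> {x<..<y})" for p
        by (auto split: prod.splits)
      moreover have "(case p of (x, y) \<Rightarrow> {x<..<y}) \<inter> (case q of (x, y) \<Rightarrow> {x<..<y}) = {}"
        if "p \<in> D" "q \<in> D" "p \<noteq> q" for p q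
        using D(1) that by (intro disjoint_family_onD) (simp_all add: subintervals_def)
      ultimately show ?thesis unfolding disjoint_family_on_def by fast
    qed
    note F = subintervals_of_family[OF fam dis]
    let ?D = "(\<lambda>i. (?l i, ?r i)) ` {i\<in>D. ?l i < ?r i}"
    have "(\<Sum>(x, y)\<in>?D. y - x) = (\<Sum>p\<in>D. ?r p - ?l p)"
      by (rule F(2)[of "\<lambda>x y. y - x"]) simp
    also have "\<dots> \<le> (\<Sum>(x, y)\<in>D. y - x)"
      using D by (intro sum_mono) (auto simp: subintervals_def max_def min_def)
    finally have "(\<Sum>(x, y)\<in>?D. \<bar>h y - h x\<bar>) < e" using D by (intro ac_modulusD(2)[OF d F(1)]) simp
    also have "(\<Sum>(x, y)\<in>?D. \<bar>h y - h x\<bar>) = (\<Sum>p\<in>D. \<bar>h (?r p) - h (?l p)\<bar>)"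
      by (rule F(2)[of "\<lambda>x y. \<bar>h y - h x\<bar>"]) simp
    finally show "(\<Sum>(x, y)\<in>D. \<bar>h (?c y) - h (?c x)\<bar>) < e" by (simp add: case_prod_beta)
  qed
  then show "\<exists>d. ac_modulus UNIV (\<lambda>x. h (?c x)) e d" ..
qed

section \<open>Positive variation\<close>

text \<open>
  This is \<open>sup \<Sum>(g(y) - g(x))\<^sup>+\<close>, as intervals with a negative increment may be left out of \<open>D\<close>.
\<close>

definition pos_variation :: "(real \<Rightarrow> real) \<Rightarrow> real \<Rightarrow> real \<Rightarrow> real" where
  "pos_variation g a b = (SUP D\<in>{D. subintervals {a..b} D}. \<Sum>(x, y)\<in>D. g y - g x)"

lemma disjoint_family_on_shrink:
  "disjoint_family_on f S \<Longrightarrow> \<forall>n. g n \<subseteq> f n \<Longrightarrow> disjoint_family_on g S"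
  unfolding disjoint_family_on_def by blast

lemma subintervals_empty [simp]: "subintervals S {}"
  by (simp add: subintervals_def disjoint_family_on_def)

text \<open>
  The bound 1 is what absolute continuity gives on sufficiently short intervals; it makes the
  suprema finite. Long intervals are later cut into short ones.
\<close>

locale small_variation =
  fixes g :: "real \<Rightarrow> real" and a b :: real
  assumes small: "\<And>D. subintervals {a..b} D \<Longrightarrow> (\<Sum>(x, y)\<in>D. \<bar>g y - g x\<bar>) \<le> 1"
begin

lemma sum_le_1: "subintervals {x..y} D \<Longrightarrow> a \<le> x \<Longrightarrow> y \<le> b \<Longrightarrow> (\<Sum>(u, v)\<in>D. g v - g u) \<le> 1"
proof -
  assume D: "subintervals {x..y} D" "a \<le> x" "y \<le> b"
  have "(\<Sum>(u, v)\<in>D. g v - g u) \<le> (\<Sum>(u, v)\<in>D. \<bar>g v - g u\<bar>)"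
    by (intro sum_mono) auto
  also have "\<dots> \<le> 1"
    using D by (intro small subintervals_mono[OF D(1)]) auto
  finally show ?thesis .
qed

lemma bdd: "a \<le> x \<Longrightarrow> y \<le> b \<Longrightarrow> bdd_above ((\<lambda>D. \<Sum>(u, v)\<in>D. g v - g u) ` {D. subintervals {x..y} D})"
  by (rule bdd_aboveI[of _ 1]) (auto dest: sum_le_1)

lemma pos_variation_upper:
  "subintervals {x..y} D \<Longrightarrow> a \<le> x \<Longrightarrow> y \<le> b \<Longrightarrow> (\<Sum>(u, v)\<in>D. g v - g u) \<le> pos_variation g x y"
  unfolding pos_variation_def by (rule cSUP_upper[OF _ bdd]) auto

lemma pos_variation_least:
  "(\<And>D. subintervals {x..y} D \<Longrightarrow> (\<Sum>(u, v)\<in>D. g v - g u) \<le> c) \<Longrightarrow> pos_variation g x y \<le> c"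
  unfolding pos_variation_def by (rule cSUP_least) (auto intro!: exI[of _ "{}"])

lemma pos_variation_incr:
  assumes "a \<le> x" "x < y" "y \<le> b"
  shows "pos_variation g a x + (g y - g x) \<le> pos_variation g a y"
proof -
  have "pos_variation g a x \<le> pos_variation g a y - (g y - g x)"
  proof (rule pos_variation_least)
    fix D assume D: "subintervals {a..x} D"
    have nin: "(x, y) \<notin> D" using D assms(2) unfolding subintervals_def by fastforce
    have "subintervals {a..y} (insert (x, y) D)"
      unfolding subintervals_def
    proof (intro conjI)
      show "finite (insert (x, y) D)" using D by (simp add: subintervals_def)
      show "\<forall>(u, v)\<in>insert (x, y) D. u < v \<and> {u..v} \<subseteq> {a..y}"
        using D assms by (auto simp: subintervals_def)
      have "{x<..<y} \<inter> (case p of (u, v) \<Rightarrow> {u<..<v}) = {}" if "p \<in> D" for p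
        using D that by (cases p) (force simp: subintervals_def)
      moreover have "disjoint_family_on (\<lambda>(x, y). {x<..<y}) D" using D by (simp add: subintervals_def)
      ultimately show "disjoint_family_on (\<lambda>(x, y). {x<..<y}) (insert (x, y) D)"
        using nin by (subst disjoint_family_on_insert) auto
    qed
    from pos_variation_upper[OF this] assms
    have "(\<Sum>(u, v)\<in>insert (x, y) D. g v - g u) \<le> pos_variation g a y" by simp
    moreover have "finite D" using D by (simp add: subintervals_def)
    ultimately show "(\<Sum>(u, v)\<in>D. g v - g u) \<le> pos_variation g a y - (g y - g x)"
      using nin by simp
  qed
  then show ?thesis by simp
qed

lemma pos_variation_mono:
  assumes "a \<le> x" "x \<le> y" "y \<le> b"
  shows "pos_variation g a x \<le> pos_variation g a y"
  using assms by (intro pos_variation_least pos_variation_upper) (auto elim: subintervals_mono)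

lemma pos_variation_split:
  assumes "a \<le> x" "x \<le> y" "y \<le> b"
  shows "pos_variation g a y \<le> pos_variation g a x + pos_variation g x y"
proof (rule pos_variation_least)
  fix D assume D: "subintervals {a..y} D"
  let ?l = "\<lambda>p::real \<times> real. min (fst p) x" and ?r = "\<lambda>p::real \<times> real. min (snd p) x"
  let ?l' = "\<lambda>p::real \<times> real. max (fst p) x" and ?r' = "\<lambda>p::real \<times> real. max (snd p) x"
  have fin: "finite D" using D by (simp add: subintervals_def)
  have in_D: "fst p < snd p \<and> a \<le> fst p \<and> snd p \<le> y" if "p \<in> D" for p
    using D that by (cases p) (force simp: subintervals_def)
  have dis: "disjoint_family_on (\<lambda>(x, y). {x<..<y}) D" using D by (simp add: subintervals_def)
  have d1: "disjoint_family_on (\<lambda>p. {?l p<..<?r p}) D"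
    by (rule disjoint_family_on_shrink[OF dis]) auto
  have d2: "disjoint_family_on (\<lambda>p. {?l' p<..<?r' p}) D"
    by (rule disjoint_family_on_shrink[OF dis]) auto
  have A1: "\<forall>p\<in>D. ?l p \<le> ?r p" "\<forall>p\<in>D. ?l p < ?r p \<longrightarrow> {?l p..?r p} \<subseteq> {a..x}"
    using in_D by fastforce+
  have A2: "\<forall>p\<in>D. ?l' p \<le> ?r' p" "\<forall>p\<in>D. ?l' p < ?r' p \<longrightarrow> {?l' p..?r' p} \<subseteq> {x..y}"
    using in_D by fastforce+
  note F1 = subintervals_of_family[OF fin A1 d1]
  note F2 = subintervals_of_family[OF fin A2 d2]
  let ?D1 = "(\<lambda>i. (?l i, ?r i)) ` {i\<in>D. ?l i < ?r i}"
  let ?D2 = "(\<lambda>i. (?l' i, ?r' i)) ` {i\<in>D. ?l' i < ?r' i}"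
  have "(\<Sum>(u, v)\<in>D. g v - g u) = (\<Sum>p\<in>D. (g (?r p) - g (?l p)) + (g (?r' p) - g (?l' p)))"
    by (intro sum.cong) (auto simp: min_def max_def)
  also have "\<dots> = (\<Sum>p\<in>D. g (?r p) - g (?l p)) + (\<Sum>p\<in>D. g (?r' p) - g (?l' p))"
    by (rule sum.distrib)
  also have "(\<Sum>p\<in>D. g (?r p) - g (?l p)) = (\<Sum>(u, v)\<in>?D1. g v - g u)"
    by (rule F1(2)[of "\<lambda>x y. g y - g x", symmetric]) simp
  also have "(\<Sum>p\<in>D. g (?r' p) - g (?l' p)) = (\<Sum>(u, v)\<in>?D2. g v - g u)"
    by (rule F2(2)[of "\<lambda>x y. g y - g x", symmetric]) simp
  also have "(\<Sum>(u, v)\<in>?D1. g v - g u) + (\<Sum>(u, v)\<in>?D2. g v - g u) \<le> pos_variation g a x + pos_variation g x y"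
    using assms by (intro add_mono pos_variation_upper F1(1) F2(1)) auto
  finally show "(\<Sum>(u, v)\<in>D. g v - g u) \<le> pos_variation g a x + pos_variation g x y" .
qed

text \<open>
  The positive variation inherits absolute continuity because its increment over each interval of a
  short family is nearly attained by a finite subdivision; all the subdivisions together form a family that is no
  longer, on which \<open>g\<close> varies little. Thus \<open>g\<close> is a difference of two increasing
  absolutely continuous functions.
\<close>

lemma abs_cont_pos_variation:
  assumes ac: "abs_cont_on {a..b} g"
  shows "abs_cont_on {a..b} (pos_variation g a)"
proof (rule abs_cont_onI)
  fix e :: real assume "e > 0"
  then have e: "e / 2 > 0" by simp
  obtain d where d: "ac_modulus {a..b} g (e / 2) d" using abs_cont_onD[OF ac e] ..
  have "ac_modulus {a..b} (pos_variation g a) e d"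
  proof (rule ac_modulusI[OF ac_modulusD(1)[OF d]])
    fix D assume D: "subintervals {a..b} D" "(\<Sum>(x, y)\<in>D. y - x) < d"
    have fin: "finite D" using D by (simp add: subintervals_def)
    have in_D: "fst p < snd p" "{fst p..snd p} \<subseteq> {a..b}" if "p \<in> D" for p
      using D(1) that by (cases p, force simp: subintervals_def)+
    \<comment> \<open>the error \<open>c\<close> on each of the \<open>card D\<close> intervals adds up to at most \<open>e/2\<close>\<close>
    define c where "c = e / (2 * (real (card D) + 1))"
    have c: "c > 0" using \<open>e > 0\<close> by (simp add: c_def)
    have "\<exists>B. subintervals {fst p..snd p} B \<and> pos_variation g (fst p) (snd p) < (\<Sum>(u, v)\<in>B. g v - g u) + c"
      if p: "p \<in> D" for p
    proof (rule ccontr)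
      assume "\<not> ?thesis"
      then have "pos_variation g (fst p) (snd p) \<le> pos_variation g (fst p) (snd p) - c"
        by (intro pos_variation_least) force
      then show False using c by simp
    qed
    then obtain B where B: "\<And>p. p \<in> D \<Longrightarrow> subintervals {fst p..snd p} (B p)"
      "\<And>p. p \<in> D \<Longrightarrow> pos_variation g (fst p) (snd p) < (\<Sum>(u, v)\<in>B p. g v - g u) + c"
      by metis
    have inB: "fst q < snd q" "fst p \<le> fst q" "snd q \<le> snd p" if "p \<in> D" "q \<in> B p" for p q
      using B(1)[OF that(1)] that(2) by (cases q, force simp: subintervals_def)+
    have finB: "\<forall>p\<in>D. finite (B p)" using B(1) by (auto simp: subintervals_def)
    have disD: "{fst p<..<snd p} \<inter> {fst q<..<snd q} = {}" if "p \<in> D" "q \<in> D" "p \<noteq> q" for p q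
      using D(1) that disjoint_family_onD[of "\<lambda>(x, y). {x<..<y}" D p q]
      by (simp add: subintervals_def case_prod_beta)
    have sub: "{fst q<..<snd q} \<subseteq> {fst p<..<snd p}" if "p \<in> D" "q \<in> B p" for p q
      using inB[OF that] by auto
    have disB: "B p \<inter> B q = {}" if "p \<in> D" "q \<in> D" "p \<noteq> q" for p q
    proof (rule ccontr)
      assume "B p \<inter> B q \<noteq> {}"
      then obtain z where z: "z \<in> B p" "z \<in> B q" by blast
      have "(fst z + snd z) / 2 \<in> {fst z<..<snd z}" using inB(1)[OF that(1) z(1)] by simp
      then show False
        using sub[OF that(1) z(1)] sub[OF that(2) z(2)] disD[OF that] by blast
    qed
    let ?U = "\<Union>p\<in>D. B p"
    have U: "subintervals {a..b} ?U"
      unfolding subintervals_def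
    proof (intro conjI)
      show "finite ?U" using fin finB by auto
      show "\<forall>(x, y)\<in>?U. x < y \<and> {x..y} \<subseteq> {a..b}"
        using inB in_D by fastforce
      have "{fst q<..<snd q} \<inter> {fst q'<..<snd q'} = {}"
        if "p \<in> D" "p' \<in> D" "q \<in> B p" "q' \<in> B p'" "q \<noteq> q'" for p p' q q'
      proof (cases "p = p'")
        case True
        with that B(1)[of p] disjoint_family_onD[of "\<lambda>(x, y). {x<..<y}" "B p" q q'] show ?thesis
          by (simp add: subintervals_def case_prod_beta)
      next
        case False
        show ?thesis using disD[OF that(1,2) False] sub[OF that(1,3)] sub[OF that(2,4)] by blast
      qed
      then show "disjoint_family_on (\<lambda>(x, y). {x<..<y}) ?U"
        unfolding disjoint_family_on_def case_prod_beta by blast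
    qed
    have sum_U: "(\<Sum>q\<in>?U. h q) = (\<Sum>p\<in>D. \<Sum>q\<in>B p. h q)" for h :: "real \<times> real \<Rightarrow> real"
      using fin finB disB by (intro sum.UNION_disjoint) auto
    have "(\<Sum>(x, y)\<in>?U. y - x) \<le> (\<Sum>(x, y)\<in>D. y - x)"
      unfolding sum_U case_prod_beta
    proof (rule sum_mono)
      fix p assume p: "p \<in> D"
      show "(\<Sum>q\<in>B p. snd q - fst q) \<le> snd p - fst p"
        using subintervals_length[OF B(1)[OF p]] in_D(1)[OF p] by (simp add: case_prod_beta)
    qed
    then have len: "(\<Sum>(x, y)\<in>?U. y - x) < d" using D(2) by simp
    have "(\<Sum>p\<in>D. \<bar>pos_variation g a (snd p) - pos_variation g a (fst p)\<bar>)
        \<le> (\<Sum>p\<in>D. (\<Sum>(u, v)\<in>B p. g v - g u) + c)"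
    proof (rule sum_mono)
      fix p assume p: "p \<in> D"
      have "pos_variation g a (fst p) \<le> pos_variation g a (snd p)"
        using in_D[OF p] by (intro pos_variation_mono) auto
      moreover have "pos_variation g a (snd p) \<le> pos_variation g a (fst p) + pos_variation g (fst p) (snd p)"
        using in_D[OF p] by (intro pos_variation_split) auto
      ultimately show "\<bar>pos_variation g a (snd p) - pos_variation g a (fst p)\<bar> \<le> (\<Sum>(u, v)\<in>B p. g v - g u) + c"
        using B(2)[OF p] by linarith
    qed
    also have "\<dots> = (\<Sum>(u, v)\<in>?U. g v - g u) + card D * c"
      unfolding sum_U by (simp add: sum.distrib)
    also have "(\<Sum>(u, v)\<in>?U. g v - g u) \<le> (\<Sum>(u, v)\<in>?U. \<bar>g v - g u\<bar>)"
      by (intro sum_mono) auto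
    also have "(\<Sum>(u, v)\<in>?U. \<bar>g v - g u\<bar>) < e / 2" by (rule ac_modulusD(2)[OF d U len])
    also have "card D * c \<le> e / 2"
      using \<open>e > 0\<close> unfolding c_def by (simp add: field_simps)
    finally show "(\<Sum>(x, y)\<in>D. \<bar>pos_variation g a y - pos_variation g a x\<bar>) < e"
      by (simp add: case_prod_beta)
  qed
  then show "\<exists>d. ac_modulus {a..b} (pos_variation g a) e d" ..
qed

end

section \<open>The fundamental theorem of calculus for absolutely continuous functions\<close>

text \<open>
  A null set lies in an open set \<open>U\<close> of small length. A compact subset of \<open>U\<close> is covered by
  cells of a fine grid that still lie in \<open>U\<close>; their total length is small, so absolute continuity makes the total
  increment of \<open>H\<close> small.
\<close>

lemma abs_cont_interval_measure:
  fixes H :: "real \<Rightarrow> real"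
  assumes mono: "\<And>x y. x \<le> y \<Longrightarrow> H x \<le> H y" and ac: "abs_cont_on UNIV H"
  shows "absolutely_continuous lborel (interval_measure H)"
  unfolding absolutely_continuous_def
proof
  let ?M = "interval_measure H"
  have cont: "continuous_on UNIV H" using abs_cont_on_imp_continuous_on[OF ac] by simp
  fix A assume A: "A \<in> null_sets (lborel :: real measure)"
  have small: "emeasure ?M A \<le> 0 + ennreal e" if e: "e > 0" for e
  proof -
    obtain d where d: "ac_modulus UNIV H e d" using abs_cont_onD[OF ac e] ..
    have "A \<in> sets borel" using A by auto
    then obtain U where U: "open U" "A \<subseteq> U" "emeasure lborel (U - A) < d"
      using outer_regular_lborel ac_modulusD(1)[OF d] by blast
    have lenU: "emeasure lborel U < d"
      using U A emeasure_Diff_null_set[OF A, of U] by auto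
    have bound: "emeasure ?M K \<le> e" if K: "compact K" "K \<subseteq> U" for K
    proof -
      obtain r where r: "r > 0" "(\<Union>x\<in>K. ball x r) \<subseteq> U"
        using compact_subset_open_imp_ball_epsilon_subset[OF K(1) U(1) K(2)] by blast
      obtain R0 where R0: "\<And>x. x \<in> K \<Longrightarrow> \<bar>x\<bar> \<le> R0"
        using compact_imp_bounded[OF K(1)] unfolding bounded_iff by auto
      define R where "R = max R0 0 + 1"
      have R: "R > 0" "\<And>x. x \<in> K \<Longrightarrow> -R < x \<and> x < R" using R0 by (force simp: R_def)+
      obtain n :: nat where n: "2 * R / r < n" using reals_Archimedean2 by blast
      have npos: "n > 0" using n R(1) r(1) by (metis divide_pos_pos gr0I mult_pos_pos not_less_iff_gr_or_eq of_nat_0 zero_less_numeral)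
      define w where "w = 2 * R / n"
      have w: "w > 0" "w < r" using n R(1) r(1) npos by (auto simp: w_def field_simps)
      \<comment> \<open>a grid of mesh \<open>w < r\<close>, so that a cell meeting \<open>K\<close> lies in \<open>U\<close>\<close>
      define x where "x i = - R + real i * w" for i
      have xS: "x (Suc i) = x i + w" for i by (simp add: x_def algebra_simps)
      have xm: "x i \<le> x j" if "i \<le> j" for i j
        using that w(1) unfolding x_def by (intro add_left_mono mult_right_mono) auto
      define B where "B = {i. i < n \<and> {x i..x (Suc i)} \<inter> K \<noteq> {}}"
      have finB: "finite B" by (simp add: B_def)
      have KB: "K \<subseteq> (\<Union>i\<in>B. {x i..x (Suc i)})"
      proof
        fix k assume k: "k \<in> K"
        define i where "i = nat \<lfloor>(k + R) / w\<rfloor>"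
        have pos: "(k + R) / w \<ge> 0" using R(2)[OF k] w by simp
        have "real i \<le> (k + R) / w" "(k + R) / w < real i + 1"
          using pos unfolding i_def by linarith+
        then have i: "real i * w \<le> k + R" "k + R < (real i + 1) * w"
          using w(1) by (simp_all add: field_simps)
        have "real i * w < n * w" using i(1) R(2)[OF k] npos by (simp add: w_def)
        then have "i < n" using w(1) by simp
        moreover have "k \<in> {x i..x (Suc i)}" using i by (simp add: x_def algebra_simps)
        ultimately have "i \<in> B" using k unfolding B_def by blast
        then show "k \<in> (\<Union>i\<in>B. {x i..x (Suc i)})" using \<open>k \<in> {x i..x (Suc i)}\<close> by blast
      qed
      have cell: "{x i..x (Suc i)} \<subseteq> U" if i: "i \<in> B" for i
      proof -
        obtain k where k: "k \<in> K" "x i \<le> k" "k \<le> x (Suc i)" using i by (auto simp: B_def)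
        have "{x i..x (Suc i)} \<subseteq> ball k r"
          using k w xS[of i] by (auto simp: dist_real_def)
        then show ?thesis using r(2) k(1) by blast
      qed
      have dis: "disjoint_family_on (\<lambda>i. {x i<..<x (Suc i)}) B"
      proof -
        have "{x i<..<x (Suc i)} \<inter> {x j<..<x (Suc j)} = {}" if "i < j" for i j
          using xm[of "Suc i" j] that by auto
        then show ?thesis unfolding disjoint_family_on_def by (metis Int_commute linorder_neqE_nat)
      qed
      have F1: "\<forall>i\<in>B. x i \<le> x (Suc i)" using w xS by simp
      have F2: "\<forall>i\<in>B. x i < x (Suc i) \<longrightarrow> {x i..x (Suc i)} \<subseteq> U" using cell by blast
      note F = subintervals_of_family[OF finB F1 F2 dis]
      let ?D = "(\<lambda>i. (x i, x (Suc i))) ` {i\<in>B. x i < x (Suc i)}"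
      have "ennreal (\<Sum>(u, v)\<in>?D. v - u) < ennreal d"
        using subintervals_length_emeasure[OF F(1)] U(1) lenU by (meson borel_open order_le_less_trans)
      moreover have "(\<Sum>(u, v)\<in>?D. v - u) \<ge> 0"
        by (rule sum_nonneg) auto
      ultimately have len: "(\<Sum>(u, v)\<in>?D. v - u) < d" by (simp add: ennreal_less_iff)
      have "(\<Sum>i\<in>B. H (x (Suc i)) - H (x i)) = (\<Sum>(u, v)\<in>?D. H v - H u)"
        by (rule F(2)[of "\<lambda>u v. H v - H u", symmetric]) simp
      also have "\<dots> \<le> (\<Sum>(u, v)\<in>?D. \<bar>H v - H u\<bar>)" by (intro sum_mono) auto
      also have "\<dots> < e"
        by (rule ac_modulusD(2)[OF d subintervals_mono[OF F(1) subset_UNIV] len])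
      finally have less: "(\<Sum>i\<in>B. H (x (Suc i)) - H (x i)) < e" .
      have "emeasure ?M K \<le> emeasure ?M (\<Union>i\<in>B. {x i..x (Suc i)})"
        using KB finB by (intro emeasure_mono) auto
      also have "\<dots> \<le> (\<Sum>i\<in>B. emeasure ?M {x i..x (Suc i)})"
        using finB by (intro emeasure_subadditive_finite) auto
      also have "\<dots> = (\<Sum>i\<in>B. ennreal (H (x (Suc i)) - H (x i)))"
        using F1 by (intro sum.cong refl emeasure_interval_measure_Icc mono cont) auto
      also have "\<dots> = ennreal (\<Sum>i\<in>B. H (x (Suc i)) - H (x i))"
        using F1 mono by (intro sum_ennreal) simp
      also have "\<dots> \<le> ennreal e" using less by (intro ennreal_leI) simp
      finally show ?thesis .
    qed
    obtain C where C: "\<And>n. compact (C n)" "\<And>n. C n \<subseteq> U" "\<And>n. C n \<subseteq> interior (C (Suc n))" "\<Union>(range C) = U"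
      using open_Union_compact_subsets[OF U(1)] by metis
    have inc: "incseq C"
      by (rule incseq_SucI) (meson C(3) interior_subset order_trans)
    have "emeasure ?M A \<le> emeasure ?M U" using U by (intro emeasure_mono) auto
    also have "emeasure ?M U = (SUP n. emeasure ?M (C n))"
      using SUP_emeasure_incseq[of C ?M] inc C(1,4) by (auto simp: image_subset_iff compact_imp_closed)
    also have "\<dots> \<le> e" by (intro SUP_least bound C)
    finally show ?thesis by simp
  qed
  have "emeasure ?M A \<le> 0" by (rule ennreal_le_epsilon) (rule small)
  then show "A \<in> null_sets ?M" using A by (auto simp: null_sets_def)
qed

text \<open>
  The Radon--Nikodym density of the measure \<open>dH\<close>.
\<close>

lemma mono_abs_cont_density:
  fixes H :: "real \<Rightarrow> real"
  assumes mono: "\<And>x y. x \<le> y \<Longrightarrow> H x \<le> H y" and ac: "abs_cont_on UNIV H"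
  obtains f :: "real \<Rightarrow> real" where "f \<in> borel_measurable borel"
    "\<And>x y. x \<le> y \<Longrightarrow> set_integrable lborel {x..y} f"
    "\<And>x y. x \<le> y \<Longrightarrow> (LBINT t:{x..y}. f t) = H y - H x"
proof -
  let ?M = "interval_measure H"
  have cont: "continuous_on UNIV H" using abs_cont_on_imp_continuous_on[OF ac] by simp
  obtain f where f: "f \<in> borel_measurable lborel" "density lborel f = ?M"
    using sigma_finite_measure.Radon_Nikodym[OF sigma_finite_lborel abs_cont_interval_measure[OF mono ac]] by auto
  define k where "k t = enn2real (f t)" for t
  have k: "k \<in> borel_measurable borel" unfolding k_def using f(1) by simp
  have k_nonneg: "k t \<ge> 0" for t by (simp add: k_def)
  have has: "has_bochner_integral lborel (\<lambda>t. indicator {x..y} t *\<^sub>R k t) (H y - H x)" if xy: "x \<le> y" for x y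
  proof -
    have 1: "(\<integral>\<^sup>+ t. f t * indicator {x..y} t \<partial>lborel) = ennreal (H y - H x)"
      using emeasure_density[OF f(1), of "{x..y}"] emeasure_interval_measure_Icc[OF xy mono cont] f(2) by simp
    have "AE t in lborel. f t * indicator {x..y} t \<noteq> \<infinity>"
      using f(1) by (intro nn_integral_PInf_AE) (auto simp: 1)
    then have "(\<integral>\<^sup>+ t. ennreal (indicator {x..y} t *\<^sub>R k t) \<partial>lborel) = (\<integral>\<^sup>+ t. f t * indicator {x..y} t \<partial>lborel)"
      by (intro nn_integral_cong_AE) (auto elim!: eventually_mono simp: k_def indicator_def less_top)
    with 1 show ?thesis
      using k mono[OF xy] by (intro has_bochner_integral_nn_integral) (auto simp: k_nonneg)
  qed
  show thesis
  proof (rule that[OF k])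
    fix x y :: real assume "x \<le> y"
    from has[OF this] show "set_integrable lborel {x..y} k" "(LBINT t:{x..y}. k t) = H y - H x"
      unfolding set_integrable_def set_lebesgue_integral_def
      by (auto simp: has_bochner_integral_iff)
  qed
qed

text \<open>
  Right difference quotients only, as the differentiation theorem for Henstock--Kurzweil integrals
  averages over \<open>[x, x + h]\<close>; the left ones follow by reflection.
\<close>

lemma right_lebesgue_differentiation:
  fixes f F :: "real \<Rightarrow> real"
  assumes int: "\<And>x y. x \<le> y \<Longrightarrow> set_integrable lborel {x..y} f"
    and F: "\<And>x y. x \<le> y \<Longrightarrow> (LBINT t:{x..y}. f t) = F y - F x"
  shows "AE x in lborel. \<forall>e>0. \<exists>d>0. \<forall>h. 0 < h \<and> h < d \<longrightarrow> \<bar>(F (x + h) - F x) / h - f x\<bar> < e"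
proof -
  have "f integrable_on cbox x y" for x y
    using set_borel_integral_eq_integral(1)[OF int, of x y] by (cases "x \<le> y") auto
  then obtain N where N: "negligible N" "\<And>x e. x \<notin> N \<Longrightarrow> 0 < e \<Longrightarrow>
      \<exists>d>0. \<forall>h. 0 < h \<and> h < d \<longrightarrow> norm (integral (cbox x (x + h *\<^sub>R One)) f /\<^sub>R h ^ DIM(real) - f x) < e"
    using integrable_ccontinuous_explicit[of f] by metis
  have "N \<in> null_sets lebesgue" using N(1) by (simp add: negligible_iff_null_sets)
  then have "AE x in lebesgue. x \<notin> N" by (rule AE_not_in)
  then have "AE x in lborel. x \<notin> N" by (simp add: AE_completion_iff)
  then show ?thesis
  proof (rule eventually_mono, intro allI impI)
    fix x e :: real assume "x \<notin> N" "e > 0"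
    from N(2)[OF this] obtain d where d: "d > 0" "\<forall>h. 0 < h \<and> h < d \<longrightarrow> \<bar>integral {x..x + h} f / h - f x\<bar> < e"
      by (auto simp: divide_inverse mult.commute)
    have "integral {x..x + h} f = F (x + h) - F x" if "h > 0" for h
      using set_borel_integral_eq_integral(2)[OF int, of x "x + h"] F[of x "x + h"] that by simp
    with d show "\<exists>d>0. \<forall>h. 0 < h \<and> h < d \<longrightarrow> \<bar>(F (x + h) - F x) / h - f x\<bar> < e" by auto
  qed
qed

lemma lebesgue_differentiation:
  fixes f F :: "real \<Rightarrow> real"
  assumes int: "\<And>x y. x \<le> y \<Longrightarrow> set_integrable lborel {x..y} f"
    and F: "\<And>x y. x \<le> y \<Longrightarrow> (LBINT t:{x..y}. f t) = F y - F x"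
  shows "AE x in lborel. (F has_real_derivative f x) (at x)"
proof -
  have ind: "indicator {x..y} (- t) = (indicator {-y..-x} t :: real)" for x y t :: real
    by (auto simp: indicator_def)
  have int': "set_integrable lborel {x..y} (\<lambda>t. f (- t))" if "x \<le> y" for x y
    using lborel_integrable_real_affine[OF int[of "-y" "-x", unfolded set_integrable_def], of "-1" 0] that
    by (simp add: set_integrable_def ind)
  have F': "(LBINT t:{x..y}. f (- t)) = - F (- y) - - F (- x)" if "x \<le> y" for x y
    using lborel_integral_real_affine[of "-1" "\<lambda>t. indicator {-y..-x} t *\<^sub>R f t" 0] F[of "-y" "-x"] that
    by (simp add: set_lebesgue_integral_def ind)
  \<comment> \<open>the left difference quotients are the right ones of the reflected function\<close>
  have "AE x in lborel. \<forall>e>0. \<exists>d>0. \<forall>h. 0 < h \<and> h < d \<longrightarrow> \<bar>(- F (- (x + h)) - - F (- x)) / h - f (- x)\<bar> < e"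
    using right_lebesgue_differentiation[OF int' F'] .
  then have "AE x in distr lborel borel uminus. \<forall>e>0. \<exists>d>0. \<forall>h. 0 < h \<and> h < d \<longrightarrow> \<bar>(- F (- (x + h)) - - F (- x)) / h - f (- x)\<bar> < e"
    unfolding lborel_distr_uminus .
  from AE_distrD[OF _ this]
  have L: "AE x in lborel. \<forall>e>0. \<exists>d>0. \<forall>h. 0 < h \<and> h < d \<longrightarrow> \<bar>(F x - F (x - h)) / h - f x\<bar> < e"
    by simp
  have "AE x in lborel. \<forall>e>0. \<exists>d>0. \<forall>h. 0 < h \<and> h < d \<longrightarrow> \<bar>(F (x + h) - F x) / h - f x\<bar> < e"
    using int F by (rule right_lebesgue_differentiation)
  then show ?thesis
    using L
  proof eventually_elim
    case (elim x)
    show ?case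
      unfolding DERIV_def LIM_eq
    proof (intro allI impI)
      fix e :: real assume e: "e > 0"
      obtain d1 where d1: "d1 > 0" "\<And>h. 0 < h \<Longrightarrow> h < d1 \<Longrightarrow> \<bar>(F (x + h) - F x) / h - f x\<bar> < e"
        using elim(1) e by meson
      obtain d2 where d2: "d2 > 0" "\<And>h. 0 < h \<Longrightarrow> h < d2 \<Longrightarrow> \<bar>(F x - F (x - h)) / h - f x\<bar> < e"
        using elim(2) e by meson
      show "\<exists>d>0. \<forall>h. h \<noteq> 0 \<and> norm (h - 0) < d \<longrightarrow> norm ((F (x + h) - F x) / h - f x) < e"
      proof (intro exI[of _ "min d1 d2"] conjI allI impI)
        fix h :: real assume h: "h \<noteq> 0 \<and> norm (h - 0) < min d1 d2"
        show "norm ((F (x + h) - F x) / h - f x) < e"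
        proof (cases "h > 0")
          case True
          then show ?thesis using d1(2)[of h] h by simp
        next
          case False
          have "(F (x + h) - F x) / h = (F x - F (x - - h)) / - h" using h by (simp add: field_simps)
          then show ?thesis using d2(2)[of "- h"] h False by simp
        qed
      qed (use d1(1) d2(1) in simp)
    qed
  qed
qed

text \<open>
  Write \<open>g = P - (P - g)\<close> with the positive variation \<open>P\<close>. Both terms are increasing and absolutely
  continuous, hence have densities, and Lebesgue's differentiation theorem identifies the derivative.
\<close>

lemma (in small_variation) ftc_small_variation:
  assumes ac: "abs_cont_on {a..b} g" and ab: "a < b"
  obtains f where "f \<in> borel_measurable borel"
    "\<And>x y. a \<le> x \<Longrightarrow> x \<le> y \<Longrightarrow> y \<le> b \<Longrightarrow> set_integrable lborel {x..y} f"
    "\<And>x y. a \<le> x \<Longrightarrow> x \<le> y \<Longrightarrow> y \<le> b \<Longrightarrow> (LBINT t:{x..y}. f t) = g y - g x"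
    "AE t in lborel. a < t \<and> t < b \<longrightarrow> (g has_real_derivative f t) (at t)"
proof -
  let ?c = "\<lambda>x. max a (min b x)"
  let ?P = "pos_variation g a"
  let ?Q = "\<lambda>x. pos_variation g a x - g x"
  have P: "abs_cont_on {a..b} ?P" by (rule abs_cont_pos_variation[OF ac])
  have Q: "abs_cont_on {a..b} ?Q" by (rule abs_cont_on_diff[OF P ac])
  have c: "a \<le> ?c x" "?c x \<le> b" "x \<le> y \<Longrightarrow> ?c x \<le> ?c y" for x y using ab by auto
  have mP: "?P (?c x) \<le> ?P (?c y)" if "x \<le> y" for x y
    using c that by (intro pos_variation_mono) auto
  have mQ: "?Q (?c x) \<le> ?Q (?c y)" if "x \<le> y" for x y
  proof (cases "?c x = ?c y")
    case False
    then have "?c x < ?c y" by (rule le_neq_trans[OF c(3)[OF that]])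
    from pos_variation_incr[OF c(1) this c(2)] show ?thesis by linarith
  next
    case True
    then show ?thesis by (simp only:)
  qed
  obtain f1 where f1: "f1 \<in> borel_measurable borel" "\<And>x y. x \<le> y \<Longrightarrow> set_integrable lborel {x..y} f1"
    "\<And>x y. x \<le> y \<Longrightarrow> (LBINT t:{x..y}. f1 t) = ?P (?c y) - ?P (?c x)"
    using mono_abs_cont_density[OF mP abs_cont_on_clamp[OF P less_imp_le[OF ab]]] by blast
  obtain f2 where f2: "f2 \<in> borel_measurable borel" "\<And>x y. x \<le> y \<Longrightarrow> set_integrable lborel {x..y} f2"
    "\<And>x y. x \<le> y \<Longrightarrow> (LBINT t:{x..y}. f2 t) = ?Q (?c y) - ?Q (?c x)"
    using mono_abs_cont_density[OF mQ abs_cont_on_clamp[OF Q less_imp_le[OF ab]]] by blast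
  let ?f = "\<lambda>t. f1 t - f2 t"
  have int: "set_integrable lborel {x..y} ?f" if "x \<le> y" for x y
    using f1(2) f2(2) that by (intro set_integral_diff(1))
  have eq: "(LBINT t:{x..y}. ?f t) = g (?c y) - g (?c x)" if "x \<le> y" for x y
    using f1(2,3)[OF that] f2(2,3)[OF that] by (simp add: set_integral_diff(2))
  show thesis
  proof (rule that[of ?f])
    show "?f \<in> borel_measurable borel" using f1(1) f2(1) by simp
    show "set_integrable lborel {x..y} ?f" if "a \<le> x" "x \<le> y" "y \<le> b" for x y using int that by simp
    show "(LBINT t:{x..y}. ?f t) = g y - g x" if "a \<le> x" "x \<le> y" "y \<le> b" for x y
      using eq[OF that(2)] that by (simp add: max_def min_def split: if_splits)
    have "AE t in lborel. ((\<lambda>x. g (?c x)) has_real_derivative ?f t) (at t)"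
      using int eq by (rule lebesgue_differentiation)
    then show "AE t in lborel. a < t \<and> t < b \<longrightarrow> (g has_real_derivative ?f t) (at t)"
    proof (rule eventually_mono, intro impI)
      fix t assume D: "((\<lambda>x. g (?c x)) has_real_derivative ?f t) (at t)" and t: "a < t \<and> t < b"
      show "(g has_real_derivative ?f t) (at t)"
        by (rule has_field_derivative_transform_within_open[OF D, of "{a<..<b}"]) (use t in auto)
    qed
  qed
qed

lemma interval_exhaustion:
  fixes Y :: "real set"
  assumes Y: "is_interval Y" "Y \<noteq> {}"
  obtains p q :: "nat \<Rightarrow> real" where "\<And>k. p k \<in> Y" "\<And>k. q k \<in> Y" "\<And>k. p k \<le> q k" "decseq p" "incseq q"
    "Y = (\<Union>k. {p k..q k})"
proof -
  define C where "C = Y \<inter> (\<rat> \<union> {Inf Y, Sup Y})"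
  have sub: "C \<subseteq> Y" by (auto simp: C_def)
  have Q: "\<exists>c\<in>Y \<inter> \<rat>. x \<le> c \<and> c \<le> y" if xy: "x \<in> Y" "y \<in> Y" "x < y" for x y
  proof -
    obtain c where "c \<in> \<rat>" "x < c" "c < y" using Rats_dense_in_real[OF xy(3)] by blast
    then show ?thesis using mem_is_interval_1_I[OF Y(1) xy(1,2), of c] by (intro bexI[of _ c]) auto
  qed
  have lo: "\<exists>c\<in>C. c \<le> y" if "y \<in> Y" for y
  proof (cases "\<forall>z\<in>Y. y \<le> z")
    case True
    then have "Inf Y = y" using that by (intro cInf_eq_minimum) auto
    then show ?thesis using that by (auto simp: C_def)
  next
    case False
    then obtain z where "z \<in> Y" "z < y" by force
    from Q[OF this(1) that this(2)] show ?thesis by (auto simp: C_def)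
  qed
  have hi: "\<exists>c\<in>C. y \<le> c" if "y \<in> Y" for y
  proof (cases "\<forall>z\<in>Y. z \<le> y")
    case True
    then have "Sup Y = y" using that by (intro cSup_eq_maximum) auto
    then show ?thesis using that by (auto simp: C_def)
  next
    case False
    then obtain z where "z \<in> Y" "y < z" by force
    from Q[OF that this(1) this(2)] show ?thesis by (auto simp: C_def)
  qed
  have cnt: "countable C" unfolding C_def by (intro countable_Int2) (simp add: countable_rat)
  have ne: "C \<noteq> {}" using lo Y(2) by auto
  define c where "c = from_nat_into C"
  have c: "c i \<in> C" for i unfolding c_def using ne by (rule from_nat_into)
  have surj: "\<exists>i. x = c i" if "x \<in> C" for x
    using from_nat_into_surj[OF cnt that] unfolding c_def by metis
  define p where "p k = Min (c ` {..k})" for k :: nat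
  define q where "q k = Max (c ` {..k})" for k :: nat
  have pC: "p k \<in> c ` {..k}" and qC: "q k \<in> c ` {..k}" for k
    unfolding p_def q_def by (intro Min_in Max_in; simp)+
  have pY: "p k \<in> Y" and qY: "q k \<in> Y" for k using pC[of k] qC[of k] c sub by auto
  have le: "p k \<le> c i" "c i \<le> q k" if "i \<le> k" for i k
    using that unfolding p_def q_def by auto
  show thesis
  proof (rule that[of p q])
    show "p k \<le> q k" for k using le[of 0 k] by simp
    show "decseq p" unfolding decseq_def p_def by (intro allI impI Min_antimono) auto
    show "incseq q" unfolding incseq_def q_def by (intro allI impI Max_mono) auto
    show "Y = (\<Union>k. {p k..q k})"
    proof (intro equalityI subsetI)
      fix y assume y: "y \<in> Y"
      obtain i j where "c i \<le> y" "y \<le> c j" using lo[OF y] hi[OF y] surj by metis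
      then have "p (max i j) \<le> y" "y \<le> q (max i j)"
        using le(1)[of i "max i j"] le(2)[of j "max i j"] by auto
      then show "y \<in> (\<Union>k. {p k..q k})" by auto
    next
      fix y assume "y \<in> (\<Union>k. {p k..q k})"
      then show "y \<in> Y" using mem_is_interval_1_I[OF Y(1) pY qY] by auto
    qed
  qed (fact pY qY)+
qed

lemma locally_abs_cont_on_imp_continuous_on:
  assumes Y: "is_interval Y" and g: "locally_abs_cont_on Y g"
  shows "continuous_on Y g"
  unfolding continuous_on_iff
proof (intro ballI allI impI)
  fix x e :: real assume x: "x \<in> Y" and e: "e > 0"
  obtain p where p: "p \<in> Y" "p \<le> x" "p < x \<or> (\<forall>y\<in>Y. x \<le> y)"
    using x by (metis less_le_not_le linear)
  obtain q where q: "q \<in> Y" "x \<le> q" "x < q \<or> (\<forall>y\<in>Y. y \<le> x)"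
    using x by (metis less_le_not_le linear)
  have "abs_cont_on {p..q} g" using g p q unfolding locally_abs_cont_on_def by auto
  then have "continuous_on {p..q} g" by (rule abs_cont_on_imp_continuous_on) simp
  then obtain d where d: "d > 0" "\<forall>y\<in>{p..q}. dist y x < d \<longrightarrow> dist (g y) (g x) < e"
    using p(2) q(2) e unfolding continuous_on_iff by (metis atLeastAtMost_iff)
  define d' where "d' = min d (min (if p < x then x - p else 1) (if x < q then q - x else 1))"
  have "d' > 0" using d(1) by (simp add: d'_def)
  moreover have "y \<in> {p..q}" if "y \<in> Y" "dist y x < d'" for y
    using that p q by (auto simp: d'_def dist_real_def split: if_splits)
  ultimately show "\<exists>d>0. \<forall>x'\<in>Y. dist x' x < d \<longrightarrow> dist (g x') (g x) < e"
    using d(2) by (intro exI[of _ d']) (auto simp: d'_def)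
qed

lemma set_integral_Icc_combine:
  fixes f :: "real \<Rightarrow> real"
  assumes "a \<le> b" "b \<le> c" "set_integrable lborel {a..b} f" "set_integrable lborel {b..c} f"
  shows "set_integrable lborel {a..c} f"
    "(LBINT t:{a..c}. f t) = (LBINT t:{a..b}. f t) + (LBINT t:{b..c}. f t)"
proof -
  have "{a..c} = {a..b} \<union> {b..c}" using assms by auto
  then show 1: "set_integrable lborel {a..c} f"
    using set_integrable_Un[OF assms(3,4)] by simp
  show "(LBINT t:{a..c}. f t) = (LBINT t:{a..b}. f t) + (LBINT t:{b..c}. f t)"
    using Henstock_Kurzweil_Integration.integral_combine[OF assms(1,2) set_borel_integral_eq_integral(1)[OF 1]]
      set_borel_integral_eq_integral(2)[OF 1] set_borel_integral_eq_integral(2)[OF assms(3)]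
      set_borel_integral_eq_integral(2)[OF assms(4)] by simp
qed

text \<open>
  The candidate for \<open>f\<close> is a limit of difference quotients, which is defined on all of \<open>Y\<close>
  at once and measurable. So the pieces obtained on short intervals agree almost everywhere, and subdividing a
  compact interval (Bolzano's bisection principle) gives the statement on all of it.
\<close>

theorem ftc_locally_abs_cont:
  fixes g :: "real \<Rightarrow> real"
  assumes Y: "is_interval Y" and g: "locally_abs_cont_on Y g"
  obtains f where "f \<in> borel_measurable borel"
    "\<And>p q. p \<in> Y \<Longrightarrow> q \<in> Y \<Longrightarrow> p \<le> q \<Longrightarrow> set_integrable lborel {p..q} f"
    "\<And>p q. p \<in> Y \<Longrightarrow> q \<in> Y \<Longrightarrow> p \<le> q \<Longrightarrow> (LBINT t:{p..q}. f t) = g q - g p"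
    "AE t in lborel. t \<in> Y \<longrightarrow> (g has_real_derivative f t) (at t)"
proof (cases "Y = {}")
  case True
  show thesis by (rule that[of "\<lambda>_. 0"]) (use True in auto)
next
  case False
  define G where "G t = indicator Y t *\<^sub>R g t" for t
  have "Y \<in> sets borel" using Y by (rule real_interval_borel_measurable)
  then have G: "G \<in> borel_measurable borel" unfolding G_def
    by (rule borel_measurable_continuous_on_indicator[OF _ locally_abs_cont_on_imp_continuous_on[OF Y g]])
  \<comment> \<open>equals the derivative wherever it exists in the interior of \<open>Y\<close>, and is measurable everywhere\<close>
  define f where "f t = lim (\<lambda>k. (G (t + 1 / real (Suc k)) - G t) * real (Suc k))" for t
  have fm: "f \<in> borel_measurable borel" unfolding f_def
  proof (rule borel_measurable_lim_metric)
    note [measurable] = G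
    show "(\<lambda>t. (G (t + 1 / real (Suc k)) - G t) * real (Suc k)) \<in> borel_measurable borel" for k
      by measurable
  qed
  have fD: "f t = D" if "(g has_real_derivative D) (at t)" "p < t" "t < q" "p \<in> Y" "q \<in> Y" for t D p q
  proof -
    have sub: "{p<..<q} \<subseteq> Y" using mem_is_interval_1_I[OF Y that(4,5)] by auto
    have "(G has_real_derivative D) (at t)"
      by (rule has_field_derivative_transform_within_open[OF that(1), of "{p<..<q}"])
        (use that sub in \<open>auto simp: G_def\<close>)
    then have "((\<lambda>h. (G (t + h) - G t) / h) \<longlongrightarrow> D) (at 0)" by (simp add: DERIV_def)
    moreover have "filterlim (\<lambda>k. 1 / real (Suc k)) (at 0) sequentially"
      using lim_inverse_n' LIMSEQ_Suc[OF lim_inverse_n'] by (auto simp: filterlim_at lim_1_over_n)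
    ultimately have "(\<lambda>k. (G (t + 1 / real (Suc k)) - G t) / (1 / real (Suc k))) \<longlonglongrightarrow> D"
      by (rule filterlim_compose)
    then show ?thesis unfolding f_def by (intro limI) simp
  qed
  have main: "set_integrable lborel {p..q} f \<and> (LBINT t:{p..q}. f t) = g q - g p \<and>
      (AE t in lborel. p < t \<and> t < q \<longrightarrow> (g has_real_derivative f t) (at t))"
    if pq: "p \<in> Y" "q \<in> Y" "p \<le> q" for p q
  proof -
    define Q where "Q a b \<longleftrightarrow> set_integrable lborel {a..b} f \<and> (LBINT t:{a..b}. f t) = g b - g a \<and>
      (AE t in lborel. a < t \<and> t < b \<longrightarrow> (g has_real_derivative f t) (at t))" for a b
    have sub: "{p..q} \<subseteq> Y" using mem_is_interval_1_I[OF Y pq(1,2)] by auto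
    have ac: "abs_cont_on {p..q} g" using g pq unfolding locally_abs_cont_on_def by blast
    \<comment> \<open>on intervals shorter than \<open>d\<close> the variation is at most 1\<close>
    obtain d where d: "ac_modulus {p..q} g 1 d" using abs_cont_onD[OF ac zero_less_one] ..
    have short: "Q a b" if ab: "p \<le> a" "a \<le> b" "b \<le> q" "b - a < d" for a b
    proof (cases "a = b")
      case True
      have "set_integrable lborel {b..b} f" unfolding set_integrable_def
        by (rule integrable_cong_AE_imp[of _ "\<lambda>_. 0"]) (use fm in \<open>auto intro: AE_mp[OF AE_lborel_singleton[of b]]\<close>)
      moreover have "(LBINT t:{b..b}. f t) = (LBINT t:{b..b}. 0)"
        unfolding set_lebesgue_integral_def
        by (rule integral_cong_AE) (use fm in \<open>auto intro: AE_mp[OF AE_lborel_singleton[of b]]\<close>)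
      moreover have "AE t in lborel. b < t \<and> t < b \<longrightarrow> (g has_real_derivative f t) (at t)"
        by (rule always_eventually) auto
      ultimately show ?thesis using True by (simp add: Q_def)
    next
      case False
      then have lt: "a < b" using ab by simp
      have sub': "{a..b} \<subseteq> {p..q}" using ab by auto
      interpret small_variation g a b
      proof
        fix D assume D: "subintervals {a..b} D"
        have "(\<Sum>(x, y)\<in>D. y - x) < d" using subintervals_length[OF D ab(2)] ab(4) by simp
        from ac_modulusD(2)[OF d subintervals_mono[OF D sub'] this]
        show "(\<Sum>(x, y)\<in>D. \<bar>g y - g x\<bar>) \<le> 1" by simp
      qed
      obtain k where k: "k \<in> borel_measurable borel"
        "\<And>x y. a \<le> x \<Longrightarrow> x \<le> y \<Longrightarrow> y \<le> b \<Longrightarrow> set_integrable lborel {x..y} k"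
        "\<And>x y. a \<le> x \<Longrightarrow> x \<le> y \<Longrightarrow> y \<le> b \<Longrightarrow> (LBINT t:{x..y}. k t) = g y - g x"
        "AE t in lborel. a < t \<and> t < b \<longrightarrow> (g has_real_derivative k t) (at t)"
        using ftc_small_variation[OF abs_cont_on_subset[OF ac sub'] lt] by blast
      have abY: "a \<in> Y" "b \<in> Y" using sub ab by auto
      have kf: "AE t in lborel. a < t \<and> t < b \<longrightarrow> k t = f t \<and> (g has_real_derivative f t) (at t)"
        using k(4) by (rule eventually_mono) (use fD abY in metis)
      have kf': "AE t in lborel. indicator {a..b} t *\<^sub>R f t = indicator {a..b} t *\<^sub>R k t"
        using kf AE_lborel_singleton[of a] AE_lborel_singleton[of b]
        by eventually_elim (auto simp: indicator_def)
      have "set_integrable lborel {a..b} f"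
        using k(2)[of a b] lt fm k(1) kf' unfolding set_integrable_def
        by (subst integrable_cong_AE[OF _ _ kf']) auto
      moreover have "(LBINT t:{a..b}. f t) = (LBINT t:{a..b}. k t)"
        unfolding set_lebesgue_integral_def using fm k(1) by (intro integral_cong_AE kf') auto
      ultimately show ?thesis unfolding Q_def using k(3)[of a b] lt kf by (auto elim: eventually_mono)
    qed
    have "p \<le> p \<and> q \<le> q \<longrightarrow> Q p q"
    proof (rule Bolzano[where P = "\<lambda>a b. p \<le> a \<and> b \<le> q \<longrightarrow> Q a b", OF pq(3)])
      fix a b c assume P: "p \<le> a \<and> b \<le> q \<longrightarrow> Q a b" "p \<le> b \<and> c \<le> q \<longrightarrow> Q b c" "a \<le> b" "b \<le> c"
      show "p \<le> a \<and> c \<le> q \<longrightarrow> Q a c"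
      proof
        assume "p \<le> a \<and> c \<le> q"
        then have ab: "Q a b" and bc: "Q b c" using P by auto
        have "AE t in lborel. a < t \<and> t < c \<longrightarrow> (g has_real_derivative f t) (at t)"
          using ab[unfolded Q_def, THEN conjunct2, THEN conjunct2] bc[unfolded Q_def, THEN conjunct2, THEN conjunct2]
            AE_lborel_singleton[of b]
          by eventually_elim auto
        then show "Q a c"
          using ab bc set_integral_Icc_combine[OF P(3,4), of f] unfolding Q_def by auto
      qed
    next
      fix x assume "p \<le> x" "x \<le> q"
      show "\<exists>d>0. \<forall>a b. a \<le> x \<and> x \<le> b \<and> b - a < d \<longrightarrow> p \<le> a \<and> b \<le> q \<longrightarrow> Q a b"
        using short ac_modulusD(1)[OF d] by (intro exI[of _ d]) auto
    qed
    then show ?thesis by (simp add: Q_def)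
  qed
  obtain p q where pq: "\<And>k. p k \<in> Y" "\<And>k. q k \<in> Y" "\<And>k. p k \<le> q k" "decseq p" "incseq q" "Y = (\<Union>k. {p k..q k})"
    by (rule interval_exhaustion[OF Y False]) (rule that)
  have "AE t in lborel. (p k < t \<and> t < q k \<longrightarrow> (g has_real_derivative f t) (at t)) \<and> t \<noteq> p k \<and> t \<noteq> q k" for k
    using main[OF pq(1)[of k] pq(2)[of k] pq(3)[of k], THEN conjunct2, THEN conjunct2]
      AE_lborel_singleton[of "p k"] AE_lborel_singleton[of "q k"]
    by eventually_elim simp
  then have "AE t in lborel. \<forall>k. (p k < t \<and> t < q k \<longrightarrow> (g has_real_derivative f t) (at t)) \<and> t \<noteq> p k \<and> t \<noteq> q k"
    by (subst AE_all_countable) (rule allI)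
  then have ae: "AE t in lborel. t \<in> Y \<longrightarrow> (g has_real_derivative f t) (at t)"
  proof (rule eventually_mono, intro impI)
    fix t assume t: "\<forall>k. (p k < t \<and> t < q k \<longrightarrow> (g has_real_derivative f t) (at t)) \<and> t \<noteq> p k \<and> t \<noteq> q k" "t \<in> Y"
    then obtain k where "p k \<le> t" "t \<le> q k" using pq(6) by auto
    then show "(g has_real_derivative f t) (at t)" using t(1)[rule_format, of k] by linarith
  qed
  show thesis
  proof (rule that[OF fm _ _ ae])
    show "set_integrable lborel {p..q} f" "(LBINT t:{p..q}. f t) = g q - g p"
      if "p \<in> Y" "q \<in> Y" "p \<le> q" for p q
      using main[OF that] by blast+
  qed
qed

section \<open>Smooth functions of one variable\<close>

definition smooth :: "(real \<Rightarrow> real) \<Rightarrow> bool" where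
  "smooth f \<longleftrightarrow> (\<forall>k x. (deriv ^^ k) f differentiable (at x))"

definition n_times_diff :: "nat \<Rightarrow> (real \<Rightarrow> real) \<Rightarrow> bool" where
  "n_times_diff n f \<longleftrightarrow> (\<forall>k<n. \<forall>x. (deriv ^^ k) f differentiable (at x))"

text \<open>
  Finite orders of differentiability allow induction: the product and chain rules express the first
  derivative of a composite by functions that are differentiable one time less.
\<close>

lemma smooth_iff: "smooth f \<longleftrightarrow> (\<forall>n. n_times_diff n f)"
  unfolding smooth_def n_times_diff_def by blast

lemma n_times_diff_0 [simp]: "n_times_diff 0 f"
  by (simp add: n_times_diff_def)

lemma n_times_diff_Suc:
  "n_times_diff (Suc n) f \<longleftrightarrow> (\<forall>x. f differentiable (at x)) \<and> n_times_diff n (deriv f)"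
  unfolding n_times_diff_def
  by (auto simp: All_less_Suc2 funpow_Suc_right simp del: funpow.simps(2))

lemma n_times_diff_SucD: "n_times_diff (Suc n) f \<Longrightarrow> n_times_diff n f"
  unfolding n_times_diff_def by auto

lemma n_times_diff_SucI:
  assumes "\<And>x. (f has_real_derivative f' x) (at x)" "n_times_diff n f'"
  shows "n_times_diff (Suc n) f"
proof -
  have "deriv f = f'" using assms(1) by (intro ext DERIV_imp_deriv)
  then show ?thesis
    using assms by (auto simp: n_times_diff_Suc real_differentiable_def)
qed

lemma n_times_diff_DERIV: "n_times_diff (Suc n) f \<Longrightarrow> (f has_real_derivative deriv f x) (at x)"
  by (simp add: n_times_diff_Suc DERIV_deriv_iff_real_differentiable)

lemma smooth_DERIV: "smooth f \<Longrightarrow> (f has_real_derivative deriv f x) (at x)"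
  using n_times_diff_DERIV smooth_iff by blast

lemma smooth_deriv: "smooth f \<Longrightarrow> smooth (deriv f)"
  using n_times_diff_Suc smooth_iff by blast

lemma smooth_primitive:
  assumes "\<And>x. (f has_real_derivative f' x) (at x)" "smooth f'"
  shows "smooth f"
  unfolding smooth_iff
proof
  fix n
  have "n_times_diff (Suc n) f"
    using assms by (intro n_times_diff_SucI) (auto simp: smooth_iff)
  then show "n_times_diff n f" by (rule n_times_diff_SucD)
qed

lemma smooth_continuous: "smooth f \<Longrightarrow> continuous_on UNIV f"
  by (meson DERIV_isCont continuous_at_imp_continuous_on smooth_DERIV)

lemma n_times_diff_const: "n_times_diff n (\<lambda>x. c)"
proof (induction n arbitrary: c)
  case (Suc n)
  show ?case by (rule n_times_diff_SucI[of _ "\<lambda>_. 0"]) (auto intro: Suc)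
qed simp

lemma n_times_diff_ident: "n_times_diff n (\<lambda>x. x)"
proof (cases n)
  case (Suc k)
  show ?thesis unfolding Suc
    by (rule n_times_diff_SucI[of _ "\<lambda>_. 1"]) (auto intro: n_times_diff_const)
qed simp

lemma n_times_diff_add: "n_times_diff n f \<Longrightarrow> n_times_diff n g \<Longrightarrow> n_times_diff n (\<lambda>x. f x + g x)"
proof (induction n arbitrary: f g)
  case (Suc n)
  show ?case
  proof (rule n_times_diff_SucI)
    show "((\<lambda>x. f x + g x) has_real_derivative deriv f x + deriv g x) (at x)" for x
      by (intro DERIV_add n_times_diff_DERIV[OF Suc.prems(1)] n_times_diff_DERIV[OF Suc.prems(2)])
    show "n_times_diff n (\<lambda>x. deriv f x + deriv g x)"
      using Suc.prems by (intro Suc.IH) (auto simp: n_times_diff_Suc)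
  qed
qed simp

lemma n_times_diff_mult: "n_times_diff n f \<Longrightarrow> n_times_diff n g \<Longrightarrow> n_times_diff n (\<lambda>x. f x * g x)"
proof (induction n arbitrary: f g)
  case (Suc n)
  show ?case
  proof (rule n_times_diff_SucI)
    show "((\<lambda>x. f x * g x) has_real_derivative deriv f x * g x + deriv g x * f x) (at x)" for x
      by (intro DERIV_mult n_times_diff_DERIV[OF Suc.prems(1)] n_times_diff_DERIV[OF Suc.prems(2)])
    show "n_times_diff n (\<lambda>x. deriv f x * g x + deriv g x * f x)"
      using Suc.prems n_times_diff_SucD[OF Suc.prems(1)] n_times_diff_SucD[OF Suc.prems(2)]
      by (intro n_times_diff_add Suc.IH) (simp_all add: n_times_diff_Suc)
  qed
qed simp

lemma n_times_diff_compose: "n_times_diff n f \<Longrightarrow> n_times_diff n g \<Longrightarrow> n_times_diff n (\<lambda>x. f (g x))"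
proof (induction n arbitrary: f g)
  case (Suc n)
  show ?case
  proof (rule n_times_diff_SucI)
    show "((\<lambda>x. f (g x)) has_real_derivative deriv f (g x) * deriv g x) (at x)" for x
      by (rule DERIV_chain2[OF n_times_diff_DERIV[OF Suc.prems(1)] n_times_diff_DERIV[OF Suc.prems(2)]])
    show "n_times_diff n (\<lambda>x. deriv f (g x) * deriv g x)"
      using Suc.prems n_times_diff_SucD[OF Suc.prems(2)]
      by (intro n_times_diff_mult[OF Suc.IH]) (simp_all add: n_times_diff_Suc)
  qed
qed simp

lemma smooth_const [simp]: "smooth (\<lambda>x. c)"
  and smooth_ident [simp]: "smooth (\<lambda>x. x)"
  and smooth_add: "smooth f \<Longrightarrow> smooth g \<Longrightarrow> smooth (\<lambda>x. f x + g x)"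
  and smooth_mult: "smooth f \<Longrightarrow> smooth g \<Longrightarrow> smooth (\<lambda>x. f x * g x)"
  and smooth_compose: "smooth f \<Longrightarrow> smooth g \<Longrightarrow> smooth (\<lambda>x. f (g x))"
  by (auto simp: smooth_iff n_times_diff_const n_times_diff_ident n_times_diff_add n_times_diff_mult n_times_diff_compose)

lemma smooth_diff: "smooth f \<Longrightarrow> smooth g \<Longrightarrow> smooth (\<lambda>x. f x - g x)"
  using smooth_add[OF _ smooth_mult[OF smooth_const[of "-1"]], of f g] by simp

lemma smooth_prod: "finite A \<Longrightarrow> (\<And>i. i \<in> A \<Longrightarrow> smooth (f i)) \<Longrightarrow> smooth (\<lambda>x. \<Prod>i\<in>A. f i x)"
  by (induction A rule: finite_induct) (auto intro: smooth_mult)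

lemma ex_primitive:
  fixes f :: "real \<Rightarrow> real"
  assumes "continuous_on UNIV f"
  obtains F where "\<And>x. (F has_real_derivative f x) (at x)"
proof -
  have "isCont f x" for x using assms by (simp add: continuous_on_eq_continuous_at)
  then obtain F where "\<forall>x :: real. -\<infinity> < ereal x \<longrightarrow> ereal x < \<infinity> \<longrightarrow> (F has_vector_derivative f x) (at x)"
    using einterval_antiderivative[of "-\<infinity>" \<infinity> f] by auto
  then show thesis by (intro that[of F]) (simp add: has_real_derivative_iff_has_vector_derivative)
qed

text \<open>
  For \<open>k = 0\<close> this is the classical smooth function that is flat at 0. The powers of \<open>1/x\<close> make the
  family closed under differentiation, up to linear combinations.
\<close>

definition flat_exp :: "nat \<Rightarrow> real \<Rightarrow> real" where
  "flat_exp k x = (if x > 0 then (1 / x) ^ k * exp (- 1 / x) else 0)"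

lemma tendsto_flat_exp: "(flat_exp k \<longlongrightarrow> 0) (at 0)"
proof -
  have "((\<lambda>x. inverse x ^ k / exp (inverse x)) \<longlongrightarrow> 0) (at_right (0::real))"
    by (rule filterlim_compose[OF tendsto_power_div_exp_0 filterlim_inverse_at_top_right])
  then have r: "(flat_exp k \<longlongrightarrow> 0) (at_right 0)"
    by (rule Lim_transform_eventually)
      (auto simp: eventually_at_filter flat_exp_def exp_minus field_simps inverse_eq_divide)
  have l: "(flat_exp k \<longlongrightarrow> 0) (at_left 0)"
    by (rule Lim_transform_eventually[OF tendsto_const]) (auto simp: eventually_at_filter flat_exp_def)
  show ?thesis using l r by (simp add: filterlim_split_at)
qed

lemma flat_exp_DERIV:
  "(flat_exp k has_real_derivative flat_exp (k + 2) x - real k * flat_exp (k + 1) x) (at x)"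
proof -
  consider "x > 0" | "x < 0" | "x = 0" by linarith
  then show ?thesis
  proof cases
    case 1
    have "((\<lambda>x. (1 / x) ^ k * exp (- 1 / x)) has_real_derivative flat_exp (k + 2) x - real k * flat_exp (k + 1) x) (at x)"
    proof -
      have inv: "((\<lambda>x. 1 / x) has_real_derivative - ((1 / x) ^ 2)) (at x)"
        using 1 by (auto intro!: derivative_eq_intros simp: field_simps power2_eq_square)
      have "((\<lambda>x. (1 / x) ^ k) has_real_derivative - (real k * (1 / x) ^ (k + 1))) (at x)"
        using DERIV_power[OF inv, of k] by (cases k) (simp_all add: power2_eq_square algebra_simps)
      moreover have "((\<lambda>x. exp (- 1 / x)) has_real_derivative exp (- 1 / x) * (1 / x) ^ 2) (at x)"
        using DERIV_fun_exp[OF DERIV_minus[OF inv]] by simp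
      ultimately have "((\<lambda>x. (1 / x) ^ k * exp (- 1 / x)) has_real_derivative
          - (real k * (1 / x) ^ (k + 1)) * exp (- 1 / x) + (exp (- 1 / x) * (1 / x) ^ 2) * (1 / x) ^ k) (at x)"
        by (rule DERIV_mult)
      moreover have "- (real k * (1 / x) ^ (k + 1)) * exp (- 1 / x) + (exp (- 1 / x) * (1 / x) ^ 2) * (1 / x) ^ k
          = flat_exp (k + 2) x - real k * flat_exp (k + 1) x"
        using 1 by (simp only: flat_exp_def power_add if_True) (simp add: algebra_simps)
      ultimately show ?thesis by simp
    qed
    then show ?thesis
      by (rule has_field_derivative_transform_within_open[of _ _ _ "{0<..}"]) (use 1 in \<open>auto simp: flat_exp_def\<close>)
  next
    case 2
    have "((\<lambda>x. 0) has_real_derivative flat_exp (k + 2) x - real k * flat_exp (k + 1) x) (at x)"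
      using 2 by (auto simp: flat_exp_def)
    then show ?thesis
      by (rule has_field_derivative_transform_within_open[of _ _ _ "{..<0}"]) (use 2 in \<open>auto simp: flat_exp_def\<close>)
  next
    case 3
    have "((\<lambda>h. (flat_exp k (0 + h) - flat_exp k 0) / h) \<longlongrightarrow> 0) (at 0)"
      by (rule Lim_transform_eventually[OF tendsto_flat_exp[of "Suc k"]])
        (auto simp: eventually_at_filter flat_exp_def)
    then show ?thesis unfolding DERIV_def by (simp add: 3 flat_exp_def)
  qed
qed

lemma smooth_flat_exp: "smooth (flat_exp k)"
  unfolding smooth_iff
proof
  fix n show "n_times_diff n (flat_exp k)"
  proof (induction n arbitrary: k)
    case (Suc n)
    show ?case
    proof (rule n_times_diff_SucI[OF flat_exp_DERIV])
      have "n_times_diff n (\<lambda>x. flat_exp (k + 2) x + (- real k) * flat_exp (k + 1) x)"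
        by (intro n_times_diff_add n_times_diff_mult n_times_diff_const Suc)
      then show "n_times_diff n (\<lambda>x. flat_exp (k + 2) x - real k * flat_exp (k + 1) x)" by simp
    qed
  qed simp
qed

text \<open>
  The normalized antiderivative of a bump on \<open>[0, 1]\<close>.
\<close>

lemma ex_smooth_step:
  obtains \<theta> where "smooth \<theta>" "\<And>x. 0 \<le> \<theta> x" "\<And>x. \<theta> x \<le> 1" "\<And>x. x \<le> 0 \<Longrightarrow> \<theta> x = 0" "\<And>x. x \<ge> 1 \<Longrightarrow> \<theta> x = 1"
proof -
  define \<beta> where "\<beta> x = flat_exp 0 x * flat_exp 0 (1 - x)" for x
  have \<beta>: "smooth \<beta>" unfolding \<beta>_def
    by (intro smooth_mult smooth_compose[OF smooth_flat_exp] smooth_diff smooth_flat_exp smooth_const smooth_ident)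
  have nonneg: "\<beta> x \<ge> 0" for x by (simp add: \<beta>_def flat_exp_def)
  have pos: "\<beta> x > 0" if "0 < x" "x < 1" for x using that by (simp add: \<beta>_def flat_exp_def)
  have zero: "\<beta> x = 0" if "x \<le> 0 \<or> x \<ge> 1" for x using that by (auto simp: \<beta>_def flat_exp_def)
  obtain B where B: "\<And>x. (B has_real_derivative \<beta> x) (at x)"
    by (rule ex_primitive[OF smooth_continuous[OF \<beta>]]) (rule that)
  have mono: "B x \<le> B y" if "x \<le> y" for x y
    using that B nonneg by (intro DERIV_nonneg_imp_nondecreasing[of x y B]) blast+
  have const: "B x = B y" if lt: "x < y" "y \<le> 0 \<or> x \<ge> 1" for x y
  proof -
    obtain z where z: "x < z" "z < y" "B y - B x = (y - x) * \<beta> z"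
      using MVT2[OF lt(1), of B \<beta>] B by blast
    have "\<beta> z = 0" using z lt(2) by (intro zero) auto
    then show ?thesis using z(3) by simp
  qed
  obtain z where z: "0 < z" "z < 1" "B 1 - B 0 = (1 - 0) * \<beta> z"
    using MVT2[of 0 1 B \<beta>] B by auto
  then have lt: "B 1 - B 0 > 0" using pos by simp
  define \<theta> where "\<theta> x = (B x - B 0) * (1 / (B 1 - B 0))" for x
  have lo: "B x = B 0" if "x \<le> 0" for x using const[of x 0] that by (cases "x = 0") auto
  have hi: "B x = B 1" if "x \<ge> 1" for x using const[of 1 x] that by (cases "x = 1") auto
  have "B 0 \<le> B x" "B x \<le> B 1" for x
    using mono[of 0 x] lo[of x] mono[of x 1] hi[of x] mono[of 0 1] by (cases "x \<le> 0"; cases "x \<le> 1"; simp)+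
  note bounds = this
  show thesis
  proof (rule that[of \<theta>])
    show "smooth \<theta>" unfolding \<theta>_def
      by (intro smooth_mult smooth_diff smooth_const smooth_primitive[OF B \<beta>])
    show "0 \<le> \<theta> x" "\<theta> x \<le> 1" for x
      unfolding \<theta>_def using lt bounds[of x] by simp_all
    show "\<theta> x = 0" if "x \<le> 0" for x using lo[OF that] by (simp add: \<theta>_def)
    show "\<theta> x = 1" if "x \<ge> 1" for x using hi[OF that] lt by (simp add: \<theta>_def)
  qed
qed

lemma ex_smooth_plateau:
  fixes a b r :: real
  assumes "r > 0"
  obtains u where "smooth u" "\<And>x. 0 \<le> u x" "\<And>x. u x \<le> 1" "\<And>x. a \<le> x \<Longrightarrow> x \<le> b \<Longrightarrow> u x = 1"
    "\<And>x. x \<le> a - r \<or> x \<ge> b + r \<Longrightarrow> u x = 0"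
proof -
  obtain \<theta> where \<theta>: "smooth \<theta>" "\<And>x. 0 \<le> \<theta> x" "\<And>x. \<theta> x \<le> 1" "\<And>x. x \<le> 0 \<Longrightarrow> \<theta> x = 0" "\<And>x. x \<ge> 1 \<Longrightarrow> \<theta> x = 1"
    by (rule ex_smooth_step) (rule that)
  define u where "u x = \<theta> ((x - (a - r)) * (1 / r)) * \<theta> (((b + r) - x) * (1 / r))" for x
  show thesis
  proof (rule that[of u])
    show "smooth u" unfolding u_def
      by (intro smooth_mult smooth_compose[OF \<theta>(1)] smooth_diff smooth_const smooth_ident)
    show "0 \<le> u x" "u x \<le> 1" for x unfolding u_def using \<theta>(2,3) by (auto intro: mult_le_one)
    show "u x = 1" if "a \<le> x" "x \<le> b" for x
      using that assms \<theta>(5) by (simp add: u_def)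
    show "u x = 0" if "x \<le> a - r \<or> x \<ge> b + r" for x
      using that assms \<theta>(4) by (auto simp: u_def divide_le_0_iff)
  qed
qed

text \<open>
  \<open>1 - \<Prod>(1 - b\<^sub>x)\<close> over finitely many plateaus \<open>b\<^sub>x\<close> that cover \<open>K\<close> equals 1 where one of them does, and
  vanishes where all of them do.
\<close>

lemma smooth_urysohn:
  fixes K G :: "real set"
  assumes "compact K" "open G" "K \<subseteq> G"
  obtains u where "smooth u" "\<And>x. 0 \<le> u x" "\<And>x. u x \<le> 1" "\<And>x. x \<in> K \<Longrightarrow> u x = 1" "\<And>x. x \<notin> G \<Longrightarrow> u x = 0"
proof -
  have "\<forall>x\<in>K. \<exists>r>0. {x - 2 * r..x + 2 * r} \<subseteq> G"
  proof
    fix x assume "x \<in> K"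
    then obtain e where "e > 0" "cball x e \<subseteq> G" using assms(2,3) open_contains_cball by blast
    then show "\<exists>r>0. {x - 2 * r..x + 2 * r} \<subseteq> G" by (intro exI[of _ "e / 2"]) (simp add: cball_eq_atLeastAtMost)
  qed
  then obtain r where r: "\<And>x. x \<in> K \<Longrightarrow> r x > 0" "\<And>x. x \<in> K \<Longrightarrow> {x - 2 * r x..x + 2 * r x} \<subseteq> G" by metis
  have "K \<subseteq> (\<Union>x\<in>K. ball x (r x))" using r(1) by force
  then obtain A where A: "A \<subseteq> K" "finite A" "K \<subseteq> (\<Union>x\<in>A. ball x (r x))"
    using compactE_image[OF assms(1), of K "\<lambda>x. ball x (r x)"] by auto
  have "\<exists>u. smooth u \<and> (\<forall>y. 0 \<le> u y \<and> u y \<le> 1) \<and> (\<forall>y. x - r x \<le> y \<and> y \<le> x + r x \<longrightarrow> u y = 1) \<and>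
      (\<forall>y. y \<le> (x - r x) - r x \<or> y \<ge> (x + r x) + r x \<longrightarrow> u y = 0)" if x: "x \<in> A" for x
  proof -
    have "r x > 0" using r(1) A(1) x by blast
    then obtain u where "smooth u" "\<And>y. 0 \<le> u y" "\<And>y. u y \<le> 1" "\<And>y. x - r x \<le> y \<Longrightarrow> y \<le> x + r x \<Longrightarrow> u y = 1"
      "\<And>y. y \<le> (x - r x) - r x \<or> y \<ge> (x + r x) + r x \<Longrightarrow> u y = 0"
      by (rule ex_smooth_plateau) (rule that)
    then show ?thesis by blast
  qed
  then obtain b where b: "\<And>x. x \<in> A \<Longrightarrow> smooth (b x)" "\<And>x y. x \<in> A \<Longrightarrow> 0 \<le> b x y \<and> b x y \<le> 1"
    "\<And>x y. x \<in> A \<Longrightarrow> x - r x \<le> y \<and> y \<le> x + r x \<Longrightarrow> b x y = 1"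
    "\<And>x y. x \<in> A \<Longrightarrow> y \<le> (x - r x) - r x \<or> y \<ge> (x + r x) + r x \<Longrightarrow> b x y = 0"
    by metis
  define u where "u y = 1 - (\<Prod>x\<in>A. 1 - b x y)" for y
  show thesis
  proof (rule that[of u])
    show "smooth u" unfolding u_def
      by (intro smooth_diff smooth_const smooth_prod A(2) b(1))
    show "0 \<le> u y" for y unfolding u_def using b(2) by (simp add: prod_le_1)
    show "u y \<le> 1" for y unfolding u_def using b(2) by (simp add: prod_nonneg)
    show "u y = 1" if y: "y \<in> K" for y
    proof -
      obtain x where x: "x \<in> A" "y \<in> ball x (r x)" using A(3) y by blast
      then have "b x y = 1" by (intro b(3)) (auto simp: dist_real_def)
      then have "(\<Prod>x\<in>A. 1 - b x y) = 0" using A(2) x(1) by (intro prod_zero) auto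
      then show ?thesis by (simp add: u_def)
    qed
    show "u y = 0" if y: "y \<notin> G" for y
    proof -
      have "b x y = 0" if x: "x \<in> A" for x
      proof (rule b(4)[OF x])
        have "y \<notin> {x - 2 * r x..x + 2 * r x}" using r(2)[of x] A(1) x y by blast
        then show "y \<le> (x - r x) - r x \<or> y \<ge> (x + r x) + r x" by auto
      qed
      then show ?thesis by (simp add: u_def)
    qed
  qed
qed

lemma compact_support_iff:
  fixes u :: "real \<Rightarrow> real"
  shows "compact (closure (support_on UNIV u)) \<longleftrightarrow> (\<exists>R. \<forall>x. R < \<bar>x\<bar> \<longrightarrow> u x = 0)"
  unfolding compact_closure bounded_iff by (auto simp: support_on_def not_le[symmetric])

lemma Cc_infty_iff: "u \<in> Cc_infty \<longleftrightarrow> smooth u \<and> (\<exists>R. \<forall>x. R < \<bar>x\<bar> \<longrightarrow> u x = 0)"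
  unfolding Cc_infty_def smooth_def compact_support_iff by simp

lemma Cc_iff: "u \<in> Cc \<longleftrightarrow> continuous_on UNIV u \<and> (\<exists>R. \<forall>x. R < \<bar>x\<bar> \<longrightarrow> u x = 0)"
  unfolding Cc_def compact_support_iff by simp

lemma smooth_real_polynomial_function: "real_polynomial_function p \<Longrightarrow> smooth p" for p :: "real \<Rightarrow> real"
proof (induction p rule: real_polynomial_function.induct)
  case (linear f)
  then obtain c where "f = (\<lambda>x. x * c)" using real_bounded_linear by blast
  then show ?case by (simp add: smooth_mult)
qed (auto intro: smooth_add smooth_mult)

text \<open>
  A Weierstrass polynomial on a slightly larger interval, cut off by a smooth plateau: in the
  transition zone the function is 0, so the polynomial is small there.
\<close>

lemma uniformly_dense_Cc_infty: "uniformly_dense_in Cc_infty Cc"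
  unfolding uniformly_dense_in_def
proof (intro ballI allI impI)
  fix f and \<epsilon> :: real assume f: "f \<in> Cc" and "\<epsilon> > 0"
  obtain R where R: "continuous_on UNIV f" "\<And>x. R < \<bar>x\<bar> \<Longrightarrow> f x = 0" using f unfolding Cc_iff by auto
  obtain p where p: "real_polynomial_function p" "\<And>x. x \<in> {-R - 1..R + 1} \<Longrightarrow> \<bar>f x - p x\<bar> < \<epsilon>"
    using Stone_Weierstrass_real_polynomial_function[of "{-R - 1..R + 1}" f \<epsilon>] \<open>\<epsilon> > 0\<close>
      continuous_on_subset[OF R(1)] by blast
  obtain u where u: "smooth u" "\<And>x. 0 \<le> u x" "\<And>x. u x \<le> 1" "\<And>x. - R \<le> x \<Longrightarrow> x \<le> R \<Longrightarrow> u x = 1"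
    "\<And>x. x \<le> - R - 1 \<or> x \<ge> R + 1 \<Longrightarrow> u x = 0"
    by (rule ex_smooth_plateau[OF zero_less_one]) (rule that)
  have "(\<lambda>x. u x * p x) \<in> Cc_infty" unfolding Cc_infty_iff
  proof (intro conjI exI[of _ "R + 1"] allI impI smooth_mult u(1) smooth_real_polynomial_function[OF p(1)])
    fix x assume "R + 1 < \<bar>x\<bar>"
    then show "u x * p x = 0" using u(5)[of x] by (cases "x \<ge> 0") auto
  qed
  moreover have "\<bar>f x - u x * p x\<bar> < \<epsilon>" for x
  proof -
    have close: "\<bar>f x - p x\<bar> < \<epsilon>" if "\<bar>x\<bar> \<le> R + 1"
      using that by (intro p(2)) (simp add: abs_le_iff)
    consider "\<bar>x\<bar> \<le> R" | "R < \<bar>x\<bar>" "\<bar>x\<bar> \<le> R + 1" | "R + 1 < \<bar>x\<bar>" by linarith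
    then show ?thesis
    proof cases
      case 1
      then show ?thesis using close u(4)[of x] by (simp add: abs_le_iff)
    next
      case 2
      then have f0: "f x = 0" and px: "\<bar>p x\<bar> < \<epsilon>" using close R(2)[of x] by simp_all
      have "\<bar>u x * p x\<bar> = u x * \<bar>p x\<bar>" using u(2)[of x] by (simp add: abs_mult)
      also have "\<dots> \<le> 1 * \<bar>p x\<bar>" using u(3)[of x] by (intro mult_right_mono) auto
      finally show ?thesis using f0 px by simp
    next
      case 3
      then show ?thesis using R(2)[of x] u(5)[of x] \<open>\<epsilon> > 0\<close> by (cases "x \<ge> 0") auto
    qed
  qed
  ultimately show "\<exists>g\<in>Cc_infty. \<forall>x. \<bar>f x - g x\<bar> < \<epsilon>"
    by (intro bexI[of _ "\<lambda>x. u x * p x"] allI)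
qed

text \<open>
  The antiderivative, vanishing at 0, of a plateau that is 1 on \<open>[0, 1]\<close> and 0 off \<open>[-\<epsilon>, 1 + \<epsilon>]\<close>.
\<close>

lemma ex_smooth_contraction:
  fixes \<epsilon> :: real
  assumes "\<epsilon> > 0"
  obtains \<phi> where "smooth \<phi>" "\<And>t. t \<in> {0..1} \<Longrightarrow> \<phi> t = t" "\<And>t. - \<epsilon> \<le> \<phi> t \<and> \<phi> t \<le> 1 + \<epsilon>"
    "\<And>t t'. t < t' \<Longrightarrow> 0 \<le> \<phi> t' - \<phi> t \<and> \<phi> t' - \<phi> t \<le> t' - t"
proof -
  obtain \<eta> where \<eta>: "smooth \<eta>" "\<And>x. 0 \<le> \<eta> x" "\<And>x. \<eta> x \<le> 1" "\<And>x. 0 \<le> x \<Longrightarrow> x \<le> 1 \<Longrightarrow> \<eta> x = 1"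
    "\<And>x. x \<le> 0 - \<epsilon> \<or> x \<ge> 1 + \<epsilon> \<Longrightarrow> \<eta> x = 0"
    by (rule ex_smooth_plateau[OF assms]) (rule that)
  obtain B where B: "\<And>x. (B has_real_derivative \<eta> x) (at x)"
    by (rule ex_primitive[OF smooth_continuous[OF \<eta>(1)]]) (rule that)
  define \<phi> where "\<phi> t = B t - B 0" for t
  have mvt: "\<exists>z. t < z \<and> z < t' \<and> \<phi> t' - \<phi> t = (t' - t) * \<eta> z" if "t < t'" for t t'
    using MVT2[OF that, of B \<eta>] B by (auto simp: \<phi>_def)
  have contr: "0 \<le> \<phi> t' - \<phi> t \<and> \<phi> t' - \<phi> t \<le> t' - t" if lt: "t < t'" for t t'
  proof -
    obtain z where "\<phi> t' - \<phi> t = (t' - t) * \<eta> z" using mvt[OF lt] by blast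
    then show ?thesis using \<eta>(2,3)[of z] lt by (simp add: mult_left_le)
  qed
  have "0 = \<phi> 0" by (simp add: \<phi>_def)
  have lo: "- \<epsilon> \<le> \<phi> t" for t
  proof (cases "t < - \<epsilon>")
    case True
    obtain z where "z < - \<epsilon>" "\<phi> (- \<epsilon>) - \<phi> t = (- \<epsilon> - t) * \<eta> z" using mvt[OF True] by blast
    then show ?thesis using \<eta>(5)[of z] contr[of "- \<epsilon>" 0] assms \<open>0 = \<phi> 0\<close> by simp
  next
    case False
    consider "t < 0" | "t = 0" | "t > 0" by linarith
    then show ?thesis using contr[of t 0] contr[of 0 t] False assms \<open>0 = \<phi> 0\<close> by cases auto
  qed
  have one: "\<phi> t = t" if t: "t \<in> {0..1}" for t
  proof (cases "t = 0")
    case False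
    then obtain z where "0 < z" "z < t" "\<phi> t - \<phi> 0 = (t - 0) * \<eta> z" using mvt[of 0 t] t by auto
    then show ?thesis using \<eta>(4)[of z] t \<open>0 = \<phi> 0\<close> by simp
  qed (simp add: \<phi>_def)
  have hi: "\<phi> t \<le> 1 + \<epsilon>" for t
  proof (cases "t > 1 + \<epsilon>")
    case True
    obtain z where "z > 1 + \<epsilon>" "\<phi> t - \<phi> (1 + \<epsilon>) = (t - (1 + \<epsilon>)) * \<eta> z" using mvt[OF True] by blast
    then show ?thesis using \<eta>(5)[of z] contr[of 1 "1 + \<epsilon>"] assms one[of 1] by simp
  next
    case False
    consider "t < 1" | "t = 1" | "t > 1" by linarith
    then show ?thesis using contr[of t 1] contr[of 1 t] False assms one[of 1] by cases auto
  qed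
  have "smooth \<phi>" unfolding \<phi>_def by (intro smooth_diff smooth_const smooth_primitive[OF B \<eta>(1)])
  have bounds: "- \<epsilon> \<le> \<phi> t \<and> \<phi> t \<le> 1 + \<epsilon>" for t using lo hi by simp
  show thesis
  proof (rule that[of \<phi>])
    show "smooth \<phi>" by fact
  qed (fact one bounds contr)+
qed

text \<open>
  The algebraic and topological requirements are properties of the test functions alone: they form an
  algebra, are stable under the smooth contractions above, separate compact from open sets, and are
  uniformly dense.
\<close>

lemma special_standard_core_Cc_infty_iff:
  assumes "Cc_infty \<subseteq> F"
  shows "special_standard_core m E F Cc_infty \<longleftrightarrow> E1_dense_in m E Cc_infty F"
proof
  assume dense: "E1_dense_in m E Cc_infty F"
  have Cc: "Cc_infty \<subseteq> Cc" by (auto simp: Cc_infty_iff Cc_iff smooth_continuous)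
  have contr: "\<exists>\<phi>::real \<Rightarrow> real. (\<forall>t\<in>{0..1}. \<phi> t = t) \<and> (\<forall>t. - \<epsilon> \<le> \<phi> t \<and> \<phi> t \<le> 1 + \<epsilon>) \<and>
        (\<forall>t t'. t < t' \<longrightarrow> 0 \<le> \<phi> t' - \<phi> t \<and> \<phi> t' - \<phi> t \<le> t' - t) \<and>
        (\<forall>u\<in>Cc_infty. (\<lambda>x. \<phi> (u x)) \<in> Cc_infty)" if "\<epsilon> > 0" for \<epsilon>
  proof -
    obtain \<phi> where \<phi>: "smooth \<phi>" "\<And>t. t \<in> {0..1} \<Longrightarrow> \<phi> t = t" "\<And>t. - \<epsilon> \<le> \<phi> t \<and> \<phi> t \<le> 1 + \<epsilon>"
      "\<And>t t'. t < t' \<Longrightarrow> 0 \<le> \<phi> t' - \<phi> t \<and> \<phi> t' - \<phi> t \<le> t' - t"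
      by (rule ex_smooth_contraction[OF \<open>\<epsilon> > 0\<close>]) (rule that)
    have "(\<lambda>x. \<phi> (u x)) \<in> Cc_infty" if "u \<in> Cc_infty" for u
    proof -
      obtain R where "\<forall>x. R < \<bar>x\<bar> \<longrightarrow> u x = 0" "smooth u" using \<open>u \<in> Cc_infty\<close> by (auto simp: Cc_infty_iff)
      then show ?thesis
        using \<phi>(2)[of 0] smooth_compose[OF \<phi>(1), of u] by (auto simp: Cc_infty_iff intro!: exI[of _ R])
    qed
    then show ?thesis using \<phi>(2,3,4) by (intro exI[of _ \<phi>] conjI allI ballI impI) blast+
  qed
  have add: "(\<lambda>x. u x + v x) \<in> Cc_infty" if uv: "u \<in> Cc_infty" "v \<in> Cc_infty" for u v
  proof -
    obtain R R' where "\<forall>x. R < \<bar>x\<bar> \<longrightarrow> u x = 0" "\<forall>x. R' < \<bar>x\<bar> \<longrightarrow> v x = 0" "smooth u" "smooth v"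
      using uv by (auto simp: Cc_infty_iff)
    then show ?thesis by (auto simp: Cc_infty_iff intro!: smooth_add exI[of _ "max R R'"])
  qed
  have mult: "(\<lambda>x. u x * v x) \<in> Cc_infty" if "smooth u" "v \<in> Cc_infty" for u v
    using that by (auto simp: Cc_infty_iff intro!: smooth_mult)
  have urysohn: "\<exists>u\<in>Cc_infty. (\<forall>x. u x \<ge> 0) \<and> (\<forall>x\<in>K. u x = 1) \<and> (\<forall>x\<in>-G. u x = 0)"
    if KG: "compact K" "open G" "compact (closure G)" "K \<subseteq> G" for K G
  proof -
    obtain u where u: "smooth u" "\<And>x. 0 \<le> u x" "\<And>x. u x \<le> 1" "\<And>x. x \<in> K \<Longrightarrow> u x = 1" "\<And>x. x \<notin> G \<Longrightarrow> u x = 0"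
      by (rule smooth_urysohn[OF KG(1,2,4)]) (rule that)
    have "bounded G" using KG(3) by (simp add: compact_closure)
    then obtain R where "\<forall>x\<in>G. \<bar>x\<bar> \<le> R" by (auto simp: bounded_iff)
    then have "\<forall>x. R < \<bar>x\<bar> \<longrightarrow> u x = 0" using u(5) not_le by blast
    then have "u \<in> Cc_infty" using u(1) by (auto simp: Cc_infty_iff)
    then show ?thesis using u by (intro bexI[of _ u]) auto
  qed
  have zero: "(\<lambda>x. 0) \<in> Cc_infty" by (auto simp: Cc_infty_iff)
  show "special_standard_core m E F Cc_infty"
    unfolding special_standard_core_def standard_core_def form_core_def
  proof (intro conjI allI impI ballI)
    show "Cc_infty \<subseteq> F \<inter> Cc" using assms Cc by simp
    show "(\<lambda>x. u x * v x) \<in> Cc_infty" if "u \<in> Cc_infty" "v \<in> Cc_infty" for u v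
      using that by (intro mult) (auto simp: Cc_infty_iff)
    show "E1_dense_in m E Cc_infty F" by (rule dense)
    show "uniformly_dense_in Cc_infty Cc" by (rule uniformly_dense_Cc_infty)
    show "(\<lambda>x. 0) \<in> Cc_infty" by (rule zero)
    show "(\<lambda>x. u x + v x) \<in> Cc_infty" if "u \<in> Cc_infty" "v \<in> Cc_infty" for u v
      using that by (rule add)
    show "(\<lambda>x. c * u x) \<in> Cc_infty" if "u \<in> Cc_infty" for u c
      using smooth_const that by (rule mult)
    show "\<exists>\<phi>::real \<Rightarrow> real. (\<forall>t\<in>{0..1}. \<phi> t = t) \<and> (\<forall>t. - \<epsilon> \<le> \<phi> t \<and> \<phi> t \<le> 1 + \<epsilon>) \<and>
        (\<forall>t t'. t < t' \<longrightarrow> 0 \<le> \<phi> t' - \<phi> t \<and> \<phi> t' - \<phi> t \<le> t' - t) \<and>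
        (\<forall>u\<in>Cc_infty. (\<lambda>x. \<phi> (u x)) \<in> Cc_infty)" if "\<epsilon> > 0" for \<epsilon>
      using that by (rule contr)
    show "\<exists>u\<in>Cc_infty. (\<forall>x. u x \<ge> 0) \<and> (\<forall>x\<in>K. u x = 1) \<and> (\<forall>x\<in>-G. u x = 0)"
      if "compact K \<and> open G \<and> compact (closure G) \<and> K \<subseteq> G" for K G
      using that by (intro urysohn) simp_all
  qed
qed (auto simp: special_standard_core_def standard_core_def form_core_def)

section \<open>Smooth approximation in a weighted norm\<close>

lemma smooth_borel: "smooth h \<Longrightarrow> h \<in> borel_measurable borel"
  by (intro borel_measurable_continuous_onI smooth_continuous)

text \<open>
  If \<open>h\<close> is an error in the density of a function with compact support, the first term bounds the
  uniform error of the function itself, and the second one is its energy, as \<open>(h \<tau>)\<^sup>2 d\<sigma> = h\<^sup>2 \<tau> dx\<close> for the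
  measure \<open>\<sigma>\<close> introduced below.
\<close>

definition weighted_size :: "real set \<Rightarrow> (real \<Rightarrow> real) \<Rightarrow> (real \<Rightarrow> real) \<Rightarrow> ennreal" where
  "weighted_size U \<tau> f = (\<integral>\<^sup>+x. ennreal (\<bar>f x\<bar> + (f x)\<^sup>2 * \<tau> x) * indicator U x \<partial>lborel)"

context
  fixes U :: "real set" and \<tau> :: "real \<Rightarrow> real"
  assumes U: "open U" and \<tau>: "\<tau> \<in> borel_measurable borel" "\<And>x. \<tau> x \<ge> 0"
begin

lemma weighted_size_mono:
  assumes "\<And>x. \<bar>f x\<bar> \<le> \<bar>g x\<bar>"
  shows "weighted_size U \<tau> f \<le> weighted_size U \<tau> g"
  unfolding weighted_size_def
proof (rule nn_integral_mono)
  fix x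
  have "(f x)\<^sup>2 \<le> (g x)\<^sup>2" using assms[of x] by (simp add: abs_le_square_iff)
  then have "(f x)\<^sup>2 * \<tau> x \<le> (g x)\<^sup>2 * \<tau> x" using \<tau>(2) by (rule mult_right_mono)
  then have "ennreal (\<bar>f x\<bar> + (f x)\<^sup>2 * \<tau> x) \<le> ennreal (\<bar>g x\<bar> + (g x)\<^sup>2 * \<tau> x)"
    using assms[of x] by (intro ennreal_leI add_mono)
  then show "ennreal (\<bar>f x\<bar> + (f x)\<^sup>2 * \<tau> x) * indicator U x \<le> ennreal (\<bar>g x\<bar> + (g x)\<^sup>2 * \<tau> x) * indicator U x"
    by (rule mult_right_mono) simp
qed

lemma weighted_size_add:
  assumes [measurable]: "f \<in> borel_measurable borel" "g \<in> borel_measurable borel"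
  shows "weighted_size U \<tau> (\<lambda>x. f x + g x) \<le> 2 * weighted_size U \<tau> f + 2 * weighted_size U \<tau> g"
proof -
  note [measurable] = \<tau>(1) borel_open[OF U]
  have "weighted_size U \<tau> (\<lambda>x. f x + g x) \<le>
      (\<integral>\<^sup>+x. 2 * (ennreal (\<bar>f x\<bar> + (f x)\<^sup>2 * \<tau> x) * indicator U x) +
             2 * (ennreal (\<bar>g x\<bar> + (g x)\<^sup>2 * \<tau> x) * indicator U x) \<partial>lborel)"
    unfolding weighted_size_def
  proof (rule nn_integral_mono)
    fix x
    have "(f x + g x)\<^sup>2 \<le> 2 * (f x)\<^sup>2 + 2 * (g x)\<^sup>2"
      using sum_squares_bound[of "f x" "g x"] by (simp add: power2_sum)
    then have "(f x + g x)\<^sup>2 * \<tau> x \<le> (2 * (f x)\<^sup>2 + 2 * (g x)\<^sup>2) * \<tau> x"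
      by (rule mult_right_mono[OF _ \<tau>(2)])
    then have "\<bar>f x + g x\<bar> + (f x + g x)\<^sup>2 * \<tau> x \<le> 2 * (\<bar>f x\<bar> + (f x)\<^sup>2 * \<tau> x) + 2 * (\<bar>g x\<bar> + (g x)\<^sup>2 * \<tau> x)"
      by (simp add: algebra_simps)
    then have "ennreal (\<bar>f x + g x\<bar> + (f x + g x)\<^sup>2 * \<tau> x) \<le>
        ennreal (2 * (\<bar>f x\<bar> + (f x)\<^sup>2 * \<tau> x) + 2 * (\<bar>g x\<bar> + (g x)\<^sup>2 * \<tau> x))" by (rule ennreal_leI)
    also have "\<dots> = 2 * ennreal (\<bar>f x\<bar> + (f x)\<^sup>2 * \<tau> x) + 2 * ennreal (\<bar>g x\<bar> + (g x)\<^sup>2 * \<tau> x)"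
      using \<tau>(2) by (subst ennreal_plus) (auto simp: ennreal_mult)
    finally show "ennreal (\<bar>f x + g x\<bar> + (f x + g x)\<^sup>2 * \<tau> x) * indicator U x \<le>
        2 * (ennreal (\<bar>f x\<bar> + (f x)\<^sup>2 * \<tau> x) * indicator U x) + 2 * (ennreal (\<bar>g x\<bar> + (g x)\<^sup>2 * \<tau> x) * indicator U x)"
      by (auto simp: indicator_def)
  qed
  also have "\<dots> = 2 * weighted_size U \<tau> f + 2 * weighted_size U \<tau> g"
    unfolding weighted_size_def by (subst nn_integral_add) (auto simp: nn_integral_cmult)
  finally show ?thesis .
qed

lemma weighted_size_cmult:
  assumes [measurable]: "f \<in> borel_measurable borel"
  shows "weighted_size U \<tau> (\<lambda>x. c * f x) \<le> ennreal (\<bar>c\<bar> + c\<^sup>2) * weighted_size U \<tau> f"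
proof -
  note [measurable] = \<tau>(1) borel_open[OF U]
  have "weighted_size U \<tau> (\<lambda>x. c * f x) \<le>
      (\<integral>\<^sup>+x. ennreal (\<bar>c\<bar> + c\<^sup>2) * (ennreal (\<bar>f x\<bar> + (f x)\<^sup>2 * \<tau> x) * indicator U x) \<partial>lborel)"
    unfolding weighted_size_def
  proof (rule nn_integral_mono)
    fix x
    have "0 \<le> \<bar>c\<bar> * ((f x)\<^sup>2 * \<tau> x)" "0 \<le> c\<^sup>2 * \<bar>f x\<bar>" using \<tau>(2) by simp_all
    then have "\<bar>c * f x\<bar> + (c * f x)\<^sup>2 * \<tau> x \<le> (\<bar>c\<bar> + c\<^sup>2) * (\<bar>f x\<bar> + (f x)\<^sup>2 * \<tau> x)"
      by (simp add: algebra_simps abs_mult power_mult_distrib)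
    then have "ennreal (\<bar>c * f x\<bar> + (c * f x)\<^sup>2 * \<tau> x) \<le> ennreal (\<bar>c\<bar> + c\<^sup>2) * ennreal (\<bar>f x\<bar> + (f x)\<^sup>2 * \<tau> x)"
      using \<tau>(2)[of x] by (subst ennreal_mult[symmetric]) (simp_all del: ennreal_plus add: ennreal_leI)
    then show "ennreal (\<bar>c * f x\<bar> + (c * f x)\<^sup>2 * \<tau> x) * indicator U x \<le>
        ennreal (\<bar>c\<bar> + c\<^sup>2) * (ennreal (\<bar>f x\<bar> + (f x)\<^sup>2 * \<tau> x) * indicator U x)"
      by (auto simp: indicator_def)
  qed
  also have "\<dots> = ennreal (\<bar>c\<bar> + c\<^sup>2) * weighted_size U \<tau> f"
    unfolding weighted_size_def by (rule nn_integral_cmult) simp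
  finally show ?thesis .
qed

definition smoothly_approximable :: "(real \<Rightarrow> real) \<Rightarrow> bool" where
  "smoothly_approximable f \<longleftrightarrow> (\<forall>e>0. \<exists>h. smooth h \<and> (\<forall>x. x \<notin> U \<longrightarrow> h x = 0) \<and>
     weighted_size U \<tau> (\<lambda>x. f x - h x) < ennreal e)"

lemma smoothly_approximable_add:
  assumes fg: "smoothly_approximable f" "smoothly_approximable g"
    and [measurable]: "f \<in> borel_measurable borel" "g \<in> borel_measurable borel"
  shows "smoothly_approximable (\<lambda>x. f x + g x)"
  unfolding smoothly_approximable_def
proof (intro allI impI)
  fix e :: real assume "e > 0"
  then have e: "e / 4 > 0" by simp
  obtain h where h: "smooth h" "\<forall>x. x \<notin> U \<longrightarrow> h x = 0" "weighted_size U \<tau> (\<lambda>x. f x - h x) < ennreal (e / 4)"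
    using fg(1) e unfolding smoothly_approximable_def by blast
  obtain k where k: "smooth k" "\<forall>x. x \<notin> U \<longrightarrow> k x = 0" "weighted_size U \<tau> (\<lambda>x. g x - k x) < ennreal (e / 4)"
    using fg(2) e unfolding smoothly_approximable_def by blast
  note [measurable] = smooth_borel[OF h(1)] smooth_borel[OF k(1)]
  have "weighted_size U \<tau> (\<lambda>x. (f x + g x) - (h x + k x)) = weighted_size U \<tau> (\<lambda>x. (f x - h x) + (g x - k x))"
    by (simp add: algebra_simps)
  also have "\<dots> \<le> 2 * weighted_size U \<tau> (\<lambda>x. f x - h x) + 2 * weighted_size U \<tau> (\<lambda>x. g x - k x)"
    by (rule weighted_size_add) measurable
  also have "\<dots> < 2 * ennreal (e / 4) + 2 * ennreal (e / 4)"
    using h(3) k(3) by (intro add_strict_mono ennreal_mult_strict_left_mono) auto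
  also have "\<dots> = ennreal e"
    using \<open>e > 0\<close> by (simp add: ennreal_mult[symmetric] ennreal_plus[symmetric] ennreal_numeral[symmetric] del: ennreal_numeral ennreal_plus)
  finally show "\<exists>h. smooth h \<and> (\<forall>x. x \<notin> U \<longrightarrow> h x = 0) \<and> weighted_size U \<tau> (\<lambda>x. (f x + g x) - h x) < ennreal e"
    using h(1,2) k(1,2) by (intro exI[of _ "\<lambda>x. h x + k x"]) (simp add: smooth_add)
qed

lemma smoothly_approximable_cmult:
  assumes f: "smoothly_approximable f" and [measurable]: "f \<in> borel_measurable borel"
  shows "smoothly_approximable (\<lambda>x. c * f x)"
  unfolding smoothly_approximable_def
proof (intro allI impI)
  fix e :: real assume "e > 0"
  define C where "C = \<bar>c\<bar> + c\<^sup>2 + 1"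
  have C: "C > 0" by (simp add: C_def add_nonneg_pos)
  obtain h where h: "smooth h" "\<forall>x. x \<notin> U \<longrightarrow> h x = 0" "weighted_size U \<tau> (\<lambda>x. f x - h x) < ennreal (e / C)"
    using f \<open>e > 0\<close> C unfolding smoothly_approximable_def by (metis divide_pos_pos)
  note [measurable] = smooth_borel[OF h(1)]
  have "weighted_size U \<tau> (\<lambda>x. c * f x - c * h x) = weighted_size U \<tau> (\<lambda>x. c * (f x - h x))"
    by (simp add: algebra_simps)
  also have "\<dots> \<le> ennreal (\<bar>c\<bar> + c\<^sup>2) * weighted_size U \<tau> (\<lambda>x. f x - h x)"
    by (rule weighted_size_cmult) measurable
  also have "\<dots> \<le> ennreal C * weighted_size U \<tau> (\<lambda>x. f x - h x)"
    by (intro mult_right_mono ennreal_leI) (auto simp: C_def)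
  also have "\<dots> < ennreal C * ennreal (e / C)"
    using h(3) C by (intro ennreal_mult_strict_left_mono) auto
  also have "\<dots> = ennreal e" using C \<open>e > 0\<close> by (simp add: ennreal_mult[symmetric])
  finally show "\<exists>h. smooth h \<and> (\<forall>x. x \<notin> U \<longrightarrow> h x = 0) \<and> weighted_size U \<tau> (\<lambda>x. c * f x - h x) < ennreal e"
    using h(1,2) by (intro exI[of _ "\<lambda>x. c * h x"]) (simp add: smooth_mult)
qed

lemma smoothly_approximable_sum:
  assumes "finite A" "\<And>i. i \<in> A \<Longrightarrow> smoothly_approximable (f i)" "\<And>i. i \<in> A \<Longrightarrow> f i \<in> borel_measurable borel"
  shows "smoothly_approximable (\<lambda>x. \<Sum>i\<in>A. f i x)"
  using assms
proof (induction A rule: finite_induct)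
  case empty
  have "weighted_size U \<tau> (\<lambda>x. 0) = 0" by (simp add: weighted_size_def)
  then show ?case unfolding smoothly_approximable_def by (auto intro!: exI[of _ "\<lambda>_. 0"])
next
  case (insert i A)
  have "smoothly_approximable (\<lambda>x. f i x + (\<Sum>i\<in>A. f i x))"
    using insert.prems by (intro smoothly_approximable_add insert.IH borel_measurable_sum) auto
  then show ?case using insert.hyps by simp
qed

text \<open>
  The measure \<open>(1 + \<tau>) dx\<close> on \<open>U\<close> is finite, hence regular: there are a compact \<open>K\<close> and an open \<open>V\<close> that
  enclose \<open>B\<close> up to a small measure, and a smooth function that is 1 on \<open>K\<close> and 0 off \<open>V\<close> does the job.
\<close>

lemma smoothly_approximable_indicator:
  assumes fin: "weighted_size U \<tau> (\<lambda>x. 1) < \<infinity>" and B: "B \<in> sets borel"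
  shows "smoothly_approximable (indicator B)"
  unfolding smoothly_approximable_def
proof (intro allI impI)
  fix e :: real assume e: "e > 0"
  note [measurable] = \<tau>(1) borel_open[OF U] B
  define M where "M = density lborel (\<lambda>x. ennreal (1 + \<tau> x) * indicator U x)"
  have sets_M: "sets M = sets borel" by (simp add: M_def)
  have M: "emeasure M A = weighted_size U \<tau> (indicator A)" if [measurable]: "A \<in> sets borel" for A
    unfolding M_def weighted_size_def
    by (subst emeasure_density) (auto intro!: nn_integral_cong simp: indicator_def)
  have finM: "emeasure M (space M) \<noteq> \<infinity>"
    using M[of UNIV] fin by (simp add: M_def)
  have BU: "B \<inter> U \<in> sets borel" by measurable
  have inner: "emeasure M (B \<inter> U) = (SUP K \<in> {K. K \<subseteq> B \<inter> U \<and> compact K}. emeasure M K)"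
    and outer: "emeasure M (B \<inter> U) = (INF V \<in> {V. B \<inter> U \<subseteq> V \<and> open V}. emeasure M V)"
    by (rule inner_regular[OF sets_M finM BU], rule outer_regular[OF sets_M finM BU])
  have finB: "emeasure M (B \<inter> U) \<noteq> \<infinity>"
    using finM emeasure_space[of M "B \<inter> U"] by (auto simp: top_unique)
  obtain K where K: "K \<subseteq> B \<inter> U" "compact K" "emeasure M (B \<inter> U) < emeasure M K + ennreal (e / 2)"
  proof (cases "emeasure M (B \<inter> U) = 0")
    case True
    then show ?thesis using e by (intro that[of "{}"]) auto
  next
    case False
    then have "emeasure M (B \<inter> U) - ennreal (e / 2) < emeasure M (B \<inter> U)"
      using e finB by (intro ennreal_between) (auto simp: less_top zero_less_iff_neq_zero)
    then obtain K where K: "K \<subseteq> B \<inter> U" "compact K" "emeasure M (B \<inter> U) - ennreal (e / 2) < emeasure M K"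
      unfolding inner less_SUP_iff by auto
    have "emeasure M (B \<inter> U) < emeasure M K + ennreal (e / 2)"
    proof (rule ccontr)
      assume "\<not> ?thesis"
      then have "(emeasure M K + ennreal (e / 2)) - ennreal (e / 2) \<le> emeasure M (B \<inter> U) - ennreal (e / 2)"
        by (intro ennreal_minus_mono) (auto simp: not_less)
      then show False using K(3) by (simp add: ennreal_add_diff_cancel_right)
    qed
    then show ?thesis by (rule that[OF K(1,2)])
  qed
  have "emeasure M (B \<inter> U) + 0 < emeasure M (B \<inter> U) + ennreal (e / 2)"
    using finB e unfolding ennreal_add_left_cancel_less by simp
  then have "(INF V \<in> {V. B \<inter> U \<subseteq> V \<and> open V}. emeasure M V) < emeasure M (B \<inter> U) + ennreal (e / 2)"
    unfolding outer[symmetric] by simp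
  then obtain V where V: "B \<inter> U \<subseteq> V" "open V" "emeasure M V < emeasure M (B \<inter> U) + ennreal (e / 2)"
    unfolding INF_less_iff by blast
  have [measurable]: "K \<in> sets borel" "V \<in> sets borel" using K V by (auto simp: compact_imp_closed)
  have "K \<subseteq> V \<inter> U" using K(1) V(1) by blast
  then obtain h where h: "smooth h" "\<And>x. 0 \<le> h x" "\<And>x. h x \<le> 1" "\<And>x. x \<in> K \<Longrightarrow> h x = 1" "\<And>x. x \<notin> V \<inter> U \<Longrightarrow> h x = 0"
    by (rule smooth_urysohn[OF K(2) open_Int[OF V(2) U]]) (rule that)
  have "weighted_size U \<tau> (\<lambda>x. indicator B x - h x) = weighted_size U \<tau> (\<lambda>x. indicator U x * (indicator B x - h x))"
    unfolding weighted_size_def by (intro nn_integral_cong) (auto simp: indicator_def)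
  also have "\<dots> \<le> weighted_size U \<tau> (indicator (V - K))"
  proof (rule weighted_size_mono)
    fix x
    have "\<bar>indicator B x - h x\<bar> \<le> 1" using h(2,3)[of x] by (auto simp: indicator_def)
    moreover have "indicator B x - h x = 0" if "x \<in> U" "x \<in> K \<or> x \<notin> V"
      using that K(1) V(1) h(4,5)[of x] by (auto simp: indicator_def)
    ultimately show "\<bar>indicator U x * (indicator B x - h x)\<bar> \<le> \<bar>indicator (V - K) x\<bar>"
      by (auto simp: indicator_def)
  qed
  also have "\<dots> = emeasure M (V - K)" by (rule M[symmetric]) measurable
  also have "\<dots> = emeasure M V - emeasure M K"
    using \<open>K \<subseteq> V \<inter> U\<close> K(1) finB emeasure_mono[of K "B \<inter> U" M]
    by (intro emeasure_Diff) (auto simp: sets_M top_unique BU)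
  also have "\<dots> < ennreal e"
  proof -
    have fK: "emeasure M K \<noteq> \<infinity>"
      using K(1) finB emeasure_mono[of K "B \<inter> U" M] by (auto simp: sets_M top_unique BU)
    have "emeasure M V < (emeasure M K + ennreal (e / 2)) + ennreal (e / 2)"
      using V(3) K(3) by (meson add_right_mono less_imp_le order_less_le_trans)
    also have "\<dots> = emeasure M K + ennreal e"
      using e by (simp add: add.assoc ennreal_plus[symmetric] del: ennreal_plus)
    finally have lt: "emeasure M V < emeasure M K + ennreal e" .
    have "emeasure M K \<le> emeasure M V" using \<open>K \<subseteq> V \<inter> U\<close> by (intro emeasure_mono) (auto simp: sets_M)
    then have eq: "(emeasure M V - emeasure M K) + emeasure M K = emeasure M V" by (rule diff_add_cancel_ennreal)
    show ?thesis
    proof (rule ccontr)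
      assume "\<not> ?thesis"
      then have "ennreal e + emeasure M K \<le> (emeasure M V - emeasure M K) + emeasure M K"
        by (intro add_right_mono) (simp add: not_less)
      then show False using lt unfolding eq by (simp add: add.commute)
    qed
  qed
  finally show "\<exists>h. smooth h \<and> (\<forall>x. x \<notin> U \<longrightarrow> h x = 0) \<and> weighted_size U \<tau> (\<lambda>x. indicator B x - h x) < ennreal e"
    using h(1,5) by (intro exI[of _ h]) auto
qed

text \<open>
  Simple functions \<open>s\<^sub>i\<close> converge to \<open>f\<close> with \<open>|f - s\<^sub>i| \<le> 3|f|\<close>, which dominates the weighted size; a simple function
  is a combination of indicators.
\<close>

theorem smooth_approximation:
  assumes fin: "weighted_size U \<tau> (\<lambda>x. 1) < \<infinity>" and f: "weighted_size U \<tau> f < \<infinity>"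
    and [measurable]: "f \<in> borel_measurable borel"
  shows "smoothly_approximable f"
  unfolding smoothly_approximable_def
proof (intro allI impI)
  fix e :: real assume e: "e > 0"
  note [measurable] = \<tau>(1) borel_open[OF U]
  obtain s where s: "\<And>i. simple_function borel (s i)" "\<And>x. (\<lambda>i. s i x) \<longlonglongrightarrow> f x"
    "\<And>i x. dist (s i x) 0 \<le> 2 * dist (f x) 0"
    using borel_measurable_implies_sequence_metric[of f borel 0] by auto
  have [measurable]: "s i \<in> borel_measurable borel" for i
    using s(1) by (rule borel_measurable_simple_function)
  have "(\<lambda>i. weighted_size U \<tau> (\<lambda>x. f x - s i x)) \<longlonglongrightarrow> (\<integral>\<^sup>+(x::real). 0 \<partial>lborel)"
    unfolding weighted_size_def
  proof (rule nn_integral_dominated_convergence[where u' = "\<lambda>x. 0" and w = "\<lambda>x. ennreal (\<bar>3 * f x\<bar> + (3 * f x)\<^sup>2 * \<tau> x) * indicator U x"])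
    show "(\<integral>\<^sup>+x. ennreal (\<bar>3 * f x\<bar> + (3 * f x)\<^sup>2 * \<tau> x) * indicator U x \<partial>lborel) < \<infinity>"
    proof -
      have "weighted_size U \<tau> (\<lambda>x. 3 * f x) \<le> ennreal (\<bar>3\<bar> + 3\<^sup>2) * weighted_size U \<tau> f"
        by (rule weighted_size_cmult) measurable
      also have "\<dots> < \<infinity>" using f by (simp add: ennreal_mult_less_top)
      finally show ?thesis by (simp add: weighted_size_def)
    qed
    show "AE x in lborel. ennreal (\<bar>f x - s i x\<bar> + (f x - s i x)\<^sup>2 * \<tau> x) * indicator U x
        \<le> ennreal (\<bar>3 * f x\<bar> + (3 * f x)\<^sup>2 * \<tau> x) * indicator U x" for i
    proof (intro always_eventually allI)
      fix x
      have le: "\<bar>f x - s i x\<bar> \<le> \<bar>3 * f x\<bar>" using s(3)[of i x] by (simp add: dist_real_def abs_mult)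
      then have "(f x - s i x)\<^sup>2 \<le> (3 * f x)\<^sup>2" by (simp only: abs_le_square_iff)
      then have "(f x - s i x)\<^sup>2 * \<tau> x \<le> (3 * f x)\<^sup>2 * \<tau> x"
        by (rule mult_right_mono[OF _ \<tau>(2)])
      then have "ennreal (\<bar>f x - s i x\<bar> + (f x - s i x)\<^sup>2 * \<tau> x) \<le> ennreal (\<bar>3 * f x\<bar> + (3 * f x)\<^sup>2 * \<tau> x)"
        using le by (intro ennreal_leI add_mono)
      then show "ennreal (\<bar>f x - s i x\<bar> + (f x - s i x)\<^sup>2 * \<tau> x) * indicator U x
        \<le> ennreal (\<bar>3 * f x\<bar> + (3 * f x)\<^sup>2 * \<tau> x) * indicator U x"
        by (rule mult_right_mono) simp
    qed
    show "AE x in lborel. (\<lambda>i. ennreal (\<bar>f x - s i x\<bar> + (f x - s i x)\<^sup>2 * \<tau> x) * indicator U x) \<longlonglongrightarrow> 0"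
    proof (intro always_eventually allI)
      fix x
      have "(\<lambda>i. \<bar>f x - s i x\<bar> + (f x - s i x)\<^sup>2 * \<tau> x) \<longlonglongrightarrow> \<bar>f x - f x\<bar> + (f x - f x)\<^sup>2 * \<tau> x"
        by (intro tendsto_intros s(2))
      then have "(\<lambda>i. ennreal (\<bar>f x - s i x\<bar> + (f x - s i x)\<^sup>2 * \<tau> x)) \<longlonglongrightarrow> ennreal 0"
        by (intro tendsto_ennrealI) simp
      then show "(\<lambda>i. ennreal (\<bar>f x - s i x\<bar> + (f x - s i x)\<^sup>2 * \<tau> x) * indicator U x) \<longlonglongrightarrow> 0"
        by (cases "x \<in> U") auto
    qed
  qed measurable
  then have "eventually (\<lambda>i. weighted_size U \<tau> (\<lambda>x. f x - s i x) < ennreal (e / 4)) sequentially"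
    using e by (intro order_tendstoD(2)) auto
  then obtain i where i: "weighted_size U \<tau> (\<lambda>x. f x - s i x) < ennreal (e / 4)"
    by (auto simp: eventually_sequentially)
  have "smoothly_approximable (\<lambda>x. \<Sum>y\<in>range (s i). y * indicator (s i -` {y}) x)"
  proof (rule smoothly_approximable_sum)
    show "finite (range (s i))" using simple_functionD(1)[OF s(1)[of i]] by simp
    fix y
    have [measurable]: "s i -` {y} \<in> sets borel" using simple_functionD(2)[OF s(1)[of i], of "{y}"] by simp
    show "smoothly_approximable (\<lambda>x. y * indicator (s i -` {y}) x)"
      by (intro smoothly_approximable_cmult smoothly_approximable_indicator fin) measurable
    show "(\<lambda>x. y * indicator (s i -` {y}) x) \<in> borel_measurable borel" by measurable
  qed
  also have "(\<lambda>x. \<Sum>y\<in>range (s i). y * indicator (s i -` {y}) x) = s i"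
  proof
    fix x
    have "(\<Sum>y\<in>range (s i). y * indicator (s i -` {y}) x) = (\<Sum>y\<in>range (s i). if y = s i x then y else 0)"
      by (intro sum.cong) (auto simp: indicator_def)
    also have "\<dots> = s i x" using simple_functionD(1)[OF s(1)[of i]] by (simp add: sum.delta')
    finally show "(\<Sum>y\<in>range (s i). y * indicator (s i -` {y}) x) = s i x" .
  qed
  finally obtain h where h: "smooth h" "\<forall>x. x \<notin> U \<longrightarrow> h x = 0" "weighted_size U \<tau> (\<lambda>x. s i x - h x) < ennreal (e / 4)"
    using e unfolding smoothly_approximable_def by (meson divide_pos_pos zero_less_numeral)
  note [measurable] = smooth_borel[OF h(1)]
  have "weighted_size U \<tau> (\<lambda>x. f x - h x) = weighted_size U \<tau> (\<lambda>x. (f x - s i x) + (s i x - h x))"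
    by simp
  also have "\<dots> \<le> 2 * weighted_size U \<tau> (\<lambda>x. f x - s i x) + 2 * weighted_size U \<tau> (\<lambda>x. s i x - h x)"
    by (rule weighted_size_add) measurable
  also have "\<dots> < 2 * ennreal (e / 4) + 2 * ennreal (e / 4)"
    using i h(3) by (intro add_strict_mono ennreal_mult_strict_left_mono) auto
  also have "\<dots> = ennreal e"
    using e by (simp add: ennreal_mult[symmetric] ennreal_plus[symmetric] ennreal_numeral[symmetric] del: ennreal_numeral ennreal_plus)
  finally show "\<exists>h. smooth h \<and> (\<forall>x. x \<notin> U \<longrightarrow> h x = 0) \<and> weighted_size U \<tau> (\<lambda>x. f x - h x) < ennreal e"
    using h by blast
qed

end

section \<open>The measure and the derivative of one scale function\<close>

lemma interval_minus_interior:
  fixes Y :: "real set"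
  assumes "is_interval Y"
  shows "finite (Y - interior Y)"
proof (rule finite_subset)
  show "Y - interior Y \<subseteq> {Inf Y, Sup Y}"
  proof
    fix y assume y: "y \<in> Y - interior Y"
    have "(\<forall>z\<in>Y. y \<le> z) \<or> (\<forall>z\<in>Y. z \<le> y)"
    proof (rule ccontr)
      assume "\<not> ?thesis"
      then obtain z w where zw: "z \<in> Y" "z < y" "w \<in> Y" "y < w" by (meson not_le)
      then have "{z<..<w} \<subseteq> Y" using mem_is_interval_1_I[OF assms zw(1,3)] by auto
      then have "y \<in> interior Y" using zw by (intro interiorI[of "{z<..<w}"]) auto
      then show False using y by simp
    qed
    then show "y \<in> {Inf Y, Sup Y}"
      using y cInf_eq_minimum[of y Y] cSup_eq_maximum[of y Y] by auto
  qed
qed simp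

lemma AE_interior_interval:
  fixes Y :: "real set"
  assumes "is_interval Y"
  shows "AE y in lborel. y \<in> Y \<longrightarrow> y \<in> interior Y"
proof -
  have "Y - interior Y \<in> null_sets lborel"
    using interval_minus_interior[OF assms] by (rule finite_imp_null_set_lborel)
  from AE_not_in[OF this] show ?thesis by (rule eventually_mono) auto
qed

text \<open>
  The setting of a single scale function, whose inverse is \<open>T : Y \<rightarrow> J\<close>. By definition of the
  Stieltjes measure, integrals against \<open>ds\<close> on \<open>J\<close> are Lebesgue integrals on \<open>Y\<close> after substituting \<open>T\<close>.
\<close>

locale scale_interval =
  fixes J :: "real set" and s :: "real \<Rightarrow> real"
  assumes nondeg: "nondeg_interval J" and cont: "continuous_on J s" and smono: "strict_mono_on J s"
begin

definition Y :: "real set" where "Y = s ` J"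
definition T :: "real \<Rightarrow> real" where "T = the_inv_into J s"

lemma is_interval_J: "is_interval J" using nondeg by (simp add: nondeg_interval_def)

lemma inj: "inj_on s J" using smono by (rule strict_mono_on_imp_inj_on)

lemma T_s [simp]: "x \<in> J \<Longrightarrow> T (s x) = x" using inj by (simp add: T_def the_inv_into_f_f)

lemma s_in [simp]: "x \<in> J \<Longrightarrow> s x \<in> Y" by (simp add: Y_def)

lemma T_in [simp]: "y \<in> Y \<Longrightarrow> T y \<in> J" and s_T [simp]: "y \<in> Y \<Longrightarrow> s (T y) = y"
  by (auto simp: Y_def)

lemma s_le: "x \<in> J \<Longrightarrow> x' \<in> J \<Longrightarrow> s x \<le> s x' \<longleftrightarrow> x \<le> x'"
  by (rule strict_mono_on_less_eq[OF smono])

lemma T_le: "y \<in> Y \<Longrightarrow> y' \<in> Y \<Longrightarrow> T y \<le> T y' \<longleftrightarrow> y \<le> y'"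
  by (metis s_le s_T T_in)

lemma is_interval_Y: "is_interval Y"
  unfolding Y_def
  using connected_continuous_image[OF cont is_interval_connected[OF is_interval_J]]
  by (simp only: is_interval_connected_1)

lemma interior_Y_in: "y \<in> interior Y \<Longrightarrow> y \<in> Y"
  using interior_subset by blast

lemma J_borel [measurable]: "J \<in> sets borel" and Y_borel [measurable]: "Y \<in> sets borel"
  using is_interval_J is_interval_Y real_interval_borel_measurable by auto

lemma Icc_sub_J: "p \<in> J \<Longrightarrow> q \<in> J \<Longrightarrow> {p..q} \<subseteq> J"
  using mem_is_interval_1_I[OF is_interval_J, of p q] by (simp add: subset_eq)

lemma Icc_sub_Y: "p \<in> Y \<Longrightarrow> q \<in> Y \<Longrightarrow> {p..q} \<subseteq> Y"
  using mem_is_interval_1_I[OF is_interval_Y, of p q] by (simp add: subset_eq)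

lemma T_Icc: "p \<in> J \<Longrightarrow> q \<in> J \<Longrightarrow> y \<in> Y \<Longrightarrow> T y \<in> {p..q} \<longleftrightarrow> y \<in> {s p..s q}"
  by (metis T_in T_le T_s atLeastAtMost_iff s_in)

lemma T_measurable: "T \<in> measurable (restrict_space lborel Y) (restrict_space borel J)"
  unfolding T_def Y_def by (rule the_inv_into_scale_measurable[OF is_interval_J cont smono])

lemma stieltjes_eq: "stieltjes J s = distr (restrict_space lborel Y) (restrict_space borel J) T"
  unfolding stieltjes_def T_def Y_def ..

lemma sets_stieltjes: "sets (stieltjes J s) = sets (restrict_space borel J)"
  and space_stieltjes: "space (stieltjes J s) = J"
  by (auto simp: stieltjes_eq space_restrict_space)

lemma borel_measurable_stieltjes: "borel_measurable (stieltjes J s) = borel_measurable (restrict_space borel J)"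
  by (rule measurable_cong_sets[OF sets_stieltjes refl])

lemma s_measurable: "(\<lambda>x. indicator J x * s x) \<in> borel_measurable borel"
  using borel_measurable_continuous_on_indicator[OF J_borel cont] by simp

lemma nn_integral_stieltjes:
  assumes "f \<in> borel_measurable (restrict_space borel J)"
  shows "(\<integral>\<^sup>+x. f x \<partial>stieltjes J s) = (\<integral>\<^sup>+y. f (T y) * indicator Y y \<partial>lborel)"
  unfolding stieltjes_eq
  using assms by (subst nn_integral_distr[OF T_measurable]) (simp_all add: nn_integral_restrict_space)

lemma integrable_stieltjes:
  fixes f :: "real \<Rightarrow> real"
  assumes "f \<in> borel_measurable (restrict_space borel J)"
  shows "integrable (stieltjes J s) f \<longleftrightarrow> integrable lborel (\<lambda>y. indicator Y y * f (T y))"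
  unfolding stieltjes_eq
  by (subst integrable_distr_eq[OF T_measurable assms]) (simp add: integrable_restrict_space)

lemma integral_stieltjes:
  fixes f :: "real \<Rightarrow> real"
  assumes "f \<in> borel_measurable (restrict_space borel J)"
  shows "(\<integral>x. f x \<partial>stieltjes J s) = (\<integral>y. indicator Y y * f (T y) \<partial>lborel)"
  unfolding stieltjes_eq
  by (subst integral_distr[OF T_measurable assms]) (simp add: integral_restrict_space)

lemma AE_stieltjesI:
  assumes "AE y in lborel. y \<in> Y \<longrightarrow> P (T y)"
  shows "AE x in stieltjes J s. P x"
proof -
  obtain A where A: "{y \<in> space lborel. \<not> (y \<in> Y \<longrightarrow> P (T y))} \<subseteq> A" "A \<in> null_sets lborel"
    using assms by (rule AE_E3) auto
  note [measurable] = s_measurable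
  have A': "A \<in> sets borel" using A(2) by auto
  let ?B = "{x. indicator J x * s x \<in> A} \<inter> J"
  have B: "?B \<in> sets borel" using A' by measurable
  then have B': "?B \<in> sets (restrict_space borel J)" by (subst sets_restrict_space_iff) auto
  have "(\<integral>\<^sup>+x. indicator ?B x \<partial>stieltjes J s) = (\<integral>\<^sup>+y. indicator ?B (T y) * indicator Y y \<partial>lborel)"
    by (rule nn_integral_stieltjes) (use B' in simp)
  also have "\<dots> \<le> (\<integral>\<^sup>+y. indicator A y \<partial>lborel)"
    by (intro nn_integral_mono) (auto simp: indicator_def)
  also have "\<dots> = 0" using A(2) by (subst nn_integral_indicator) auto
  finally have "emeasure (stieltjes J s) ?B = 0"
    using B' by (simp add: sets_stieltjes)
  then have "?B \<in> null_sets (stieltjes J s)" using B' by (simp add: null_sets_def sets_stieltjes)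
  moreover have "{x \<in> space (stieltjes J s). \<not> P x} \<subseteq> ?B"
  proof
    fix x assume "x \<in> {x \<in> space (stieltjes J s). \<not> P x}"
    then have x: "x \<in> J" "\<not> P x" by (auto simp: space_stieltjes)
    then have "s x \<in> {y \<in> space lborel. \<not> (y \<in> Y \<longrightarrow> P (T y))}" by simp
    then have "s x \<in> A" using A(1) by blast
    then show "x \<in> ?B" using x(1) by simp
  qed
  ultimately show ?thesis by (rule AE_I')
qed

lemma scale_deriv_T: "y \<in> Y \<Longrightarrow> scale_deriv J s u (T y) = deriv (u \<circ> T) y"
  by (simp add: scale_deriv_def T_def[symmetric])

text \<open>
  The function \<open>u \<circ> T\<close> is unspecified outside \<open>Y\<close>, which is harmless at interior points.
\<close>

lemma deriv_comp_T:
  assumes "\<And>y. y \<in> Y \<Longrightarrow> u (T y) = g y" "y \<in> interior Y" "(g has_real_derivative k) (at y)"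
  shows "deriv (u \<circ> T) y = k"
proof (rule DERIV_imp_deriv)
  show "((u \<circ> T) has_real_derivative k) (at y)"
    by (rule has_field_derivative_transform_within_open[OF assms(3) open_interior assms(2)])
      (simp_all add: assms(1) interior_Y_in)
qed

text \<open>
  For the tents and ramps below, which are differentiable in the scale with finitely many exceptions.
\<close>

lemma scale_deriv_piecewise:
  assumes u: "\<And>x. x \<in> J \<Longrightarrow> u x = g (s x)" and X: "finite X" and k: "k \<in> borel_measurable borel"
    and g: "\<And>y. y \<notin> X \<Longrightarrow> (g has_real_derivative k y) (at y)"
  shows "scale_deriv J s u \<in> borel_measurable (restrict_space borel J)"
    and "AE x in stieltjes J s. scale_deriv J s u x = k (s x)"
proof -
  have eq: "scale_deriv J s u x = k (s x)" if "x \<in> J" "s x \<in> interior Y" "s x \<notin> X" for x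
    using deriv_comp_T[of u g "s x" "k (s x)"] u g that scale_deriv_T[of "s x" u] by simp
  have fin: "finite {x \<in> J. s x \<in> X \<union> (Y - interior Y)}"
    using finite_vimage_IntI[OF _ inj, of "X \<union> (Y - interior Y)"] X interval_minus_interior[OF is_interval_Y]
    by (simp add: vimage_def Int_def conj_commute)
  have s: "s \<in> borel_measurable (restrict_space borel J)"
    using s_measurable by (subst borel_measurable_restrict_space_iff) auto
  have m: "(\<lambda>x. k (s x)) \<in> borel_measurable (restrict_space borel J)"
    using s k by (rule measurable_compose)
  show "scale_deriv J s u \<in> borel_measurable (restrict_space borel J)"
  proof (rule measurable_discrete_difference[OF m, of "{x \<in> J. s x \<in> X \<union> (Y - interior Y)}"])
    show "countable {x \<in> J. s x \<in> X \<union> (Y - interior Y)}" using fin by (rule countable_finite)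
    show "{x} \<in> sets (restrict_space borel J)" if "x \<in> {x \<in> J. s x \<in> X \<union> (Y - interior Y)}" for x
      using that by (subst sets_restrict_space_iff) auto
    show "k (s x) = scale_deriv J s u x"
      if "x \<in> space (restrict_space borel J)" "x \<notin> {x \<in> J. s x \<in> X \<union> (Y - interior Y)}" for x
      using that eq[of x] by (simp add: space_restrict_space)
  qed simp
  show "AE x in stieltjes J s. scale_deriv J s u x = k (s x)"
  proof (rule AE_stieltjesI)
    have "AE y in lborel. y \<notin> X" using X by (intro AE_not_in finite_imp_null_set_lborel)
    with AE_interior_interval[OF is_interval_Y]
    show "AE y in lborel. y \<in> Y \<longrightarrow> scale_deriv J s u (T y) = k (s (T y))"
      by eventually_elim (use eq in auto)
  qed
qed

lemma scale_deriv_cong: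
  assumes "\<And>x. x \<in> J \<Longrightarrow> u x = v x"
  shows "x \<in> J \<Longrightarrow> s x \<in> interior Y \<Longrightarrow> scale_deriv J s u x = scale_deriv J s v x"
    and "AE x in stieltjes J s. scale_deriv J s u x = scale_deriv J s v x"
    and "scale_deriv J s v \<in> borel_measurable (restrict_space borel J) \<Longrightarrow>
         scale_deriv J s u \<in> borel_measurable (restrict_space borel J)"
proof -
  have eq: "scale_deriv J s u x = scale_deriv J s v x" if "x \<in> J" "s x \<in> interior Y" for x
  proof -
    have "eventually (\<lambda>y. (u \<circ> T) y = (v \<circ> T) y) (nhds (s x))"
      using eventually_nhds_in_open[OF open_interior that(2)]
      by (rule eventually_mono) (simp add: assms interior_Y_in)
    then have "deriv (u \<circ> T) (s x) = deriv (v \<circ> T) (s x)" by (rule deriv_cong_ev) simp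
    then show ?thesis by (simp add: scale_deriv_def T_def)
  qed
  then show "x \<in> J \<Longrightarrow> s x \<in> interior Y \<Longrightarrow> scale_deriv J s u x = scale_deriv J s v x" .
  show "AE x in stieltjes J s. scale_deriv J s u x = scale_deriv J s v x"
    by (rule AE_stieltjesI, rule eventually_mono[OF AE_interior_interval[OF is_interval_Y]]) (use eq in auto)
  assume m: "scale_deriv J s v \<in> borel_measurable (restrict_space borel J)"
  have fin: "finite {x \<in> J. s x \<in> Y - interior Y}"
    using finite_vimage_IntI[OF interval_minus_interior[OF is_interval_Y] inj]
    by (simp add: vimage_def Int_def conj_commute)
  show "scale_deriv J s u \<in> borel_measurable (restrict_space borel J)"
  proof (rule measurable_discrete_difference[OF m, of "{x \<in> J. s x \<in> Y - interior Y}"])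
    show "countable {x \<in> J. s x \<in> Y - interior Y}" using fin by (rule countable_finite)
    show "{x} \<in> sets (restrict_space borel J)" if "x \<in> {x \<in> J. s x \<in> Y - interior Y}" for x
      using that by (subst sets_restrict_space_iff) auto
    show "scale_deriv J s v x = scale_deriv J s u x"
      if "x \<in> space (restrict_space borel J)" "x \<notin> {x \<in> J. s x \<in> Y - interior Y}" for x
      using that eq[of x] by (simp add: space_restrict_space)
  qed simp
qed

lemma scale_dominated_continuous:
  assumes "scale_dominated J s u"
  shows "continuous_on J u"
proof -
  obtain g where g: "locally_abs_cont_on Y g" "\<And>x. x \<in> J \<Longrightarrow> u x = g (s x)"
    using assms unfolding scale_dominated_def Y_def by blast
  have "continuous_on J (\<lambda>x. g (s x))"
    by (rule continuous_on_compose2[OF locally_abs_cont_on_imp_continuous_on[OF is_interval_Y g(1)] cont]) auto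
  then show ?thesis using g(2) by (simp cong: continuous_on_cong)
qed

text \<open>
  The fundamental theorem on \<open>Y\<close> for \<open>g = u \<circ> T\<close>, transported to \<open>J\<close>.
\<close>

lemma scale_dominated_ftc:
  assumes "scale_dominated J s u"
  shows "AE y in lborel. y \<in> Y \<longrightarrow> (\<exists>D. ((u \<circ> T) has_real_derivative D) (at y))"
    and "p \<in> J \<Longrightarrow> q \<in> J \<Longrightarrow> p \<le> q \<Longrightarrow> scale_deriv J s u \<in> borel_measurable (restrict_space borel J) \<Longrightarrow>
       integrable (stieltjes J s) (\<lambda>x. indicator {p..q} x * scale_deriv J s u x) \<and>
       (\<integral>x. indicator {p..q} x * scale_deriv J s u x \<partial>stieltjes J s) = u q - u p"
proof -
  obtain g where g: "locally_abs_cont_on Y g" "\<And>x. x \<in> J \<Longrightarrow> u x = g (s x)"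
    using assms unfolding scale_dominated_def Y_def by blast
  obtain f where f: "f \<in> borel_measurable borel"
    "\<And>p q. p \<in> Y \<Longrightarrow> q \<in> Y \<Longrightarrow> p \<le> q \<Longrightarrow> set_integrable lborel {p..q} f"
    "\<And>p q. p \<in> Y \<Longrightarrow> q \<in> Y \<Longrightarrow> p \<le> q \<Longrightarrow> (LBINT t:{p..q}. f t) = g q - g p"
    "AE t in lborel. t \<in> Y \<longrightarrow> (g has_real_derivative f t) (at t)"
    by (rule ftc_locally_abs_cont[OF is_interval_Y g(1)]) (rule that)
  have uT: "u (T y) = g y" if "y \<in> Y" for y using g(2)[of "T y"] that by simp
  have ae: "AE y in lborel. y \<in> Y \<longrightarrow> ((u \<circ> T) has_real_derivative f y) (at y)"
    using f(4) AE_interior_interval[OF is_interval_Y]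
  proof eventually_elim
    case (elim y)
    show ?case
    proof
      assume "y \<in> Y"
      then have "(g has_real_derivative f y) (at y)" "y \<in> interior Y" using elim by auto
      then show "((u \<circ> T) has_real_derivative f y) (at y)"
        by (rule has_field_derivative_transform_within_open[OF _ open_interior])
          (simp_all add: uT interior_Y_in)
    qed
  qed
  then show "AE y in lborel. y \<in> Y \<longrightarrow> (\<exists>D. ((u \<circ> T) has_real_derivative D) (at y))"
    by (rule eventually_mono) auto
  assume pq: "p \<in> J" "q \<in> J" "p \<le> q" and m: "scale_deriv J s u \<in> borel_measurable (restrict_space borel J)"
  have le: "s p \<le> s q" using s_le pq by simp
  have sub: "{s p..s q} \<subseteq> Y" using Icc_sub_Y pq by simp
  have ind: "(\<lambda>x. indicator {p..q} x * scale_deriv J s u x) \<in> borel_measurable (restrict_space borel J)"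
    using m by (intro borel_measurable_times) (auto intro!: borel_measurable_indicator' simp: measurable_restrict_space1)
  let ?h = "\<lambda>y. indicator Y y * (indicator {p..q} (T y) * scale_deriv J s u (T y))"
  have aeh: "AE y in lborel. ?h y = indicator {s p..s q} y *\<^sub>R f y"
    using ae
  proof (rule eventually_mono)
    fix y assume y: "y \<in> Y \<longrightarrow> ((u \<circ> T) has_real_derivative f y) (at y)"
    show "?h y = indicator {s p..s q} y *\<^sub>R f y"
    proof (cases "y \<in> Y")
      case True
      then have "scale_deriv J s u (T y) = f y" using y scale_deriv_T[OF True] by (simp add: DERIV_imp_deriv)
      then show ?thesis using T_Icc[OF pq(1,2) True] True by (simp add: indicator_def)
    next
      case False
      then show ?thesis using sub by (auto simp: indicator_def)
    qed
  qed
  have hm: "?h \<in> borel_measurable lborel"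
  proof -
    have "(\<lambda>y. indicator {p..q} (T y) * scale_deriv J s u (T y)) \<in> borel_measurable (restrict_space lborel Y)"
      by (rule measurable_compose[OF T_measurable ind])
    then show ?thesis by (subst (asm) borel_measurable_restrict_space_iff) auto
  qed
  have fm: "(\<lambda>y. indicator {s p..s q} y *\<^sub>R f y) \<in> borel_measurable lborel" using f(1) by measurable
  have spq: "s p \<in> Y" "s q \<in> Y" using pq by auto
  have "integrable lborel ?h"
    using f(2)[OF spq le] integrable_cong_AE[OF hm fm aeh] by (simp add: set_integrable_def)
  moreover have "integral\<^sup>L lborel ?h = u q - u p"
    using f(3)[OF spq le] integral_cong_AE[OF hm fm aeh] g(2) pq by (simp add: set_lebesgue_integral_def)
  ultimately show "integrable (stieltjes J s) (\<lambda>x. indicator {p..q} x * scale_deriv J s u x) \<and>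
       (\<integral>x. indicator {p..q} x * scale_deriv J s u x \<partial>stieltjes J s) = u q - u p"
    using integrable_stieltjes[OF ind] integral_stieltjes[OF ind] by simp
qed

end

text \<open>
  Compact intervals form a generator stable under intersection; both measures are cut down
  to \<open>[p, q]\<close> to make them finite.
\<close>

lemma measure_eq_on_Icc:
  fixes M1 M2 :: "real measure"
  assumes sets: "sets M1 = sets borel" "sets M2 = sets borel"
    and eq: "\<And>u v. p \<le> u \<Longrightarrow> u \<le> v \<Longrightarrow> v \<le> q \<Longrightarrow> emeasure M1 {u..v} = emeasure M2 {u..v}"
    and fin: "emeasure M1 {p..q} \<noteq> \<infinity>" and A: "A \<in> sets borel" "A \<subseteq> {p..q}"
  shows "emeasure M1 A = emeasure M2 A"
proof -
  let ?N = "\<lambda>M. density M (indicator {p..q})"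
  have N: "emeasure (?N M) B = emeasure M (B \<inter> {p..q})" if "sets M = sets borel" "B \<in> sets borel" for M and B :: "real set"
  proof -
    have "B \<in> sets M" "{p..q} \<in> sets M" using that by auto
    then have "emeasure (?N M) B = (\<integral>\<^sup>+x. indicator {p..q} x * indicator B x \<partial>M)"
      by (intro emeasure_density) auto
    also have "\<dots> = (\<integral>\<^sup>+x. indicator (B \<inter> {p..q}) x \<partial>M)"
      by (rule nn_integral_cong) (simp split: split_indicator)
    also have "\<dots> = emeasure M (B \<inter> {p..q})" using that by (intro nn_integral_indicator) auto
    finally show ?thesis .
  qed
  have "?N M1 = ?N M2"
  proof (rule measure_eqI_generator_eq[where E = "range (\<lambda>(a, b). {a..b})" and \<Omega> = UNIV and A = "\<lambda>i. {- real i..real i}"])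
    show "Int_stable (range (\<lambda>(a::real, b). {a..b}))" by (auto simp: Int_stable_def)
    show "sets (?N M1) = sigma_sets UNIV (range (\<lambda>(a::real, b). {a..b}))"
      "sets (?N M2) = sigma_sets UNIV (range (\<lambda>(a::real, b). {a..b}))"
      using sets by (simp_all add: borel_eq_atLeastAtMost)
    fix X assume "X \<in> range (\<lambda>(a::real, b). {a..b})"
    then obtain a b where X: "X = {a..b}" by auto
    show "emeasure (?N M1) X = emeasure (?N M2) X"
    proof (cases "max a p \<le> min b q")
      case True
      then show ?thesis using eq[of "max a p" "min b q"] sets by (simp add: N X)
    next
      case False
      then have "{a..b} \<inter> {p..q} = {}" by auto
      then show ?thesis using sets by (simp add: N X)
    qed
  next
    show "range (\<lambda>i. {- real i..real i}) \<subseteq> range (\<lambda>(a, b). {a..b})" by auto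
    show "(\<Union>i. {- real i..real i}) = UNIV"
    proof (intro equalityI subsetI)
      fix x :: real
      obtain i :: nat where "\<bar>x\<bar> \<le> real i" using real_arch_simple by blast
      then show "x \<in> (\<Union>i. {- real i..real i})" by (auto simp: abs_le_iff intro!: exI[of _ i])
    qed simp
    show "emeasure (?N M1) {- real i..real i} \<noteq> \<infinity>" for i
    proof -
      have "emeasure M1 ({- real i..real i} \<inter> {p..q}) \<le> emeasure M1 {p..q}"
        using sets by (intro emeasure_mono) auto
      then show ?thesis using fin sets by (auto simp: N top_unique)
    qed
  qed auto
  then have "emeasure (?N M1) A = emeasure (?N M2) A" by simp
  moreover have "A \<inter> {p..q} = A" using A(2) by auto
  ultimately show ?thesis using sets A(1) by (simp add: N)
qed

section \<open>The sum of the scale measures\<close>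

locale effective_family =
  fixes N :: "nat set" and I :: "nat \<Rightarrow> real set" and s :: "nat \<Rightarrow> real \<Rightarrow> real" and e :: "nat \<Rightarrow> real"
  assumes eff: "\<And>n. n \<in> N \<Longrightarrow> nondeg_interval (I n) \<and> e n \<in> interior (I n) \<and> adapted_scale (I n) (e n) (s n)"
    and disj: "disjoint_family_on I N"
begin

abbreviation Y :: "nat \<Rightarrow> real set" where "Y n \<equiv> scale_interval.Y (I n) (s n)"
abbreviation T :: "nat \<Rightarrow> real \<Rightarrow> real" where "T n \<equiv> scale_interval.T (I n) (s n)"
abbreviation \<sigma> :: "real measure" where "\<sigma> \<equiv> lambda_s N I s"
definition G :: "real set" where "G = (\<Union>n\<in>N. I n)"

lemma scale: "n \<in> N \<Longrightarrow> scale_interval (I n) (s n)"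
  using eff[of n] by (simp add: scale_interval_def adapted_scale_def scale_function_def)

lemma sets_sigma [simp, measurable_cong]: "sets \<sigma> = sets borel"
  unfolding lambda_s_def using sets.sets_measure_of_eq[of "borel :: real measure"] by simp

lemma space_sigma [simp]: "space \<sigma> = UNIV"
  using sets_eq_imp_space_eq[OF sets_sigma] by simp

lemma borel_measurable_sigma [simp]: "borel_measurable \<sigma> = borel_measurable borel"
  by (rule measurable_cong_sets) simp_all

lemma I_borel [measurable, simp]: "n \<in> N \<Longrightarrow> I n \<in> sets borel"
  by (rule scale_interval.J_borel[OF scale])

lemma G_borel [measurable, simp]: "G \<in> sets borel"
  unfolding G_def by (rule sets.countable_UN'') auto

lemma I_disj: "n \<in> N \<Longrightarrow> k \<in> N \<Longrightarrow> x \<in> I n \<Longrightarrow> x \<in> I k \<Longrightarrow> n = k"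
  using disjoint_family_onD[OF disj, of n k] by blast

lemma emeasure_sigma_sub:
  assumes n: "n \<in> N" and A: "A \<in> sets borel" "A \<subseteq> I n"
  shows "emeasure \<sigma> A = emeasure (stieltjes (I n) (s n)) A"
proof -
  have "emeasure \<sigma> A = (\<integral>\<^sup>+ k. emeasure (stieltjes (I k) (s k)) (A \<inter> I k) \<partial>count_space N)"
    by (rule emeasure_lambda_s[OF A(1)])
  also have "\<dots> = (\<Sum>k\<in>{n}. emeasure (stieltjes (I k) (s k)) (A \<inter> I k))"
  proof (rule nn_integral_count_space')
    fix k assume k: "k \<in> N" "k \<notin> {n}"
    then have "A \<inter> I k = {}" using A(2) I_disj[OF n k(1)] by blast
    then show "emeasure (stieltjes (I k) (s k)) (A \<inter> I k) = 0" by simp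
  qed (use n in auto)
  also have "\<dots> = emeasure (stieltjes (I n) (s n)) A" using A(2) by (simp add: Int_absorb2)
  finally show ?thesis .
qed

lemma restrict_sigma: "n \<in> N \<Longrightarrow> restrict_space \<sigma> (I n) = stieltjes (I n) (s n)"
proof (rule measure_eqI)
  assume n: "n \<in> N"
  show sets: "sets (restrict_space \<sigma> (I n)) = sets (stieltjes (I n) (s n))"
    unfolding scale_interval.sets_stieltjes[OF scale[OF n]] by (rule sets_restrict_space_cong) simp
  fix A assume "A \<in> sets (restrict_space \<sigma> (I n))"
  then have A: "A \<in> sets borel" "A \<subseteq> I n" using n by (simp_all add: sets_restrict_space_iff)
  show "emeasure (restrict_space \<sigma> (I n)) A = emeasure (stieltjes (I n) (s n)) A"
    using n A by (subst emeasure_restrict_space) (auto simp: emeasure_sigma_sub)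
qed

lemma null_compl_G: "- G \<in> null_sets \<sigma>"
proof -
  have "emeasure \<sigma> (- G) = (\<integral>\<^sup>+ k. emeasure (stieltjes (I k) (s k)) (- G \<inter> I k) \<partial>count_space N)"
    by (rule emeasure_lambda_s) simp
  also have "\<dots> = (\<integral>\<^sup>+ k. 0 \<partial>count_space N)"
  proof (rule nn_integral_cong)
    fix k assume "k \<in> space (count_space N)"
    then have "- G \<inter> I k = {}" by (auto simp: G_def)
    then show "emeasure (stieltjes (I k) (s k)) (- G \<inter> I k) = 0" by simp
  qed
  finally show ?thesis by (simp add: null_sets_def)
qed

text \<open>
  Almost everywhere statements for \<open>\<sigma>\<close> are proved in the coordinate \<open>y = s\<^sub>n(x)\<close> on every \<open>Y\<^sub>n\<close> with
  respect to Lebesgue measure.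
\<close>

lemma AE_sigmaI:
  assumes "\<And>n. n \<in> N \<Longrightarrow> AE y in lborel. y \<in> Y n \<longrightarrow> P (T n y)"
  shows "AE x in \<sigma>. P x"
proof -
  have "AE x in \<sigma>. x \<in> I n \<longrightarrow> P x" if n: "n \<in> N" for n
    using scale_interval.AE_stieltjesI[OF scale[OF n] assms[OF n]] n
    unfolding restrict_sigma[OF n, symmetric] by (subst (asm) AE_restrict_space_iff) auto
  then have "AE x in \<sigma>. \<forall>n\<in>N. x \<in> I n \<longrightarrow> P x" by (subst AE_ball_countable) auto
  moreover have "AE x in \<sigma>. x \<in> G" using AE_not_in[OF null_compl_G] by simp
  ultimately show ?thesis by eventually_elim (auto simp: G_def)
qed

lemma AE_sigmaD:
  assumes "AE x in \<sigma>. P x" and n: "n \<in> N"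
  shows "AE y in lborel. y \<in> Y n \<longrightarrow> P (T n y)"
proof -
  have "AE x in restrict_space \<sigma> (I n). P x"
    using assms by (subst AE_restrict_space_iff) (auto elim: eventually_mono)
  then have "AE x in distr (restrict_space lborel (Y n)) (restrict_space borel (I n)) (T n). P x"
    unfolding restrict_sigma[OF n] scale_interval.stieltjes_eq[OF scale[OF n]] .
  from AE_distrD[OF scale_interval.T_measurable[OF scale[OF n]] this] show ?thesis
    using scale_interval.Y_borel[OF scale[OF n]] by (subst (asm) AE_restrict_space_iff) auto
qed

lemma nn_integral_sigma:
  assumes n: "n \<in> N" and f: "f \<in> borel_measurable borel"
  shows "(\<integral>\<^sup>+x. f x * indicator (I n) x \<partial>\<sigma>) = (\<integral>\<^sup>+y. f (T n y) * indicator (Y n) y \<partial>lborel)"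
proof -
  have "(\<integral>\<^sup>+x. f x * indicator (I n) x \<partial>\<sigma>) = (\<integral>\<^sup>+x. f x \<partial>restrict_space \<sigma> (I n))"
    using n by (subst nn_integral_restrict_space) auto
  also have "\<dots> = (\<integral>\<^sup>+y. f (T n y) * indicator (Y n) y \<partial>lborel)"
    unfolding restrict_sigma[OF n]
    by (rule scale_interval.nn_integral_stieltjes[OF scale[OF n] measurable_restrict_space1[OF f]])
  finally show ?thesis .
qed

lemma emeasure_sigma_Icc:
  assumes n: "n \<in> N" and pq: "p \<in> I n" "q \<in> I n" "p \<le> q"
  shows "emeasure \<sigma> {p..q} = ennreal (s n q - s n p)"
  using emeasure_sigma_sub[OF n _ scale_interval.Icc_sub_J[OF scale[OF n] pq(1,2)]]
    emeasure_stieltjes_Icc[OF scale_interval.is_interval_J[OF scale[OF n]] scale_interval.cont[OF scale[OF n]]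
      scale_interval.smono[OF scale[OF n]] pq] by simp

lemma null_singleton_sigma: "{x} \<in> null_sets \<sigma>"
proof (cases "x \<in> G")
  case True
  then obtain n where "n \<in> N" "x \<in> I n" by (auto simp: G_def)
  from emeasure_sigma_Icc[OF this(1) this(2) this(2)] show ?thesis by (simp add: null_sets_def)
next
  case False
  then show ?thesis by (intro null_sets_subset[OF null_compl_G]) auto
qed

text \<open>
  At most one term of the series differs from 0, as the intervals are disjoint; written as a series,
  the function is visibly measurable.
\<close>

definition glue :: "(nat \<Rightarrow> real \<Rightarrow> real) \<Rightarrow> real \<Rightarrow> real" where
  "glue f x = (\<Sum>n. indicator {n \<in> N. x \<in> I n} n * f n x)"

lemma glue_eq: "n \<in> N \<Longrightarrow> x \<in> I n \<Longrightarrow> glue f x = f n x"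
proof -
  assume n: "n \<in> N" "x \<in> I n"
  have "{k \<in> N. x \<in> I k} = {n}" using n I_disj by blast
  then have "glue f x = (\<Sum>k\<in>{n}. indicator {k \<in> N. x \<in> I k} k * f k x)"
    unfolding glue_def by (intro suminf_finite) auto
  then show ?thesis using n by simp
qed

lemma glue_outside: "x \<notin> G \<Longrightarrow> glue f x = 0"
proof -
  assume "x \<notin> G"
  then have "{n \<in> N. x \<in> I n} = {}" by (auto simp: G_def)
  then show ?thesis unfolding glue_def by simp
qed

lemma glue_measurable:
  assumes "\<And>n. n \<in> N \<Longrightarrow> f n \<in> borel_measurable (restrict_space borel (I n))"
  shows "glue f \<in> borel_measurable borel"
  unfolding glue_def
proof (rule borel_measurable_suminf)
  fix n
  show "(\<lambda>x. indicator {n \<in> N. x \<in> I n} n * f n x) \<in> borel_measurable borel"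
  proof (cases "n \<in> N")
    case True
    then have "(\<lambda>x. indicator (I n) x * f n x) \<in> borel_measurable borel"
      using assms[OF True] by (subst (asm) borel_measurable_restrict_space_iff) auto
    also have "(\<lambda>x. indicator (I n) x * f n x) = (\<lambda>x. indicator {n \<in> N. x \<in> I n} n * f n x)"
      using True by (auto simp: indicator_def)
    finally show ?thesis .
  qed simp
qed

text \<open>
  The derivative \<open>du/ds\<^sub>n\<close> on all intervals at once, with the value 0 off \<open>G\<close>.
\<close>

definition D :: "(real \<Rightarrow> real) \<Rightarrow> real \<Rightarrow> real" where
  "D u = glue (\<lambda>n. scale_deriv (I n) (s n) u)"

lemma D_eq: "n \<in> N \<Longrightarrow> x \<in> I n \<Longrightarrow> D u x = scale_deriv (I n) (s n) u x"
  unfolding D_def by (rule glue_eq)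

lemma D_T: "n \<in> N \<Longrightarrow> y \<in> Y n \<Longrightarrow> D u (T n y) = deriv (u \<circ> T n) y"
  by (simp add: D_eq scale_interval.T_in[OF scale] scale_interval.scale_deriv_T[OF scale])

lemma ftc_sigma:
  assumes n: "n \<in> N" and u: "scale_dominated (I n) (s n) u"
    and m: "scale_deriv (I n) (s n) u \<in> borel_measurable (restrict_space borel (I n))"
    and pq: "p \<in> I n" "q \<in> I n" "p \<le> q"
  shows "integrable \<sigma> (\<lambda>x. indicator {p..q} x * D u x)"
    and "(\<integral>x. indicator {p..q} x * D u x \<partial>\<sigma>) = u q - u p"
proof -
  note S = scale[OF n]
  have eq: "(\<lambda>x. indicator (I n) x *\<^sub>R (indicator {p..q} x * scale_deriv (I n) (s n) u x)) = (\<lambda>x. indicator {p..q} x * D u x)"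
  proof
    fix x
    show "indicator (I n) x *\<^sub>R (indicator {p..q} x * scale_deriv (I n) (s n) u x) = indicator {p..q} x * D u x"
      using scale_interval.Icc_sub_J[OF S pq(1,2)] by (cases "x \<in> I n") (auto simp: D_eq[OF n] split: split_indicator)
  qed
  have I: "I n \<inter> space \<sigma> \<in> sets \<sigma>" using n by simp
  have "integrable (restrict_space \<sigma> (I n)) (\<lambda>x. indicator {p..q} x * scale_deriv (I n) (s n) u x)"
    "(\<integral>x. indicator {p..q} x * scale_deriv (I n) (s n) u x \<partial>restrict_space \<sigma> (I n)) = u q - u p"
    using scale_interval.scale_dominated_ftc(2)[OF S u pq m] unfolding restrict_sigma[OF n] by auto
  then show "integrable \<sigma> (\<lambda>x. indicator {p..q} x * D u x)"
    "(\<integral>x. indicator {p..q} x * D u x \<partial>\<sigma>) = u q - u p"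
    unfolding integrable_restrict_space[OF I] integral_restrict_space[OF I] eq by auto
qed

text \<open>
  Every measure without mass off \<open>G\<close> is determined by its restrictions to the countably many
  intervals.
\<close>

lemma piecewise_measure_sum:
  fixes M :: "real measure"
  assumes M: "sets M = sets borel" "emeasure M (- G) = 0" and A: "A \<in> sets borel"
  shows "emeasure M A = (\<Sum>n. emeasure M (A \<inter> (if n \<in> N then I n else {})))"
proof -
  have "emeasure M A = emeasure M ((A \<inter> G) \<union> (A \<inter> - G))" by (rule arg_cong[of _ _ "emeasure M"]) auto
  also have "\<dots> = emeasure M (A \<inter> G)"
    using M A emeasure_mono[of "A \<inter> - G" "- G" M]
    by (intro emeasure_Un_null_set) (auto simp: null_sets_def)
  also have "A \<inter> G = (\<Union>n. A \<inter> (if n \<in> N then I n else {}))" by (auto simp: G_def split: if_splits)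
  also have "emeasure M \<dots> = (\<Sum>n. emeasure M (A \<inter> (if n \<in> N then I n else {})))"
    using M A I_disj by (intro suminf_emeasure[symmetric]) (auto simp: disjoint_family_on_def)
  finally show ?thesis .
qed

lemma nn_integral_sigma_sum:
  assumes f: "f \<in> borel_measurable borel"
  shows "(\<integral>\<^sup>+x. f x \<partial>\<sigma>) = (\<Sum>n. \<integral>\<^sup>+x. f x * indicator (if n \<in> N then I n else {}) x \<partial>\<sigma>)"
proof -
  have "AE x in \<sigma>. x \<in> G" using AE_not_in[OF null_compl_G] by simp
  then have "(\<integral>\<^sup>+x. f x \<partial>\<sigma>) = (\<integral>\<^sup>+x. (\<Sum>n. f x * indicator (if n \<in> N then I n else {}) x) \<partial>\<sigma>)"
  proof (intro nn_integral_cong_AE, elim eventually_mono)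
    fix x assume "x \<in> G"
    then obtain n where n: "n \<in> N" "x \<in> I n" by (auto simp: G_def)
    have "(\<Sum>k. f x * indicator (if k \<in> N then I k else {}) x) = (\<Sum>k\<in>{n}. f x * indicator (if k \<in> N then I k else {}) x)"
      using n I_disj by (intro suminf_finite) (auto simp: indicator_def)
    then show "f x = (\<Sum>k. f x * indicator (if k \<in> N then I k else {}) x)" using n by simp
  qed
  also have "\<dots> = (\<Sum>n. \<integral>\<^sup>+x. f x * indicator (if n \<in> N then I n else {}) x \<partial>\<sigma>)"
    using f by (intro nn_integral_suminf) auto
  finally show ?thesis .
qed

end

locale effective_family_ac = effective_family +
  assumes T_ac: "\<And>n. n \<in> N \<Longrightarrow> locally_abs_cont_on (Y n) (T n)"
begin

text \<open>
  One family of densities \<open>T\<^sub>n'\<close> is fixed once and for all. Unlike \<open>deriv\<close>, it is measurable by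
  construction, and it has the integral property.
\<close>

lemma ex_T_deriv: "\<exists>f. \<forall>n\<in>N. f n \<in> borel_measurable borel \<and>
    (\<forall>p q. p \<in> Y n \<longrightarrow> q \<in> Y n \<longrightarrow> p \<le> q \<longrightarrow> set_integrable lborel {p..q} (f n) \<and>
       (LBINT t:{p..q}. f n t) = T n q - T n p) \<and>
    (AE t in lborel. t \<in> Y n \<longrightarrow> (T n has_real_derivative f n t) (at t))"
proof (rule bchoice, rule ballI)
  fix n assume n: "n \<in> N"
  show "\<exists>f. f \<in> borel_measurable borel \<and>
    (\<forall>p q. p \<in> Y n \<longrightarrow> q \<in> Y n \<longrightarrow> p \<le> q \<longrightarrow> set_integrable lborel {p..q} f \<and>
       (LBINT t:{p..q}. f t) = T n q - T n p) \<and>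
    (AE t in lborel. t \<in> Y n \<longrightarrow> (T n has_real_derivative f t) (at t))"
    by (rule ftc_locally_abs_cont[OF scale_interval.is_interval_Y[OF scale[OF n]] T_ac[OF n]]) blast
qed

definition T_deriv :: "nat \<Rightarrow> real \<Rightarrow> real" where
  "T_deriv = (SOME f. \<forall>n\<in>N. f n \<in> borel_measurable borel \<and>
    (\<forall>p q. p \<in> Y n \<longrightarrow> q \<in> Y n \<longrightarrow> p \<le> q \<longrightarrow> set_integrable lborel {p..q} (f n) \<and>
       (LBINT t:{p..q}. f n t) = T n q - T n p) \<and>
    (AE t in lborel. t \<in> Y n \<longrightarrow> (T n has_real_derivative f n t) (at t)))"

lemma T_deriv:
  assumes "n \<in> N"
  shows "T_deriv n \<in> borel_measurable borel"
    "p \<in> Y n \<Longrightarrow> q \<in> Y n \<Longrightarrow> p \<le> q \<Longrightarrow> set_integrable lborel {p..q} (T_deriv n)"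
    "p \<in> Y n \<Longrightarrow> q \<in> Y n \<Longrightarrow> p \<le> q \<Longrightarrow> (LBINT t:{p..q}. T_deriv n t) = T n q - T n p"
    "AE t in lborel. t \<in> Y n \<longrightarrow> (T n has_real_derivative T_deriv n t) (at t)"
  using someI_ex[OF ex_T_deriv, folded T_deriv_def] assms by blast+

lemma T_deriv_nonneg:
  assumes n: "n \<in> N"
  shows "AE t in lborel. t \<in> Y n \<longrightarrow> t \<in> interior (Y n) \<and> (T n has_real_derivative T_deriv n t) (at t) \<and> T_deriv n t \<ge> 0"
  using T_deriv(4)[OF n] AE_interior_interval[OF scale_interval.is_interval_Y[OF scale[OF n]]]
proof eventually_elim
  case (elim t)
  have "mono_on (Y n) (T n)"
    using scale_interval.T_le[OF scale[OF n]] by (auto simp: mono_on_def)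
  then show ?case using elim mono_on_imp_deriv_nonneg by blast
qed

text \<open>
  The truncation at 0 changes \<open>T\<^sub>n'\<close> on a null set only, and makes \<open>\<tau>\<close> nonnegative everywhere.
\<close>

definition \<tau> :: "real \<Rightarrow> real" where
  "\<tau> = glue (\<lambda>n x. max 0 (T_deriv n (s n x)))"

lemma tau_measurable [measurable]: "\<tau> \<in> borel_measurable borel"
  unfolding \<tau>_def
proof (rule glue_measurable)
  fix n assume n: "n \<in> N"
  have "s n \<in> borel_measurable (restrict_space borel (I n))"
    using scale_interval.s_measurable[OF scale[OF n]] n by (subst borel_measurable_restrict_space_iff) auto
  from measurable_compose[OF this T_deriv(1)[OF n]]
  show "(\<lambda>x. max 0 (T_deriv n (s n x))) \<in> borel_measurable (restrict_space borel (I n))" by simp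
qed

lemma tau_nonneg: "\<tau> x \<ge> 0"
  unfolding \<tau>_def by (cases "x \<in> G") (auto simp: glue_outside G_def glue_eq)

lemma tau_outside: "x \<notin> G \<Longrightarrow> \<tau> x = 0"
  unfolding \<tau>_def by (rule glue_outside)

lemma tau_T: "n \<in> N \<Longrightarrow> y \<in> Y n \<Longrightarrow> \<tau> (T n y) = max 0 (T_deriv n y)"
  unfolding \<tau>_def
  by (simp add: glue_eq scale_interval.T_in[OF scale] scale_interval.s_T[OF scale])

text \<open>
  The chain rule for \<open>\<phi> \<circ> T\<^sub>n\<close>.
\<close>

lemma D_chain:
  assumes "\<And>x. (\<phi> has_real_derivative \<phi>' x) (at x)"
  shows "AE x in \<sigma>. D \<phi> x = \<phi>' x * \<tau> x"
proof (rule AE_sigmaI)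
  fix n assume n: "n \<in> N"
  show "AE y in lborel. y \<in> Y n \<longrightarrow> D \<phi> (T n y) = \<phi>' (T n y) * \<tau> (T n y)"
    using T_deriv_nonneg[OF n]
  proof (rule eventually_mono, intro impI)
    fix y assume H: "y \<in> Y n \<longrightarrow> y \<in> interior (Y n) \<and> (T n has_real_derivative T_deriv n y) (at y) \<and> T_deriv n y \<ge> 0"
      and y: "y \<in> Y n"
    then have "(T n has_real_derivative T_deriv n y) (at y)" and nn: "T_deriv n y \<ge> 0" by auto
    then have "((\<phi> \<circ> T n) has_real_derivative \<phi>' (T n y) * T_deriv n y) (at y)"
      unfolding comp_def by (intro DERIV_chain2[OF assms])
    then show "D \<phi> (T n y) = \<phi>' (T n y) * \<tau> (T n y)"
      using D_T[OF n y] tau_T[OF n y] nn by (simp add: DERIV_imp_deriv)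
  qed
qed

lemma emeasure_tau_Icc:
  assumes n: "n \<in> N" and uv: "u \<in> I n" "v \<in> I n" "u \<le> v"
  shows "emeasure (density \<sigma> \<tau>) {u..v} = ennreal (v - u)"
proof -
  note S = scale[OF n]
  have Y: "s n u \<in> Y n" "s n v \<in> Y n" "s n u \<le> s n v"
    using uv scale_interval.s_in[OF S] scale_interval.s_le[OF S] by auto
  have sub: "{u..v} \<subseteq> I n" by (rule scale_interval.Icc_sub_J[OF S uv(1,2)])
  have subY: "{s n u..s n v} \<subseteq> Y n" by (rule scale_interval.Icc_sub_Y[OF S Y(1,2)])
  have "emeasure (density \<sigma> \<tau>) {u..v} = (\<integral>\<^sup>+x. ennreal (\<tau> x) * indicator {u..v} x \<partial>\<sigma>)"
    by (rule emeasure_density) auto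
  also have "\<dots> = (\<integral>\<^sup>+x. (ennreal (\<tau> x) * indicator {u..v} x) * indicator (I n) x \<partial>\<sigma>)"
    using sub by (intro nn_integral_cong) (auto simp: indicator_def)
  also have "\<dots> = (\<integral>\<^sup>+y. (ennreal (\<tau> (T n y)) * indicator {u..v} (T n y)) * indicator (Y n) y \<partial>lborel)"
    by (rule nn_integral_sigma[OF n]) measurable
  also have "\<dots> = (\<integral>\<^sup>+y. ennreal (indicator {s n u..s n v} y *\<^sub>R T_deriv n y) \<partial>lborel)"
  proof (rule nn_integral_cong_AE, rule eventually_mono[OF T_deriv_nonneg[OF n]])
    fix y assume H: "y \<in> Y n \<longrightarrow> y \<in> interior (Y n) \<and> (T n has_real_derivative T_deriv n y) (at y) \<and> T_deriv n y \<ge> 0"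
    show "ennreal (\<tau> (T n y)) * indicator {u..v} (T n y) * indicator (Y n) y = ennreal (indicator {s n u..s n v} y *\<^sub>R T_deriv n y)"
    proof (cases "y \<in> Y n")
      case True
      then show ?thesis
        using H tau_T[OF n True] scale_interval.T_Icc[OF S uv(1,2) True] by (simp add: indicator_def)
    next
      case False
      then have "y \<notin> {s n u..s n v}" using subY by blast
      then show ?thesis using False by simp
    qed
  qed
  also have "\<dots> = ennreal (LBINT y:{s n u..s n v}. T_deriv n y)"
    unfolding set_lebesgue_integral_def
  proof (rule nn_integral_eq_integral)
    show "integrable lborel (\<lambda>y. indicator {s n u..s n v} y *\<^sub>R T_deriv n y)"
      using T_deriv(2)[OF n Y] by (simp add: set_integrable_def)
    show "AE y in lborel. 0 \<le> indicator {s n u..s n v} y *\<^sub>R T_deriv n y"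
      using T_deriv_nonneg[OF n] by (rule eventually_mono) (use subY in \<open>auto simp: indicator_def\<close>)
  qed
  also have "(LBINT y:{s n u..s n v}. T_deriv n y) = v - u"
    using T_deriv(3)[OF n Y] uv scale_interval.T_s[OF S] by simp
  finally show ?thesis .
qed

text \<open>
  On a compact subinterval of \<open>I\<^sub>n\<close> both sides have the mass \<open>v - u\<close>: the left one because
  \<open>T\<^sub>n\<close> is the integral of its derivative.
\<close>

lemma density_tau: "density \<sigma> (\<lambda>x. ennreal (\<tau> x)) = density lborel (\<lambda>x. ennreal (indicator G x))" (is "?M1 = ?M2")
proof (rule measure_eqI)
  show "sets ?M1 = sets ?M2" by simp
  have M2: "emeasure ?M2 B = emeasure lborel (B \<inter> G)" if B: "B \<in> sets borel" for B
  proof -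
    have "emeasure ?M2 B = (\<integral>\<^sup>+x. ennreal (indicator G x) * indicator B x \<partial>lborel)"
      using B by (intro emeasure_density) auto
    also have "\<dots> = (\<integral>\<^sup>+x. indicator (B \<inter> G) x \<partial>lborel)"
      by (intro nn_integral_cong) (simp split: split_indicator)
    finally show ?thesis using B by simp
  qed
  fix A assume "A \<in> sets ?M1"
  then have A: "A \<in> sets borel" by simp
  have "emeasure ?M1 (- G) = (\<integral>\<^sup>+x. ennreal (\<tau> x) * indicator (- G) x \<partial>\<sigma>)"
    by (rule emeasure_density) auto
  also have "\<dots> = (\<integral>\<^sup>+x. 0 \<partial>\<sigma>)"
    by (intro nn_integral_cong) (simp add: tau_outside split: split_indicator)
  finally have G1: "emeasure ?M1 (- G) = 0" by simp
  have G2: "emeasure ?M2 (- G) = 0" by (simp add: M2)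
  have "emeasure ?M1 (A \<inter> (if n \<in> N then I n else {})) = emeasure ?M2 (A \<inter> (if n \<in> N then I n else {}))" for n
  proof (cases "n \<in> N")
    case n: True
    have ne: "I n \<noteq> {}" using eff[OF n] by (auto simp: nondeg_interval_def)
    obtain p q where pq: "\<And>k. p k \<in> I n" "\<And>k. q k \<in> I n" "\<And>k. p k \<le> q k" "decseq p" "incseq q" "I n = (\<Union>k. {p k..q k})"
      by (rule interval_exhaustion[OF scale_interval.is_interval_J[OF scale[OF n]] ne]) (rule that)
    have eq: "emeasure ?M1 (A \<inter> {p k..q k}) = emeasure ?M2 (A \<inter> {p k..q k})" for k
    proof (rule measure_eq_on_Icc)
      have sub: "{p k..q k} \<subseteq> I n" using pq(6) by blast
      show "emeasure ?M1 {u..v} = emeasure ?M2 {u..v}" if "p k \<le> u" "u \<le> v" "v \<le> q k" for u v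
      proof -
        have "{u..v} \<subseteq> I n" by (rule order_trans[OF _ sub]) (use that in auto)
        then have "u \<in> I n" "v \<in> I n" "{u..v} \<inter> G = {u..v}" using that n unfolding G_def by fastforce+
        then show ?thesis using emeasure_tau_Icc[OF n] that(2) by (simp add: M2)
      qed
      show "emeasure ?M1 {p k..q k} \<noteq> \<infinity>" using emeasure_tau_Icc[OF n pq(1-3)] by simp
    qed (use A in auto)
    have inc: "incseq (\<lambda>k. A \<inter> {p k..q k})"
    proof (rule incseq_SucI)
      fix k show "A \<inter> {p k..q k} \<subseteq> A \<inter> {p (Suc k)..q (Suc k)}"
        using decseq_SucD[OF pq(4), of k] incseq_SucD[OF pq(5), of k] by auto
    qed
    have U: "A \<inter> I n = (\<Union>k. A \<inter> {p k..q k})" using pq(6) by blast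
    have "emeasure ?M1 (A \<inter> I n) = (SUP k. emeasure ?M1 (A \<inter> {p k..q k}))"
      unfolding U using A by (intro SUP_emeasure_incseq[symmetric] inc) auto
    also have "\<dots> = (SUP k. emeasure ?M2 (A \<inter> {p k..q k}))" using eq by simp
    also have "\<dots> = emeasure ?M2 (A \<inter> I n)"
      unfolding U using A by (intro SUP_emeasure_incseq inc) auto
    finally show ?thesis using n by simp
  qed simp
  then show "emeasure ?M1 A = emeasure ?M2 A"
    using piecewise_measure_sum[OF _ G1 A] piecewise_measure_sum[OF _ G2 A] by simp
qed

lemma nn_integral_tau:
  assumes [measurable]: "f \<in> borel_measurable borel"
  shows "(\<integral>\<^sup>+x. ennreal (\<tau> x) * f x \<partial>\<sigma>) = (\<integral>\<^sup>+x. ennreal (indicator G x) * f x \<partial>lborel)"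
proof -
  have "(\<integral>\<^sup>+x. ennreal (\<tau> x) * f x \<partial>\<sigma>) = (\<integral>\<^sup>+x. f x \<partial>density \<sigma> \<tau>)"
    by (subst nn_integral_density) auto
  also have "\<dots> = (\<integral>\<^sup>+x. ennreal (indicator G x) * f x \<partial>lborel)"
    unfolding density_tau by (subst nn_integral_density) auto
  finally show ?thesis .
qed

lemma integral_tau:
  fixes f :: "real \<Rightarrow> real"
  assumes [measurable]: "f \<in> borel_measurable borel"
  shows "integrable \<sigma> (\<lambda>x. \<tau> x * f x) \<longleftrightarrow> integrable lborel (\<lambda>x. indicator G x * f x)"
    and "(\<integral>x. \<tau> x * f x \<partial>\<sigma>) = (\<integral>x. indicator G x * f x \<partial>lborel)"
proof -
  have "integrable \<sigma> (\<lambda>x. \<tau> x * f x) \<longleftrightarrow> integrable (density \<sigma> \<tau>) f"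
    by (subst integrable_density) (auto simp: tau_nonneg)
  also have "\<dots> \<longleftrightarrow> integrable lborel (\<lambda>x. indicator G x * f x)"
    unfolding density_tau by (subst integrable_density) auto
  finally show "integrable \<sigma> (\<lambda>x. \<tau> x * f x) \<longleftrightarrow> integrable lborel (\<lambda>x. indicator G x * f x)" .
  have "(\<integral>x. \<tau> x * f x \<partial>\<sigma>) = (\<integral>x. f x \<partial>density \<sigma> \<tau>)"
    by (subst integral_density) (auto simp: tau_nonneg)
  also have "\<dots> = (\<integral>x. indicator G x * f x \<partial>lborel)"
    unfolding density_tau by (subst integral_density) auto
  finally show "(\<integral>x. \<tau> x * f x \<partial>\<sigma>) = (\<integral>x. indicator G x * f x \<partial>lborel)" .
qed

end

section \<open>Restricting functions to the effective intervals\<close>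

text \<open>
  Where two continuous functions differ, they differ on a nonempty open set, which has positive
  measure.
\<close>

lemma continuous_AE_eq_on_interval:
  fixes v w :: "real \<Rightarrow> real"
  assumes m: "sets m = sets borel" "fully_supported m" and J: "nondeg_interval J"
    and cont: "continuous_on J v" "continuous_on J w" and ae: "AE x in m. v x = w x" and x: "x \<in> J"
  shows "v x = w x"
proof -
  let ?d = "\<lambda>x. v x - w x"
  have d: "continuous_on J ?d" by (intro continuous_intros cont)
  have int: "?d y = 0" if y: "y \<in> interior J" for y
  proof (rule ccontr)
    assume ne: "?d y \<noteq> 0"
    have "continuous_on (interior J) ?d" by (rule continuous_on_subset[OF d interior_subset])
    then have op: "open (?d -` (- {0}) \<inter> interior J)"
      by (rule continuous_on_open_vimage[OF open_interior, THEN iffD1, rule_format]) auto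
    define W where "W = ?d -` (- {0}) \<inter> interior J"
    have "open W" using op by (simp add: W_def)
    moreover have "W \<noteq> {}" using ne y by (auto simp: W_def)
    ultimately have pos: "emeasure m W > 0" using m(2) unfolding fully_supported_def by blast
    have "AE x in m. x \<notin> W" using ae by (rule eventually_mono) (auto simp: W_def)
    then have "W \<in> null_sets m"
      using AE_iff_null_sets[of W m] \<open>open W\<close> m(1) by simp
    then show False using pos by auto
  qed
  have "convex J" "interior J \<noteq> {}" using J by (auto simp: nondeg_interval_def is_interval_convex)
  then have "x \<in> closure (interior J)" using convex_closure_interior[of J] x closure_subset by blast
  then obtain a where a: "\<And>n. a n \<in> interior J" "a \<longlonglongrightarrow> x" unfolding closure_sequential by blast
  have aJ: "a n \<in> J" for n using a(1) interior_subset by blast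
  have "(\<lambda>n. ?d (a n)) \<longlonglongrightarrow> ?d x"
    by (rule continuous_on_tendsto_compose[OF d a(2) x]) (simp add: aJ)
  moreover have "(\<lambda>n. ?d (a n)) = (\<lambda>n. 0)" using int a(1) by auto
  ultimately have "?d x = 0" using LIMSEQ_const_iff[of 0 "?d x"] by simp
  then show ?thesis by simp
qed

lemma L2_restrict:
  assumes "u \<in> L2 m" "sets m = sets borel" "J \<in> sets borel"
  shows "u \<in> L2 (restrict_space m J)"
proof -
  have J: "J \<inter> space m \<in> sets m" using assms(2,3) sets_eq_imp_space_eq[OF assms(2)] by simp
  have "integrable m (\<lambda>x. indicator J x *\<^sub>R (u x)\<^sup>2)"
    using assms by (intro integrable_mult_indicator) (simp_all add: L2_def)
  then have "integrable (restrict_space m J) (\<lambda>x. (u x)\<^sup>2)"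
    unfolding integrable_restrict_space[OF J] .
  moreover have "u \<in> borel_measurable (restrict_space m J)"
    using assms(1) by (intro measurable_restrict_space1) (simp add: L2_def)
  ultimately show ?thesis by (simp add: L2_def)
qed

lemma left_unbounded_interval:
  assumes "is_interval J" "left_end J = -\<infinity>" "c \<in> J"
  shows "{..c} \<subseteq> J"
proof
  fix x assume x: "x \<in> {..c}"
  have "(INF x\<in>J. ereal x) < ereal x" using assms(2) by (simp add: left_end_def)
  then obtain y where "y \<in> J" "y < x" unfolding INF_less_iff by auto
  then show "x \<in> J" using mem_is_interval_1_I[OF assms(1) _ assms(3), of y x] x by simp
qed

lemma right_unbounded_interval:
  assumes "is_interval J" "right_end J = \<infinity>" "c \<in> J"
  shows "{c..} \<subseteq> J"
proof
  fix x assume x: "x \<in> {c..}"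
  have "ereal x < (SUP x\<in>J. ereal x)" using assms(2) by (simp add: right_end_def)
  then obtain y where "y \<in> J" "x < y" unfolding less_SUP_iff by auto
  then show "x \<in> J" using mem_is_interval_1_I[OF assms(1) assms(3), of y x] x by simp
qed

context scale_interval begin

lemma scale_domain_cong:
  assumes v: "v \<in> scale_domain m J s" and w: "w \<in> L2 (restrict_space m J)" and eq: "\<And>x. x \<in> J \<Longrightarrow> w x = v x"
  shows "w \<in> scale_domain m J s"
proof -
  have vm: "scale_deriv J s v \<in> borel_measurable (restrict_space borel J)"
    and vi: "integrable (stieltjes J s) (\<lambda>x. (scale_deriv J s v x)\<^sup>2)"
    using v by (auto simp: scale_domain_def L2_def borel_measurable_stieltjes)
  have wm: "scale_deriv J s w \<in> borel_measurable (restrict_space borel J)"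
    by (rule scale_deriv_cong(3)[OF eq vm])
  have "integrable (stieltjes J s) (\<lambda>x. (scale_deriv J s w x)\<^sup>2)"
  proof (rule integrable_cong_AE_imp[OF vi])
    show "(\<lambda>x. (scale_deriv J s w x)\<^sup>2) \<in> borel_measurable (stieltjes J s)"
      unfolding borel_measurable_stieltjes using wm by simp
    show "AE x in stieltjes J s. (scale_deriv J s v x)\<^sup>2 = (scale_deriv J s w x)\<^sup>2"
      using scale_deriv_cong(2)[of w v, OF eq]
      by (rule eventually_mono) simp_all
  qed
  then have "scale_deriv J s w \<in> L2 (stieltjes J s)" using wm by (simp add: L2_def borel_measurable_stieltjes)
  moreover have "scale_dominated J s w"
    using v eq unfolding scale_domain_def scale_dominated_def by auto
  moreover have "(w \<longlongrightarrow> 0) at_bot" if "left_end J = -\<infinity>" "(v \<longlongrightarrow> 0) at_bot"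
  proof -
    obtain c where c: "c \<in> J" using nondeg interior_subset unfolding nondeg_interval_def by blast
    have "eventually (\<lambda>x. v x = w x) at_bot"
      by (rule eventually_mono[OF eventually_le_at_bot[of c]])
        (use left_unbounded_interval[OF is_interval_J that(1) c] eq in auto)
    then show ?thesis using that(2) by (rule Lim_transform_eventually[rotated])
  qed
  moreover have "(w \<longlongrightarrow> 0) at_top" if "right_end J = \<infinity>" "(v \<longlongrightarrow> 0) at_top"
  proof -
    obtain c where c: "c \<in> J" using nondeg interior_subset unfolding nondeg_interval_def by blast
    have "eventually (\<lambda>x. v x = w x) at_top"
      by (rule eventually_mono[OF eventually_ge_at_top[of c]])
        (use right_unbounded_interval[OF is_interval_J that(1) c] eq in auto)
    then show ?thesis using that(2) by (rule Lim_transform_eventually[rotated])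
  qed
  ultimately show ?thesis using v w by (simp add: scale_domain_def)
qed

lemma scale_energy_cong:
  assumes "\<And>x. x \<in> J \<Longrightarrow> v x = w x" "v \<in> scale_domain m J s" "w \<in> scale_domain m J s"
  shows "scale_energy J s v v = scale_energy J s w w"
proof -
  have m: "scale_deriv J s v \<in> borel_measurable (stieltjes J s)" "scale_deriv J s w \<in> borel_measurable (stieltjes J s)"
    using assms(2,3) by (simp_all add: scale_domain_def L2_def)
  have "(\<integral>x. scale_deriv J s v x * scale_deriv J s v x \<partial>stieltjes J s) = (\<integral>x. scale_deriv J s w x * scale_deriv J s w x \<partial>stieltjes J s)"
  proof (intro integral_cong_AE borel_measurable_times m)
  show "AE x in stieltjes J s. scale_deriv J s v x * scale_deriv J s v x = scale_deriv J s w x * scale_deriv J s w x"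
    using scale_deriv_cong(2)[of v w, OF assms(1)]
    by (rule eventually_mono) simp_all
  qed
  then show ?thesis by (simp add: scale_energy_def)
qed

lemma zero_in_scale_domain: "(\<lambda>x. 0) \<in> scale_domain m J s" "scale_energy J s (\<lambda>x. 0) (\<lambda>x. 0) = 0"
proof -
  note p = scale_deriv_piecewise[of "\<lambda>x. 0" "\<lambda>x. 0" "{}" "\<lambda>x. 0", simplified]
  have m: "scale_deriv J s (\<lambda>x. 0) \<in> borel_measurable (stieltjes J s)"
    using p(1) unfolding borel_measurable_stieltjes .
  have "integrable (stieltjes J s) (\<lambda>x. (scale_deriv J s (\<lambda>x. 0) x)\<^sup>2)"
    by (rule integrable_cong_AE_imp[of _ "\<lambda>x. 0"]) (use m p(2) in \<open>auto elim: eventually_mono\<close>)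
  moreover have "scale_dominated J s (\<lambda>x. 0)"
    unfolding scale_dominated_def locally_abs_cont_on_def abs_cont_on_def
    by (intro exI[of _ "\<lambda>x. 0"]) (auto intro: exI[of _ 1])
  ultimately show "(\<lambda>x. 0) \<in> scale_domain m J s"
    using m by (auto simp: scale_domain_def L2_def)
  have "(\<integral>x. scale_deriv J s (\<lambda>x. 0) x * scale_deriv J s (\<lambda>x. 0) x \<partial>stieltjes J s) = (\<integral>x. 0 \<partial>stieltjes J s)"
    by (rule integral_cong_AE) (use m p(2) in \<open>auto elim: eventually_mono\<close>)
  then show "scale_energy J s (\<lambda>x. 0) (\<lambda>x. 0) = 0" by (simp add: scale_energy_def)
qed

end

lemma lipschitz_imp_abs_cont_on:
  assumes "\<And>x y. \<bar>g y - g x\<bar> \<le> C * \<bar>y - x\<bar>" "C > 0"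
  shows "abs_cont_on S (g :: real \<Rightarrow> real)"
proof (rule abs_cont_onI)
  fix e :: real assume e: "e > 0"
  have "ac_modulus S g e (e / C)"
  proof (rule ac_modulusI)
    show "e / C > 0" using e assms(2) by simp
    fix A assume A: "subintervals S A" "(\<Sum>(x, y)\<in>A. y - x) < e / C"
    have "(\<Sum>(x, y)\<in>A. \<bar>g y - g x\<bar>) \<le> (\<Sum>(x, y)\<in>A. C * (y - x))"
    proof (rule sum_mono)
      fix p assume "p \<in> A"
      then have "fst p < snd p" using A(1) by (cases p) (auto simp: subintervals_def)
      then show "(case p of (x, y) \<Rightarrow> \<bar>g y - g x\<bar>) \<le> (case p of (x, y) \<Rightarrow> C * (y - x))"
        using assms(1)[of "snd p" "fst p"] by (simp add: case_prod_beta)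
    qed
    also have "\<dots> = C * (\<Sum>(x, y)\<in>A. y - x)" by (simp add: sum_distrib_left case_prod_beta)
    also have "\<dots> < C * (e / C)" using A(2) assms(2) by (rule mult_strict_left_mono)
    also have "\<dots> = e" using assms(2) by simp
    finally show "(\<Sum>(x, y)\<in>A. \<bar>g y - g x\<bar>) < e" .
  qed
  then show "\<exists>d. ac_modulus S g e d" ..
qed

lemma abs_cont_on_cong:
  assumes "\<And>x. x \<in> S \<Longrightarrow> f x = g x" "abs_cont_on S f"
  shows "abs_cont_on S g"
proof (rule abs_cont_onI)
  fix e :: real assume e: "e > 0"
  obtain d where d: "ac_modulus S f e d" using abs_cont_onD[OF assms(2) e] ..
  have "ac_modulus S g e d"
  proof (rule ac_modulusI[OF ac_modulusD(1)[OF d]])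
    fix A assume A: "subintervals S A" "(\<Sum>(x, y)\<in>A. y - x) < d"
    have "(\<Sum>(x, y)\<in>A. \<bar>g y - g x\<bar>) = (\<Sum>(x, y)\<in>A. \<bar>f y - f x\<bar>)"
    proof (rule sum.cong[OF refl])
      fix p assume p: "p \<in> A"
      obtain x y where xy: "p = (x, y)" by (cases p)
      have "x < y" "{x..y} \<subseteq> S" using p A(1) xy unfolding subintervals_def by auto
      then have "x \<in> S" "y \<in> S" by auto
      then show "(case p of (x, y) \<Rightarrow> \<bar>g y - g x\<bar>) = (case p of (x, y) \<Rightarrow> \<bar>f y - f x\<bar>)"
        using assms(1) xy by simp
    qed
    then show "(\<Sum>(x, y)\<in>A. \<bar>g y - g x\<bar>) < e" using ac_modulusD(2)[OF d A] by simp
  qed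
  then show "\<exists>d. ac_modulus S g e d" ..
qed

context effective_family begin

text \<open>
  Countable additivity over the disjoint intervals turns a sum of energies into one integral.
\<close>

lemma infsum_sigma:
  fixes h :: "real \<Rightarrow> real"
  assumes h: "integrable \<sigma> h"
  shows "(\<Sum>\<^sub>\<infinity>n\<in>N. \<integral>x. indicator (I n) x * h x \<partial>\<sigma>) = (\<integral>x. h x \<partial>\<sigma>)"
proof -
  define I' where "I' n = (if n \<in> N then I n else {})" for n
  have I': "I' n \<in> sets \<sigma>" "\<And>k. k \<noteq> n \<Longrightarrow> I' n \<inter> I' k = {}" for n
    using I_disj by (auto simp: I'_def)
  have U: "(\<Union>n. I' n) = G" by (auto simp: I'_def G_def split: if_splits)
  define a where "a n = (\<integral>x. indicator (I' n) x * h x \<partial>\<sigma>)" for n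
  have int: "integrable \<sigma> (\<lambda>x. indicator A x * h x)" if "A \<in> sets \<sigma>" for A
    using integrable_mult_indicator[OF that h] by simp
  have "(\<integral>x. h x \<partial>\<sigma>) = (\<integral>x. indicator G x * h x \<partial>\<sigma>)"
  proof (rule integral_cong_AE)
    have "AE x in \<sigma>. x \<in> G" using AE_not_in[OF null_compl_G] by simp
    then show "AE x in \<sigma>. h x = indicator G x * h x" by (rule eventually_mono) simp
  qed (use h in auto)
  also have "\<dots> = (\<Sum>n. a n)"
    using lebesgue_integral_countable_add[of I' \<sigma> h] I' int[of G] U
    by (simp add: a_def set_lebesgue_integral_def set_integrable_def)
  finally have eq: "(\<integral>x. h x \<partial>\<sigma>) = (\<Sum>n. a n)" .
  have summ: "summable (\<lambda>n. norm (a n))"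
  proof (rule summableI_nonneg_bounded)
    fix k
    have "(\<Sum>n<k. norm (a n)) \<le> (\<Sum>n<k. \<integral>x. indicator (I' n) x * \<bar>h x\<bar> \<partial>\<sigma>)"
    proof (rule sum_mono)
      fix n
      have "norm (a n) \<le> (\<integral>x. norm (indicator (I' n) x * h x) \<partial>\<sigma>)"
        unfolding a_def by (rule integral_norm_bound)
      then show "norm (a n) \<le> (\<integral>x. indicator (I' n) x * \<bar>h x\<bar> \<partial>\<sigma>)" by (simp add: abs_mult)
    qed
    also have "\<dots> = (\<integral>x. (\<Sum>n<k. indicator (I' n) x * \<bar>h x\<bar>) \<partial>\<sigma>)"
    proof (rule Bochner_Integration.integral_sum[symmetric])
      fix n
      have "integrable \<sigma> (\<lambda>x. indicator (I' n) x *\<^sub>R \<bar>h x\<bar>)"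
        using I'(1) h by (intro integrable_mult_indicator) auto
      then show "integrable \<sigma> (\<lambda>x. indicator (I' n) x * \<bar>h x\<bar>)" by simp
    qed
    also have "\<dots> \<le> (\<integral>x. \<bar>h x\<bar> \<partial>\<sigma>)"
    proof (rule integral_mono')
      show "integrable \<sigma> (\<lambda>x. \<bar>h x\<bar>)" using h by simp
      fix x
      have "(\<Sum>n<k. indicator (I' n) x) = (indicator (\<Union>n<k. I' n) x :: real)"
        using I'(2) by (intro indicator_UN_disjoint[symmetric]) (auto simp: disjoint_family_on_def)
      then have "(\<Sum>n<k. indicator (I' n) x * \<bar>h x\<bar>) = indicator (\<Union>n<k. I' n) x * \<bar>h x\<bar>"
        by (simp add: sum_distrib_right[symmetric])
      also have "\<dots> \<le> \<bar>h x\<bar>" by (simp add: indicator_def)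
      finally show "(\<Sum>n<k. indicator (I' n) x * \<bar>h x\<bar>) \<le> \<bar>h x\<bar>" .
    qed simp
    finally show "(\<Sum>n<k. norm (a n)) \<le> (\<integral>x. \<bar>h x\<bar> \<partial>\<sigma>)" .
  qed simp
  have "(a has_sum (\<Sum>n. a n)) UNIV"
    by (rule norm_summable_imp_has_sum[OF summ summable_sums[OF summable_norm_cancel[OF summ]]])
  then have "infsum a UNIV = (\<Sum>n. a n)" by (rule infsumI)
  moreover have "infsum a UNIV = (\<Sum>\<^sub>\<infinity>n\<in>N. \<integral>x. indicator (I n) x * h x \<partial>\<sigma>)"
    by (rule infsum_cong_neutral) (auto simp: a_def I'_def)
  ultimately show ?thesis using eq by simp
qed

end

section \<open>The form as an integral with respect to the scale measure\<close>

lemma (in effective_family) AE_sigma_stieltjesI: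
  assumes "\<And>n. n \<in> N \<Longrightarrow> AE x in stieltjes (I n) (s n). P x"
  shows "AE x in \<sigma>. P x"
proof -
  have "AE x in \<sigma>. x \<in> I n \<longrightarrow> P x" if n: "n \<in> N" for n
    using assms[OF n] n unfolding restrict_sigma[OF n, symmetric] by (subst (asm) AE_restrict_space_iff) auto
  then have "AE x in \<sigma>. \<forall>n\<in>N. x \<in> I n \<longrightarrow> P x" by (subst AE_ball_countable) auto
  moreover have "AE x in \<sigma>. x \<in> G" using AE_not_in[OF null_compl_G] by simp
  ultimately show ?thesis by eventually_elim (auto simp: G_def)
qed

locale form_setting =
  fixes m :: "real measure" and E :: "(real \<Rightarrow> real) \<Rightarrow> (real \<Rightarrow> real) \<Rightarrow> real" and F :: "(real \<Rightarrow> real) set"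
    and N :: "nat set" and I :: "nat \<Rightarrow> real set" and s :: "nat \<Rightarrow> real \<Rightarrow> real" and e :: "nat \<Rightarrow> real"
  assumes radon: "radon_measure m" and supp: "fully_supported m" and dirichlet: "dirichlet_form m E F"
    and regular: "regular_form m E F" and eff_int: "effective_intervals m E F N I s e"
    and Cc_infty_F: "Cc_infty \<subseteq> F"

sublocale form_setting \<subseteq> effective_family N I s e
  using eff_int unfolding effective_intervals_def by unfold_locales auto

context form_setting begin

abbreviation version :: "(real \<Rightarrow> real) \<Rightarrow> (real \<Rightarrow> real) \<Rightarrow> bool" where
  "version \<equiv> interval_version m N I s"

lemma sets_m [simp, measurable_cong]: "sets m = sets borel" using radon by (simp add: radon_measure_def)
lemma space_m [simp]: "space m = UNIV" using sets_eq_imp_space_eq[OF sets_m] by simp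

lemma m_Icc_finite: "emeasure m {a..b} < \<infinity>" using radon by (simp add: radon_measure_def)

lemma F_eq: "F = {u \<in> L2 m. \<exists>v. version u v \<and> (\<lambda>n. scale_energy (I n) (s n) v v) summable_on N}"
  using eff_int unfolding effective_intervals_def by blast

lemma F_L2: "u \<in> F \<Longrightarrow> u \<in> L2 m" using F_eq by blast

lemma E_infsum: "u \<in> F \<Longrightarrow> w \<in> F \<Longrightarrow> version u u' \<Longrightarrow> version w w' \<Longrightarrow>
    E u w = (\<Sum>\<^sub>\<infinity>n\<in>N. scale_energy (I n) (s n) u' w')"
  using eff_int unfolding effective_intervals_def by blast

lemma versionD:
  assumes "version u v"
  shows "v \<in> L2 m" "AE x in m. v x = u x" "n \<in> N \<Longrightarrow> v \<in> scale_domain m (I n) (s n)"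
  using assms unfolding interval_version_def by auto

lemma version_interval:
  assumes v: "version u v" and n: "n \<in> N"
  shows "scale_dominated (I n) (s n) v" "continuous_on (I n) v"
    "scale_deriv (I n) (s n) v \<in> borel_measurable (restrict_space borel (I n))"
    "integrable (stieltjes (I n) (s n)) (\<lambda>x. (scale_deriv (I n) (s n) v x)\<^sup>2)"
proof -
  show 1: "scale_dominated (I n) (s n) v" "scale_deriv (I n) (s n) v \<in> borel_measurable (restrict_space borel (I n))"
    "integrable (stieltjes (I n) (s n)) (\<lambda>x. (scale_deriv (I n) (s n) v x)\<^sup>2)"
    using versionD(3)[OF v n] by (simp_all add: scale_domain_def L2_def scale_interval.borel_measurable_stieltjes[OF scale[OF n]])
  show "continuous_on (I n) v" by (rule scale_interval.scale_dominated_continuous[OF scale[OF n] 1(1)])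
qed

text \<open>
  Versions are continuous on every interval and \<open>m\<close> has full support, so it does not matter which
  version is used to compute energies.
\<close>

lemma version_unique:
  assumes "version u v" "version u v'" "n \<in> N" "x \<in> I n"
  shows "v x = v' x"
proof (rule continuous_AE_eq_on_interval[OF sets_m supp _ _ _ _ assms(4)])
  show "nondeg_interval (I n)" using eff[OF assms(3)] by blast
  show "continuous_on (I n) v" "continuous_on (I n) v'" using version_interval(2) assms by blast+
  show "AE x in m. v x = v' x" using versionD(2)[OF assms(1)] versionD(2)[OF assms(2)] by eventually_elim simp
qed

text \<open>
  A continuous member of \<open>F\<close> is its own version, for it is continuous on every \<open>I\<^sub>n\<close> and therefore agrees with any other
  version there.
\<close>

lemma version_self:
  assumes u: "u \<in> F" "continuous_on UNIV u"
  shows "version u u"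
proof -
  obtain v where v: "version u v" using u(1) F_eq by blast
  have uL: "u \<in> L2 m" using u(1) F_L2 by blast
  have "u \<in> scale_domain m (I n) (s n)" if n: "n \<in> N" for n
  proof (rule scale_interval.scale_domain_cong[OF scale[OF n] versionD(3)[OF v n]])
    show "u \<in> L2 (restrict_space m (I n))" using L2_restrict[OF uL sets_m] n by simp
    fix x assume x: "x \<in> I n"
    show "u x = v x"
    proof (rule continuous_AE_eq_on_interval[OF sets_m supp _ _ _ _ x])
      show "nondeg_interval (I n)" using eff[OF n] by blast
      show "continuous_on (I n) u" using u(2) by (rule continuous_on_subset) simp
      show "continuous_on (I n) v" using version_interval(2)[OF v n] .
      show "AE x in m. u x = v x" using versionD(2)[OF v] by eventually_elim simp
    qed
  qed
  then show ?thesis using uL by (simp add: interval_version_def)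
qed

lemma D_measurable: "version u v \<Longrightarrow> D v \<in> borel_measurable borel"
  unfolding D_def by (rule glue_measurable) (rule version_interval(3))

lemma scale_energy_sigma:
  assumes n: "n \<in> N"
  shows "scale_energy (I n) (s n) v w = 1 / 2 * (\<integral>x. indicator (I n) x * (D v x * D w x) \<partial>\<sigma>)"
proof -
  have I: "I n \<inter> space \<sigma> \<in> sets \<sigma>" using n by simp
  have "(\<integral>x. scale_deriv (I n) (s n) v x * scale_deriv (I n) (s n) w x \<partial>restrict_space \<sigma> (I n))
      = (\<integral>x. indicator (I n) x * (D v x * D w x) \<partial>\<sigma>)"
    unfolding integral_restrict_space[OF I]
    by (rule Bochner_Integration.integral_cong) (simp_all add: D_eq[OF n] split: split_indicator)
  then show ?thesis by (simp add: scale_energy_def restrict_sigma[OF n])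
qed

lemma D_square_integrable:
  assumes u: "u \<in> F" and v: "version u v"
  shows "integrable \<sigma> (\<lambda>x. (D v x)\<^sup>2)"
proof -
  obtain v0 where v0: "version u v0" "(\<lambda>n. scale_energy (I n) (s n) v0 v0) summable_on N"
    using u F_eq by blast
  have eq: "scale_energy (I n) (s n) v v = scale_energy (I n) (s n) v0 v0" if n: "n \<in> N" for n
    by (rule scale_interval.scale_energy_cong[OF scale[OF n] version_unique[OF v v0(1) n] versionD(3)[OF v n] versionD(3)[OF v0(1) n]])
  define a where "a n = (if n \<in> N then 2 * scale_energy (I n) (s n) v v else 0)" for n
  have energy: "scale_energy (I n) (s n) v v = 1 / 2 * (\<integral>x. (scale_deriv (I n) (s n) v x)\<^sup>2 \<partial>stieltjes (I n) (s n))" for n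
    by (simp add: scale_energy_def power2_eq_square)
  have a_nonneg: "a n \<ge> 0" for n by (simp add: a_def energy)
  have "(\<lambda>n. 2 * scale_energy (I n) (s n) v0 v0) summable_on N" using v0(2) by (rule summable_on_cmult_right)
  then have "a summable_on UNIV"
    by (rule summable_on_cong_neutral[THEN iffD1, rotated -1]) (auto simp: a_def eq)
  then have a_sum: "summable a" by (rule summable_on_imp_summable)
  have "(\<integral>\<^sup>+x. ennreal ((D v x)\<^sup>2) \<partial>\<sigma>) = (\<Sum>n. \<integral>\<^sup>+x. ennreal ((D v x)\<^sup>2) * indicator (if n \<in> N then I n else {}) x \<partial>\<sigma>)"
    using D_measurable[OF v] by (intro nn_integral_sigma_sum) simp
  also have "\<dots> = (\<Sum>n. ennreal (a n))"
  proof (rule suminf_cong)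
    fix n
    show "(\<integral>\<^sup>+x. ennreal ((D v x)\<^sup>2) * indicator (if n \<in> N then I n else {}) x \<partial>\<sigma>) = ennreal (a n)"
    proof (cases "n \<in> N")
      case n: True
      have "(\<integral>\<^sup>+x. ennreal ((D v x)\<^sup>2) * indicator (I n) x \<partial>\<sigma>) = (\<integral>\<^sup>+x. ennreal ((D v x)\<^sup>2) \<partial>restrict_space \<sigma> (I n))"
        using n by (subst nn_integral_restrict_space) auto
      also have "\<dots> = (\<integral>\<^sup>+x. ennreal ((scale_deriv (I n) (s n) v x)\<^sup>2) \<partial>stieltjes (I n) (s n))"
        unfolding restrict_sigma[OF n]
        by (rule nn_integral_cong) (simp add: scale_interval.space_stieltjes[OF scale[OF n]] D_eq[OF n])
      also have "\<dots> = ennreal (\<integral>x. (scale_deriv (I n) (s n) v x)\<^sup>2 \<partial>stieltjes (I n) (s n))"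
        by (rule nn_integral_eq_integral[OF version_interval(4)[OF v n]]) simp
      finally show ?thesis using n by (simp add: a_def energy)
    qed (simp add: a_def)
  qed
  also have "\<dots> = ennreal (\<Sum>n. a n)" by (rule suminf_ennreal2[OF a_nonneg a_sum])
  finally show ?thesis using D_measurable[OF v] by (intro integrableI_bounded) auto
qed

lemma D_product_integrable:
  assumes "u \<in> F" "version u v" "w \<in> F" "version w w'"
  shows "integrable \<sigma> (\<lambda>x. D v x * D w' x)"
proof (rule Bochner_Integration.integrable_bound)
  show "integrable \<sigma> (\<lambda>x. (D v x)\<^sup>2 + (D w' x)\<^sup>2)" using D_square_integrable assms by simp
  show "(\<lambda>x. D v x * D w' x) \<in> borel_measurable \<sigma>" using D_measurable assms by simp
  have "\<bar>a * b\<bar> \<le> a\<^sup>2 + b\<^sup>2" for a b :: real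
  proof -
    have "2 * (\<bar>a\<bar> * \<bar>b\<bar>) \<le> a\<^sup>2 + b\<^sup>2" using sum_squares_bound[of "\<bar>a\<bar>" "\<bar>b\<bar>"] by simp
    moreover have "0 \<le> \<bar>a\<bar> * \<bar>b\<bar>" by simp
    ultimately show ?thesis unfolding abs_mult by linarith
  qed
  then show "AE x in \<sigma>. norm (D v x * D w' x) \<le> norm ((D v x)\<^sup>2 + (D w' x)\<^sup>2)" by simp
qed

lemma E_eq:
  assumes "u \<in> F" "version u v" "w \<in> F" "version w w'"
  shows "E u w = 1 / 2 * (\<integral>x. D v x * D w' x \<partial>\<sigma>)"
proof -
  have "E u w = (\<Sum>\<^sub>\<infinity>n\<in>N. scale_energy (I n) (s n) v w')" using E_infsum assms by blast
  also have "\<dots> = (\<Sum>\<^sub>\<infinity>n\<in>N. \<integral>x. indicator (I n) x * (1 / 2 * (D v x * D w' x)) \<partial>\<sigma>)"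
  proof (rule infsum_cong)
    fix n assume "n \<in> N"
    have "(\<integral>x. indicator (I n) x * (1 / 2 * (D v x * D w' x)) \<partial>\<sigma>) = (\<integral>x. 1 / 2 * (indicator (I n) x * (D v x * D w' x)) \<partial>\<sigma>)"
      by (simp add: algebra_simps)
    then show "scale_energy (I n) (s n) v w' = (\<integral>x. indicator (I n) x * (1 / 2 * (D v x * D w' x)) \<partial>\<sigma>)"
      by (simp only: scale_energy_sigma[OF \<open>n \<in> N\<close>] integral_mult_right_zero)
  qed
  also have "\<dots> = (\<integral>x. 1 / 2 * (D v x * D w' x) \<partial>\<sigma>)"
    by (rule infsum_sigma) (use D_product_integrable[OF assms] in simp)
  finally show ?thesis by simp
qed

lemma F_diff:
  assumes "u \<in> F" "w \<in> F"
  shows "(\<lambda>x. u x - w x) \<in> F"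
    and "E (\<lambda>x. u x - w x) (\<lambda>x. u x - w x) = E u u - 2 * E u w + E w w"
proof -
  have add: "\<forall>u\<in>F. \<forall>v\<in>F. (\<lambda>x. u x + v x) \<in> F"
    using dirichlet unfolding dirichlet_form_def by (elim conjE) assumption
  have cm: "\<forall>c. \<forall>u\<in>F. (\<lambda>x. c * u x) \<in> F"
    using dirichlet unfolding dirichlet_form_def by (elim conjE) assumption
  have sym: "\<forall>u\<in>F. \<forall>v\<in>F. E u v = E v u"
    using dirichlet unfolding dirichlet_form_def by (elim conjE) assumption
  have Eadd: "\<forall>u\<in>F. \<forall>v\<in>F. \<forall>w\<in>F. E (\<lambda>x. u x + v x) w = E u w + E v w"
    using dirichlet unfolding dirichlet_form_def by (elim conjE) assumption
  have Ecm: "\<forall>c. \<forall>u\<in>F. \<forall>v\<in>F. E (\<lambda>x. c * u x) v = c * E u v"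
    using dirichlet unfolding dirichlet_form_def by (elim conjE) assumption
  let ?w = "\<lambda>x. (-1) * w x"
  have w: "?w \<in> F" using cm assms(2) by blast
  have eq: "(\<lambda>x. u x - w x) = (\<lambda>x. u x + ?w x)" by simp
  show F: "(\<lambda>x. u x - w x) \<in> F" unfolding eq by (rule add[rule_format, OF assms(1) w])
  have "E (\<lambda>x. u x - w x) z = E u z - E w z" if "z \<in> F" for z
  proof -
    have "E (\<lambda>x. u x + ?w x) z = E u z + E ?w z" by (rule Eadd[rule_format, OF assms(1) w that])
    moreover have "E ?w z = (-1) * E w z" by (rule Ecm[rule_format, OF assms(2) that])
    ultimately show ?thesis unfolding eq by simp
  qed
  note diff = this
  have "E (\<lambda>x. u x - w x) (\<lambda>x. u x - w x) = E (\<lambda>x. u x - w x) u - E (\<lambda>x. u x - w x) w"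
    using diff[OF F] sym[rule_format, OF F assms(1)] sym[rule_format, OF F assms(2)] by simp
  also have "\<dots> = (E u u - E w u) - (E u w - E w w)" using diff[OF assms(1)] diff[OF assms(2)] by simp
  also have "E w u = E u w" by (rule sym[rule_format, OF assms(2,1)])
  finally show "E (\<lambda>x. u x - w x) (\<lambda>x. u x - w x) = E u u - 2 * E u w + E w w"
    by simp
qed

lemma E_diff:
  assumes u: "u \<in> F" "version u v" and w: "w \<in> F" "version w w'"
  shows "E (\<lambda>x. u x - w x) (\<lambda>x. u x - w x) = 1 / 2 * (\<integral>x. (D v x - D w' x)\<^sup>2 \<partial>\<sigma>)"
    and "integrable \<sigma> (\<lambda>x. (D v x - D w' x)\<^sup>2)"
proof -
  have eq: "(D v x - D w' x)\<^sup>2 = (D v x)\<^sup>2 - 2 * (D v x * D w' x) + (D w' x)\<^sup>2" for x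
    by (simp add: power2_diff algebra_simps)
  note int = D_square_integrable[OF u] D_square_integrable[OF w] D_product_integrable[OF u w]
  show "integrable \<sigma> (\<lambda>x. (D v x - D w' x)\<^sup>2)" unfolding eq using int by simp
  show "E (\<lambda>x. u x - w x) (\<lambda>x. u x - w x) = 1 / 2 * (\<integral>x. (D v x - D w' x)\<^sup>2 \<partial>\<sigma>)"
    unfolding eq F_diff(2)[OF u(1) w(1)] E_eq[OF u u] E_eq[OF u w] E_eq[OF w w]
    using int by (simp add: power2_eq_square)
qed

lemma E1_norm_diff_less:
  assumes u: "u \<in> F" "version u v" and w: "w \<in> F" "version w w'" and less: "E1_norm m E (\<lambda>x. u x - w x) < \<epsilon>"
  shows "(\<integral>x. (D v x - D w' x)\<^sup>2 \<partial>\<sigma>) < 2 * \<epsilon>\<^sup>2" and "(\<integral>x. (u x - w x)\<^sup>2 \<partial>m) < \<epsilon>\<^sup>2"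
proof -
  let ?A = "\<integral>x. (D v x - D w' x)\<^sup>2 \<partial>\<sigma>" and ?B = "\<integral>x. (u x - w x)\<^sup>2 \<partial>m"
  have nn: "?A \<ge> 0" "?B \<ge> 0" by simp_all
  have sq: "sqrt (1 / 2 * ?A + ?B) < \<epsilon>" using less unfolding E1_norm_def E_diff(1)[OF u w] .
  moreover have "0 \<le> sqrt (1 / 2 * ?A + ?B)" using nn by simp
  ultimately have "(sqrt (1 / 2 * ?A + ?B))\<^sup>2 < \<epsilon>\<^sup>2" by (intro power_strict_mono) auto
  moreover have "(sqrt (1 / 2 * ?A + ?B))\<^sup>2 = 1 / 2 * ?A + ?B" using nn by (intro real_sqrt_pow2) simp
  ultimately have "1 / 2 * ?A + ?B < \<epsilon>\<^sup>2" by simp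
  then show "?A < 2 * \<epsilon>\<^sup>2" "?B < \<epsilon>\<^sup>2" using nn by linarith+
qed

lemma Cc_infty_version: "\<phi> \<in> Cc_infty \<Longrightarrow> \<phi> \<in> F \<and> version \<phi> \<phi>"
proof -
  assume \<phi>: "\<phi> \<in> Cc_infty"
  then have "\<phi> \<in> F" "smooth \<phi>" using Cc_infty_F Cc_infty_iff by blast+
  then show ?thesis using version_self smooth_continuous by blast
qed

lemma ex_local_identity:
  obtains \<phi> where "\<phi> \<in> Cc_infty" "\<And>x. - R \<le> x \<Longrightarrow> x \<le> R \<Longrightarrow> \<phi> x = x"
proof -
  obtain u where u: "smooth u" "\<And>x. 0 \<le> u x" "\<And>x. u x \<le> 1" "\<And>x. - R \<le> x \<Longrightarrow> x \<le> R \<Longrightarrow> u x = 1"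
    "\<And>x. x \<le> - R - 1 \<or> x \<ge> R + 1 \<Longrightarrow> u x = 0"
    by (rule ex_smooth_plateau[OF zero_less_one]) (rule that)
  have "(\<lambda>x. u x * x) \<in> Cc_infty" unfolding Cc_infty_iff
  proof (intro conjI exI[of _ "R + 1"] allI impI smooth_mult u(1) smooth_ident)
    fix x assume "R + 1 < \<bar>x\<bar>"
    then show "u x * x = 0" using u(5)[of x] by (cases "x \<ge> 0") auto
  qed
  then show thesis by (rule that) (simp add: u(4))
qed

text \<open>
  A test function that agrees with the identity on \<open>[-R, R]\<close> lies in \<open>F\<close>, so it is absolutely continuous
  as a function of \<open>s\<^sub>n\<close>; this function is \<open>T\<^sub>n\<close> as long as its values stay in \<open>[-R, R]\<close>.
\<close>

lemma T_loc_ac: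
  assumes n: "n \<in> N"
  shows "locally_abs_cont_on (Y n) (T n)"
  unfolding locally_abs_cont_on_def
proof (intro ballI impI)
  note S = scale[OF n]
  fix p q assume pq: "p \<in> Y n" "q \<in> Y n" "p \<le> q"
  define R where "R = max \<bar>T n p\<bar> \<bar>T n q\<bar>"
  obtain \<phi> where \<phi>: "\<phi> \<in> Cc_infty" "\<And>x. - R \<le> x \<Longrightarrow> x \<le> R \<Longrightarrow> \<phi> x = x" by (rule ex_local_identity) (rule that)
  obtain g where g: "locally_abs_cont_on (Y n) g" "\<And>x. x \<in> I n \<Longrightarrow> \<phi> x = g (s n x)"
    using version_interval(1)[OF conjunct2[OF Cc_infty_version[OF \<phi>(1)]] n]
    unfolding scale_dominated_def scale_interval.Y_def[OF S] by blast
  have "abs_cont_on {p..q} g" using g(1) pq unfolding locally_abs_cont_on_def by blast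
  moreover have "g y = T n y" if y: "y \<in> {p..q}" for y
  proof -
    have yY: "y \<in> Y n" using scale_interval.Icc_sub_Y[OF S pq(1,2)] y by blast
    have "T n p \<le> T n y" "T n y \<le> T n q"
      using scale_interval.T_le[OF S] pq yY y by auto
    then have "\<phi> (T n y) = T n y" by (intro \<phi>(2)) (auto simp: R_def)
    then show ?thesis using g(2)[of "T n y"] scale_interval.T_in[OF S yY] scale_interval.s_T[OF S yY] by simp
  qed
  ultimately show "abs_cont_on {p..q} (T n)" by (rule abs_cont_on_cong[rotated])
qed

end

sublocale form_setting \<subseteq> effective_family_ac N I s e
  by unfold_locales (rule T_loc_ac)

context form_setting begin

lemma D_Cc_infty:
  assumes "\<phi> \<in> Cc_infty"
  shows "AE x in \<sigma>. D \<phi> x = deriv \<phi> x * \<tau> x"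
  by (rule D_chain) (use assms smooth_DERIV in \<open>auto simp: Cc_infty_iff\<close>)

text \<open>
  The same test functions have \<open>D \<phi> = \<tau>\<close> on \<open>[-R, R]\<close>, and their energy is finite.
\<close>

lemma tau_square_integrable: "integrable \<sigma> (\<lambda>x. indicator {- R..R} x * (\<tau> x)\<^sup>2)"
proof -
  obtain \<phi> where \<phi>: "\<phi> \<in> Cc_infty" "\<And>x. - (R + 1) \<le> x \<Longrightarrow> x \<le> R + 1 \<Longrightarrow> \<phi> x = x"
    by (rule ex_local_identity[of "R + 1"]) (rule that)
  have der: "deriv \<phi> x = 1" if "- R \<le> x" "x \<le> R" for x
  proof -
    have "((\<lambda>x. x) has_real_derivative 1) (at x)" by simp
    then have "(\<phi> has_real_derivative 1) (at x)"
      by (rule has_field_derivative_transform_within_open[of _ _ _ "{- (R + 1)<..<R + 1}"]) (use that \<phi>(2) in auto)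
    then show ?thesis by (rule DERIV_imp_deriv)
  qed
  have V: "\<phi> \<in> F" "version \<phi> \<phi>" using Cc_infty_version[OF \<phi>(1)] by auto
  have int: "integrable \<sigma> (\<lambda>x. indicator {- R..R} x *\<^sub>R (D \<phi> x)\<^sup>2)"
    by (intro integrable_mult_indicator D_square_integrable[OF V]) simp
  show ?thesis
  proof (rule integrable_cong_AE_imp[OF int])
    show "AE x in \<sigma>. indicator {- R..R} x *\<^sub>R (D \<phi> x)\<^sup>2 = indicator {- R..R} x * (\<tau> x)\<^sup>2"
      using D_Cc_infty[OF \<phi>(1)] by (rule eventually_mono) (auto simp: der split: split_indicator)
  qed simp
qed

text \<open>
  Functions of one scale coordinate that vanish on all other intervals and jump freely at the ends of \<open>I\<^sub>n\<close>: \<open>F\<close> does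
  not see such jumps. These are the functions that test functions will have to approximate.
\<close>

lemma piecewise_in_F:
  fixes g k :: "real \<Rightarrow> real"
  assumes n: "n \<in> N" and lip: "\<And>x y. \<bar>g y - g x\<bar> \<le> C * \<bar>y - x\<bar>" "C > 0" and bound: "\<And>y. \<bar>g y\<bar> \<le> B"
    and X: "finite X" and k: "k \<in> borel_measurable borel" "\<And>y. y \<notin> X \<Longrightarrow> (g has_real_derivative k y) (at y)"
    and k_bound: "\<And>y. \<bar>k y\<bar> \<le> K" and k_supp: "\<And>y. y \<notin> {a..b} \<Longrightarrow> k y = 0"
    and g_supp: "\<And>x. x \<in> I n \<Longrightarrow> R < \<bar>x\<bar> \<Longrightarrow> g (s n x) = 0"
  defines "u \<equiv> \<lambda>x. if x \<in> I n then g (s n x) else 0"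
  shows "u \<in> F" "version u u" "AE x in \<sigma>. D u x = (if x \<in> I n then k (s n x) else 0)"
proof -
  note S = scale[OF n]
  have u_n: "u x = g (s n x)" if "x \<in> I n" for x using that by (simp add: u_def)
  have u_0: "u x = 0" if "x \<in> I i" "i \<in> N" "i \<noteq> n" for x i
    using that I_disj[OF n] by (auto simp: u_def)
  have u_supp: "u x = 0" if "R < \<bar>x\<bar>" for x using that g_supp by (simp add: u_def)
  have "continuous_on UNIV g"
    by (rule abs_cont_on_imp_continuous_on[OF lipschitz_imp_abs_cont_on[OF lip]]) simp
  then have gm: "g \<in> borel_measurable borel" by (rule borel_measurable_continuous_onI)
  have um: "u \<in> borel_measurable borel"
  proof -
    note [measurable] = gm scale_interval.s_measurable[OF S] I_borel[OF n]
    have "(\<lambda>x. indicator (I n) x * g (indicator (I n) x * s n x)) \<in> borel_measurable borel" by measurable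
    also have "(\<lambda>x. indicator (I n) x * g (indicator (I n) x * s n x)) = u" by (auto simp: u_def split: split_indicator)
    finally show ?thesis .
  qed
  have uL: "u \<in> L2 m" unfolding L2_def
  proof (intro CollectI conjI)
    show "u \<in> borel_measurable m" using um by (simp cong: measurable_cong_sets)
    have "integrable m (\<lambda>x. indicator {- R..R} x * B\<^sup>2)"
      using m_Icc_finite[of "- R" R] by (intro integrable_mult_left) (auto simp: integrable_indicator_iff)
    then show "integrable m (\<lambda>x. (u x)\<^sup>2)"
    proof (rule Bochner_Integration.integrable_bound)
      show "(\<lambda>x. (u x)\<^sup>2) \<in> borel_measurable m" using um by (simp cong: measurable_cong_sets)
      have "(u x)\<^sup>2 \<le> indicator {- R..R} x * B\<^sup>2" for x
      proof (cases "R < \<bar>x\<bar>")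
        case True
        then show ?thesis using u_supp by simp
      next
        case False
        have "\<bar>u x\<bar> \<le> \<bar>B\<bar>" using bound[of "s n x"] bound[of 0] by (auto simp: u_def)
        then have "(u x)\<^sup>2 \<le> B\<^sup>2" by (simp only: abs_le_square_iff)
        then show ?thesis using False by (auto simp: indicator_def abs_le_iff)
      qed
      then show "AE x in m. norm ((u x)\<^sup>2) \<le> norm (indicator {- R..R} x * B\<^sup>2)"
        by (simp add: abs_mult)
    qed
  qed
  have p: "scale_deriv (I n) (s n) u \<in> borel_measurable (restrict_space borel (I n))"
    "AE x in stieltjes (I n) (s n). scale_deriv (I n) (s n) u x = k (s n x)"
    by (rule scale_interval.scale_deriv_piecewise[OF S _ X k(1)], erule u_n, erule k(2))+
  have "u \<in> scale_domain m (I n) (s n)"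
    unfolding scale_domain_def
  proof (intro CollectI conjI impI)
    show "u \<in> L2 (restrict_space m (I n))" using L2_restrict[OF uL sets_m] n by simp
    show "scale_dominated (I n) (s n) u" unfolding scale_dominated_def locally_abs_cont_on_def
      using u_n by (intro exI[of _ g] conjI ballI impI lipschitz_imp_abs_cont_on[OF lip])
    have km: "(\<lambda>x. (k (s n x))\<^sup>2) \<in> borel_measurable (restrict_space borel (I n))"
    proof -
      have "s n \<in> borel_measurable (restrict_space borel (I n))"
        using scale_interval.s_measurable[OF S] n by (subst borel_measurable_restrict_space_iff) auto
      from measurable_compose[OF this k(1)] show ?thesis by simp
    qed
    have "integrable lborel (\<lambda>y. indicator (Y n) y * (k (s n (T n y)))\<^sup>2)"
    proof (rule Bochner_Integration.integrable_bound)
      show "integrable lborel (\<lambda>y. indicator {a..b} y * K\<^sup>2)"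
        by (intro integrable_mult_left) (auto simp: integrable_indicator_iff emeasure_lborel_Icc_eq)
      have eq: "(\<lambda>y. indicator (Y n) y * (k (s n (T n y)))\<^sup>2) = (\<lambda>y. indicator (Y n) y * (k y)\<^sup>2)"
        by (auto simp: scale_interval.s_T[OF S] split: split_indicator)
      show "(\<lambda>y. indicator (Y n) y * (k (s n (T n y)))\<^sup>2) \<in> borel_measurable lborel"
        unfolding eq using k(1) scale_interval.Y_borel[OF S] by measurable
      have "indicator (Y n) y * (k (s n (T n y)))\<^sup>2 \<le> indicator {a..b} y * K\<^sup>2" for y
      proof (cases "y \<in> Y n \<and> y \<in> {a..b}")
        case True
        have "\<bar>k y\<bar> \<le> \<bar>K\<bar>" using k_bound[of y] by linarith
        then have "(k y)\<^sup>2 \<le> K\<^sup>2" by (simp only: abs_le_square_iff)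
        then show ?thesis using True by (simp add: scale_interval.s_T[OF S])
      next
        case False
        then show ?thesis using k_supp[of y] by (auto simp: scale_interval.s_T[OF S] split: split_indicator)
      qed
      then show "AE y in lborel. norm (indicator (Y n) y * (k (s n (T n y)))\<^sup>2) \<le> norm (indicator {a..b} y * K\<^sup>2)"
        by (simp add: abs_mult)
    qed
    then have "integrable (stieltjes (I n) (s n)) (\<lambda>x. (k (s n x))\<^sup>2)"
      using scale_interval.integrable_stieltjes[OF S km] by simp
    then have "integrable (stieltjes (I n) (s n)) (\<lambda>x. (scale_deriv (I n) (s n) u x)\<^sup>2)"
      by (rule integrable_cong_AE_imp)
        (use p(1) p(2) in \<open>auto simp: scale_interval.borel_measurable_stieltjes[OF S] elim: eventually_mono\<close>)
    then show "scale_deriv (I n) (s n) u \<in> L2 (stieltjes (I n) (s n))"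
      using p(1) by (simp add: L2_def scale_interval.borel_measurable_stieltjes[OF S])
    have "eventually (\<lambda>x. 0 = u x) at_bot"
      using eventually_le_at_bot[of "- \<bar>R\<bar> - 1"] by (rule eventually_mono) (use u_supp in auto)
    then show "(u \<longlongrightarrow> 0) at_bot" by (rule Lim_transform_eventually[OF tendsto_const])
    have "eventually (\<lambda>x. 0 = u x) at_top"
      using eventually_ge_at_top[of "\<bar>R\<bar> + 1"] by (rule eventually_mono) (use u_supp in auto)
    then show "(u \<longlongrightarrow> 0) at_top" by (rule Lim_transform_eventually[OF tendsto_const])
  qed
  moreover have dom0: "u \<in> scale_domain m (I i) (s i)" if i: "i \<in> N" "i \<noteq> n" for i
    by (rule scale_interval.scale_domain_cong[OF scale[OF i(1)] scale_interval.zero_in_scale_domain(1)[OF scale[OF i(1)]]])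
      (use u_0 i L2_restrict[OF uL sets_m] in auto)
  ultimately show V: "version u u" using uL by (auto simp: interval_version_def)
  have "scale_energy (I i) (s i) u u = 0" if i: "i \<in> N" "i \<noteq> n" for i
    using scale_interval.scale_energy_cong[OF scale[OF i(1)] _ dom0[OF i] scale_interval.zero_in_scale_domain(1)[OF scale[OF i(1)]]]
      u_0[OF _ i] scale_interval.zero_in_scale_domain(2)[OF scale[OF i(1)]] by simp
  then have "{i \<in> N. scale_energy (I i) (s i) u u \<noteq> 0} \<subseteq> {n}" by blast
  then have "finite {i \<in> N. scale_energy (I i) (s i) u u \<noteq> 0}" by (rule finite_subset) simp
  then have "(\<lambda>i. scale_energy (I i) (s i) u u) summable_on N" by (rule finite_nonzero_values_imp_summable_on)
  then show "u \<in> F" using V uL F_eq by blast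
  show "AE x in \<sigma>. D u x = (if x \<in> I n then k (s n x) else 0)"
  proof (rule AE_sigma_stieltjesI)
    fix i assume i: "i \<in> N"
    show "AE x in stieltjes (I i) (s i). D u x = (if x \<in> I n then k (s n x) else 0)"
    proof (cases "i = n")
      case True
      show ?thesis using p(2) AE_space unfolding True
        by eventually_elim (simp add: scale_interval.space_stieltjes[OF S] D_eq[OF n])
    next
      case False
      have p0: "AE x in stieltjes (I i) (s i). scale_deriv (I i) (s i) u x = 0"
        using scale_interval.scale_deriv_piecewise(2)[OF scale[OF i], of u "\<lambda>_. 0" "{}" "\<lambda>_. 0"] u_0[OF _ i False] by simp
      show ?thesis using p0 AE_space
      proof eventually_elim
        case (elim x)
        then have "x \<in> I i" by (simp add: scale_interval.space_stieltjes[OF scale[OF i]])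
        moreover have "x \<notin> I n" using I_disj[OF i n] False calculation by blast
        ultimately show ?case using elim by (simp add: D_eq[OF i])
      qed
    qed
  qed
qed

end

section \<open>Necessity: positivity of the density and isolation\<close>

definition tent :: "real \<Rightarrow> real \<Rightarrow> real \<Rightarrow> real" where
  "tent c d z = max 0 (min (z - c) (d - z))"

definition tent_slope :: "real \<Rightarrow> real \<Rightarrow> real \<Rightarrow> real" where
  "tent_slope c d z = (if c < z \<and> z < (c + d) / 2 then 1 else if (c + d) / 2 < z \<and> z < d then - 1 else 0)"

definition ramp :: "real \<Rightarrow> real \<Rightarrow> real \<Rightarrow> real" where
  "ramp c d z = max 0 (min 1 ((z - c) / (d - c)))"

definition ramp_slope :: "real \<Rightarrow> real \<Rightarrow> real \<Rightarrow> real" where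
  "ramp_slope c d z = (if c < z \<and> z < d then 1 / (d - c) else 0)"

lemma tent_function:
  fixes c d :: real
  assumes "c < d"
  defines "g \<equiv> tent c d" and "k \<equiv> tent_slope c d"
  shows "\<bar>g y - g x\<bar> \<le> 1 * \<bar>y - x\<bar>" "\<bar>g y\<bar> \<le> d - c" "\<bar>k y\<bar> \<le> 1" "y \<notin> {c..d} \<Longrightarrow> k y = 0"
    "y \<notin> {c<..<d} \<Longrightarrow> g y = 0"
    "y \<notin> {c, (c + d) / 2, d} \<Longrightarrow> (g has_real_derivative k y) (at y)" "k \<in> borel_measurable borel"
proof -
  show "\<bar>g y - g x\<bar> \<le> 1 * \<bar>y - x\<bar>" unfolding g_def tent_def by (smt (verit))
  show "\<bar>g y\<bar> \<le> d - c" unfolding g_def tent_def using assms(1) by (smt (verit))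
  show "\<bar>k y\<bar> \<le> 1" "y \<notin> {c..d} \<Longrightarrow> k y = 0" unfolding k_def tent_slope_def using assms(1) by (auto simp: field_simps)
  show "y \<notin> {c<..<d} \<Longrightarrow> g y = 0" unfolding g_def tent_def by (auto simp: max_def min_def)
  show "k \<in> borel_measurable borel" unfolding k_def tent_slope_def[abs_def] by measurable
  assume y: "y \<notin> {c, (c + d) / 2, d}"
  let ?m = "(c + d) / 2"
  have md: "c < ?m" "?m < d" using assms(1) by (simp_all add: field_simps)
  consider "y < c" | "c < y" "y < ?m" | "?m < y" "y < d" | "d < y" using y by force
  then show "(g has_real_derivative k y) (at y)"
  proof cases
    case 1
    then have k: "k y = 0" using assms(1) md by (simp add: k_def tent_slope_def)
    have "((\<lambda>z. 0) has_real_derivative k y) (at y)" unfolding k by simp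
    then show ?thesis
      by (rule has_field_derivative_transform_within_open[of _ _ _ "{..<c}"]) (use 1 in \<open>auto simp: g_def tent_def\<close>)
  next
    case 2
    then have k: "k y = 1" by (simp add: k_def tent_slope_def)
    have "((\<lambda>z. z - c) has_real_derivative k y) (at y)" unfolding k by (auto intro!: derivative_eq_intros)
    then show ?thesis
      by (rule has_field_derivative_transform_within_open[of _ _ _ "{c<..<?m}"])
        (use 2 in \<open>auto simp: g_def tent_def max_def min_def field_simps\<close>)
  next
    case 3
    then have k: "k y = - 1" by (simp add: k_def tent_slope_def)
    have "((\<lambda>z. d - z) has_real_derivative k y) (at y)" unfolding k by (auto intro!: derivative_eq_intros)
    then show ?thesis
      by (rule has_field_derivative_transform_within_open[of _ _ _ "{?m<..<d}"])
        (use 3 in \<open>auto simp: g_def tent_def max_def min_def field_simps\<close>)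
  next
    case 4
    then have k: "k y = 0" using md by (simp add: k_def tent_slope_def)
    have "((\<lambda>z. 0) has_real_derivative k y) (at y)" unfolding k by simp
    then show ?thesis
      by (rule has_field_derivative_transform_within_open[of _ _ _ "{d<..}"]) (use 4 in \<open>auto simp: g_def tent_def\<close>)
  qed
qed

lemma ramp_function:
  fixes c d :: real
  assumes "c < d"
  defines "g \<equiv> ramp c d" and "k \<equiv> ramp_slope c d"
  shows "\<bar>g y - g x\<bar> \<le> 1 / (d - c) * \<bar>y - x\<bar>" "\<bar>g y\<bar> \<le> 1" "\<bar>k y\<bar> \<le> 1 / (d - c)" "y \<notin> {c..d} \<Longrightarrow> k y = 0"
    "y \<le> c \<Longrightarrow> g y = 0" "d \<le> y \<Longrightarrow> g y = 1" "d \<le> y \<Longrightarrow> k y = 0"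
    "y \<notin> {c, d} \<Longrightarrow> (g has_real_derivative k y) (at y)" "k \<in> borel_measurable borel"
proof -
  have clamp: "\<bar>max 0 (min 1 p) - max 0 (min 1 q)\<bar> \<le> \<bar>p - q\<bar>" for p q :: real
    by (simp add: max_def min_def abs_if)
  have "\<bar>g y - g x\<bar> \<le> \<bar>(y - c) / (d - c) - (x - c) / (d - c)\<bar>" unfolding g_def ramp_def by (rule clamp)
  also have "(y - c) / (d - c) - (x - c) / (d - c) = (y - x) / (d - c)" by (simp add: diff_divide_distrib)
  also have "\<bar>(y - x) / (d - c)\<bar> = 1 / (d - c) * \<bar>y - x\<bar>" using assms(1) by simp
  finally show "\<bar>g y - g x\<bar> \<le> 1 / (d - c) * \<bar>y - x\<bar>" .
  show "\<bar>g y\<bar> \<le> 1" unfolding g_def ramp_def by (simp add: max_def min_def)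
  show "\<bar>k y\<bar> \<le> 1 / (d - c)" "y \<notin> {c..d} \<Longrightarrow> k y = 0" "d \<le> y \<Longrightarrow> k y = 0" unfolding k_def ramp_slope_def using assms(1) by auto
  have g0: "g z = 0" if "z \<le> c" for z
  proof -
    have "(z - c) / (d - c) \<le> 0" using that assms(1) by (intro divide_nonpos_pos) auto
    then show ?thesis by (simp add: g_def ramp_def)
  qed
  have g1: "g z = 1" if "d \<le> z" for z
  proof -
    have "1 \<le> (z - c) / (d - c)" using that assms(1) by simp
    then show ?thesis by (simp add: g_def ramp_def)
  qed
  have gm: "g z = (z - c) / (d - c)" if "c < z" "z < d" for z
  proof -
    have "(z - c) / (d - c) \<le> 1" "0 \<le> (z - c) / (d - c)" using that by simp_all
    then show ?thesis by (simp add: g_def ramp_def)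
  qed
  show "y \<le> c \<Longrightarrow> g y = 0" "d \<le> y \<Longrightarrow> g y = 1" by (rule g0 g1; assumption)+
  show "k \<in> borel_measurable borel" unfolding k_def ramp_slope_def[abs_def] by measurable
  assume y: "y \<notin> {c, d}"
  consider "y < c" | "c < y" "y < d" | "d < y" using y by force
  then show "(g has_real_derivative k y) (at y)"
  proof cases
    case 1
    then have k: "k y = 0" by (simp add: k_def ramp_slope_def)
    have "((\<lambda>z. 0) has_real_derivative k y) (at y)" unfolding k by simp
    then show ?thesis
      by (rule has_field_derivative_transform_within_open[of _ _ _ "{..<c}"])
        (use 1 g0 in auto)
  next
    case 2
    then have k: "k y = 1 / (d - c)" by (simp add: k_def ramp_slope_def)
    have "((\<lambda>z. (z - c) / (d - c)) has_real_derivative k y) (at y)" unfolding k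
      using assms(1) by (auto intro!: derivative_eq_intros)
    then show ?thesis
      by (rule has_field_derivative_transform_within_open[of _ _ _ "{c<..<d}"])
        (use 2 gm in auto)
  next
    case 3
    then have k: "k y = 0" by (simp add: k_def ramp_slope_def)
    have "((\<lambda>z. 1) has_real_derivative k y) (at y)" unfolding k by simp
    then show ?thesis
      by (rule has_field_derivative_transform_within_open[of _ _ _ "{d<..}"])
        (use 3 g1 in auto)
  qed
qed

lemma (in effective_family) AE_scale_not_in_finite:
  assumes n: "n \<in> N" and X: "finite X"
  shows "AE x in \<sigma>. x \<in> I n \<longrightarrow> s n x \<notin> X"
proof (rule AE_sigmaI)
  fix i assume i: "i \<in> N"
  have "AE y in lborel. y \<notin> X" using X by (intro AE_not_in finite_imp_null_set_lborel)
  then show "AE y in lborel. y \<in> Y i \<longrightarrow> T i y \<in> I n \<longrightarrow> s n (T i y) \<notin> X"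
  proof (rule eventually_mono, intro impI)
    fix y assume y: "y \<notin> X" "y \<in> Y i" "T i y \<in> I n"
    have "i = n" using I_disj[OF i n scale_interval.T_in[OF scale[OF i] y(2)] y(3)] .
    then show "s n (T i y) \<notin> X" using y scale_interval.s_T[OF scale[OF i] y(2)] by simp
  qed
qed

context form_setting begin

text \<open>
  Take for \<open>u\<close> a tent over \<open>[c, d] \<subseteq> Y\<^sub>n\<close>. On the part \<open>A\<close> of the corresponding interval where \<open>\<tau> = 0\<close> we have
  \<open>(D u - D \<phi>)\<^sup>2 = (D u)\<^sup>2 = 1\<close> for every test function \<open>\<phi>\<close>, so \<open>\<sigma>(A)\<close> is at most twice the energy of
  \<open>u - \<phi>\<close>, which can be made arbitrarily small.
\<close>

lemma dense_imp_tau_pos: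
  assumes dense: "E1_dense_in m E Cc_infty F"
  shows "AE x in \<sigma>. \<tau> x > 0"
proof (rule AE_sigmaI)
  fix n assume n: "n \<in> N"
  note S = scale[OF n]
  have compact_part: "AE y in lborel. y \<in> Y n \<longrightarrow> c \<le> y \<and> y \<le> d \<longrightarrow> \<tau> (T n y) > 0"
    if cd: "c \<in> Y n" "d \<in> Y n" "c < d" for c d
  proof -
    define g where "g = tent c d"
    define k where "k = tent_slope c d"
    note gk = tent_function[OF cd(3), folded g_def k_def]
    define R where "R = max \<bar>T n c\<bar> \<bar>T n d\<bar>"
    define u where "u = (\<lambda>x. if x \<in> I n then g (s n x) else 0)"
    have supp_g: "g (s n x) = 0" if x: "x \<in> I n" "R < \<bar>x\<bar>" for x
    proof (rule ccontr)
      assume "g (s n x) \<noteq> 0"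
      then have "s n x \<in> {c<..<d}" using gk(5) by blast
      then have "s n (T n c) \<le> s n x" "s n x \<le> s n (T n d)" using scale_interval.s_T[OF S] cd by auto
      then have "T n c \<le> x" "x \<le> T n d"
        using scale_interval.s_le[OF S] scale_interval.T_in[OF S] cd x(1) by blast+
      then show False using x(2) by (auto simp: R_def)
    qed
    have fin: "finite {c, (c + d) / 2, d}" by simp
    have u: "u \<in> F" "version u u" "AE x in \<sigma>. D u x = (if x \<in> I n then k (s n x) else 0)"
      unfolding u_def
      by (rule piecewise_in_F[where g = g and k = k and X = "{c, (c + d) / 2, d}" and C = 1 and B = "d - c" and K = 1
            and a = c and b = d and R = R, OF n gk(1) zero_less_one gk(2) fin gk(7) gk(6) gk(3) gk(4) supp_g], assumption+)+
    define A where "A = {T n c..T n d} \<inter> {x. \<tau> x = 0}"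
    have A: "A \<in> sets \<sigma>" unfolding A_def by measurable
    have Tcd: "T n c \<in> I n" "T n d \<in> I n" "T n c \<le> T n d"
      using scale_interval.T_in[OF S] scale_interval.T_le[OF S] cd by auto
    have finA: "emeasure \<sigma> A < \<infinity>"
    proof -
      have "emeasure \<sigma> A \<le> emeasure \<sigma> {T n c..T n d}" by (intro emeasure_mono) (auto simp: A_def)
      then show ?thesis using emeasure_sigma_Icc[OF n Tcd] by (simp add: order_le_less_trans)
    qed
    have AI: "A \<subseteq> I n" using scale_interval.Icc_sub_J[OF S Tcd(1,2)] by (auto simp: A_def)
    have small: "measure \<sigma> A \<le> 0 + r" if r: "r > 0" for r
    proof -
      \<comment> \<open>the energy carries the factor \<open>1/2\<close>, so \<open>\<integral>(D u - D \<phi>)\<^sup>2 d\<sigma> < 2 \<epsilon>\<^sup>2 = r\<close>\<close>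
      define \<epsilon> where "\<epsilon> = sqrt (r / 2)"
      have \<epsilon>: "\<epsilon> > 0" "2 * \<epsilon>\<^sup>2 = r" using r by (simp_all add: \<epsilon>_def)
      obtain \<phi> where \<phi>: "\<phi> \<in> Cc_infty" "E1_norm m E (\<lambda>x. u x - \<phi> x) < \<epsilon>"
        using dense u(1) \<epsilon>(1) unfolding E1_dense_in_def by blast
      have V: "\<phi> \<in> F" "version \<phi> \<phi>" using Cc_infty_version[OF \<phi>(1)] by auto
      have "measure \<sigma> A = (\<integral>x. indicator A x \<partial>\<sigma>)" by simp
      also have "\<dots> \<le> (\<integral>x. (D u x - D \<phi> x)\<^sup>2 \<partial>\<sigma>)"
      proof (rule integral_mono_AE)
        show "integrable \<sigma> (indicator A :: real \<Rightarrow> real)" using A finA by (simp add: integrable_indicator_iff)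
        show "integrable \<sigma> (\<lambda>x. (D u x - D \<phi> x)\<^sup>2)" by (rule E_diff(2)[OF u(1,2) V])
        show "AE x in \<sigma>. indicator A x \<le> (D u x - D \<phi> x)\<^sup>2"
          using u(3) D_Cc_infty[OF \<phi>(1)] AE_scale_not_in_finite[OF n fin]
        proof eventually_elim
          case (elim x)
          show ?case
          proof (cases "x \<in> A")
            case True
            then have x: "x \<in> I n" "\<tau> x = 0" using AI by (auto simp: A_def)
            have "s n (T n c) \<le> s n x" "s n x \<le> s n (T n d)"
              using True x scale_interval.s_le[OF S] Tcd by (auto simp: A_def)
            then have "c \<le> s n x" "s n x \<le> d" using scale_interval.s_T[OF S] cd by auto
            then have "k (s n x) = 1 \<or> k (s n x) = - 1"
              using elim(3) x(1) unfolding k_def tent_slope_def by (auto simp: not_less le_less)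
            then have "(D u x - D \<phi> x)\<^sup>2 = 1" using elim(1,2) x by auto
            then show ?thesis using True by simp
          qed simp
        qed
      qed
      also have "\<dots> < 2 * \<epsilon>\<^sup>2" by (rule E1_norm_diff_less(1)[OF u(1,2) V \<phi>(2)])
      finally show ?thesis using \<epsilon>(2) by simp
    qed
    have "measure \<sigma> A \<le> 0" by (rule field_le_epsilon) (rule small)
    then have "measure \<sigma> A = 0" by (simp add: order_antisym)
    then have "emeasure \<sigma> A = 0" using finA by (simp add: emeasure_eq_ennreal_measure less_top)
    then have "A \<in> null_sets \<sigma>" using A by (simp add: null_sets_def)
    from AE_sigmaD[OF AE_not_in[OF this] n]
    show ?thesis
    proof (rule eventually_mono, intro impI)
      fix y assume y: "y \<in> Y n \<longrightarrow> T n y \<notin> A" "y \<in> Y n" "c \<le> y \<and> y \<le> d"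
      have "T n c \<le> T n y" "T n y \<le> T n d" using scale_interval.T_le[OF S] y cd by auto
      then have "\<tau> (T n y) \<noteq> 0" using y by (auto simp: A_def)
      then show "\<tau> (T n y) > 0" using tau_nonneg[of "T n y"] by simp
    qed
  qed
  have ne: "Y n \<noteq> {}" using eff[OF n] interior_subset[of "I n"] scale_interval.s_in[OF S] by blast
  obtain p q where pq: "\<And>k. p k \<in> Y n" "\<And>k. q k \<in> Y n" "\<And>k. p k \<le> q k" "decseq p" "incseq q" "Y n = (\<Union>k. {p k..q k})"
    by (rule interval_exhaustion[OF scale_interval.is_interval_Y[OF S] ne]) (rule that)
  have "AE y in lborel. y \<in> Y n \<longrightarrow> p k \<le> y \<and> y \<le> q k \<longrightarrow> \<tau> (T n y) > 0" for k
  proof (cases "p k < q k")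
    case True
    then show ?thesis by (rule compact_part[OF pq(1,2)])
  next
    case False
    then show ?thesis using AE_lborel_singleton[of "p k"] pq(3)[of k] by (auto elim: eventually_mono)
  qed
  then have "AE y in lborel. \<forall>k. y \<in> Y n \<longrightarrow> p k \<le> y \<and> y \<le> q k \<longrightarrow> \<tau> (T n y) > 0"
    by (subst AE_all_countable) blast
  then show "AE y in lborel. y \<in> Y n \<longrightarrow> \<tau> (T n y) > 0"
    by (rule eventually_mono) (use pq(6) in auto)
qed

text \<open>
  For \<open>W\<close> inside a compact part of \<open>I\<^sub>n\<close>, split off the set \<open>A\<^sub>M\<close> where \<open>\<tau> \<le> 1/(M + 1)\<close>:
  since \<open>\<tau> d\<sigma> = 1\<^sub>G dx\<close>, the measure \<open>\<sigma>(W)\<close> is at most \<open>\<sigma>(A\<^sub>M) + (M + 1)|W|\<close>. The first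
  term tends to 0 as \<open>M \<rightarrow> \<infinity>\<close>, the second one is small when \<open>W\<close> is short.
\<close>

lemma tau_pos_imp_scale_ac:
  assumes pos: "AE x in \<sigma>. \<tau> x > 0" and n: "n \<in> N"
  shows "locally_abs_cont_on (I n) (s n)"
  unfolding locally_abs_cont_on_def
proof (intro ballI impI abs_cont_onI)
  note S = scale[OF n]
  fix x y e :: real assume xy: "x \<in> I n" "y \<in> I n" "x \<le> y" and e: "e > 0"
  have sub: "{x..y} \<subseteq> I n" by (rule scale_interval.Icc_sub_J[OF S xy(1,2)])
  have fin: "emeasure \<sigma> {x..y} < \<infinity>" using emeasure_sigma_Icc[OF n xy] by simp
  define A where "A M = {x..y} \<inter> {t. \<tau> t \<le> 1 / real (Suc M)}" for M
  have A: "A M \<in> sets borel" for M unfolding A_def by measurable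
  have finA: "emeasure \<sigma> (A M) \<noteq> \<infinity>" for M
  proof -
    have "emeasure \<sigma> (A M) \<le> emeasure \<sigma> {x..y}" by (intro emeasure_mono) (auto simp: A_def)
    then show ?thesis using fin by (auto simp: top_unique)
  qed
  have dec: "decseq A"
  proof (rule decseq_SucI)
    fix M
    have "1 / real (Suc (Suc M)) \<le> 1 / real (Suc M)" by (simp add: frac_le)
    then show "A (Suc M) \<subseteq> A M" by (auto simp: A_def)
  qed
  have "(\<lambda>M. emeasure \<sigma> (A M)) \<longlonglongrightarrow> emeasure \<sigma> (\<Inter>M. A M)"
    by (rule Lim_emeasure_decseq) (use A finA dec in auto)
  also have "emeasure \<sigma> (\<Inter>M. A M) = 0"
  proof -
    have Asub: "(\<Inter>M. A M) \<subseteq> {t. \<not> \<tau> t > 0}"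
    proof
      fix t assume t: "t \<in> (\<Inter>M. A M)"
      have "\<not> \<tau> t > 0"
      proof
        assume "\<tau> t > 0"
        then obtain M where "1 / real (Suc M) < \<tau> t" using nat_approx_posE by blast
        moreover have "t \<in> A M" using t by blast
        ultimately show False by (simp add: A_def)
      qed
      then show "t \<in> {t. \<not> \<tau> t > 0}" by simp
    qed
    have Z: "{t. \<not> \<tau> t > 0} \<in> null_sets \<sigma>"
      using pos by (subst (asm) AE_iff_null) auto
    have "(\<Inter>M. A M) \<in> sets \<sigma>" using A by (intro sets.countable_INT) auto
    from null_sets_subset[OF Z this Asub] show ?thesis by (rule null_setsD1)
  qed
  finally have lim: "(\<lambda>M. emeasure \<sigma> (A M)) \<longlonglongrightarrow> 0" .
  have "eventually (\<lambda>M. emeasure \<sigma> (A M) < ennreal (e / 2)) sequentially"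
    using order_tendstoD(2)[OF lim, of "ennreal (e / 2)"] e by simp
  then obtain M where M: "emeasure \<sigma> (A M) < ennreal (e / 2)" by (auto simp: eventually_sequentially)
  \<comment> \<open>so that \<open>(M + 1)|W| \<le> e/2\<close> for \<open>|W| < d\<close>\<close>
  define d where "d = e / (2 * real (Suc M))"
  have d: "d > 0" using e by (simp add: d_def)
  have small: "emeasure \<sigma> W < ennreal e" if W: "W \<in> sets borel" "W \<subseteq> {x..y}" "emeasure lborel W < ennreal d" for W
  proof -
    have "emeasure \<sigma> W \<le> emeasure \<sigma> (A M) + emeasure \<sigma> (W - A M)"
    proof -
      have "emeasure \<sigma> W \<le> emeasure \<sigma> (A M \<union> (W - A M))" using W A by (intro emeasure_mono) auto
      also have "\<dots> \<le> emeasure \<sigma> (A M) + emeasure \<sigma> (W - A M)" using W A by (intro emeasure_subadditive) auto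
      finally show ?thesis .
    qed
    also have "emeasure \<sigma> (W - A M) = (\<integral>\<^sup>+t. indicator (W - A M) t \<partial>\<sigma>)" using W A by simp
    also have "\<dots> \<le> (\<integral>\<^sup>+t. ennreal (\<tau> t) * (ennreal (real (Suc M)) * indicator W t) \<partial>\<sigma>)"
    proof (rule nn_integral_mono)
      fix t
      show "indicator (W - A M) t \<le> ennreal (\<tau> t) * (ennreal (real (Suc M)) * indicator W t)"
      proof (cases "t \<in> W - A M")
        case True
        then have "\<tau> t > 1 / real (Suc M)" using W(2) by (auto simp: A_def)
        then have "1 \<le> \<tau> t * real (Suc M)" by (simp add: field_simps)
        then have "ennreal 1 \<le> ennreal (\<tau> t) * ennreal (real (Suc M))"
          using tau_nonneg by (subst ennreal_mult[symmetric]) (auto intro: ennreal_leI)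
        then show ?thesis using True by simp
      qed simp
    qed
    also have "\<dots> = (\<integral>\<^sup>+t. ennreal (indicator G t) * (ennreal (real (Suc M)) * indicator W t) \<partial>lborel)"
      using W by (intro nn_integral_tau) auto
    also have "\<dots> \<le> (\<integral>\<^sup>+t. ennreal (real (Suc M)) * indicator W t \<partial>lborel)"
      by (intro nn_integral_mono) (simp split: split_indicator)
    also have "\<dots> = ennreal (real (Suc M)) * emeasure lborel W" using W by (intro nn_integral_cmult_indicator) simp
    also have "\<dots> \<le> ennreal (real (Suc M)) * ennreal d" using W(3) by (intro mult_left_mono) auto
    also have "\<dots> = ennreal (e / 2)"
    proof -
      have "real (Suc M) * d = e / 2" unfolding d_def by (simp del: of_nat_Suc)
      moreover have "ennreal (real (Suc M)) * ennreal d = ennreal (real (Suc M) * d)"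
        using d by (intro ennreal_mult[symmetric]) auto
      ultimately show ?thesis by (simp only:)
    qed
    finally have "emeasure \<sigma> W \<le> emeasure \<sigma> (A M) + ennreal (e / 2)" by (simp add: add_left_mono)
    also have "\<dots> < ennreal (e / 2) + ennreal (e / 2)"
      unfolding add.commute[of "emeasure \<sigma> (A M)"] ennreal_add_left_cancel_less using M by simp
    also have "\<dots> = ennreal e" using e by (subst ennreal_plus[symmetric]) auto
    finally show ?thesis .
  qed
  have "ac_modulus {x..y} (s n) e d"
  proof (rule ac_modulusI[OF d])
    fix B assume B: "subintervals {x..y} B" "(\<Sum>(u, v)\<in>B. v - u) < d"
    let ?W = "\<Union>p\<in>B. {fst p<..<snd p}"
    have finB: "finite B" and inB: "\<And>p. p \<in> B \<Longrightarrow> fst p < snd p \<and> {fst p..snd p} \<subseteq> {x..y}"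
      using B(1) unfolding subintervals_def by (auto simp: case_prod_beta)
    have "(\<lambda>(u::real, v). {u<..<v}) = (\<lambda>p. {fst p<..<snd p})" by (rule ext) (simp add: case_prod_beta)
    then have disB: "disjoint_family_on (\<lambda>p. {fst p<..<snd p}) B"
      using B(1) unfolding subintervals_def by simp
    have W: "?W \<in> sets borel" using finB by auto
    have Wsub: "?W \<subseteq> {x..y}"
    proof
      fix t assume "t \<in> ?W"
      then obtain p where p: "p \<in> B" "fst p < t" "t < snd p" by auto
      then have "t \<in> {fst p..snd p}" by simp
      then show "t \<in> {x..y}" using inB[OF p(1)] by blast
    qed
    have "emeasure lborel ?W = (\<Sum>p\<in>B. emeasure lborel {fst p<..<snd p})"
      using finB disB by (intro sum_emeasure[symmetric]) auto
    also have "\<dots> = (\<Sum>p\<in>B. ennreal (snd p - fst p))" using inB by (intro sum.cong) (auto simp: less_imp_le)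
    also have "\<dots> = ennreal (\<Sum>p\<in>B. snd p - fst p)" using inB by (intro sum_ennreal) (simp add: less_imp_le)
    also have "\<dots> < ennreal d" using B(2) d by (intro ennreal_lessI) (simp_all add: case_prod_beta)
    finally have len: "emeasure lborel ?W < ennreal d" .
    have le: "s n (fst p) \<le> s n (snd p)" "fst p \<in> I n" "snd p \<in> I n" if "p \<in> B" for p
    proof -
      show p: "fst p \<in> I n" "snd p \<in> I n" using inB[OF that] sub by auto
      show "s n (fst p) \<le> s n (snd p)" using scale_interval.s_le[OF S p] inB[OF that] by simp
    qed
    have sig: "emeasure \<sigma> {fst p<..<snd p} = ennreal (s n (snd p) - s n (fst p))" if "p \<in> B" for p
    proof -
      have "{fst p..snd p} = {fst p<..<snd p} \<union> {fst p, snd p}" using inB[OF that] by auto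
      moreover have "{fst p, snd p} \<in> null_sets \<sigma>"
        using null_sets.Un[OF null_singleton_sigma[of "fst p"] null_singleton_sigma[of "snd p"]] by (simp add: insert_is_Un[symmetric] insert_commute)
      ultimately have "emeasure \<sigma> {fst p..snd p} = emeasure \<sigma> {fst p<..<snd p}"
        using emeasure_Un_null_set[of "{fst p<..<snd p}" \<sigma> "{fst p, snd p}"] by (simp only:) simp
      then show ?thesis using emeasure_sigma_Icc[OF n le(2,3)[OF that]] inB[OF that] by simp
    qed
    have "ennreal (\<Sum>p\<in>B. s n (snd p) - s n (fst p)) = (\<Sum>p\<in>B. ennreal (s n (snd p) - s n (fst p)))"
      using le by (intro sum_ennreal[symmetric]) simp
    also have "\<dots> = (\<Sum>p\<in>B. emeasure \<sigma> {fst p<..<snd p})" using sig by (intro sum.cong) auto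
    also have "\<dots> = emeasure \<sigma> ?W" using finB disB by (intro sum_emeasure) auto
    also have "\<dots> < ennreal e" by (rule small[OF W Wsub len])
    finally have "(\<Sum>p\<in>B. s n (snd p) - s n (fst p)) < e"
      using le by (subst (asm) ennreal_less_iff) (auto intro!: sum_nonneg)
    also have "(\<Sum>p\<in>B. s n (snd p) - s n (fst p)) = (\<Sum>(u, v)\<in>B. \<bar>s n v - s n u\<bar>)"
      using le by (intro sum.cong) (auto simp: case_prod_beta)
    finally show "(\<Sum>(u, v)\<in>B. \<bar>s n v - s n u\<bar>) < e" .
  qed
  then show "\<exists>d. ac_modulus {x..y} (s n) e d" ..
qed

text \<open>
  The ordinary fundamental theorem, rewritten with \<open>D \<phi> d\<sigma> = \<phi>' \<tau> d\<sigma> = \<phi>' 1\<^sub>G dx\<close>. The length off \<open>G\<close>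
  must be 0, as increments there are not seen by \<open>\<sigma>\<close>.
\<close>

lemma ftc_Cc_infty:
  assumes \<phi>: "\<phi> \<in> Cc_infty" and xy: "x \<le> y" and null: "{x..y} - G \<in> null_sets lborel"
  shows "integrable \<sigma> (\<lambda>t. indicator {x..y} t * D \<phi> t)" "(\<integral>t. indicator {x..y} t * D \<phi> t \<partial>\<sigma>) = \<phi> y - \<phi> x"
proof -
  have sm: "smooth \<phi>" using \<phi> by (simp add: Cc_infty_iff)
  have D\<phi>: "(\<phi> has_real_derivative deriv \<phi> t) (at t)" for t by (rule smooth_DERIV[OF sm])
  have [measurable]: "deriv \<phi> \<in> borel_measurable borel" by (rule borel_measurable_continuous_onI[OF smooth_continuous[OF smooth_deriv[OF sm]]])
  have cont: "isCont (deriv \<phi>) t" for t using smooth_continuous[OF smooth_deriv[OF sm]] by (simp add: continuous_on_eq_continuous_at)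
  have has: "has_bochner_integral lborel (\<lambda>t. deriv \<phi> t * indicator {x..y} t) (\<phi> y - \<phi> x)"
    using xy D\<phi> cont by (rule has_bochner_integral_FTC_Icc_real)
  have ae: "AE t in lborel. deriv \<phi> t * indicator {x..y} t = indicator G t * (indicator {x..y} t * deriv \<phi> t)"
    using AE_not_in[OF null] by (rule eventually_mono) (auto split: split_indicator)
  have "has_bochner_integral lborel (\<lambda>t. indicator G t * (indicator {x..y} t * deriv \<phi> t)) (\<phi> y - \<phi> x)"
    by (rule has_bochner_integral_cong_AE[OF _ _ ae, THEN iffD1, OF _ _ has]) measurable
  then have int: "integrable \<sigma> (\<lambda>t. \<tau> t * (indicator {x..y} t * deriv \<phi> t))"
    "(\<integral>t. \<tau> t * (indicator {x..y} t * deriv \<phi> t) \<partial>\<sigma>) = \<phi> y - \<phi> x"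
    by (subst integral_tau; simp add: has_bochner_integral_iff)+
  have ae2: "AE t in \<sigma>. \<tau> t * (indicator {x..y} t * deriv \<phi> t) = indicator {x..y} t * D \<phi> t"
    using D_Cc_infty[OF \<phi>] by (rule eventually_mono) simp
  have m: "(\<lambda>t. indicator {x..y} t * D \<phi> t) \<in> borel_measurable \<sigma>"
    using D_measurable[OF conjunct2[OF Cc_infty_version[OF \<phi>]]] by simp
  show "integrable \<sigma> (\<lambda>t. indicator {x..y} t * D \<phi> t)" by (rule integrable_cong_AE_imp[OF int(1) m]) (use ae2 in \<open>auto elim: eventually_mono\<close>)
  show "(\<integral>t. indicator {x..y} t * D \<phi> t \<partial>\<sigma>) = \<phi> y - \<phi> x"
    using integral_cong_AE[OF _ m ae2] int by auto
qed

text \<open>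
  The function \<open>u\<close> rises from 0 to 1 on \<open>I\<^sub>i\<close> to the left of \<open>e\<^sub>i\<close>, stays 1 up to the right end of \<open>I\<^sub>i\<close>, and is 0
  elsewhere; so \<open>D u = 0\<close> on \<open>[e\<^sub>i, e\<^sub>j]\<close>. A test function close to \<open>u\<close> in \<open>L\<^sup>2(m)\<close> must drop by more than \<open>1/2\<close>
  between a point near \<open>e\<^sub>i\<close> and a point near \<open>e\<^sub>j\<close>. Its drop is at most \<open>\<integral>|D \<phi>| d\<sigma>\<close>, which Cauchy--Schwarz (in the
  form \<open>2\<epsilon>|t| \<le> t\<^sup>2 + \<epsilon>\<^sup>2\<close>) bounds by the energy distance and the finite number \<open>\<sigma>([e\<^sub>i, e\<^sub>j])\<close>.
\<close>

lemma dense_imp_not_connected: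
  assumes dense: "E1_dense_in m E Cc_infty F" and ij: "i \<in> N" "j \<in> N" "e i < e j" and conn: "scale_connected N I s e i j"
  shows False
proof -
  note S = scale[OF ij(1)]
  define a b where "a = e i" and "b = e j"
  have ab: "a < b" using ij(3) by (simp add: a_def b_def)
  have seg: "closed_segment (e i) (e j) = {a..b}" using ij(3) by (simp add: closed_segment_eq_real_ivl a_def b_def)
  have finK: "emeasure \<sigma> {a..b} < \<infinity>" using conn unfolding scale_connected_def seg by simp
  have nullK: "{a..b} - G \<in> null_sets lborel"
  proof -
    have "emeasure (lambda_l N I) {a..b} = (\<integral>\<^sup>+x. indicator (- G) x * indicator {a..b} x \<partial>lborel)"
      unfolding lambda_l_def G_def[symmetric] by (intro emeasure_density) auto
    also have "\<dots> = (\<integral>\<^sup>+x. indicator ({a..b} - G) x \<partial>lborel)" by (intro nn_integral_cong) (simp split: split_indicator)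
    also have "\<dots> = emeasure lborel ({a..b} - G)" by (intro nn_integral_indicator) auto
    finally show ?thesis using conn unfolding scale_connected_def seg by (simp add: null_sets_def)
  qed
  have ij_ne: "i \<noteq> j" using ij(3) by auto
  obtain ra where ra: "ra > 0" "cball a ra \<subseteq> I i"
    using eff[OF ij(1)] open_contains_cball[of "interior (I i)"] interior_subset[of "I i"] unfolding a_def by (metis open_interior order_trans)
  obtain rb where rb: "rb > 0" "cball b rb \<subseteq> I j"
    using eff[OF ij(2)] open_contains_cball[of "interior (I j)"] interior_subset[of "I j"] unfolding b_def by (metis open_interior order_trans)
  have bj: "b \<in> I j" and ai: "a \<in> I i" "a - ra \<in> I i" using ra rb by (auto simp: cball_eq_atLeastAtMost)
  have lt_b: "x < b" if x: "x \<in> I i" for x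
  proof (rule ccontr)
    assume "\<not> x < b"
    then have "b \<in> I i" using mem_is_interval_1_I[OF scale_interval.is_interval_J[OF S] ai(1) x, of b] ab by simp
    then show False using I_disj[OF ij(1,2) _ bj] ij_ne by simp
  qed
  define c d where "c = s i (a - ra)" and "d = s i a"
  have cd: "c < d" unfolding c_def d_def using scale_interval.smono[OF S] ai ra(1) by (auto simp: strict_mono_on_def)
  define g where "g = ramp c d"
  define k where "k = ramp_slope c d"
  note gk = ramp_function[OF cd, folded g_def k_def]
  define R where "R = max \<bar>a - ra\<bar> \<bar>b\<bar>"
  define u where "u = (\<lambda>x. if x \<in> I i then g (s i x) else 0)"
  have supp_g: "g (s i x) = 0" if x: "x \<in> I i" "R < \<bar>x\<bar>" for x
  proof (rule gk(5))
    have "x \<le> a - ra" using lt_b[OF x(1)] x(2) unfolding R_def by linarith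
    then show "s i x \<le> c" unfolding c_def using scale_interval.s_le[OF S x(1) ai(2)] by simp
  qed
  have cpos: "1 / (d - c) > 0" using cd by simp
  have fin: "finite {c, d}" by simp
  have u: "u \<in> F" "version u u" "AE x in \<sigma>. D u x = (if x \<in> I i then k (s i x) else 0)"
    unfolding u_def
    by (rule piecewise_in_F[where g = g and k = k and X = "{c, d}" and C = "1 / (d - c)" and B = 1 and K = "1 / (d - c)"
          and a = c and b = d and R = R, OF ij(1) gk(1) cpos gk(2) fin gk(9) gk(8) gk(3) gk(4) supp_g], assumption+)+
  have Du0: "AE x in \<sigma>. x \<in> {a..b} \<longrightarrow> D u x = 0"
    using u(3)
  proof (rule eventually_mono, intro impI)
    fix x assume x: "D u x = (if x \<in> I i then k (s i x) else 0)" "x \<in> {a..b}"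
    have "k (s i x) = 0" if "x \<in> I i"
      using scale_interval.s_le[OF S ai(1) that] x(2) by (intro gk(7)) (simp add: d_def)
    then show "D u x = 0" using x(1) by simp
  qed
  have u1: "u x = 1" if "x \<in> {a..a + ra}" for x
  proof -
    have "x \<in> I i" using ra that by (auto simp: cball_eq_atLeastAtMost)
    moreover have "g (s i x) = 1" using scale_interval.s_le[OF S ai(1) calculation] that by (intro gk(6)) (simp add: d_def)
    ultimately show ?thesis by (simp add: u_def)
  qed
  have u0: "u x = 0" if "x \<in> I j" for x using I_disj[OF ij(1,2) _ that] ij_ne by (auto simp: u_def)
  have pos: "measure m {x..x + r} > 0" if "r > 0" for x r
  proof -
    have "emeasure m {x<..<x + r} > 0" using supp that unfolding fully_supported_def by simp
    also have "emeasure m {x<..<x + r} \<le> emeasure m {x..x + r}" by (intro emeasure_mono) auto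
    finally show ?thesis using m_Icc_finite[of x "x + r"]
      by (subst (asm) emeasure_eq_ennreal_measure) (auto simp: less_top)
  qed
  define L where "L = measure \<sigma> {a..b}"
  define \<mu>1 \<mu>2 where "\<mu>1 = measure m {a..a + ra}" and "\<mu>2 = measure m {b - rb..b}"
  have \<mu>: "\<mu>1 > 0" "\<mu>2 > 0" unfolding \<mu>1_def \<mu>2_def using pos[OF ra(1), of a] pos[OF rb(1), of "b - rb"] by simp_all
  have L: "L \<ge> 0" by (simp add: L_def)
  \<comment> \<open>the first two bounds force \<open>|u - \<phi>| < 1/4\<close> at some point near each end, the last one keeps the drop of \<open>\<phi>\<close> below \<open>1/2\<close>\<close>
  define \<epsilon> where "\<epsilon> = min (min (sqrt \<mu>1 / 4) (sqrt \<mu>2 / 4)) (1 / (2 + L))"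
  have \<epsilon>: "\<epsilon> > 0" "\<epsilon> \<le> sqrt \<mu>1 / 4" "\<epsilon> \<le> sqrt \<mu>2 / 4" "\<epsilon> \<le> 1 / (2 + L)" using \<mu> L by (auto simp: \<epsilon>_def)
  have eps_sq: "\<epsilon>\<^sup>2 \<le> \<mu> / 16" if "\<epsilon> \<le> sqrt \<mu> / 4" "\<mu> > 0" for \<mu>
  proof -
    have "\<epsilon>\<^sup>2 \<le> (sqrt \<mu> / 4)\<^sup>2" using \<epsilon>(1) that by (intro power_mono) auto
    then show ?thesis using that(2) by (simp add: power_divide)
  qed
  obtain \<phi> where \<phi>: "\<phi> \<in> Cc_infty" "E1_norm m E (\<lambda>x. u x - \<phi> x) < \<epsilon>"
    using dense u(1) \<epsilon>(1) unfolding E1_dense_in_def by blast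
  have V: "\<phi> \<in> F" "version \<phi> \<phi>" using Cc_infty_version[OF \<phi>(1)] by auto
  note close = E1_norm_diff_less[OF u(1,2) V \<phi>(2)]
  have ex: "\<exists>x\<in>{p..q}. \<bar>u x - \<phi> x\<bar> < 1 / 4" if pq: "\<epsilon>\<^sup>2 \<le> measure m {p..q} / 16" for p q
  proof (rule ccontr)
    assume "\<not> ?thesis"
    then have far: "1 / 4 \<le> \<bar>u x - \<phi> x\<bar>" if "x \<in> {p..q}" for x using that by force
    have far2: "1 / 16 \<le> (u x - \<phi> x)\<^sup>2" if "x \<in> {p..q}" for x
    proof -
      have "(1 / 4)\<^sup>2 \<le> \<bar>u x - \<phi> x\<bar>\<^sup>2" using far[OF that] by (intro power_mono) auto
      then show ?thesis by (simp add: power2_eq_square)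
    qed
    have intm: "integrable m (\<lambda>x. (u x - \<phi> x)\<^sup>2)" using F_L2[OF F_diff(1)[OF u(1) V(1)]] by (simp add: L2_def)
    have ii: "integrable m (\<lambda>x. indicator {p..q} x * (1 / 16 :: real))"
      using m_Icc_finite[of p q] by (intro integrable_mult_left) (auto simp: integrable_indicator_iff)
    have "measure m {p..q} / 16 = (\<integral>x. indicator {p..q} x * (1 / 16) \<partial>m)" by simp
    also have "\<dots> \<le> (\<integral>x. (u x - \<phi> x)\<^sup>2 \<partial>m)"
      using far2 by (intro integral_mono ii intm) (auto split: split_indicator)
    also have "\<dots> < \<epsilon>\<^sup>2" by (rule close(2))
    finally show False using pq by simp
  qed
  obtain x where x: "x \<in> {a..a + ra}" "\<bar>u x - \<phi> x\<bar> < 1 / 4"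
    using ex[of a "a + ra"] eps_sq[OF \<epsilon>(2) \<mu>(1)] by (auto simp: \<mu>1_def)
  obtain y where y: "y \<in> {b - rb..b}" "\<bar>u y - \<phi> y\<bar> < 1 / 4"
    using ex[of "b - rb" b] eps_sq[OF \<epsilon>(3) \<mu>(2)] by (auto simp: \<mu>2_def)
  have xI: "x \<in> I i" and yI: "y \<in> I j" using x(1) y(1) ra rb by (auto simp: cball_eq_atLeastAtMost)
  have xy: "x \<le> y"
  proof (rule ccontr)
    assume "\<not> x \<le> y"
    then have "x \<in> I j"
      using mem_is_interval_1_I[OF scale_interval.is_interval_J[OF scale[OF ij(2)]] yI bj, of x] lt_b[OF xI] by simp
    then show False using I_disj[OF ij(1,2) xI] ij_ne by simp
  qed
  have sub: "{x..y} \<subseteq> {a..b}" using x(1) y(1) by auto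
  have gap: "\<bar>\<phi> y - \<phi> x\<bar> > 1 / 2" using u1[OF x(1)] u0[OF yI] x(2) y(2) by linarith
  have nullxy: "{x..y} - G \<in> null_sets lborel"
    by (rule null_sets_subset[OF nullK]) (use sub in auto)
  note ftc = ftc_Cc_infty[OF \<phi>(1) xy nullxy]
  have "\<bar>\<phi> y - \<phi> x\<bar> \<le> (\<integral>t. \<bar>indicator {x..y} t * D \<phi> t\<bar> \<partial>\<sigma>)"
    using integral_norm_bound[of \<sigma> "\<lambda>t. indicator {x..y} t * D \<phi> t"] ftc(2) by simp
  also have "\<dots> \<le> (\<integral>t. (1 / (2 * \<epsilon>)) * (D u t - D \<phi> t)\<^sup>2 + (\<epsilon> / 2) * indicator {a..b} t \<partial>\<sigma>)"
  proof (rule integral_mono_AE)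
    show "integrable \<sigma> (\<lambda>t. \<bar>indicator {x..y} t * D \<phi> t\<bar>)" using ftc(1) by (rule integrable_abs)
    show "integrable \<sigma> (\<lambda>t. (1 / (2 * \<epsilon>)) * (D u t - D \<phi> t)\<^sup>2 + (\<epsilon> / 2) * indicator {a..b} t)"
      using E_diff(2)[OF u(1,2) V] finK by (intro Bochner_Integration.integrable_add integrable_mult_right) (auto simp: integrable_indicator_iff)
    show "AE t in \<sigma>. \<bar>indicator {x..y} t * D \<phi> t\<bar> \<le> (1 / (2 * \<epsilon>)) * (D u t - D \<phi> t)\<^sup>2 + (\<epsilon> / 2) * indicator {a..b} t"
      using Du0
    proof (rule eventually_mono)
      fix t assume t: "t \<in> {a..b} \<longrightarrow> D u t = 0"
      show "\<bar>indicator {x..y} t * D \<phi> t\<bar> \<le> (1 / (2 * \<epsilon>)) * (D u t - D \<phi> t)\<^sup>2 + (\<epsilon> / 2) * indicator {a..b} t"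
      proof (cases "t \<in> {x..y}")
        case True
        then have tab: "t \<in> {a..b}" using sub by blast
        have "2 * \<epsilon> * \<bar>D \<phi> t\<bar> \<le> (D \<phi> t)\<^sup>2 + \<epsilon>\<^sup>2" using sum_squares_bound[of "\<bar>D \<phi> t\<bar>" \<epsilon>] by (simp add: mult_ac)
        then have "(2 * \<epsilon> * \<bar>D \<phi> t\<bar>) / (2 * \<epsilon>) \<le> ((D \<phi> t)\<^sup>2 + \<epsilon>\<^sup>2) / (2 * \<epsilon>)" using \<epsilon>(1) by (intro divide_right_mono) auto
        also have "((D \<phi> t)\<^sup>2 + \<epsilon>\<^sup>2) / (2 * \<epsilon>) = (1 / (2 * \<epsilon>)) * (D \<phi> t)\<^sup>2 + \<epsilon> / 2"
          using \<epsilon>(1) by (simp add: field_simps power2_eq_square)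
        finally have "\<bar>D \<phi> t\<bar> \<le> (1 / (2 * \<epsilon>)) * (D \<phi> t)\<^sup>2 + \<epsilon> / 2" using \<epsilon>(1) by simp
        then show ?thesis using True tab t by simp
      next
        case False
        then show ?thesis using \<epsilon>(1) by simp
      qed
    qed
  qed
  also have "\<dots> = (1 / (2 * \<epsilon>)) * (\<integral>t. (D u t - D \<phi> t)\<^sup>2 \<partial>\<sigma>) + (\<epsilon> / 2) * L"
  proof -
    have "integrable \<sigma> (\<lambda>t. (1 / (2 * \<epsilon>)) * (D u t - D \<phi> t)\<^sup>2)" using E_diff(2)[OF u(1,2) V] by simp
    moreover have "integrable \<sigma> (\<lambda>t. (\<epsilon> / 2) * indicator {a..b} t)"
      using finK by (intro integrable_mult_right) (auto simp: integrable_indicator_iff)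
    ultimately show ?thesis by (subst Bochner_Integration.integral_add) (simp_all add: L_def)
  qed
  also have "\<dots> \<le> (1 / (2 * \<epsilon>)) * (2 * \<epsilon>\<^sup>2) + (\<epsilon> / 2) * L"
    using close(1) \<epsilon>(1) by (intro add_right_mono mult_left_mono) auto
  also have "\<dots> = \<epsilon> * (2 + L) / 2" using \<epsilon>(1) by (simp add: field_simps power2_eq_square)
  also have "\<dots> \<le> 1 / 2" using \<epsilon>(4) L by (simp add: field_simps)
  finally show False using gap by simp
qed

theorem dense_imp_scale_isolated:
  assumes dense: "E1_dense_in m E Cc_infty F" and i: "i \<in> N"
  shows "scale_isolated N I s e i"
  unfolding scale_isolated_def
proof (intro ballI impI notI)
  fix j assume j: "j \<in> N" "j \<noteq> i" "scale_connected N I s e i j"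
  have "e i \<noteq> e j"
    using I_disj[OF i j(1), of "e i"] eff[OF i] eff[OF j(1)] j(2) interior_subset by (metis subsetD)
  then consider "e i < e j" | "e j < e i" by linarith
  then show False
  proof cases
    case 1
    show ?thesis by (rule dense_imp_not_connected[OF dense i j(1) 1 j(3)])
  next
    case 2
    have "scale_connected N I s e j i" using j(3) by (simp add: scale_connected_def closed_segment_commute)
    then show ?thesis by (rule dense_imp_not_connected[OF dense j(1) i 2])
  qed
qed

end

section \<open>Isolation and the dichotomy for intervals\<close>

lemma positive_length_meets:
  assumes "p < q" "{p..q} - G \<in> null_sets lborel"
  obtains c where "c \<in> G" "p < c" "c < (q::real)"
proof (rule ccontr)
  assume "\<not> thesis"
  then have "{p<..<q} \<subseteq> {p..q} - G" using that by auto
  then have "{p<..<q} \<in> null_sets lborel" using null_sets_subset[OF assms(2)] by simp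
  then show False using assms(1) by (auto simp: null_sets_def)
qed

text \<open>
  If \<open>ds\<^sub>n\<close> has a Lebesgue density, every Lebesgue null subset of \<open>I\<^sub>n\<close> is \<open>\<sigma>\<close>-null. The set \<open>{\<tau> = 0}\<close>
  is Lebesgue null in \<open>I\<^sub>n\<close>, because \<open>dx = \<tau> d\<sigma>\<close> there.
\<close>

lemma (in form_setting) scale_ac_imp_tau_pos:
  assumes ac: "\<And>n. n \<in> N \<Longrightarrow> locally_abs_cont_on (I n) (s n)"
  shows "AE x in \<sigma>. \<tau> x > 0"
proof -
  have null: "{x \<in> I n. \<tau> x = 0} \<in> null_sets \<sigma>" if n: "n \<in> N" for n
  proof -
    note S = scale[OF n]
    obtain f where f: "f \<in> borel_measurable borel"
      "\<And>p q. p \<in> I n \<Longrightarrow> q \<in> I n \<Longrightarrow> p \<le> q \<Longrightarrow> set_integrable lborel {p..q} f"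
      "\<And>p q. p \<in> I n \<Longrightarrow> q \<in> I n \<Longrightarrow> p \<le> q \<Longrightarrow> (LBINT t:{p..q}. f t) = s n q - s n p"
      "AE t in lborel. t \<in> I n \<longrightarrow> (s n has_real_derivative f t) (at t)"
      by (rule ftc_locally_abs_cont[OF scale_interval.is_interval_J[OF S] ac[OF n]]) (rule that)
    have mono: "mono_on (I n) (s n)" using scale_interval.s_le[OF S] by (auto simp: mono_on_def)
    have nonneg: "AE t in lborel. t \<in> I n \<longrightarrow> f t \<ge> 0"
      using f(4) AE_interior_interval[OF scale_interval.is_interval_J[OF S]]
    proof eventually_elim
      case (elim t)
      then show ?case using mono_on_imp_deriv_nonneg[OF mono] by blast
    qed
    let ?M = "density lborel (\<lambda>t. ennreal (f t))"
    have Icc: "emeasure \<sigma> {u..v} = emeasure ?M {u..v}" if uv: "u \<in> I n" "v \<in> I n" "u \<le> v" for u v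
    proof -
      have "emeasure ?M {u..v} = (\<integral>\<^sup>+t. ennreal (f t) * indicator {u..v} t \<partial>lborel)"
        using f(1) by (intro emeasure_density) auto
      also have "\<dots> = (\<integral>\<^sup>+t. ennreal (indicator {u..v} t *\<^sub>R f t) \<partial>lborel)"
        by (intro nn_integral_cong) (simp split: split_indicator)
      also have "\<dots> = ennreal (LBINT t:{u..v}. f t)"
        unfolding set_lebesgue_integral_def
      proof (rule nn_integral_eq_integral)
        show "integrable lborel (\<lambda>t. indicator {u..v} t *\<^sub>R f t)" using f(2)[OF uv] by (simp add: set_integrable_def)
        show "AE t in lborel. 0 \<le> indicator {u..v} t *\<^sub>R f t"
          using nonneg by (rule eventually_mono)
            (use scale_interval.Icc_sub_J[OF S uv(1,2)] in \<open>auto split: split_indicator\<close>)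
      qed
      also have "\<dots> = emeasure \<sigma> {u..v}" using f(3)[OF uv] emeasure_sigma_Icc[OF n uv] by simp
      finally show ?thesis by simp
    qed
    have ne: "I n \<noteq> {}" using eff[OF n] by (auto simp: nondeg_interval_def)
    obtain p q where pq: "\<And>k. p k \<in> I n" "\<And>k. q k \<in> I n" "\<And>k. p k \<le> q k" "decseq p" "incseq q" "I n = (\<Union>k. {p k..q k})"
      by (rule interval_exhaustion[OF scale_interval.is_interval_J[OF S] ne]) (rule that)
    have "{p k..q k} \<inter> {x. \<tau> x = 0} \<in> null_sets \<sigma>" for k
    proof -
      let ?Z = "{p k..q k} \<inter> {x. \<tau> x = 0}"
      have Z: "?Z \<in> sets borel" by measurable
      have sub: "{p k..q k} \<subseteq> I n" using pq(6) by blast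
      have "emeasure lborel ?Z = (\<integral>\<^sup>+x. ennreal (indicator G x) * indicator ?Z x \<partial>lborel)"
      proof -
        have "(\<integral>\<^sup>+x. ennreal (indicator G x) * indicator ?Z x \<partial>lborel) = (\<integral>\<^sup>+x. indicator ?Z x \<partial>lborel)"
        proof (rule nn_integral_cong)
          fix x
          have "x \<in> G" if "x \<in> ?Z" using that sub n by (auto simp: G_def)
          then show "ennreal (indicator G x) * indicator ?Z x = indicator ?Z x" by (simp split: split_indicator)
        qed
        then show ?thesis using Z by simp
      qed
      also have "\<dots> = (\<integral>\<^sup>+x. ennreal (\<tau> x) * indicator ?Z x \<partial>\<sigma>)"
        using Z by (intro nn_integral_tau[symmetric]) simp
      also have "\<dots> = (\<integral>\<^sup>+x. 0 \<partial>\<sigma>)" by (intro nn_integral_cong) (simp split: split_indicator)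
      finally have "?Z \<in> null_sets lborel" using Z by (simp add: null_sets_def)
      moreover have "absolutely_continuous lborel ?M" using f(1) by (intro absolutely_continuousI_density) simp
      ultimately have "emeasure ?M ?Z = 0" unfolding absolutely_continuous_def by auto
      moreover have "emeasure \<sigma> ?Z = emeasure ?M ?Z"
      proof (rule measure_eq_on_Icc)
        show "emeasure \<sigma> {u..v} = emeasure ?M {u..v}" if "p k \<le> u" "u \<le> v" "v \<le> q k" for u v
        proof (rule Icc)
          have "u \<in> {p k..q k}" "v \<in> {p k..q k}" using that by auto
          then show "u \<in> I n" "v \<in> I n" using sub by blast+
        qed (rule that(2))
        show "emeasure \<sigma> {p k..q k} \<noteq> \<infinity>" using emeasure_sigma_Icc[OF n pq(1-3)] by simp
        show "?Z \<subseteq> {p k..q k}" by blast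
      qed (use Z in simp_all)
      ultimately show ?thesis using Z by (simp add: null_sets_def)
    qed
    then have "(\<Union>k. {p k..q k} \<inter> {x. \<tau> x = 0}) \<in> null_sets \<sigma>" by (intro null_sets_UN) blast
    also have "(\<Union>k. {p k..q k} \<inter> {x. \<tau> x = 0}) = {x \<in> I n. \<tau> x = 0}" using pq(6) by blast
    finally show ?thesis .
  qed
  have "AE x in \<sigma>. x \<in> I n \<longrightarrow> \<tau> x > 0" if n: "n \<in> N" for n
    using AE_not_in[OF null[OF n]]
  proof (rule eventually_mono)
    fix x assume "x \<notin> {x \<in> I n. \<tau> x = 0}"
    then show "x \<in> I n \<longrightarrow> \<tau> x > 0" using tau_nonneg[of x] by (auto simp: le_less)
  qed
  then have "AE x in \<sigma>. \<forall>n\<in>N. x \<in> I n \<longrightarrow> \<tau> x > 0" by (subst AE_ball_countable) auto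
  moreover have "AE x in \<sigma>. x \<in> G" using AE_not_in[OF null_compl_G] by simp
  ultimately show ?thesis by eventually_elim (auto simp: G_def)
qed

context effective_family begin

text \<open>
  The base points may be replaced by any other points of the intervals: compact subintervals of
  \<open>I\<^sub>i\<close> and \<open>I\<^sub>j\<close> have finite \<open>\<sigma>\<close>-measure and lie in \<open>G\<close>.
\<close>

lemma connected_through:
  assumes ij: "i \<in> N" "j \<in> N" and c: "c \<in> I i" "c' \<in> I j" "c \<le> c'"
    and fin: "emeasure \<sigma> {c..c'} < \<infinity>" and null: "{c..c'} - G \<in> null_sets lborel"
  shows "scale_connected N I s e i j"
proof -
  have eI: "e n \<in> I n" if "n \<in> N" for n using eff[OF that] interior_subset by blast
  have seg: "closed_segment (e n) x \<subseteq> I n \<and> closed_segment (e n) x \<in> sets borel \<and> emeasure \<sigma> (closed_segment (e n) x) < \<infinity>"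
    if n: "n \<in> N" and x: "x \<in> I n" for n x
  proof -
    have "closed_segment (e n) x = {min (e n) x..max (e n) x}" by (auto simp: closed_segment_eq_real_ivl)
    moreover have m: "min (e n) x \<in> I n" "max (e n) x \<in> I n" "min (e n) x \<le> max (e n) x"
      using eI[OF n] x by (auto simp: min_def max_def)
    ultimately show ?thesis
      using emeasure_sigma_Icc[OF n m] scale_interval.Icc_sub_J[OF scale[OF n] m(1,2)] by simp
  qed
  let ?A = "closed_segment (e i) c" and ?B = "closed_segment (e j) c'"
  note A = seg[OF ij(1) c(1)] and B = seg[OF ij(2) c(2)]
  have cover: "closed_segment (e i) (e j) \<subseteq> ?A \<union> {c..c'} \<union> ?B"
    using c(3) by (auto simp: closed_segment_eq_real_ivl split: if_splits)
  have K: "closed_segment (e i) (e j) \<in> sets borel" by (auto simp: closed_segment_eq_real_ivl)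
  have "emeasure \<sigma> (closed_segment (e i) (e j)) \<le> emeasure \<sigma> (?A \<union> {c..c'} \<union> ?B)"
    using cover A B by (intro emeasure_mono) auto
  also have "\<dots> \<le> emeasure \<sigma> (?A \<union> {c..c'}) + emeasure \<sigma> ?B" using A B by (intro emeasure_subadditive) auto
  also have "\<dots> \<le> emeasure \<sigma> ?A + emeasure \<sigma> {c..c'} + emeasure \<sigma> ?B" using A by (intro add_right_mono emeasure_subadditive) auto
  also have "\<dots> < \<infinity>" using A B fin by simp
  finally have 1: "emeasure \<sigma> (closed_segment (e i) (e j)) < \<infinity>" .
  have "emeasure (lambda_l N I) (closed_segment (e i) (e j)) = (\<integral>\<^sup>+x. indicator (- G) x * indicator (closed_segment (e i) (e j)) x \<partial>lborel)"
    unfolding lambda_l_def G_def[symmetric] using K by (intro emeasure_density) auto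
  also have "\<dots> \<le> (\<integral>\<^sup>+x. indicator ({c..c'} - G) x \<partial>lborel)"
  proof (rule nn_integral_mono)
    fix x
    have "x \<in> {c..c'} - G" if "x \<in> closed_segment (e i) (e j)" "x \<notin> G"
    proof -
      have "x \<notin> ?A" "x \<notin> ?B" using that(2) A B ij unfolding G_def by blast+
      then show ?thesis using that cover by blast
    qed
    then show "indicator (- G) x * indicator (closed_segment (e i) (e j)) x \<le> (indicator ({c..c'} - G) x :: ennreal)"
      by (simp split: split_indicator)
  qed
  also have "\<dots> = 0" using null by (subst nn_integral_indicator) auto
  finally show ?thesis using 1 by (simp add: scale_connected_def)
qed

text \<open>
  By isolation, \<open>[p, q]\<close> meets only one interval \<open>I\<^sub>n\<close>, and this interval fills it up to length 0. If \<open>q\<close> did not belong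
  to \<open>I\<^sub>n\<close>, the scale would be bounded towards the right end \<open>b \<le> q\<close>, as \<open>\<sigma>([p, q])\<close> is finite; adaptedness
  then puts \<open>b\<close> into \<open>I\<^sub>n\<close>, so \<open>b < q\<close>, and some other interval would have to meet \<open>(b, q)\<close>. The same applies to \<open>p\<close>.
\<close>

theorem interval_dichotomy:
  assumes iso: "\<And>i. i \<in> N \<Longrightarrow> scale_isolated N I s e i"
    and pq: "p < q" and fin: "emeasure \<sigma> {p..q} < \<infinity>" and null: "{p..q} - G \<in> null_sets lborel"
  shows "\<exists>n\<in>N. {p..q} \<subseteq> I n"
proof -
  obtain c where c: "c \<in> G" "p < c" "c < q" by (rule positive_length_meets[OF pq null]) (rule that)
  then obtain n where n: "n \<in> N" "c \<in> I n" by (auto simp: G_def)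
  note S = scale[OF n(1)]
  have sub: "emeasure \<sigma> {x..y} < \<infinity> \<and> {x..y} - G \<in> null_sets lborel" if "p \<le> x" "y \<le> q" for x y
  proof -
    have "emeasure \<sigma> {x..y} \<le> emeasure \<sigma> {p..q}" using that by (intro emeasure_mono) auto
    moreover have "{x..y} - G \<in> null_sets lborel" by (rule null_sets_subset[OF null]) (use that in auto)
    ultimately show ?thesis using fin by (simp add: order_le_less_trans)
  qed
  have same: "i = j" if "i \<in> N" "j \<in> N" "x \<in> I i" "y \<in> I j" "p \<le> x" "x \<le> y" "y \<le> q" for i j x y
  proof (rule ccontr)
    assume "i \<noteq> j"
    then have "\<not> scale_connected N I s e i j" using iso[OF that(1)] that(2) unfolding scale_isolated_def by auto
    then show False using connected_through[OF that(1-4,6)] sub[OF that(5,7)] by blast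
  qed
  define L where "L = measure \<sigma> {p..q}"
  have len: "s n y - s n x \<le> L" if "x \<in> I n" "y \<in> I n" "p \<le> x" "x \<le> y" "y \<le> q" for x y
  proof -
    have "emeasure \<sigma> {x..y} = ennreal (s n y - s n x)" by (rule emeasure_sigma_Icc[OF n(1) that(1,2,4)])
    moreover have "emeasure \<sigma> {x..y} \<le> emeasure \<sigma> {p..q}" using that by (intro emeasure_mono) auto
    moreover have "emeasure \<sigma> {p..q} = ennreal L" unfolding L_def using fin by (intro emeasure_eq_ennreal_measure) auto
    ultimately show ?thesis by (simp add: L_def ennreal_le_iff)
  qed
  have ad: "adapted_scale (I n) (e n) (s n)" using eff[OF n(1)] by blast
  have "q \<in> I n"
  proof (rule ccontr)
    assume q: "q \<notin> I n"
    have le_q: "y \<le> q" if "y \<in> I n" for y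
      using mem_is_interval_1_I[OF scale_interval.is_interval_J[OF S] n(2) that, of q] q c by force
    \<comment> \<open>the scale increases by at most \<open>L\<close> to the right of \<open>c\<close>\<close>
    have bound: "s n y \<le> s n c + L" if y: "y \<in> I n" for y
    proof (cases "c \<le> y")
      case True
      then show ?thesis using len[OF n(2) y] c le_q[OF y] by simp
    next
      case False
      then have "s n y \<le> s n c" using scale_interval.s_le[OF S y n(2)] by simp
      then show ?thesis by (simp add: L_def add_increasing2)
    qed
    have "right_end (I n) \<le> ereal q" unfolding right_end_def using le_q by (intro SUP_least) simp
    then have "right_end (I n) < \<infinity>" by (rule order_le_less_trans) simp
    moreover have "scale_right (I n) (s n) \<le> ereal (s n c + L)" unfolding scale_right_def using bound by (intro SUP_least) simp
    then have "scale_right (I n) (s n) < \<infinity>" by (rule order_le_less_trans) simp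
    ultimately have "right_end (I n) \<in> ereal ` I n" using ad by (simp add: adapted_scale_def)
    then obtain b where b: "b \<in> I n" "right_end (I n) = ereal b" by auto
    have max: "y \<le> b" if "y \<in> I n" for y
      using SUP_upper[OF that, of ereal] b(2) by (simp add: right_end_def)
    have "b \<noteq> q" using q b(1) by blast
    then have "b < q" using le_q[OF b(1)] by simp
    have "p \<le> b" using max[OF n(2)] c by simp
    obtain c' where c': "c' \<in> G" "b < c'" "c' < q"
      by (rule positive_length_meets[OF \<open>b < q\<close> conjunct2[OF sub[OF \<open>p \<le> b\<close> order_refl]]]) (rule that)
    then obtain j where j: "j \<in> N" "c' \<in> I j" by (auto simp: G_def)
    have "n = j" using same[OF n(1) j(1) b(1) j(2)] c' \<open>p \<le> b\<close> by simp
    then show False using max j(2) c'(2) by force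
  qed
  moreover have "p \<in> I n"
  proof (rule ccontr)
    assume p: "p \<notin> I n"
    have ge_p: "p \<le> y" if "y \<in> I n" for y
      using mem_is_interval_1_I[OF scale_interval.is_interval_J[OF S] that n(2), of p] p c by force
    have bound: "s n c - L \<le> s n y" if y: "y \<in> I n" for y
    proof (cases "y \<le> c")
      case True
      then show ?thesis using len[OF y n(2)] c ge_p[OF y] by simp
    next
      case False
      then have "s n c \<le> s n y" using scale_interval.s_le[OF S n(2) y] by simp
      moreover have "L \<ge> 0" by (simp add: L_def)
      ultimately show ?thesis by simp
    qed
    have "ereal p \<le> left_end (I n)" unfolding left_end_def using ge_p by (intro INF_greatest) simp
    then have "left_end (I n) > - \<infinity>" by (rule order_less_le_trans[rotated]) simp
    moreover have "ereal (s n c - L) \<le> scale_left (I n) (s n)" unfolding scale_left_def using bound by (intro INF_greatest) simp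
    then have "scale_left (I n) (s n) > - \<infinity>" by (rule order_less_le_trans[rotated]) simp
    ultimately have "left_end (I n) \<in> ereal ` I n" using ad by (simp add: adapted_scale_def)
    then obtain b where b: "b \<in> I n" "left_end (I n) = ereal b" by auto
    have min: "b \<le> y" if "y \<in> I n" for y
      using INF_lower[OF that, of ereal] b(2) by (simp add: left_end_def)
    have "b \<noteq> p" using p b(1) by blast
    then have "p < b" using ge_p[OF b(1)] by simp
    have "b \<le> q" using min[OF n(2)] c by simp
    obtain c' where c': "c' \<in> G" "p < c'" "c' < b"
      by (rule positive_length_meets[OF \<open>p < b\<close> conjunct2[OF sub[OF order_refl \<open>b \<le> q\<close>]]]) (rule that)
    then obtain j where j: "j \<in> N" "c' \<in> I j" by (auto simp: G_def)
    have "j = n" using same[OF j(1) n(1) j(2) b(1)] c' \<open>b \<le> q\<close> by simp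
    then show False using min j(2) c'(3) by force
  qed
  ultimately show ?thesis using scale_interval.Icc_sub_J[OF S] n(1) by blast
qed

text \<open>
  Finite unions of compact subintervals of the \<open>I\<^sub>n\<close> that exhaust \<open>G\<close>. Only finitely many
  intervals are used at each stage, which makes the measures finite.
\<close>

lemma compact_exhaustion:
  obtains P Q :: "nat \<Rightarrow> nat \<Rightarrow> real" where
    "\<And>n k. n \<in> N \<Longrightarrow> P n k \<in> I n \<and> Q n k \<in> I n \<and> P n k \<le> Q n k"
    "incseq (\<lambda>k. \<Union>n\<in>{n \<in> N. n \<le> k}. {P n k..Q n k})" "(\<Union>k. \<Union>n\<in>{n \<in> N. n \<le> k}. {P n k..Q n k}) = G"
    "\<And>k. emeasure \<sigma> (\<Union>n\<in>{n \<in> N. n \<le> k}. {P n k..Q n k}) < \<infinity>"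
proof -
  have "\<forall>n\<in>N. \<exists>pq :: (nat \<Rightarrow> real) \<times> (nat \<Rightarrow> real). (\<forall>k. fst pq k \<in> I n \<and> snd pq k \<in> I n \<and> fst pq k \<le> snd pq k) \<and>
      decseq (fst pq) \<and> incseq (snd pq) \<and> I n = (\<Union>k. {fst pq k..snd pq k})"
  proof
    fix n assume n: "n \<in> N"
    have ne: "I n \<noteq> {}" using eff[OF n] by (auto simp: nondeg_interval_def)
    obtain p q where "\<And>k. p k \<in> I n" "\<And>k. q k \<in> I n" "\<And>k. p k \<le> q k" "decseq p" "incseq q" "I n = (\<Union>k. {p k..q k})"
      by (rule interval_exhaustion[OF scale_interval.is_interval_J[OF scale[OF n]] ne]) (rule that)
    then show "\<exists>pq :: (nat \<Rightarrow> real) \<times> (nat \<Rightarrow> real). (\<forall>k. fst pq k \<in> I n \<and> snd pq k \<in> I n \<and> fst pq k \<le> snd pq k) \<and>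
      decseq (fst pq) \<and> incseq (snd pq) \<and> I n = (\<Union>k. {fst pq k..snd pq k})"
      by (intro exI[of _ "(p, q)"]) simp
  qed
  then obtain pq :: "nat \<Rightarrow> (nat \<Rightarrow> real) \<times> (nat \<Rightarrow> real)" where pq: "\<forall>n\<in>N. (\<forall>k. fst (pq n) k \<in> I n \<and> snd (pq n) k \<in> I n \<and> fst (pq n) k \<le> snd (pq n) k) \<and>
      decseq (fst (pq n)) \<and> incseq (snd (pq n)) \<and> I n = (\<Union>k. {fst (pq n) k..snd (pq n) k})"
    unfolding bchoice_iff by blast
  define P Q where "P n = fst (pq n)" and "Q n = snd (pq n)" for n
  have PQ: "P n k \<in> I n \<and> Q n k \<in> I n \<and> P n k \<le> Q n k" if "n \<in> N" for n k using pq that unfolding P_def Q_def by blast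
  have mono: "decseq (P n)" "incseq (Q n)" "I n = (\<Union>k. {P n k..Q n k})" if "n \<in> N" for n
    using pq that unfolding P_def Q_def by blast+
  let ?\<Theta> = "\<lambda>k. \<Union>n\<in>{n \<in> N. n \<le> k}. {P n k..Q n k}"
  have inc: "incseq ?\<Theta>"
  proof (rule incseq_SucI)
    fix k
    have "{P n k..Q n k} \<subseteq> {P n (Suc k)..Q n (Suc k)}" if "n \<in> N" for n
      using decseq_SucD[OF mono(1)[OF that], of k] incseq_SucD[OF mono(2)[OF that], of k] by auto
    then show "?\<Theta> k \<subseteq> ?\<Theta> (Suc k)" by (intro UN_mono) auto
  qed
  have U: "(\<Union>k. ?\<Theta> k) = G"
  proof (intro equalityI subsetI)
    fix x assume "x \<in> (\<Union>k. ?\<Theta> k)"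
    then obtain k n where n: "n \<in> N" "x \<in> {P n k..Q n k}" by auto
    then have "x \<in> I n" using mono(3)[OF n(1)] by blast
    then show "x \<in> G" using n(1) by (auto simp: G_def)
  next
    fix x assume "x \<in> G"
    then obtain n where n: "n \<in> N" "x \<in> I n" by (auto simp: G_def)
    then obtain k where "x \<in> {P n k..Q n k}" using mono(3)[OF n(1)] by blast
    moreover have "{P n k..Q n k} \<subseteq> {P n (max n k)..Q n (max n k)}"
      using decseqD[OF mono(1)[OF n(1)], of k "max n k"] incseqD[OF mono(2)[OF n(1)], of k "max n k"] by auto
    ultimately have "x \<in> ?\<Theta> (max n k)" using n(1) by fastforce
    then show "x \<in> (\<Union>k. ?\<Theta> k)" by blast
  qed
  have fin: "emeasure \<sigma> (?\<Theta> k) < \<infinity>" for k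
  proof -
    have "emeasure \<sigma> (?\<Theta> k) \<le> (\<Sum>n\<in>{n \<in> N. n \<le> k}. emeasure \<sigma> {P n k..Q n k})"
      by (intro emeasure_subadditive_finite) auto
    also have "\<dots> < \<infinity>" using emeasure_sigma_Icc PQ by (simp add: ennreal_sum_less_top less_top[symmetric])
    finally show ?thesis .
  qed
  show thesis by (rule that[OF PQ inc U fin])
qed

end

section \<open>Following a function by absolutely continuous functions\<close>

text \<open>
  The two conditions of the theorem, with absolute continuity of the scales in the form \<open>\<tau> > 0\<close>.
\<close>

locale isolated_setting = form_setting +
  assumes tau_pos: "AE x in \<sigma>. \<tau> x > 0"
    and isolated: "\<And>i. i \<in> N \<Longrightarrow> scale_isolated N I s e i"
begin

text \<open>
  A unit increment across \<open>[p, q]\<close> with arbitrarily small energy. If part of \<open>[p, q]\<close> with positive length lies off \<open>G\<close>, the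
  increment is made there, at no cost. Otherwise \<open>\<sigma>([p, q]) = \<infinity>\<close> by the dichotomy. Choose a subset \<open>B\<close> of large finite
  measure \<open>b\<close> and let \<open>f = 1\<^sub>B/(b \<tau>)\<close>: then \<open>\<integral>f dx = \<integral>f \<tau> d\<sigma> = 1\<close> and \<open>\<integral>(f \<tau>)\<^sup>2 d\<sigma> = 1/b\<close>.
\<close>

lemma free_bump:
  assumes pq: "p < q" and free: "\<not> (\<exists>n\<in>N. {p..q} \<subseteq> I n)" and \<delta>: "\<delta> > 0"
  shows "\<exists>f. f \<in> borel_measurable borel \<and> (\<forall>x. f x \<ge> 0) \<and> (\<forall>x. x \<notin> {p..q} \<longrightarrow> f x = 0) \<and>
    has_bochner_integral lborel f 1 \<and> (\<integral>\<^sup>+x. ennreal ((f x * \<tau> x)\<^sup>2) \<partial>\<sigma>) \<le> ennreal \<delta>"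
proof (cases "{p..q} - G \<in> null_sets lborel")
  case False
  define len where "len = measure lborel ({p..q} - G)"
  have fin: "emeasure lborel ({p..q} - G) < \<infinity>"
  proof -
    have "emeasure lborel ({p..q} - G) \<le> emeasure lborel {p..q}" by (intro emeasure_mono) auto
    then show ?thesis using pq by (simp add: order_le_less_trans)
  qed
  have pos: "len > 0"
  proof -
    have "emeasure lborel ({p..q} - G) \<noteq> 0" using False by (auto simp: null_sets_def)
    moreover have "emeasure lborel ({p..q} - G) = ennreal len"
      unfolding len_def using fin by (intro emeasure_eq_ennreal_measure) auto
    ultimately have "len \<noteq> 0" by auto
    moreover have "len \<ge> 0" by (simp add: len_def)
    ultimately show ?thesis by simp
  qed
  define f where "f x = indicator ({p..q} - G) x / len" for x
  have "has_bochner_integral lborel (indicator ({p..q} - G)) len"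
    unfolding len_def using fin by (intro has_bochner_integral_real_indicator) auto
  from has_bochner_integral_divide_zero[OF this, of len]
  have "has_bochner_integral lborel f 1" using pos by (simp add: f_def[abs_def])
  moreover have "(\<integral>\<^sup>+x. ennreal ((f x * \<tau> x)\<^sup>2) \<partial>\<sigma>) \<le> ennreal \<delta>"
  proof -
    have zero: "f x * \<tau> x = 0" for x by (auto simp: f_def tau_outside split: split_indicator)
    show ?thesis unfolding zero by simp
  qed
  moreover have "f \<in> borel_measurable borel" unfolding f_def by measurable
  moreover have "f x \<ge> 0" for x using pos by (simp add: f_def)
  moreover have "f x = 0" if "x \<notin> {p..q}" for x using that by (auto simp: f_def indicator_def)
  ultimately show ?thesis by (intro exI[of _ f]) simp
next
  case True
  have inf: "emeasure \<sigma> {p..q} = \<infinity>"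
  proof (rule ccontr)
    assume "\<not> ?thesis"
    then have "emeasure \<sigma> {p..q} < \<infinity>" by (simp add: less_top)
    then show False using interval_dichotomy[OF isolated pq _ True] free by blast
  qed
  obtain P Q where PQ: "\<And>n k. n \<in> N \<Longrightarrow> P n k \<in> I n \<and> Q n k \<in> I n \<and> P n k \<le> Q n k"
    "incseq (\<lambda>k. \<Union>n\<in>{n \<in> N. n \<le> k}. {P n k..Q n k})" "(\<Union>k. \<Union>n\<in>{n \<in> N. n \<le> k}. {P n k..Q n k}) = G"
    "\<And>k. emeasure \<sigma> (\<Union>n\<in>{n \<in> N. n \<le> k}. {P n k..Q n k}) < \<infinity>"
    by (rule compact_exhaustion) (rule that)
  define \<Theta> where "\<Theta> k = (\<Union>n\<in>{n \<in> N. n \<le> k}. {P n k..Q n k})" for k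
  have \<Theta>: "incseq \<Theta>" "(\<Union>k. \<Theta> k) = G" "\<And>k. emeasure \<sigma> (\<Theta> k) < \<infinity>"
    unfolding \<Theta>_def by (rule PQ(2), rule PQ(3), rule PQ(4))
  have \<Theta>m [measurable]: "\<Theta> k \<in> sets borel" for k unfolding \<Theta>_def by auto
  have "(SUP k. emeasure \<sigma> (\<Theta> k \<inter> {p..q})) = emeasure \<sigma> (\<Union>k. \<Theta> k \<inter> {p..q})"
    using \<Theta>(1) by (intro SUP_emeasure_incseq) (auto simp: incseq_def)
  also have "(\<Union>k. \<Theta> k \<inter> {p..q}) = G \<inter> {p..q}" using \<Theta>(2) by blast
  also have "emeasure \<sigma> (G \<inter> {p..q}) = emeasure \<sigma> {p..q}"
  proof (rule emeasure_eq_AE)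
    have "AE x in \<sigma>. x \<in> G" using AE_not_in[OF null_compl_G] by simp
    then show "AE x in \<sigma>. (x \<in> G \<inter> {p..q}) = (x \<in> {p..q})" by (rule eventually_mono) simp
  qed auto
  finally have sup: "(SUP k. emeasure \<sigma> (\<Theta> k \<inter> {p..q})) = \<infinity>" using inf by simp
  have "ennreal (1 / \<delta>) < (SUP k. emeasure \<sigma> (\<Theta> k \<inter> {p..q}))" unfolding sup by simp
  then obtain k where k: "ennreal (1 / \<delta>) < emeasure \<sigma> (\<Theta> k \<inter> {p..q})" unfolding less_SUP_iff by blast
  \<comment> \<open>\<open>\<sigma>(\<Theta>\<^sub>k)\<close> is finite and increases to \<open>\<infinity>\<close> on \<open>[p, q]\<close>, so some \<open>k\<close> gives a finite mass above \<open>1/\<delta>\<close>\<close>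
  define B where "B = \<Theta> k \<inter> {p..q} \<inter> G"
  have Bm [measurable]: "B \<in> sets borel" unfolding B_def by measurable
  have B_eq: "B = \<Theta> k \<inter> {p..q}" using \<Theta>(2) by (auto simp: B_def)
  have finB: "emeasure \<sigma> B < \<infinity>"
  proof -
    have "emeasure \<sigma> B \<le> emeasure \<sigma> (\<Theta> k)" by (intro emeasure_mono) (auto simp: B_def)
    then show ?thesis using \<Theta>(3)[of k] by (rule order_le_less_trans)
  qed
  define b where "b = measure \<sigma> B"
  have eB: "emeasure \<sigma> B = ennreal b" unfolding b_def using finB by (intro emeasure_eq_ennreal_measure) auto
  have b: "b > 1 / \<delta>" "b > 0"
  proof -
    show 1: "b > 1 / \<delta>" using k \<delta> unfolding B_eq[symmetric] eB by (simp add: ennreal_less_iff)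
    have "1 / \<delta> > 0" using \<delta> by simp
    then show "b > 0" using 1 by linarith
  qed
  define f where "f x = indicator B x / (\<tau> x * b)" for x
  have fm [measurable]: "f \<in> borel_measurable borel" unfolding f_def by measurable
  have f\<tau>: "AE x in \<sigma>. \<tau> x * f x = indicator B x / b"
    using tau_pos by (rule eventually_mono) (simp add: f_def)
  have hasB: "has_bochner_integral \<sigma> (\<lambda>x. indicator B x / b) 1"
    using has_bochner_integral_divide_zero[OF has_bochner_integral_real_indicator[of B \<sigma>], of b] finB b(2)
    by (simp add: b_def)
  have has: "has_bochner_integral \<sigma> (\<lambda>x. \<tau> x * f x) 1"
    by (rule has_bochner_integral_cong_AE[OF _ _ f\<tau>, THEN iffD2, OF _ _ hasB]) measurable
  have Gf: "(\<lambda>x. indicator G x * f x) = f" by (auto simp: f_def B_def split: split_indicator)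
  have "has_bochner_integral lborel f 1"
    using has integral_tau[OF fm] unfolding has_bochner_integral_iff Gf by simp
  moreover have "f x \<ge> 0" for x using b(2) tau_nonneg[of x] by (simp add: f_def)
  moreover have "f x = 0" if "x \<notin> {p..q}" for x using that by (auto simp: f_def B_def indicator_def)
  moreover have "(\<integral>\<^sup>+x. ennreal ((f x * \<tau> x)\<^sup>2) \<partial>\<sigma>) \<le> ennreal \<delta>"
  proof -
    have "(\<integral>\<^sup>+x. ennreal ((f x * \<tau> x)\<^sup>2) \<partial>\<sigma>) = (\<integral>\<^sup>+x. ennreal (1 / b\<^sup>2) * indicator B x \<partial>\<sigma>)"
    proof (rule nn_integral_cong_AE)
      show "AE x in \<sigma>. ennreal ((f x * \<tau> x)\<^sup>2) = ennreal (1 / b\<^sup>2) * indicator B x"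
        using f\<tau>
      proof (rule eventually_mono)
        fix x assume "\<tau> x * f x = indicator B x / b"
        then have "f x * \<tau> x = indicator B x / b" by (simp add: mult.commute)
        then show "ennreal ((f x * \<tau> x)\<^sup>2) = ennreal (1 / b\<^sup>2) * indicator B x"
          by (simp add: power_divide split: split_indicator)
      qed
    qed
    also have "\<dots> = ennreal (1 / b\<^sup>2) * ennreal b" by (subst nn_integral_cmult_indicator) (simp_all add: eB)
    also have "\<dots> = ennreal (1 / b)" using b(2) by (subst ennreal_mult[symmetric]) (auto simp: power2_eq_square)
    also have "\<dots> \<le> ennreal \<delta>" using b \<delta> by (intro ennreal_leI) (simp add: field_simps)
    finally show ?thesis .
  qed
  ultimately show ?thesis using fm by (intro exI[of _ f]) simp
qed

text \<open>
  Here \<open>f\<close> is the density of an absolutely continuous function that starts and ends with \<open>u\<close> on \<open>[p, q]\<close>,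
  stays \<open>\<eta>\<close>-close to it in between, and has the scale derivative \<open>f \<tau>\<close>. The set \<open>\<Theta>\<close> will be a finite union of
  compact subintervals of the \<open>I\<^sub>n\<close>, on which \<open>D u\<close> must be reproduced; elsewhere it may be lost. The
  factor 2 comes from \<open>(a - b)\<^sup>2 \<le> 2a\<^sup>2 + 2b\<^sup>2\<close>, and \<open>\<delta>\<close> is the price of the increments
  outside \<open>\<Theta>\<close>; as it is arbitrary, it can be shared when two intervals are joined, so that no
  count of the pieces is needed.
\<close>

definition traceable :: "(real \<Rightarrow> real) \<Rightarrow> real set \<Rightarrow> real \<Rightarrow> real \<Rightarrow> real \<Rightarrow> bool" where
  "traceable u \<Theta> \<eta> p q \<longleftrightarrow> (\<forall>\<delta>>0. \<exists>f. f \<in> borel_measurable borel \<and> integrable lborel f \<and>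
     (\<forall>x. x \<notin> {p..q} \<longrightarrow> f x = 0) \<and> (\<integral>t. f t \<partial>lborel) = u q - u p \<and>
     (\<forall>x\<in>{p..q}. \<bar>(\<integral>t. indicator {..x} t * f t \<partial>lborel) - (u x - u p)\<bar> \<le> \<eta>) \<and>
     (\<integral>\<^sup>+x. ennreal ((f x * \<tau> x - D u x)\<^sup>2) * indicator {p..q} x \<partial>\<sigma>) \<le>
       2 * (\<integral>\<^sup>+x. ennreal ((D u x)\<^sup>2) * indicator ({p..q} - \<Theta>) x \<partial>\<sigma>) + ennreal \<delta>)"

text \<open>
  Inside one \<open>I\<^sub>n\<close> the density \<open>f = D u/\<tau>\<close> follows \<open>u\<close> exactly.
\<close>

lemma traceable_contained:
  assumes V: "version u u" and n: "n \<in> N" and sub: "{p..q} \<subseteq> I n" and pq: "p \<le> q" and \<eta>: "\<eta> \<ge> 0"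
  shows "traceable u \<Theta> \<eta> p q"
  unfolding traceable_def
proof (intro allI impI)
  fix \<delta> :: real assume \<delta>: "\<delta> > 0"
  note ftc = ftc_sigma[OF n version_interval(1)[OF V n] version_interval(3)[OF V n]]
  have [measurable]: "D u \<in> borel_measurable borel" by (rule D_measurable[OF V])
  define f where "f x = indicator {p..q} x * (D u x / \<tau> x)" for x
  have fm [measurable]: "f \<in> borel_measurable borel" unfolding f_def by measurable
  have f\<tau>: "AE x in \<sigma>. \<tau> x * f x = indicator {p..q} x * D u x"
    using tau_pos by (rule eventually_mono) (simp add: f_def)
  have trace: "integrable lborel (\<lambda>t. indicator {..x} t * f t)" "(\<integral>t. indicator {..x} t * f t \<partial>lborel) = u x - u p"
    if x: "x \<in> {p..q}" for x
  proof -
    have px: "p \<in> I n" "x \<in> I n" "p \<le> x" using x sub by auto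
    have eq: "(\<lambda>t. indicator G t * (indicator {..x} t * f t)) = (\<lambda>t. indicator {..x} t * f t)"
    proof
      fix t
      have "t \<in> G" if "t \<in> {p..q}" using that sub n by (auto simp: G_def)
      then show "indicator G t * (indicator {..x} t * f t) = indicator {..x} t * f t"
        by (simp add: f_def split: split_indicator)
    qed
    have ae: "AE t in \<sigma>. \<tau> t * (indicator {..x} t * f t) = indicator {p..x} t * D u t"
      using f\<tau>
    proof (rule eventually_mono)
      fix t assume t: "\<tau> t * f t = indicator {p..q} t * D u t"
      have "f t = 0" if "t < p" using that by (simp add: f_def)
      then show "\<tau> t * (indicator {..x} t * f t) = indicator {p..x} t * D u t"
        using t x by (cases "t \<in> {p..x}") (auto simp: indicator_def)
    qed
    have hm: "(\<lambda>t. indicator {..x} t * f t) \<in> borel_measurable borel" by measurable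
    have m1: "(\<lambda>t. \<tau> t * (indicator {..x} t * f t)) \<in> borel_measurable \<sigma>" by simp
    have m2: "(\<lambda>t. indicator {p..x} t * D u t) \<in> borel_measurable \<sigma>" by simp
    have "integrable \<sigma> (\<lambda>t. \<tau> t * (indicator {..x} t * f t))"
      using ftc(1)[OF px] integrable_cong_AE[OF m1 m2 ae] by simp
    then show "integrable lborel (\<lambda>t. indicator {..x} t * f t)"
      unfolding integral_tau(1)[OF hm] eq .
    show "(\<integral>t. indicator {..x} t * f t \<partial>lborel) = u x - u p"
      using ftc(2)[OF px] integral_cong_AE[OF m1 m2 ae] unfolding integral_tau(2)[OF hm] eq by simp
  qed
  have all: "(\<lambda>t. indicator {..q} t * f t) = f" by (auto simp: f_def split: split_indicator)
  have "integrable lborel f" "(\<integral>t. f t \<partial>lborel) = u q - u p" using trace[of q] pq unfolding all by auto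
  moreover have "(\<integral>\<^sup>+x. ennreal ((f x * \<tau> x - D u x)\<^sup>2) * indicator {p..q} x \<partial>\<sigma>) = (\<integral>\<^sup>+x. 0 \<partial>\<sigma>)"
  proof (rule nn_integral_cong_AE)
    show "AE x in \<sigma>. ennreal ((f x * \<tau> x - D u x)\<^sup>2) * indicator {p..q} x = 0"
      using f\<tau> by (rule eventually_mono) (simp add: mult.commute split: split_indicator)
  qed
  moreover have "f x = 0" if "x \<notin> {p..q}" for x using that by (simp add: f_def)
  ultimately show "\<exists>f. f \<in> borel_measurable borel \<and> integrable lborel f \<and>
     (\<forall>x. x \<notin> {p..q} \<longrightarrow> f x = 0) \<and> (\<integral>t. f t \<partial>lborel) = u q - u p \<and>
     (\<forall>x\<in>{p..q}. \<bar>(\<integral>t. indicator {..x} t * f t \<partial>lborel) - (u x - u p)\<bar> \<le> \<eta>) \<and>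
     (\<integral>\<^sup>+x. ennreal ((f x * \<tau> x - D u x)\<^sup>2) * indicator {p..q} x \<partial>\<sigma>) \<le>
       2 * (\<integral>\<^sup>+x. ennreal ((D u x)\<^sup>2) * indicator ({p..q} - \<Theta>) x \<partial>\<sigma>) + ennreal \<delta>"
    using fm trace(2) \<eta> by (intro exI[of _ f] conjI ballI allI impI) simp_all
qed

lemma traceable_refl:
  assumes "\<eta> \<ge> 0"
  shows "traceable u \<Theta> \<eta> p p"
  unfolding traceable_def
proof (intro allI impI)
  fix \<delta> :: real
  have "(\<integral>\<^sup>+x. ennreal ((0 * \<tau> x - D u x)\<^sup>2) * indicator {p..p} x \<partial>\<sigma>) = (\<integral>\<^sup>+x. 0 \<partial>\<sigma>)"
    by (rule nn_integral_cong_AE, rule eventually_mono[OF AE_not_in[OF null_singleton_sigma[of p]]]) auto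
  then have err: "(\<integral>\<^sup>+x. ennreal ((0 * \<tau> x - D u x)\<^sup>2) * indicator {p..p} x \<partial>\<sigma>) \<le>
       2 * (\<integral>\<^sup>+x. ennreal ((D u x)\<^sup>2) * indicator ({p..p} - \<Theta>) x \<partial>\<sigma>) + ennreal \<delta>"
    by (simp only: nn_integral_const mult_zero_left zero_le)
  show "\<exists>f. f \<in> borel_measurable borel \<and> integrable lborel f \<and>
     (\<forall>x. x \<notin> {p..p} \<longrightarrow> f x = 0) \<and> (\<integral>t. f t \<partial>lborel) = u p - u p \<and>
     (\<forall>x\<in>{p..p}. \<bar>(\<integral>t. indicator {..x} t * f t \<partial>lborel) - (u x - u p)\<bar> \<le> \<eta>) \<and>
     (\<integral>\<^sup>+x. ennreal ((f x * \<tau> x - D u x)\<^sup>2) * indicator {p..p} x \<partial>\<sigma>) \<le>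
       2 * (\<integral>\<^sup>+x. ennreal ((D u x)\<^sup>2) * indicator ({p..p} - \<Theta>) x \<partial>\<sigma>) + ennreal \<delta>"
    by (rule exI[of _ "\<lambda>_. 0"], intro conjI err) (use assms in auto)
qed

text \<open>
  The increment of \<open>u\<close> times a free bump. Its primitive runs between \<open>u(p)\<close> and \<open>u(q)\<close>, hence deviates
  from \<open>u\<close> by no more than the oscillation.
\<close>

lemma traceable_free:
  assumes V: "version u u" and pq: "p < q" and free: "\<not> (\<exists>n\<in>N. {p..q} \<subseteq> I n)"
    and osc: "\<And>x y. x \<in> {p..q} \<Longrightarrow> y \<in> {p..q} \<Longrightarrow> \<bar>u x - u y\<bar> \<le> \<eta>" and \<Theta>: "{p<..<q} \<inter> \<Theta> = {}" "\<Theta> \<in> sets borel"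
  shows "traceable u \<Theta> \<eta> p q"
  unfolding traceable_def
proof (intro allI impI)
  fix \<delta> :: real assume \<delta>: "\<delta> > 0"
  define c where "c = u q - u p"
  \<comment> \<open>the bump is scaled by \<open>c\<close>, and its energy by \<open>c\<^sup>2\<close>; the summand 1 covers \<open>c = 0\<close>\<close>
  define \<delta>' where "\<delta>' = \<delta> / (2 * c\<^sup>2 + 1)"
  have cc: "2 * c\<^sup>2 + 1 > 0" by (simp add: add_nonneg_pos)
  have \<delta>': "\<delta>' > 0" "2 * c\<^sup>2 * \<delta>' \<le> \<delta>" using \<delta> cc by (auto simp: \<delta>'_def field_simps)
  obtain f0 where f0: "f0 \<in> borel_measurable borel" "\<And>x. f0 x \<ge> 0" "\<And>x. x \<notin> {p..q} \<Longrightarrow> f0 x = 0"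
    "has_bochner_integral lborel f0 1" "(\<integral>\<^sup>+x. ennreal ((f0 x * \<tau> x)\<^sup>2) \<partial>\<sigma>) \<le> ennreal \<delta>'"
    using free_bump[OF pq free \<delta>'(1)] by blast
  note [measurable] = f0(1) D_measurable[OF V] \<Theta>(2)
  have int0: "integrable lborel f0" "integral\<^sup>L lborel f0 = 1" using f0(4) by (auto simp: has_bochner_integral_iff)
  define f where "f x = c * f0 x" for x
  have fm: "f \<in> borel_measurable borel" unfolding f_def by measurable
  have trace: "\<bar>(\<integral>t. indicator {..x} t * f t \<partial>lborel) - (u x - u p)\<bar> \<le> \<eta>" if x: "x \<in> {p..q}" for x
  proof -
    define \<theta> where "\<theta> = (\<integral>t. indicator {..x} t * f0 t \<partial>lborel)"
    have i: "integrable lborel (\<lambda>t. indicator {..x} t * f0 t)"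
      using integrable_mult_indicator[of "{..x}" lborel f0] int0(1) by simp
    have "\<theta> \<ge> 0" unfolding \<theta>_def using f0(2) by (intro integral_nonneg_AE) simp
    moreover have "\<theta> \<le> integral\<^sup>L lborel f0"
      unfolding \<theta>_def using f0(2) by (intro integral_mono i int0(1)) (simp split: split_indicator)
    ultimately have \<theta>: "0 \<le> \<theta>" "\<theta> \<le> 1" using int0(2) by auto
    have "(\<integral>t. indicator {..x} t * f t \<partial>lborel) = c * \<theta>"
    proof -
      have "(\<integral>t. indicator {..x} t * f t \<partial>lborel) = (\<integral>t. c * (indicator {..x} t * f0 t) \<partial>lborel)"
        by (simp add: f_def mult_ac)
      then show ?thesis by (simp add: \<theta>_def)
    qed
    then have "(\<integral>t. indicator {..x} t * f t \<partial>lborel) - (u x - u p) = \<theta> * (u q - u x) + (1 - \<theta>) * (u p - u x)"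
      by (simp add: c_def algebra_simps)
    also have "\<bar>\<dots>\<bar> \<le> \<theta> * \<bar>u q - u x\<bar> + (1 - \<theta>) * \<bar>u p - u x\<bar>"
      using \<theta> abs_triangle_ineq[of "\<theta> * (u q - u x)" "(1 - \<theta>) * (u p - u x)"] by (simp add: abs_mult)
    also have "\<dots> \<le> \<theta> * \<eta> + (1 - \<theta>) * \<eta>"
      using \<theta> osc x pq by (intro add_mono mult_left_mono) auto
    finally show ?thesis by (simp add: algebra_simps)
  qed
  have err: "(\<integral>\<^sup>+x. ennreal ((f x * \<tau> x - D u x)\<^sup>2) * indicator {p..q} x \<partial>\<sigma>) \<le>
       2 * (\<integral>\<^sup>+x. ennreal ((D u x)\<^sup>2) * indicator ({p..q} - \<Theta>) x \<partial>\<sigma>) + ennreal \<delta>"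
  proof -
    have "(\<integral>\<^sup>+x. ennreal ((f x * \<tau> x - D u x)\<^sup>2) * indicator {p..q} x \<partial>\<sigma>) \<le>
       (\<integral>\<^sup>+x. 2 * (ennreal ((D u x)\<^sup>2) * indicator ({p..q} - \<Theta>) x) + ennreal (2 * c\<^sup>2) * ennreal ((f0 x * \<tau> x)\<^sup>2) \<partial>\<sigma>)"
    proof (rule nn_integral_mono_AE)
      show "AE x in \<sigma>. ennreal ((f x * \<tau> x - D u x)\<^sup>2) * indicator {p..q} x \<le>
          2 * (ennreal ((D u x)\<^sup>2) * indicator ({p..q} - \<Theta>) x) + ennreal (2 * c\<^sup>2) * ennreal ((f0 x * \<tau> x)\<^sup>2)"
        using AE_not_in[OF null_singleton_sigma[of p]] AE_not_in[OF null_singleton_sigma[of q]]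
      proof eventually_elim
        case (elim x)
        have "(f x * \<tau> x - D u x)\<^sup>2 \<le> 2 * (D u x)\<^sup>2 + 2 * (f x * \<tau> x)\<^sup>2"
          using sum_squares_bound[of "f x * \<tau> x" "- D u x"] by (simp add: power2_diff)
        also have "2 * (f x * \<tau> x)\<^sup>2 = 2 * c\<^sup>2 * (f0 x * \<tau> x)\<^sup>2" by (simp add: f_def power_mult_distrib)
        finally have "ennreal ((f x * \<tau> x - D u x)\<^sup>2) \<le> ennreal (2 * (D u x)\<^sup>2 + 2 * c\<^sup>2 * (f0 x * \<tau> x)\<^sup>2)"
          by (rule ennreal_leI)
        also have "\<dots> = 2 * ennreal ((D u x)\<^sup>2) + ennreal (2 * c\<^sup>2) * ennreal ((f0 x * \<tau> x)\<^sup>2)"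
          by (subst ennreal_plus) (auto simp: ennreal_mult)
        finally have le: "ennreal ((f x * \<tau> x - D u x)\<^sup>2) \<le> 2 * ennreal ((D u x)\<^sup>2) + ennreal (2 * c\<^sup>2) * ennreal ((f0 x * \<tau> x)\<^sup>2)" .
        show ?case
        proof (cases "x \<in> {p..q}")
          case True
          then have "x \<in> {p<..<q}" using elim by auto
          then have "x \<notin> \<Theta>" using \<Theta>(1) by blast
          then show ?thesis using True le by simp
        qed simp
      qed
    qed
    also have "\<dots> = 2 * (\<integral>\<^sup>+x. ennreal ((D u x)\<^sup>2) * indicator ({p..q} - \<Theta>) x \<partial>\<sigma>) + ennreal (2 * c\<^sup>2) * (\<integral>\<^sup>+x. ennreal ((f0 x * \<tau> x)\<^sup>2) \<partial>\<sigma>)"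
      by (subst nn_integral_add) (auto simp: nn_integral_cmult)
    also have "\<dots> \<le> 2 * (\<integral>\<^sup>+x. ennreal ((D u x)\<^sup>2) * indicator ({p..q} - \<Theta>) x \<partial>\<sigma>) + ennreal (2 * c\<^sup>2) * ennreal \<delta>'"
      using f0(5) by (intro add_left_mono mult_left_mono) auto
    also have "ennreal (2 * c\<^sup>2) * ennreal \<delta>' = ennreal (2 * c\<^sup>2 * \<delta>')" using \<delta>'(1) by (intro ennreal_mult[symmetric]) auto
    also have "\<dots> \<le> ennreal \<delta>" using \<delta>'(2) by (rule ennreal_leI)
    finally show ?thesis by (simp add: add_left_mono)
  qed
  have f_eq: "f = (\<lambda>x. c * f0 x)" by (simp add: f_def fun_eq_iff)
  have "integrable lborel f" "(\<integral>t. f t \<partial>lborel) = u q - u p"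
    using int0 unfolding f_eq by (simp_all add: c_def)
  moreover have "f x = 0" if "x \<notin> {p..q}" for x using f0(3)[OF that] by (simp add: f_def)
  ultimately show "\<exists>f. f \<in> borel_measurable borel \<and> integrable lborel f \<and>
     (\<forall>x. x \<notin> {p..q} \<longrightarrow> f x = 0) \<and> (\<integral>t. f t \<partial>lborel) = u q - u p \<and>
     (\<forall>x\<in>{p..q}. \<bar>(\<integral>t. indicator {..x} t * f t \<partial>lborel) - (u x - u p)\<bar> \<le> \<eta>) \<and>
     (\<integral>\<^sup>+x. ennreal ((f x * \<tau> x - D u x)\<^sup>2) * indicator {p..q} x \<partial>\<sigma>) \<le>
       2 * (\<integral>\<^sup>+x. ennreal ((D u x)\<^sup>2) * indicator ({p..q} - \<Theta>) x \<partial>\<sigma>) + ennreal \<delta>"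
    using fm trace err by (intro exI[of _ f] conjI ballI allI impI) simp_all
qed

lemma traceable_trans:
  assumes V: "version u u" and T1: "traceable u \<Theta> \<eta> p b" and T2: "traceable u \<Theta> \<eta> b q" and pbq: "p \<le> b" "b \<le> q"
    and \<Theta>: "\<Theta> \<in> sets borel"
  shows "traceable u \<Theta> \<eta> p q"
  unfolding traceable_def
proof (intro allI impI)
  fix \<delta> :: real assume "\<delta> > 0"
  then have \<delta>: "\<delta> / 2 > 0" by simp
  obtain f where f: "f \<in> borel_measurable borel" "integrable lborel f" "\<And>x. x \<notin> {p..b} \<Longrightarrow> f x = 0"
    "(\<integral>t. f t \<partial>lborel) = u b - u p" "\<And>x. x \<in> {p..b} \<Longrightarrow> \<bar>(\<integral>t. indicator {..x} t * f t \<partial>lborel) - (u x - u p)\<bar> \<le> \<eta>"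
    "(\<integral>\<^sup>+x. ennreal ((f x * \<tau> x - D u x)\<^sup>2) * indicator {p..b} x \<partial>\<sigma>) \<le>
       2 * (\<integral>\<^sup>+x. ennreal ((D u x)\<^sup>2) * indicator ({p..b} - \<Theta>) x \<partial>\<sigma>) + ennreal (\<delta> / 2)"
    using T1[unfolded traceable_def, rule_format, OF \<delta>] by blast
  obtain g where g: "g \<in> borel_measurable borel" "integrable lborel g" "\<And>x. x \<notin> {b..q} \<Longrightarrow> g x = 0"
    "(\<integral>t. g t \<partial>lborel) = u q - u b" "\<And>x. x \<in> {b..q} \<Longrightarrow> \<bar>(\<integral>t. indicator {..x} t * g t \<partial>lborel) - (u x - u b)\<bar> \<le> \<eta>"
    "(\<integral>\<^sup>+x. ennreal ((g x * \<tau> x - D u x)\<^sup>2) * indicator {b..q} x \<partial>\<sigma>) \<le>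
       2 * (\<integral>\<^sup>+x. ennreal ((D u x)\<^sup>2) * indicator ({b..q} - \<Theta>) x \<partial>\<sigma>) + ennreal (\<delta> / 2)"
    using T2[unfolded traceable_def, rule_format, OF \<delta>] by blast
  note [measurable] = f(1) g(1) D_measurable[OF V] \<Theta>
  let ?h = "\<lambda>x. f x + g x"
  have trace: "\<bar>(\<integral>t. indicator {..x} t * ?h t \<partial>lborel) - (u x - u p)\<bar> \<le> \<eta>" if x: "x \<in> {p..q}" for x
  proof -
    have i: "integrable lborel (\<lambda>t. indicator {..x} t * f t)" "integrable lborel (\<lambda>t. indicator {..x} t * g t)"
      using integrable_mult_indicator[of "{..x}" lborel f] integrable_mult_indicator[of "{..x}" lborel g] f(2) g(2) by simp_all
    have split: "(\<integral>t. indicator {..x} t * ?h t \<partial>lborel) = (\<integral>t. indicator {..x} t * f t \<partial>lborel) + (\<integral>t. indicator {..x} t * g t \<partial>lborel)"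
      using i by (simp add: distrib_left)
    show ?thesis
    proof (cases "x \<le> b")
      case True
      have "AE t in lborel. indicator {..x} t * g t = 0"
        using AE_lborel_singleton[of b] by (rule eventually_mono) (use True g(3) in \<open>auto split: split_indicator\<close>)
      then have "(\<integral>t. indicator {..x} t * g t \<partial>lborel) = 0" by (rule integral_eq_zero_AE)
      then show ?thesis using f(5)[of x] x True split by simp
    next
      case False
      have "(\<lambda>t. indicator {..x} t * f t) = f"
      proof
        fix t show "indicator {..x} t * f t = f t" using f(3)[of t] False by (cases "t \<in> {p..b}") auto
      qed
      then show ?thesis using g(5)[of x] x False split f(4) by simp
    qed
  qed
  have ind: "AE x in \<sigma>. ennreal ((?h x * \<tau> x - D u x)\<^sup>2) * indicator {p..q} x =
      ennreal ((f x * \<tau> x - D u x)\<^sup>2) * indicator {p..b} x + ennreal ((g x * \<tau> x - D u x)\<^sup>2) * indicator {b..q} x"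
    using AE_not_in[OF null_singleton_sigma[of b]]
  proof (rule eventually_mono)
    fix x assume x: "x \<notin> {b}"
    then consider "x < b" | "x > b" by force
    then show "ennreal ((?h x * \<tau> x - D u x)\<^sup>2) * indicator {p..q} x =
      ennreal ((f x * \<tau> x - D u x)\<^sup>2) * indicator {p..b} x + ennreal ((g x * \<tau> x - D u x)\<^sup>2) * indicator {b..q} x"
    proof cases
      case 1
      then show ?thesis using g(3)[of x] pbq by (auto split: split_indicator)
    next
      case 2
      then show ?thesis using f(3)[of x] pbq by (auto split: split_indicator)
    qed
  qed
  have ind2: "AE x in \<sigma>. ennreal ((D u x)\<^sup>2) * indicator ({p..q} - \<Theta>) x =
      ennreal ((D u x)\<^sup>2) * indicator ({p..b} - \<Theta>) x + ennreal ((D u x)\<^sup>2) * indicator ({b..q} - \<Theta>) x"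
    using AE_not_in[OF null_singleton_sigma[of b]]
    by (rule eventually_mono) (use pbq in \<open>auto split: split_indicator\<close>)
  have "(\<integral>\<^sup>+x. ennreal ((?h x * \<tau> x - D u x)\<^sup>2) * indicator {p..q} x \<partial>\<sigma>) =
      (\<integral>\<^sup>+x. ennreal ((f x * \<tau> x - D u x)\<^sup>2) * indicator {p..b} x \<partial>\<sigma>) + (\<integral>\<^sup>+x. ennreal ((g x * \<tau> x - D u x)\<^sup>2) * indicator {b..q} x \<partial>\<sigma>)"
    unfolding nn_integral_cong_AE[OF ind] by (intro nn_integral_add) auto
  also have "\<dots> \<le> (2 * (\<integral>\<^sup>+x. ennreal ((D u x)\<^sup>2) * indicator ({p..b} - \<Theta>) x \<partial>\<sigma>) + ennreal (\<delta> / 2)) +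
      (2 * (\<integral>\<^sup>+x. ennreal ((D u x)\<^sup>2) * indicator ({b..q} - \<Theta>) x \<partial>\<sigma>) + ennreal (\<delta> / 2))"
    by (intro add_mono f(6) g(6))
  also have "\<dots> = 2 * ((\<integral>\<^sup>+x. ennreal ((D u x)\<^sup>2) * indicator ({p..b} - \<Theta>) x \<partial>\<sigma>) + (\<integral>\<^sup>+x. ennreal ((D u x)\<^sup>2) * indicator ({b..q} - \<Theta>) x \<partial>\<sigma>))
      + (ennreal (\<delta> / 2) + ennreal (\<delta> / 2))"
    by (simp only: distrib_left ac_simps)
  also have "(\<integral>\<^sup>+x. ennreal ((D u x)\<^sup>2) * indicator ({p..b} - \<Theta>) x \<partial>\<sigma>) + (\<integral>\<^sup>+x. ennreal ((D u x)\<^sup>2) * indicator ({b..q} - \<Theta>) x \<partial>\<sigma>)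
      = (\<integral>\<^sup>+x. ennreal ((D u x)\<^sup>2) * indicator ({p..q} - \<Theta>) x \<partial>\<sigma>)"
    unfolding nn_integral_cong_AE[OF ind2] by (intro nn_integral_add[symmetric]) auto
  also have "ennreal (\<delta> / 2) + ennreal (\<delta> / 2) = ennreal \<delta>" using \<open>\<delta> > 0\<close> by (subst ennreal_plus[symmetric]) auto
  finally have err: "(\<integral>\<^sup>+x. ennreal ((?h x * \<tau> x - D u x)\<^sup>2) * indicator {p..q} x \<partial>\<sigma>) \<le>
       2 * (\<integral>\<^sup>+x. ennreal ((D u x)\<^sup>2) * indicator ({p..q} - \<Theta>) x \<partial>\<sigma>) + ennreal \<delta>" .
  have "f x + g x = 0" if "x \<notin> {p..q}" for x using f(3)[of x] g(3)[of x] that pbq by auto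
  moreover have "(\<integral>t. ?h t \<partial>lborel) = u q - u p" using f(2,4) g(2,4) by simp
  ultimately show "\<exists>f. f \<in> borel_measurable borel \<and> integrable lborel f \<and>
     (\<forall>x. x \<notin> {p..q} \<longrightarrow> f x = 0) \<and> (\<integral>t. f t \<partial>lborel) = u q - u p \<and>
     (\<forall>x\<in>{p..q}. \<bar>(\<integral>t. indicator {..x} t * f t \<partial>lborel) - (u x - u p)\<bar> \<le> \<eta>) \<and>
     (\<integral>\<^sup>+x. ennreal ((f x * \<tau> x - D u x)\<^sup>2) * indicator {p..q} x \<partial>\<sigma>) \<le>
       2 * (\<integral>\<^sup>+x. ennreal ((D u x)\<^sup>2) * indicator ({p..q} - \<Theta>) x \<partial>\<sigma>) + ennreal \<delta>"
    using f(1,2) g(1,2) trace err by (intro exI[of _ ?h] conjI ballI allI impI) simp_all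
qed

text \<open>
  By bisection it suffices to start or end at a fixed point \<open>x\<close> and go a short way. To either side,
  either a short interval at \<open>x\<close> lies in one \<open>I\<^sub>n\<close>, or no such interval does; in that case \<open>\<Theta>\<close> stays away from
  that side of \<open>x\<close>, since it consists of finitely many compact subintervals of the \<open>I\<^sub>n\<close>, and a free bump
  can be used on any short interval.
\<close>

lemma traceable_interval:
  assumes V: "version u u" and cont: "continuous_on UNIV u" and \<eta>: "\<eta> > 0"
    and A: "finite A" "A \<subseteq> N" "\<And>n. n \<in> A \<Longrightarrow> P n \<in> I n \<and> Q n \<in> I n" and pq: "p \<le> q"
  shows "traceable u (\<Union>n\<in>A. {P n..Q n}) \<eta> p q"
proof -
  let ?\<Theta> = "\<Union>n\<in>A. {P n..Q n}"
  have \<Theta>: "?\<Theta> \<in> sets borel" using A(1) by auto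
  have osc: "\<exists>d>0. \<forall>y z. \<bar>y - x\<bar> < d \<longrightarrow> \<bar>z - x\<bar> < d \<longrightarrow> \<bar>u y - u z\<bar> \<le> \<eta>" for x
  proof -
    have "isCont u x" using cont by (simp add: continuous_on_eq_continuous_at)
    then obtain d where d: "d > 0" "\<And>y. \<bar>y - x\<bar> < d \<Longrightarrow> \<bar>u y - u x\<bar> < \<eta> / 2"
      using \<eta> unfolding continuous_at_eps_delta dist_real_def by (metis half_gt_zero)
    have "\<bar>u y - u z\<bar> \<le> \<eta>" if "\<bar>y - x\<bar> < d" "\<bar>z - x\<bar> < d" for y z
      using d(2)[OF that(1)] d(2)[OF that(2)] by linarith
    then show ?thesis using d(1) by blast
  qed
  have right: "\<exists>r>0. \<forall>z. x < z \<and> z < x + r \<longrightarrow> traceable u ?\<Theta> \<eta> x z" for x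
  proof (cases "\<exists>n\<in>N. \<exists>z>x. {x..z} \<subseteq> I n")
    case True
    then obtain n z0 where n: "n \<in> N" "z0 > x" "{x..z0} \<subseteq> I n" by blast
    have "traceable u ?\<Theta> \<eta> x z" if "x < z" "z < x + (z0 - x)" for z
    proof (rule traceable_contained[OF V n(1)])
      show "{x..z} \<subseteq> I n" by (rule order_trans[OF _ n(3)]) (use that in auto)
    qed (use that \<eta> in auto)
    then show ?thesis using n(2) by (intro exI[of _ "z0 - x"]) auto
  next
    case False
    have "\<exists>r>0. {x<..<x + r} \<inter> {P n..Q n} = {}" if n: "n \<in> A" for n
    proof -
      consider "x < P n" | "Q n \<le> x" | "P n \<le> x" "x < Q n" by linarith
      then show ?thesis
      proof cases
        case 1
        then show ?thesis by (intro exI[of _ "P n - x"]) auto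
      next
        case 2
        then show ?thesis by (intro exI[of _ 1]) auto
      next
        case 3
        have nN: "n \<in> N" using A(2) n by blast
        have "{x..Q n} \<subseteq> {P n..Q n}" using 3 by auto
        also have "\<dots> \<subseteq> I n" using scale_interval.Icc_sub_J[OF scale[OF nN]] A(3)[OF n] by blast
        finally show ?thesis using False nN 3 by blast
      qed
    qed
    then obtain r where r: "\<And>n. n \<in> A \<Longrightarrow> r n > 0" "\<And>n. n \<in> A \<Longrightarrow> {x<..<x + r n} \<inter> {P n..Q n} = {}" by metis
    obtain d where d: "d > 0" "\<And>y z. \<bar>y - x\<bar> < d \<Longrightarrow> \<bar>z - x\<bar> < d \<Longrightarrow> \<bar>u y - u z\<bar> \<le> \<eta>" using osc[of x] by blast
    define \<rho> where "\<rho> = Min (insert d (r ` A))"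
    have \<rho>: "\<rho> > 0" "\<rho> \<le> d" "\<And>n. n \<in> A \<Longrightarrow> \<rho> \<le> r n" unfolding \<rho>_def using A(1) d(1) r(1) by auto
    have "traceable u ?\<Theta> \<eta> x z" if z: "x < z" "z < x + \<rho>" for z
    proof (rule traceable_free[OF V z(1)])
      show "\<not> (\<exists>n\<in>N. {x..z} \<subseteq> I n)" using False z(1) by blast
      show "\<bar>u y - u y'\<bar> \<le> \<eta>" if "y \<in> {x..z}" "y' \<in> {x..z}" for y y'
        using that z \<rho>(2) by (intro d(2)) auto
      have "{x<..<z} \<inter> {P n..Q n} = {}" if n: "n \<in> A" for n
      proof -
        have "{x<..<z} \<subseteq> {x<..<x + r n}" using z \<rho>(3)[OF n] by auto
        then show ?thesis using r(2)[OF n] by blast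
      qed
      then show "{x<..<z} \<inter> ?\<Theta> = {}" by blast
    qed (rule \<Theta>)
    then show ?thesis using \<rho>(1) by blast
  qed
  have left: "\<exists>r>0. \<forall>z. x - r < z \<and> z < x \<longrightarrow> traceable u ?\<Theta> \<eta> z x" for x
  proof (cases "\<exists>n\<in>N. \<exists>z<x. {z..x} \<subseteq> I n")
    case True
    then obtain n z0 where n: "n \<in> N" "z0 < x" "{z0..x} \<subseteq> I n" by blast
    have "traceable u ?\<Theta> \<eta> z x" if "x - (x - z0) < z" "z < x" for z
    proof (rule traceable_contained[OF V n(1)])
      show "{z..x} \<subseteq> I n" by (rule order_trans[OF _ n(3)]) (use that in auto)
    qed (use that \<eta> in auto)
    then show ?thesis using n(2) by (intro exI[of _ "x - z0"]) auto
  next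
    case False
    have "\<exists>r>0. {x - r<..<x} \<inter> {P n..Q n} = {}" if n: "n \<in> A" for n
    proof -
      consider "Q n < x" | "x \<le> P n" | "P n < x" "x \<le> Q n" by linarith
      then show ?thesis
      proof cases
        case 1
        then show ?thesis by (intro exI[of _ "x - Q n"]) auto
      next
        case 2
        then show ?thesis by (intro exI[of _ 1]) auto
      next
        case 3
        have nN: "n \<in> N" using A(2) n by blast
        have "{P n..x} \<subseteq> {P n..Q n}" using 3 by auto
        also have "\<dots> \<subseteq> I n" using scale_interval.Icc_sub_J[OF scale[OF nN]] A(3)[OF n] by blast
        finally show ?thesis using False nN 3 by blast
      qed
    qed
    then obtain r where r: "\<And>n. n \<in> A \<Longrightarrow> r n > 0" "\<And>n. n \<in> A \<Longrightarrow> {x - r n<..<x} \<inter> {P n..Q n} = {}" by metis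
    obtain d where d: "d > 0" "\<And>y z. \<bar>y - x\<bar> < d \<Longrightarrow> \<bar>z - x\<bar> < d \<Longrightarrow> \<bar>u y - u z\<bar> \<le> \<eta>" using osc[of x] by blast
    define \<rho> where "\<rho> = Min (insert d (r ` A))"
    have \<rho>: "\<rho> > 0" "\<rho> \<le> d" "\<And>n. n \<in> A \<Longrightarrow> \<rho> \<le> r n" unfolding \<rho>_def using A(1) d(1) r(1) by auto
    have "traceable u ?\<Theta> \<eta> z x" if z: "x - \<rho> < z" "z < x" for z
    proof (rule traceable_free[OF V z(2)])
      show "\<not> (\<exists>n\<in>N. {z..x} \<subseteq> I n)" using False z(2) by blast
      show "\<bar>u y - u y'\<bar> \<le> \<eta>" if "y \<in> {z..x}" "y' \<in> {z..x}" for y y'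
        using that z \<rho>(2) by (intro d(2)) auto
      have "{z<..<x} \<inter> {P n..Q n} = {}" if n: "n \<in> A" for n
      proof -
        have "{z<..<x} \<subseteq> {x - r n<..<x}" using z \<rho>(3)[OF n] by auto
        then show ?thesis using r(2)[OF n] by blast
      qed
      then show "{z<..<x} \<inter> ?\<Theta> = {}" by blast
    qed (rule \<Theta>)
    then show ?thesis using \<rho>(1) by blast
  qed
  show ?thesis
  proof (rule Bolzano[where P = "traceable u ?\<Theta> \<eta>", OF pq])
    fix a b c assume "traceable u ?\<Theta> \<eta> a b" "traceable u ?\<Theta> \<eta> b c" "a \<le> b" "b \<le> c"
    then show "traceable u ?\<Theta> \<eta> a c" by (rule traceable_trans[OF V _ _ _ _ \<Theta>])
  next
    fix x
    obtain r where r: "r > 0" "\<And>z. x < z \<Longrightarrow> z < x + r \<Longrightarrow> traceable u ?\<Theta> \<eta> x z" using right[of x] by blast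
    obtain l where l: "l > 0" "\<And>z. x - l < z \<Longrightarrow> z < x \<Longrightarrow> traceable u ?\<Theta> \<eta> z x" using left[of x] by blast
    have refl: "traceable u ?\<Theta> \<eta> x x" using \<eta> by (intro traceable_refl) simp
    show "\<exists>d>0. \<forall>a b. a \<le> x \<and> x \<le> b \<and> b - a < d \<longrightarrow> traceable u ?\<Theta> \<eta> a b"
    proof (intro exI[of _ "min l r"] conjI allI impI)
      fix a b assume ab: "a \<le> x \<and> x \<le> b \<and> b - a < min l r"
      have 1: "traceable u ?\<Theta> \<eta> a x" using l(2)[of a] refl ab by (cases "a = x") auto
      have 2: "traceable u ?\<Theta> \<eta> x b" using r(2)[of b] refl ab by (cases "b = x") auto
      show "traceable u ?\<Theta> \<eta> a b" by (rule traceable_trans[OF V 1 2 _ _ \<Theta>]) (use ab in auto)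
    qed (use l(1) r(1) in simp)
  qed
qed

end

section \<open>Density of the test functions\<close>

lemma ennreal_double: "2 * ennreal z = ennreal (2 * z)"
  by (simp add: ennreal_mult')

text \<open>
  The mean value 0 makes the primitive vanish again on the right of the support.
\<close>

lemma primitive_Cc_infty:
  assumes h: "smooth h" "\<And>x. x \<notin> {a<..<b} \<Longrightarrow> h x = 0" and ab: "a < b" and int0: "(\<integral>t. h t \<partial>lborel) = 0"
  obtains \<phi> where "\<phi> \<in> Cc_infty" "\<And>x. deriv \<phi> x = h x" "\<And>x. x \<notin> {a<..<b} \<Longrightarrow> \<phi> x = 0"
    "\<And>x. \<phi> x = (\<integral>t. indicator {..x} t * h t \<partial>lborel)"
proof -
  have cont: "continuous_on UNIV h" by (rule smooth_continuous[OF h(1)])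
  obtain H where H: "\<And>x. (H has_real_derivative h x) (at x)" using ex_primitive[OF cont] by blast
  have ftc: "(\<integral>t. indicator {x..y} t * h t \<partial>lborel) = H y - H x" if "x \<le> y" for x y
  proof -
    have "(\<integral>t. h t * indicator {x..y} t \<partial>lborel) = H y - H x"
      using that H cont by (intro integral_FTC_Icc_real) (auto simp: continuous_on_eq_continuous_at)
    then show ?thesis by (simp add: mult.commute)
  qed
  define \<phi> where "\<phi> x = H x - H a" for x
  have \<phi>': "(\<phi> has_real_derivative h x) (at x)" for x
    unfolding \<phi>_def by (auto intro!: derivative_eq_intros H)
  have left: "\<phi> x = 0" if "x \<le> a" for x
  proof -
    have "(\<lambda>t. indicator {x..a} t * h t) = (\<lambda>t. 0)" using h(2) by (auto simp: fun_eq_iff split: split_indicator)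
    then show ?thesis using ftc[OF that] by (simp add: \<phi>_def)
  qed
  have trace: "\<phi> x = (\<integral>t. indicator {..x} t * h t \<partial>lborel)" for x
  proof (cases "x \<le> a")
    case True
    then have "(\<lambda>t. indicator {..x} t * h t) = (\<lambda>t. 0)" using h(2) by (auto simp: fun_eq_iff split: split_indicator)
    then show ?thesis using left[OF True] by simp
  next
    case False
    then have "(\<lambda>t. indicator {..x} t * h t) = (\<lambda>t. indicator {a..x} t * h t)"
      using h(2) by (auto simp: fun_eq_iff split: split_indicator)
    then show ?thesis using ftc[of a x] False by (simp add: \<phi>_def)
  qed
  have right: "\<phi> x = 0" if "x \<ge> b" for x
  proof -
    have "(\<lambda>t. indicator {..x} t * h t) = h" using h(2) that by (auto simp: fun_eq_iff split: split_indicator)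
    then show ?thesis using trace[of x] int0 by simp
  qed
  have out: "\<phi> x = 0" if "x \<notin> {a<..<b}" for x using that left[of x] right[of x] by force
  have "smooth \<phi>" by (rule smooth_primitive[OF \<phi>' h(1)])
  moreover have "\<phi> x = 0" if "\<bar>a\<bar> + \<bar>b\<bar> < \<bar>x\<bar>" for x using that by (intro out) auto
  ultimately have "\<phi> \<in> Cc_infty" unfolding Cc_infty_iff by blast
  then show ?thesis using DERIV_imp_deriv[OF \<phi>'] out trace by (rule that)
qed

context form_setting begin

text \<open>
  The function \<open>u \<circ> T\<^sub>n\<close> vanishes near \<open>y\<close> if \<open>T\<^sub>n(y) \<in> W\<close>, because \<open>T\<^sub>n\<close> is continuous at \<open>y\<close>.
\<close>

lemma D_zero_open:
  assumes W: "open W" and u: "\<And>x. x \<in> W \<Longrightarrow> u x = 0"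
  shows "AE x in \<sigma>. x \<in> W \<longrightarrow> D u x = 0"
proof (rule AE_sigmaI)
  fix n assume n: "n \<in> N"
  show "AE y in lborel. y \<in> Y n \<longrightarrow> T n y \<in> W \<longrightarrow> D u (T n y) = 0"
    using T_deriv_nonneg[OF n]
  proof (rule eventually_mono)
    fix y assume y: "y \<in> Y n \<longrightarrow> y \<in> interior (Y n) \<and> (T n has_real_derivative T_deriv n y) (at y) \<and> T_deriv n y \<ge> 0"
    show "y \<in> Y n \<longrightarrow> T n y \<in> W \<longrightarrow> D u (T n y) = 0"
    proof (intro impI)
      assume yY: "y \<in> Y n" and yW: "T n y \<in> W"
      have "isCont (T n) y" using y yY DERIV_isCont by blast
      then have "(T n \<longlongrightarrow> T n y) (nhds y)" by (simp add: isCont_def tendsto_at_iff_tendsto_nhds)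
      then have "\<forall>\<^sub>F z in nhds y. T n z \<in> W" using W yW by (rule topological_tendstoD)
      then have ev: "\<forall>\<^sub>F z in nhds y. (u \<circ> T n) z = 0" by (rule eventually_mono) (simp add: u)
      have "((u \<circ> T n) has_real_derivative 0) (at y)"
        by (rule DERIV_cong_ev[OF refl ev refl, THEN iffD2]) simp
      then show "D u (T n y) = 0" using D_T[OF n yY, of u] by (simp add: DERIV_imp_deriv)
    qed
  qed
qed

text \<open>
  An instance of \<open>\<tau> d\<sigma> = 1\<^sub>G dx\<close>; off \<open>G\<close> the left integrand vanishes.
\<close>

lemma nn_integral_weighted:
  assumes [measurable]: "f \<in> borel_measurable borel" "U \<in> sets borel"
  shows "(\<integral>\<^sup>+x. ennreal ((f x)\<^sup>2 * \<tau> x) * indicator U x \<partial>lborel) = (\<integral>\<^sup>+x. ennreal ((f x * \<tau> x)\<^sup>2) * indicator U x \<partial>\<sigma>)"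
proof -
  have "(\<integral>\<^sup>+x. ennreal ((f x * \<tau> x)\<^sup>2) * indicator U x \<partial>\<sigma>) =
      (\<integral>\<^sup>+x. ennreal (\<tau> x) * (ennreal ((f x)\<^sup>2 * \<tau> x) * indicator U x) \<partial>\<sigma>)"
  proof (rule nn_integral_cong)
    fix x
    have "(f x * \<tau> x)\<^sup>2 = \<tau> x * ((f x)\<^sup>2 * \<tau> x)" by (simp add: power2_eq_square mult_ac)
    then show "ennreal ((f x * \<tau> x)\<^sup>2) * indicator U x = ennreal (\<tau> x) * (ennreal ((f x)\<^sup>2 * \<tau> x) * indicator U x)"
      using tau_nonneg[of x] by (simp add: ennreal_mult mult.assoc)
  qed
  also have "\<dots> = (\<integral>\<^sup>+x. ennreal (indicator G x) * (ennreal ((f x)\<^sup>2 * \<tau> x) * indicator U x) \<partial>lborel)"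
    by (rule nn_integral_tau) measurable
  also have "\<dots> = (\<integral>\<^sup>+x. ennreal ((f x)\<^sup>2 * \<tau> x) * indicator U x \<partial>lborel)"
    by (rule nn_integral_cong) (simp add: tau_outside split: split_indicator)
  finally show ?thesis by simp
qed

lemma weighted_size_eq:
  assumes [measurable]: "f \<in> borel_measurable borel" "U \<in> sets borel"
  shows "weighted_size U \<tau> f = (\<integral>\<^sup>+x. ennreal \<bar>f x\<bar> * indicator U x \<partial>lborel) + (\<integral>\<^sup>+x. ennreal ((f x * \<tau> x)\<^sup>2) * indicator U x \<partial>\<sigma>)"
proof -
  have "weighted_size U \<tau> f = (\<integral>\<^sup>+x. ennreal \<bar>f x\<bar> * indicator U x + ennreal ((f x)\<^sup>2 * \<tau> x) * indicator U x \<partial>lborel)"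
    unfolding weighted_size_def using tau_nonneg
    by (intro nn_integral_cong) (simp add: ennreal_plus[symmetric] split: split_indicator del: ennreal_plus)
  also have "\<dots> = (\<integral>\<^sup>+x. ennreal \<bar>f x\<bar> * indicator U x \<partial>lborel) + (\<integral>\<^sup>+x. ennreal ((f x)\<^sup>2 * \<tau> x) * indicator U x \<partial>lborel)"
    by (rule nn_integral_add) auto
  finally show ?thesis by (simp only: nn_integral_weighted[OF assms])
qed

lemma weighted_size_one_finite: "weighted_size {- R<..<R} \<tau> (\<lambda>x. 1) < \<infinity>"
proof -
  have "(\<integral>\<^sup>+x. ennreal \<bar>1\<bar> * indicator {- R<..<R} x \<partial>lborel) < \<infinity>"
    by (cases "R \<ge> 0") (auto simp: nn_integral_cmult_indicator)
  moreover have "(\<integral>\<^sup>+x. ennreal ((1 * \<tau> x)\<^sup>2) * indicator {- R<..<R} x \<partial>\<sigma>) \<le> (\<integral>\<^sup>+x. ennreal (indicator {- R..R} x * (\<tau> x)\<^sup>2) \<partial>\<sigma>)"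
    by (rule nn_integral_mono) (auto split: split_indicator)
  moreover have "(\<integral>\<^sup>+x. ennreal (indicator {- R..R} x * (\<tau> x)\<^sup>2) \<partial>\<sigma>) < \<infinity>"
    using tau_square_integrable[of R] by (simp add: integrable_iff_bounded)
  ultimately show ?thesis
    by (subst weighted_size_eq) (auto simp: less_top[symmetric] top_unique)
qed

text \<open>
  A smooth approximation of \<open>f\<close> has nearly the same integral as \<open>f\<close>, namely nearly 0; a small multiple of a
  fixed bump corrects it. The larger interval leaves room for smoothing at the ends.
\<close>

lemma ex_smooth_mean_zero:
  assumes R: "R \<ge> 0" and f: "f \<in> borel_measurable borel" "integrable lborel f" "\<And>x. x \<notin> {- R..R} \<Longrightarrow> f x = 0"
    and f0: "(\<integral>t. f t \<partial>lborel) = 0" and fin: "(\<integral>\<^sup>+x. ennreal ((f x * \<tau> x)\<^sup>2) \<partial>\<sigma>) < \<infinity>" and \<rho>: "\<rho> > 0"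
  obtains h where "smooth h" "\<And>x. x \<notin> {- R - 1<..<R + 1} \<Longrightarrow> h x = 0" "(\<integral>t. h t \<partial>lborel) = 0" "integrable lborel h"
    "weighted_size {- R - 1<..<R + 1} \<tau> (\<lambda>x. f x - h x) < ennreal \<rho>"
proof -
  define U where "U = {- R - 1<..<R + 1}"
  have U: "open U" "U \<in> sets borel" by (auto simp: U_def)
  have U_eq: "U = {- (R + 1)<..<R + 1}" by (auto simp: U_def)
  note [measurable] = f(1)
  have one: "weighted_size U \<tau> (\<lambda>x. 1) < \<infinity>" unfolding U_eq by (rule weighted_size_one_finite)
  have wf: "weighted_size U \<tau> f < \<infinity>"
  proof -
    have "(\<integral>\<^sup>+x. ennreal \<bar>f x\<bar> * indicator U x \<partial>lborel) \<le> (\<integral>\<^sup>+x. ennreal (norm (f x)) \<partial>lborel)"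
      by (rule nn_integral_mono) (simp split: split_indicator)
    moreover have "(\<integral>\<^sup>+x. ennreal (norm (f x)) \<partial>lborel) < \<infinity>" using f(2) by (simp add: integrable_iff_bounded)
    moreover have "(\<integral>\<^sup>+x. ennreal ((f x * \<tau> x)\<^sup>2) * indicator U x \<partial>\<sigma>) \<le> (\<integral>\<^sup>+x. ennreal ((f x * \<tau> x)\<^sup>2) \<partial>\<sigma>)"
      by (rule nn_integral_mono) (simp split: split_indicator)
    ultimately show ?thesis unfolding weighted_size_eq[OF f(1) U(2)] using fin
      by (simp add: order_le_less_trans)
  qed
  have smooth_int: "integrable lborel g" if g: "smooth g" "\<And>x. x \<notin> U \<Longrightarrow> g x = 0" for g
  proof -
    have "set_integrable lborel {- R - 1..R + 1} g"
      using smooth_continuous[OF g(1)] by (intro borel_integrable_atLeastAtMost') (rule continuous_on_subset, auto)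
    moreover have "(\<lambda>x. indicator {- R - 1..R + 1} x *\<^sub>R g x) = g"
      using g(2) by (auto simp: fun_eq_iff U_def split: split_indicator)
    ultimately show ?thesis by (simp add: set_integrable_def)
  qed
  obtain b where b: "smooth b" "\<And>x. 0 \<le> b x" "\<And>x. b x \<le> 1" "\<And>x. 0 \<le> x \<Longrightarrow> x \<le> 1 / 2 \<Longrightarrow> b x = 1"
    "\<And>x. x \<le> 0 - 1 / 4 \<or> x \<ge> 1 / 2 + 1 / 4 \<Longrightarrow> b x = 0"
    using ex_smooth_plateau[of "1 / 4" 0 "1 / 2"] by auto
  have bU: "b x = 0" if "x \<notin> U" for x using that R by (intro b(5)) (auto simp: U_def)
  have bi: "integrable lborel b" by (rule smooth_int[OF b(1) bU])
  define \<beta> where "\<beta> = (\<integral>x. b x \<partial>lborel)"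
  have "emeasure lborel {0..1 / 2 :: real} < \<infinity>"
    by (rule order_le_less_trans[OF emeasure_mono[of _ "{0..1}"]]) auto
  then have ii: "integrable lborel (indicator {0..1 / 2 :: real} :: real \<Rightarrow> real)"
    by (intro integrable_real_indicator) auto
  have "(\<integral>x. indicator {0..1 / 2 :: real} x \<partial>lborel) \<le> \<beta>" unfolding \<beta>_def
    by (rule integral_mono[OF ii bi]) (use b(2,4) in \<open>auto split: split_indicator\<close>)
  then have \<beta>: "\<beta> \<ge> 1 / 2" by simp
  have bm [measurable]: "b \<in> borel_measurable borel" by (intro borel_measurable_continuous_onI smooth_continuous b(1))
  have "weighted_size U \<tau> b \<le> weighted_size U \<tau> (\<lambda>x. 1)"
    by (rule weighted_size_mono[OF U(1) tau_measurable tau_nonneg]) (use b(2,3) in simp)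
  then have "weighted_size U \<tau> b < \<infinity>" using one by (rule order_le_less_trans)
  then obtain K where K: "weighted_size U \<tau> b = ennreal K" "K \<ge> 0" by (cases "weighted_size U \<tau> b") auto
  \<comment> \<open>\<open>2r\<close> from the approximation and \<open>12 r K\<close> from the correction stay below \<open>\<rho>\<close>; the bound 1 absorbs the square of the correction factor\<close>
  define r where "r = min 1 (\<rho> / (3 + 12 * K))"
  have r: "r > 0" "r \<le> 1" "r * (2 + 12 * K) < \<rho>"
  proof -
    show r0: "r > 0" "r \<le> 1" using \<rho> K(2) by (auto simp: r_def intro!: divide_pos_pos add_pos_nonneg)
    have k3: "3 + 12 * K > 0" using K(2) by simp
    have "r \<le> \<rho> / (3 + 12 * K)" by (simp add: r_def)
    then have "r * (3 + 12 * K) \<le> \<rho>" using k3 by (simp add: pos_le_divide_eq)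
    then show "r * (2 + 12 * K) < \<rho>" using r0(1) by (simp add: algebra_simps)
  qed
  obtain g where g: "smooth g" "\<And>x. x \<notin> U \<Longrightarrow> g x = 0" "weighted_size U \<tau> (\<lambda>x. f x - g x) < ennreal r"
    using smooth_approximation[OF U(1) tau_measurable tau_nonneg one wf f(1)] r(1)
    unfolding smoothly_approximable_def[OF U(1) tau_measurable tau_nonneg] by blast
  have gi: "integrable lborel g" by (rule smooth_int[OF g(1,2)])
  have gm [measurable]: "g \<in> borel_measurable borel" by (intro borel_measurable_continuous_onI smooth_continuous g(1))
  have fU: "f x = 0" if "x \<notin> U" for x using that by (intro f(3)) (auto simp: U_def)
  define c where "c = (\<integral>x. g x \<partial>lborel)"
  have c: "\<bar>c\<bar> \<le> r"
  proof -
    have "ennreal \<bar>c\<bar> = ennreal (norm (\<integral>x. f x - g x \<partial>lborel))" using f0 f(2) gi by (simp add: c_def)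
    also have "\<dots> \<le> (\<integral>\<^sup>+x. ennreal (norm (f x - g x)) \<partial>lborel)"
      using f(2) gi by (intro integral_norm_bound_ennreal) auto
    also have "\<dots> = (\<integral>\<^sup>+x. ennreal \<bar>f x - g x\<bar> * indicator U x \<partial>lborel)"
      by (rule nn_integral_cong) (use fU g(2) in \<open>auto split: split_indicator\<close>)
    also have "\<dots> \<le> weighted_size U \<tau> (\<lambda>x. f x - g x)" by (subst weighted_size_eq) (use U in auto)
    also have "\<dots> \<le> ennreal r" using g(3) by simp
    finally show ?thesis using r(1) by simp
  qed
  define c' where "c' = c / \<beta>"
  have c': "\<bar>c'\<bar> + c'\<^sup>2 \<le> 6 * r"
  proof -
    have 1: "\<bar>c'\<bar> \<le> 2 * r"
    proof -
      have "\<bar>c'\<bar> = \<bar>c\<bar> / \<beta>" using \<beta> by (simp add: c'_def)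
      also have "\<dots> \<le> r / (1 / 2)" using c \<beta> r(1) by (intro frac_le) auto
      finally show ?thesis by simp
    qed
    have "\<bar>c'\<bar>\<^sup>2 \<le> (2 * r)\<^sup>2" by (intro power_mono 1) simp
    then have "c'\<^sup>2 \<le> (2 * r)\<^sup>2" by (simp only: power2_abs)
    also have "\<dots> \<le> 4 * r" using r(1,2) by (simp add: power2_eq_square)
    finally show ?thesis using 1 by linarith
  qed
  define h where "h x = g x - c' * b x" for x
  show thesis
  proof (rule that[of h, folded U_def])
    show "smooth h" unfolding h_def by (intro smooth_diff smooth_mult smooth_const g(1) b(1))
    show "h x = 0" if "x \<notin> U" for x using that g(2) bU by (simp add: h_def)
    show "integrable lborel h" using gi bi by (simp add: h_def[abs_def])
    show "(\<integral>t. h t \<partial>lborel) = 0" using gi bi \<beta> by (simp add: h_def[abs_def] c_def[symmetric] \<beta>_def[symmetric] c'_def)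
    have "weighted_size U \<tau> (\<lambda>x. f x - h x) = weighted_size U \<tau> (\<lambda>x. (f x - g x) + c' * b x)" by (simp add: h_def algebra_simps)
    also have "\<dots> \<le> 2 * weighted_size U \<tau> (\<lambda>x. f x - g x) + 2 * weighted_size U \<tau> (\<lambda>x. c' * b x)"
      by (rule weighted_size_add[OF U(1) tau_measurable tau_nonneg]) measurable
    also have "\<dots> \<le> 2 * ennreal r + 2 * (ennreal (6 * r) * ennreal K)"
    proof (intro add_mono mult_left_mono)
      show "weighted_size U \<tau> (\<lambda>x. f x - g x) \<le> ennreal r" using g(3) by simp
      have "weighted_size U \<tau> (\<lambda>x. c' * b x) \<le> ennreal (\<bar>c'\<bar> + c'\<^sup>2) * weighted_size U \<tau> b"
        by (rule weighted_size_cmult[OF U(1) tau_measurable tau_nonneg bm])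
      also have "\<dots> \<le> ennreal (6 * r) * ennreal K" unfolding K(1) using c' by (intro mult_right_mono ennreal_leI) auto
      finally show "weighted_size U \<tau> (\<lambda>x. c' * b x) \<le> ennreal (6 * r) * ennreal K" .
    qed auto
    also have "\<dots> = ennreal (r * (2 + 12 * K))"
    proof -
      have "ennreal (6 * r) * ennreal K = ennreal (6 * r * K)"
        using r(1) K(2) by (intro ennreal_mult[symmetric]) auto
      then have "2 * ennreal r + 2 * (ennreal (6 * r) * ennreal K) = ennreal (2 * r) + ennreal (2 * (6 * r * K))"
        by (simp only: ennreal_double)
      also have "\<dots> = ennreal (2 * r + 2 * (6 * r * K))" using r(1) K(2) by (intro ennreal_plus[symmetric]) auto
      also have "2 * r + 2 * (6 * r * K) = r * (2 + 12 * K)" by (simp add: algebra_simps)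
      finally show ?thesis .
    qed
    also have "\<dots> < ennreal \<rho>" using r(3) \<rho> by (intro ennreal_lessI) auto
    finally show "weighted_size U \<tau> (\<lambda>x. f x - h x) < ennreal \<rho>" .
  qed
qed

end

context isolated_setting begin

text \<open>
  The energy of \<open>u\<close> off \<open>\<Theta>\<^sub>k\<close> tends to 0 as the compact sets \<open>\<Theta>\<^sub>k\<close> exhaust \<open>G\<close>, so a late \<open>\<Theta>\<^sub>k\<close> in
  \<open>traceable_interval\<close> leaves a small total error.
\<close>

lemma ex_trace:
  assumes u: "u \<in> F" "continuous_on UNIV u" and \<eta>: "\<eta> > 0" and \<delta>: "\<delta> > 0" and pq: "p \<le> q"
  obtains f where "f \<in> borel_measurable borel" "integrable lborel f" "\<And>x. x \<notin> {p..q} \<Longrightarrow> f x = 0"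
    "(\<integral>t. f t \<partial>lborel) = u q - u p"
    "\<And>x. x \<in> {p..q} \<Longrightarrow> \<bar>(\<integral>t. indicator {..x} t * f t \<partial>lborel) - (u x - u p)\<bar> \<le> \<eta>"
    "(\<integral>\<^sup>+x. ennreal ((f x * \<tau> x - D u x)\<^sup>2) * indicator {p..q} x \<partial>\<sigma>) \<le> ennreal \<delta>"
proof -
  have V: "version u u" by (rule version_self[OF u])
  note [measurable] = D_measurable[OF V]
  obtain P Q where PQ: "\<And>n k. n \<in> N \<Longrightarrow> P n k \<in> I n \<and> Q n k \<in> I n \<and> P n k \<le> Q n k"
    "incseq (\<lambda>k. \<Union>n\<in>{n \<in> N. n \<le> k}. {P n k..Q n k})" "(\<Union>k. \<Union>n\<in>{n \<in> N. n \<le> k}. {P n k..Q n k}) = G"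
    "\<And>k. emeasure \<sigma> (\<Union>n\<in>{n \<in> N. n \<le> k}. {P n k..Q n k}) < \<infinity>"
    by (rule compact_exhaustion) (rule that)
  define \<Theta> where "\<Theta> k = (\<Union>n\<in>{n \<in> N. n \<le> k}. {P n k..Q n k})" for k
  have \<Theta>: "incseq \<Theta>" "(\<Union>k. \<Theta> k) = G" unfolding \<Theta>_def by (rule PQ(2), rule PQ(3))
  have \<Theta>m [measurable]: "\<Theta> k \<in> sets borel" for k unfolding \<Theta>_def by auto
  define \<nu> where "\<nu> = density \<sigma> (\<lambda>x. ennreal ((D u x)\<^sup>2))"
  have \<nu>: "emeasure \<nu> A = (\<integral>\<^sup>+x. ennreal ((D u x)\<^sup>2) * indicator A x \<partial>\<sigma>)" if "A \<in> sets borel" for A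
    unfolding \<nu>_def by (rule emeasure_density) (use that in auto)
  have fin: "(\<integral>\<^sup>+x. ennreal ((D u x)\<^sup>2) \<partial>\<sigma>) < \<infinity>"
    using D_square_integrable[OF u(1) V] by (simp add: integrable_iff_bounded)
  have "(\<lambda>k. emeasure \<nu> ({p..q} - \<Theta> k)) \<longlonglongrightarrow> emeasure \<nu> (\<Inter>k. {p..q} - \<Theta> k)"
  proof (rule Lim_emeasure_decseq)
    show "range (\<lambda>k. {p..q} - \<Theta> k) \<subseteq> sets \<nu>" by (auto simp: \<nu>_def)
    show "decseq (\<lambda>k. {p..q} - \<Theta> k)" using \<Theta>(1) by (auto simp: incseq_def decseq_def)
    show "emeasure \<nu> ({p..q} - \<Theta> k) \<noteq> \<infinity>" for k
    proof -
      have "emeasure \<nu> ({p..q} - \<Theta> k) \<le> (\<integral>\<^sup>+x. ennreal ((D u x)\<^sup>2) \<partial>\<sigma>)"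
        by (subst \<nu>) (auto intro!: nn_integral_mono split: split_indicator)
      then show ?thesis using fin by (auto simp: top_unique)
    qed
  qed
  also have "(\<Inter>k. {p..q} - \<Theta> k) = {p..q} - G" using \<Theta>(2) by blast
  also have "emeasure \<nu> ({p..q} - G) = 0"
  proof -
    have "emeasure \<nu> ({p..q} - G) = (\<integral>\<^sup>+x. 0 \<partial>\<sigma>)"
      by (subst \<nu>, simp, rule nn_integral_cong_AE, rule eventually_mono[OF AE_not_in[OF null_compl_G]]) auto
    then show ?thesis by simp
  qed
  finally have "(\<lambda>k. emeasure \<nu> ({p..q} - \<Theta> k)) \<longlonglongrightarrow> 0" .
  then have "\<forall>\<^sub>F k in sequentially. emeasure \<nu> ({p..q} - \<Theta> k) < ennreal (\<delta> / 4)"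
    by (rule order_tendstoD(2)) (use \<delta> in simp)
  then obtain k where "emeasure \<nu> ({p..q} - \<Theta> k) < ennreal (\<delta> / 4)"
    by (auto simp: eventually_sequentially)
  then have k: "(\<integral>\<^sup>+x. ennreal ((D u x)\<^sup>2) * indicator ({p..q} - \<Theta> k) x \<partial>\<sigma>) \<le> ennreal (\<delta> / 4)" by (subst (asm) \<nu>) auto
  have tr: "traceable u (\<Theta> k) \<eta> p q" unfolding \<Theta>_def
    by (rule traceable_interval[OF V u(2) \<eta>]) (use PQ(1) pq in auto)
  have "\<delta> / 2 > 0" using \<delta> by simp
  from tr[unfolded traceable_def, rule_format, OF this] obtain f where f: "f \<in> borel_measurable borel" "integrable lborel f" "\<And>x. x \<notin> {p..q} \<Longrightarrow> f x = 0"
    "(\<integral>t. f t \<partial>lborel) = u q - u p"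
    "\<And>x. x \<in> {p..q} \<Longrightarrow> \<bar>(\<integral>t. indicator {..x} t * f t \<partial>lborel) - (u x - u p)\<bar> \<le> \<eta>"
    "(\<integral>\<^sup>+x. ennreal ((f x * \<tau> x - D u x)\<^sup>2) * indicator {p..q} x \<partial>\<sigma>) \<le>
       2 * (\<integral>\<^sup>+x. ennreal ((D u x)\<^sup>2) * indicator ({p..q} - \<Theta> k) x \<partial>\<sigma>) + ennreal (\<delta> / 2)"
    by blast
  note f(6)
  also have "2 * (\<integral>\<^sup>+x. ennreal ((D u x)\<^sup>2) * indicator ({p..q} - \<Theta> k) x \<partial>\<sigma>) + ennreal (\<delta> / 2) \<le> 2 * ennreal (\<delta> / 4) + ennreal (\<delta> / 2)"
    by (intro add_right_mono mult_left_mono k) simp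
  also have "\<dots> = ennreal \<delta>"
  proof -
    have "2 * ennreal (\<delta> / 4) + ennreal (\<delta> / 2) = ennreal (2 * (\<delta> / 4)) + ennreal (\<delta> / 2)"
      by (simp only: ennreal_double)
    also have "\<dots> = ennreal (2 * (\<delta> / 4) + \<delta> / 2)" using \<delta> by (intro ennreal_plus[symmetric]) auto
    finally show ?thesis by simp
  qed
  finally have "(\<integral>\<^sup>+x. ennreal ((f x * \<tau> x - D u x)\<^sup>2) * indicator {p..q} x \<partial>\<sigma>) \<le> ennreal \<delta>" .
  with f(1-5) show thesis by (rule that)
qed

text \<open>
  With \<open>f\<close> following \<open>u\<close>, \<open>h\<close> a smooth approximation of \<open>f\<close> with mean 0, and \<open>\<phi>\<close> the primitive of \<open>h\<close>, we have
  \<open>D u - D \<phi> = (D u - f \<tau>) + (f - h) \<tau>\<close> almost everywhere, and \<open>|u - \<phi>| \<le> 2\<rho>\<close> on a fixed bounded interval, off which both vanish.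
\<close>

lemma ex_Cc_infty_near:
  assumes u: "u \<in> F" "u \<in> Cc" and \<epsilon>: "\<epsilon> > 0"
  obtains \<phi> where "\<phi> \<in> Cc_infty" "(\<integral>x. (D u x - D \<phi> x)\<^sup>2 \<partial>\<sigma>) < \<epsilon>" "(\<integral>x. (u x - \<phi> x)\<^sup>2 \<partial>m) < \<epsilon>"
proof -
  have cont: "continuous_on UNIV u" using u(2) by (simp add: Cc_iff)
  obtain R0 where R0: "\<And>x. R0 < \<bar>x\<bar> \<Longrightarrow> u x = 0" using u(2) by (auto simp: Cc_iff)
  define R where "R = \<bar>R0\<bar> + 1"
  have R: "R > 0" "\<And>x. R \<le> \<bar>x\<bar> \<Longrightarrow> u x = 0" by (auto simp: R_def intro!: R0)
  have V: "version u u" by (rule version_self[OF u(1) cont])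
  define C where "C = measure m {- R - 1..R + 1}"
  have C: "C \<ge> 0" by (simp add: C_def)
  \<comment> \<open>\<open>\<integral>(u - \<phi>)\<^sup>2 dm \<le> C (2\<rho>)\<^sup>2 \<le> 4 \<rho> C \<le> \<epsilon>/2\<close>, using \<open>\<rho> \<le> 1\<close>, and the energy error is at most \<open>2 (\<epsilon>/16) + 2\<rho> < \<epsilon>\<close>\<close>
  define \<rho> where "\<rho> = min 1 (\<epsilon> / (8 * (C + 1)))"
  have \<rho>: "\<rho> > 0" "\<rho> \<le> 1" "4 * \<rho> * C \<le> \<epsilon> / 2" "\<rho> \<le> \<epsilon> / 8"
  proof -
    show 1: "\<rho> > 0" "\<rho> \<le> 1" using \<epsilon> C by (auto simp: \<rho>_def)
    have "\<rho> \<le> \<epsilon> / (8 * (C + 1))" by (simp add: \<rho>_def)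
    then have 2: "\<rho> * (8 * (C + 1)) \<le> \<epsilon>" using C by (simp add: pos_le_divide_eq)
    have "\<rho> * C \<ge> 0" using 1 C by simp
    then show "4 * \<rho> * C \<le> \<epsilon> / 2" "\<rho> \<le> \<epsilon> / 8" using 2 1 by (simp_all add: algebra_simps)
  qed
  have \<delta>: "\<epsilon> / 16 > 0" using \<epsilon> by simp
  obtain f where f: "f \<in> borel_measurable borel" "integrable lborel f" "\<And>x. x \<notin> {- R..R} \<Longrightarrow> f x = 0"
    "(\<integral>t. f t \<partial>lborel) = u R - u (- R)"
    "\<And>x. x \<in> {- R..R} \<Longrightarrow> \<bar>(\<integral>t. indicator {..x} t * f t \<partial>lborel) - (u x - u (- R))\<bar> \<le> \<rho>"
    "(\<integral>\<^sup>+x. ennreal ((f x * \<tau> x - D u x)\<^sup>2) * indicator {- R..R} x \<partial>\<sigma>) \<le> ennreal (\<epsilon> / 16)"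
    using ex_trace[OF u(1) cont \<rho>(1) \<delta>, of "- R" R] R(1) by auto
  have uR: "u R = 0" "u (- R) = 0" using R by auto
  have f0: "(\<integral>t. f t \<partial>lborel) = 0" using f(4) uR by simp
  note [measurable] = f(1) D_measurable[OF V]
  have D_out: "AE x in \<sigma>. x \<in> - {- R..R} \<longrightarrow> D u x = 0"
    by (rule D_zero_open) (auto intro!: R(2))
  have sq: "(a + b)\<^sup>2 \<le> 2 * a\<^sup>2 + 2 * b\<^sup>2" for a b :: real
    using sum_squares_bound[of a b] by (simp add: power2_sum)
  have fin: "(\<integral>\<^sup>+x. ennreal ((f x * \<tau> x)\<^sup>2) \<partial>\<sigma>) < \<infinity>"
  proof -
    have "(\<integral>\<^sup>+x. ennreal ((f x * \<tau> x)\<^sup>2) \<partial>\<sigma>) \<le>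
        (\<integral>\<^sup>+x. 2 * (ennreal ((f x * \<tau> x - D u x)\<^sup>2) * indicator {- R..R} x) + 2 * ennreal ((D u x)\<^sup>2) \<partial>\<sigma>)"
    proof (rule nn_integral_mono)
      fix x
      show "ennreal ((f x * \<tau> x)\<^sup>2) \<le> 2 * (ennreal ((f x * \<tau> x - D u x)\<^sup>2) * indicator {- R..R} x) + 2 * ennreal ((D u x)\<^sup>2)"
      proof (cases "x \<in> {- R..R}")
        case True
        have "ennreal ((f x * \<tau> x)\<^sup>2) \<le> ennreal (2 * (f x * \<tau> x - D u x)\<^sup>2 + 2 * (D u x)\<^sup>2)"
          using sq[of "f x * \<tau> x - D u x" "D u x"] by (intro ennreal_leI) simp
        also have "\<dots> = 2 * ennreal ((f x * \<tau> x - D u x)\<^sup>2) + 2 * ennreal ((D u x)\<^sup>2)"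
          by (subst ennreal_plus) (auto simp: ennreal_mult)
        finally show ?thesis using True by simp
      qed (simp add: f(3))
    qed
    also have "\<dots> = 2 * (\<integral>\<^sup>+x. ennreal ((f x * \<tau> x - D u x)\<^sup>2) * indicator {- R..R} x \<partial>\<sigma>) + 2 * (\<integral>\<^sup>+x. ennreal ((D u x)\<^sup>2) \<partial>\<sigma>)"
      by (subst nn_integral_add) (auto simp: nn_integral_cmult)
    also have "\<dots> < \<infinity>"
    proof -
      have "(\<integral>\<^sup>+x. ennreal ((f x * \<tau> x - D u x)\<^sup>2) * indicator {- R..R} x \<partial>\<sigma>) < \<infinity>"
        using f(6) by (rule order_le_less_trans) simp
      moreover have "(\<integral>\<^sup>+x. ennreal ((D u x)\<^sup>2) \<partial>\<sigma>) < \<infinity>"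
        using D_square_integrable[OF u(1) V] by (simp add: integrable_iff_bounded)
      ultimately show ?thesis by (simp add: ennreal_mult_less_top)
    qed
    finally show ?thesis .
  qed
  define U where "U = {- R - 1<..<R + 1}"
  obtain h where h: "smooth h" "\<And>x. x \<notin> U \<Longrightarrow> h x = 0" "(\<integral>t. h t \<partial>lborel) = 0" "integrable lborel h"
    "weighted_size U \<tau> (\<lambda>x. f x - h x) < ennreal \<rho>"
    unfolding U_def using ex_smooth_mean_zero[OF less_imp_le[OF R(1)] f(1-3) f0 fin \<rho>(1)] by blast
  have hm [measurable]: "h \<in> borel_measurable borel" by (intro borel_measurable_continuous_onI smooth_continuous h(1))
  have Um [measurable]: "U \<in> sets borel" by (simp add: U_def)
  obtain \<phi> where \<phi>: "\<phi> \<in> Cc_infty" "\<And>x. deriv \<phi> x = h x" "\<And>x. x \<notin> U \<Longrightarrow> \<phi> x = 0"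
    "\<And>x. \<phi> x = (\<integral>t. indicator {..x} t * h t \<partial>lborel)"
    unfolding U_def by (rule primitive_Cc_infty[of h "- R - 1" "R + 1"]) (use h R(1) in \<open>auto simp: U_def\<close>)
  have weight: "(\<integral>\<^sup>+x. ennreal \<bar>f x - h x\<bar> * indicator U x \<partial>lborel) \<le> ennreal \<rho>"
    "(\<integral>\<^sup>+x. ennreal (((f x - h x) * \<tau> x)\<^sup>2) * indicator U x \<partial>\<sigma>) \<le> ennreal \<rho>"
  proof -
    have eq: "weighted_size U \<tau> (\<lambda>x. f x - h x) = (\<integral>\<^sup>+x. ennreal \<bar>f x - h x\<bar> * indicator U x \<partial>lborel) +
        (\<integral>\<^sup>+x. ennreal (((f x - h x) * \<tau> x)\<^sup>2) * indicator U x \<partial>\<sigma>)"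
      by (rule weighted_size_eq) measurable
    show "(\<integral>\<^sup>+x. ennreal \<bar>f x - h x\<bar> * indicator U x \<partial>lborel) \<le> ennreal \<rho>"
      by (rule order_trans[OF _ less_imp_le[OF h(5)]], unfold eq) simp
    show "(\<integral>\<^sup>+x. ennreal (((f x - h x) * \<tau> x)\<^sup>2) * indicator U x \<partial>\<sigma>) \<le> ennreal \<rho>"
      by (rule order_trans[OF _ less_imp_le[OF h(5)]], unfold eq) simp
  qed
  have fh: "\<bar>(\<integral>t. indicator {..x} t * f t \<partial>lborel) - \<phi> x\<bar> \<le> \<rho>" for x
  proof -
    have i: "integrable lborel (\<lambda>t. indicator {..x} t * f t)" "integrable lborel (\<lambda>t. indicator {..x} t * h t)"
      using integrable_mult_indicator[of "{..x}" lborel f] integrable_mult_indicator[of "{..x}" lborel h] f(2) h(4) by simp_all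
    have "ennreal \<bar>(\<integral>t. indicator {..x} t * f t \<partial>lborel) - \<phi> x\<bar> =
        ennreal (norm (\<integral>t. indicator {..x} t * f t - indicator {..x} t * h t \<partial>lborel))"
      using i by (simp add: \<phi>(4))
    also have "\<dots> \<le> (\<integral>\<^sup>+t. ennreal (norm (indicator {..x} t * f t - indicator {..x} t * h t)) \<partial>lborel)"
      using i by (intro integral_norm_bound_ennreal) auto
    also have "\<dots> \<le> (\<integral>\<^sup>+t. ennreal \<bar>f t - h t\<bar> * indicator U t \<partial>lborel)"
    proof (rule nn_integral_mono)
      fix t
      have "f t = 0" if "t \<notin> U" using that by (intro f(3)) (auto simp: U_def)
      then show "ennreal (norm (indicator {..x} t * f t - indicator {..x} t * h t)) \<le> ennreal \<bar>f t - h t\<bar> * indicator U t"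
        using h(2)[of t] by (auto split: split_indicator)
    qed
    also have "\<dots> \<le> ennreal \<rho>" by (rule weight(1))
    finally show ?thesis using \<rho>(1) by simp
  qed
  have near: "\<bar>u x - \<phi> x\<bar> \<le> 2 * \<rho>" for x
  proof -
    consider "x \<in> {- R..R}" | "x < - R" | "x > R" by force
    then have "\<bar>(\<integral>t. indicator {..x} t * f t \<partial>lborel) - u x\<bar> \<le> \<rho>"
    proof cases
      case 1
      then show ?thesis using f(5)[of x] uR by simp
    next
      case 2
      then have "(\<lambda>t. indicator {..x} t * f t) = (\<lambda>t. 0)" using f(3) by (auto simp: fun_eq_iff split: split_indicator)
      then show ?thesis using R(2)[of x] 2 R(1) \<rho>(1) by simp
    next
      case 3
      then have "(\<lambda>t. indicator {..x} t * f t) = f" using f(3) by (auto simp: fun_eq_iff split: split_indicator)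
      then show ?thesis using R(2)[of x] 3 R(1) \<rho>(1) f0 by simp
    qed
    then show ?thesis using fh[of x] by linarith
  qed
  have \<phi>F: "\<phi> \<in> F" "version \<phi> \<phi>" using Cc_infty_version[OF \<phi>(1)] by auto
  note [measurable] = D_measurable[OF \<phi>F(2)]
  have "(\<integral>x. (u x - \<phi> x)\<^sup>2 \<partial>m) \<le> (\<integral>x. indicator {- R - 1..R + 1} x * (2 * \<rho>)\<^sup>2 \<partial>m)"
  proof (rule integral_mono)
    show "integrable m (\<lambda>x. (u x - \<phi> x)\<^sup>2)" using F_L2[OF F_diff(1)[OF u(1) \<phi>F(1)]] by (simp add: L2_def)
    show "integrable m (\<lambda>x. indicator {- R - 1..R + 1} x * (2 * \<rho>)\<^sup>2)"
      using m_Icc_finite[of "- R - 1" "R + 1"] by (intro integrable_mult_left integrable_real_indicator) auto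
    fix x
    show "(u x - \<phi> x)\<^sup>2 \<le> indicator {- R - 1..R + 1} x * (2 * \<rho>)\<^sup>2"
    proof (cases "x \<in> {- R - 1..R + 1}")
      case True
      have "\<bar>u x - \<phi> x\<bar>\<^sup>2 \<le> (2 * \<rho>)\<^sup>2" by (intro power_mono near) simp
      then have "(u x - \<phi> x)\<^sup>2 \<le> (2 * \<rho>)\<^sup>2" by (simp only: power2_abs)
      then show ?thesis using True by simp
    next
      case False
      then have "u x = 0" "\<phi> x = 0" using R(1) by (auto intro!: R(2) \<phi>(3) simp: U_def)
      then show ?thesis using False by simp
    qed
  qed
  also have "\<dots> = C * (2 * \<rho>)\<^sup>2" by (simp add: C_def)
  also have "\<dots> \<le> C * (4 * \<rho>)" using \<rho>(1,2) C by (intro mult_left_mono) (auto simp: power2_eq_square)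
  also have "\<dots> < \<epsilon>" using \<rho>(3) \<epsilon> by (simp add: mult_ac)
  finally have L2: "(\<integral>x. (u x - \<phi> x)\<^sup>2 \<partial>m) < \<epsilon>" .
  have "(\<integral>\<^sup>+x. ennreal ((D u x - D \<phi> x)\<^sup>2) \<partial>\<sigma>) \<le>
      (\<integral>\<^sup>+x. 2 * (ennreal ((f x * \<tau> x - D u x)\<^sup>2) * indicator {- R..R} x) +
        2 * (ennreal (((f x - h x) * \<tau> x)\<^sup>2) * indicator U x) \<partial>\<sigma>)"
  proof (rule nn_integral_mono_AE)
    show "AE x in \<sigma>. ennreal ((D u x - D \<phi> x)\<^sup>2) \<le> 2 * (ennreal ((f x * \<tau> x - D u x)\<^sup>2) * indicator {- R..R} x) +
        2 * (ennreal (((f x - h x) * \<tau> x)\<^sup>2) * indicator U x)"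
      using D_Cc_infty[OF \<phi>(1)] D_out
    proof eventually_elim
      case (elim x)
      have D\<phi>: "D \<phi> x = h x * \<tau> x" using elim(1) by (simp add: \<phi>(2))
      show ?case
      proof (cases "x \<in> {- R..R}")
        case True
        then have xU: "x \<in> U" by (auto simp: U_def)
        have "(D u x - D \<phi> x)\<^sup>2 = ((D u x - f x * \<tau> x) + (f x - h x) * \<tau> x)\<^sup>2" by (simp add: D\<phi> algebra_simps)
        also have "\<dots> \<le> 2 * (D u x - f x * \<tau> x)\<^sup>2 + 2 * ((f x - h x) * \<tau> x)\<^sup>2" by (rule sq)
        also have "(D u x - f x * \<tau> x)\<^sup>2 = (f x * \<tau> x - D u x)\<^sup>2" by (rule power2_commute)
        finally have "ennreal ((D u x - D \<phi> x)\<^sup>2) \<le> ennreal (2 * (f x * \<tau> x - D u x)\<^sup>2 + 2 * ((f x - h x) * \<tau> x)\<^sup>2)"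
          by (rule ennreal_leI)
        also have "\<dots> = 2 * ennreal ((f x * \<tau> x - D u x)\<^sup>2) + 2 * ennreal (((f x - h x) * \<tau> x)\<^sup>2)"
          by (subst ennreal_plus) (auto simp: ennreal_mult)
        finally show ?thesis using True xU by simp
      next
        case False
        then have z: "D u x = 0" "f x = 0" using elim(2) f(3) by auto
        show ?thesis
        proof (cases "x \<in> U")
          case True
          have "ennreal ((D u x - D \<phi> x)\<^sup>2) = 1 * ennreal (((f x - h x) * \<tau> x)\<^sup>2)" using z D\<phi> by simp
          also have "\<dots> \<le> 2 * ennreal (((f x - h x) * \<tau> x)\<^sup>2)" by (intro mult_right_mono) auto
          finally show ?thesis using True False by simp
        next
          case out: False
          then show ?thesis using z D\<phi> h(2)[of x] by simp
        qed
      qed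
    qed
  qed
  also have "\<dots> = 2 * (\<integral>\<^sup>+x. ennreal ((f x * \<tau> x - D u x)\<^sup>2) * indicator {- R..R} x \<partial>\<sigma>) +
      2 * (\<integral>\<^sup>+x. ennreal (((f x - h x) * \<tau> x)\<^sup>2) * indicator U x \<partial>\<sigma>)"
    by (subst nn_integral_add) (auto simp: nn_integral_cmult)
  also have "\<dots> \<le> 2 * ennreal (\<epsilon> / 16) + 2 * ennreal \<rho>" by (intro add_mono mult_left_mono f(6) weight(2)) auto
  also have "\<dots> = ennreal (2 * (\<epsilon> / 16) + 2 * \<rho>)"
  proof -
    have "2 * ennreal (\<epsilon> / 16) + 2 * ennreal \<rho> = ennreal (2 * (\<epsilon> / 16)) + ennreal (2 * \<rho>)"
      by (simp only: ennreal_double)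
    also have "\<dots> = ennreal (2 * (\<epsilon> / 16) + 2 * \<rho>)" using \<epsilon> \<rho>(1) by (intro ennreal_plus[symmetric]) auto
    finally show ?thesis .
  qed
  finally have le: "(\<integral>\<^sup>+x. ennreal ((D u x - D \<phi> x)\<^sup>2) \<partial>\<sigma>) \<le> ennreal (2 * (\<epsilon> / 16) + 2 * \<rho>)" .
  have "(\<integral>x. (D u x - D \<phi> x)\<^sup>2 \<partial>\<sigma>) = enn2real (\<integral>\<^sup>+x. ennreal ((D u x - D \<phi> x)\<^sup>2) \<partial>\<sigma>)"
    by (rule integral_eq_nn_integral) auto
  also have "\<dots> \<le> 2 * (\<epsilon> / 16) + 2 * \<rho>" using le \<epsilon> \<rho>(1) by (intro enn2real_leI) auto
  also have "\<dots> < \<epsilon>" using \<rho>(4) \<epsilon> by simp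
  finally have "(\<integral>x. (D u x - D \<phi> x)\<^sup>2 \<partial>\<sigma>) < \<epsilon>" .
  then show thesis using \<phi>(1) L2 by (intro that)
qed

text \<open>
  Regularity of the form reduces the claim to functions in \<open>F\<close> that are continuous with compact support.
\<close>

theorem Cc_infty_dense: "E1_dense_in m E Cc_infty F"
  unfolding E1_dense_in_def
proof (intro ballI allI impI)
  fix w and \<epsilon> :: real assume w: "w \<in> F" and \<epsilon>: "\<epsilon> > 0"
  have "\<epsilon> / 4 > 0" using \<epsilon> by simp
  then obtain v where v: "v \<in> F" "v \<in> Cc" and wv: "E1_norm m E (\<lambda>x. w x - v x) < \<epsilon> / 4"
    using regular w unfolding regular_form_def E1_dense_in_def by blast
  have "\<epsilon>\<^sup>2 / 8 > 0" using \<epsilon> by simp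
  from ex_Cc_infty_near[OF v this] obtain \<phi> where \<phi>: "\<phi> \<in> Cc_infty"
    "(\<integral>x. (D v x - D \<phi> x)\<^sup>2 \<partial>\<sigma>) < \<epsilon>\<^sup>2 / 8" "(\<integral>x. (v x - \<phi> x)\<^sup>2 \<partial>m) < \<epsilon>\<^sup>2 / 8" by blast
  obtain w' where w': "version w w'" using w F_eq by blast
  have V: "version v v" using v by (intro version_self) (simp_all add: Cc_iff)
  have \<phi>F: "\<phi> \<in> F" "version \<phi> \<phi>" using Cc_infty_version[OF \<phi>(1)] by auto
  have sq: "(a - b)\<^sup>2 \<le> 2 * (a - c)\<^sup>2 + 2 * (c - b)\<^sup>2" for a b c :: real
  proof -
    have "(a - b)\<^sup>2 = ((a - c) + (c - b))\<^sup>2" by simp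
    also have "\<dots> \<le> 2 * (a - c)\<^sup>2 + 2 * (c - b)\<^sup>2"
      using sum_squares_bound[of "a - c" "c - b"] unfolding power2_sum by linarith
    finally show ?thesis .
  qed
  note wv' = E1_norm_diff_less[OF w w' v(1) V wv]
  have "(\<integral>x. (D w' x - D \<phi> x)\<^sup>2 \<partial>\<sigma>) \<le> (\<integral>x. 2 * (D w' x - D v x)\<^sup>2 + 2 * (D v x - D \<phi> x)\<^sup>2 \<partial>\<sigma>)"
    using E_diff(2)[OF w w' \<phi>F] E_diff(2)[OF w w' v(1) V] E_diff(2)[OF v(1) V \<phi>F] by (intro integral_mono sq) auto
  also have "\<dots> = 2 * (\<integral>x. (D w' x - D v x)\<^sup>2 \<partial>\<sigma>) + 2 * (\<integral>x. (D v x - D \<phi> x)\<^sup>2 \<partial>\<sigma>)"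
    using E_diff(2)[OF w w' v(1) V] E_diff(2)[OF v(1) V \<phi>F] by simp
  finally have 1: "(\<integral>x. (D w' x - D \<phi> x)\<^sup>2 \<partial>\<sigma>) \<le> 4 * (\<epsilon> / 4)\<^sup>2 + 2 * (\<epsilon>\<^sup>2 / 8)" using wv'(1) \<phi>(2) by linarith
  have int: "integrable m (\<lambda>x. (a x - b x)\<^sup>2)" if "a \<in> F" "b \<in> F" for a b
    using F_L2[OF F_diff(1)[OF that]] by (simp add: L2_def)
  have "(\<integral>x. (w x - \<phi> x)\<^sup>2 \<partial>m) \<le> (\<integral>x. 2 * (w x - v x)\<^sup>2 + 2 * (v x - \<phi> x)\<^sup>2 \<partial>m)"
    using int w v \<phi>F by (intro integral_mono sq) auto
  also have "\<dots> = 2 * (\<integral>x. (w x - v x)\<^sup>2 \<partial>m) + 2 * (\<integral>x. (v x - \<phi> x)\<^sup>2 \<partial>m)"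
    using int w v \<phi>F by simp
  finally have 2: "(\<integral>x. (w x - \<phi> x)\<^sup>2 \<partial>m) \<le> 2 * (\<epsilon> / 4)\<^sup>2 + 2 * (\<epsilon>\<^sup>2 / 8)" using wv'(2) \<phi>(3) by linarith
  have "(E1_norm m E (\<lambda>x. w x - \<phi> x))\<^sup>2 = E (\<lambda>x. w x - \<phi> x) (\<lambda>x. w x - \<phi> x) + (\<integral>x. (w x - \<phi> x)\<^sup>2 \<partial>m)"
    unfolding E1_norm_def E_diff(1)[OF w w' \<phi>F] by (intro real_sqrt_pow2 add_nonneg_nonneg) auto
  also have "\<dots> = 1 / 2 * (\<integral>x. (D w' x - D \<phi> x)\<^sup>2 \<partial>\<sigma>) + (\<integral>x. (w x - \<phi> x)\<^sup>2 \<partial>m)"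
    by (simp only: E_diff(1)[OF w w' \<phi>F])
  also have "\<dots> < \<epsilon>\<^sup>2"
  proof -
    have "(\<epsilon> / 4)\<^sup>2 = \<epsilon>\<^sup>2 / 16" by (simp add: power_divide)
    moreover have "\<epsilon>\<^sup>2 > 0" using \<epsilon> by simp
    ultimately show ?thesis using 1 2 by linarith
  qed
  finally have "E1_norm m E (\<lambda>x. w x - \<phi> x) < \<epsilon>" by (rule power2_less_imp_less) (use \<epsilon> in simp)
  then show "\<exists>v\<in>Cc_infty. E1_norm m E (\<lambda>x. w x - v x) < \<epsilon>" using \<phi>(1) by blast
qed

end

section \<open>The characterization\<close>

theorem theorem3p7:
  fixes m :: "real measure"
    and E :: "(real \<Rightarrow> real) \<Rightarrow> (real \<Rightarrow> real) \<Rightarrow> real"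
    and F :: "(real \<Rightarrow> real) set"
    and N :: "nat set"
    and I :: "nat \<Rightarrow> real set"
    and s :: "nat \<Rightarrow> real \<Rightarrow> real"
    and e :: "nat \<Rightarrow> real"
  assumes "radon_measure m" and "fully_supported m"
    and "dirichlet_form m E F" and "regular_form m E F" and "strongly_local m E F"
    and "effective_intervals m E F N I s e"
    and "Cc_infty \<subseteq> F"
  shows "special_standard_core m E F Cc_infty \<longleftrightarrow>
           (\<forall>n\<in>N. locally_abs_cont_on (I n) (s n)) \<and>
           (\<forall>i\<in>N. scale_isolated N I s e i)"
proof -
  interpret form_setting m E F N I s e
    by (rule form_setting.intro) (fact assms)+
  show ?thesis
    unfolding special_standard_core_Cc_infty_iff[OF assms(7)]
  proof
    assume dense: "E1_dense_in m E Cc_infty F"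
    show "(\<forall>n\<in>N. locally_abs_cont_on (I n) (s n)) \<and> (\<forall>i\<in>N. scale_isolated N I s e i)"
      using tau_pos_imp_scale_ac[OF dense_imp_tau_pos[OF dense]] dense_imp_scale_isolated[OF dense] by blast
  next
    assume ac_iso: "(\<forall>n\<in>N. locally_abs_cont_on (I n) (s n)) \<and> (\<forall>i\<in>N. scale_isolated N I s e i)"
    have "AE x in \<sigma>. \<tau> x > 0" by (rule scale_ac_imp_tau_pos) (use ac_iso in blast)
    then have "isolated_setting m E F N I s e"
      using ac_iso by (intro isolated_setting.intro isolated_setting_axioms.intro form_setting_axioms) blast+
    then show "E1_dense_in m E Cc_infty F" by (rule isolated_setting.Cc_infty_dense)
  qed
qed

end
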